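(* Let $\Theta=(\alpha_a,\beta_a)\times(\alpha_f,\beta_f)$ with $\alpha_a>0$, $\alpha_f>0$, let $b\ne0$ be known, and let $\vartheta^*_T=(a^*_T,f^*_T)^\top$ be the method of moments estimator (defined in the context) of $\vartheta=(a,f)^\top\in\Theta$. Then, as $T\to\infty$, $\vartheta_T^*$ is uniformly consistent; it is, uniformly on compacts $\mathbb K\subset\Theta$, asymptotically normal: $$\sqrt T\left(\vartheta_T^*-\vartheta_0\right)\Longrightarrow\xi^*\sim\mathcal N\left(0,\mathbf Q(\vartheta_0)\right);$$ the polynomial moments (of $\sqrt T(\vartheta_T^*-\vartheta_0)$ to those of $\xi^*$) converge; and the estimate $$\sup_{\vartheta_0\in\mathbb K}T^{p/2}\,\mathbf E_{\vartheta_0}\left\|\vartheta_T^*-\vartheta_0\right\|^p\le C$$ holds for any $p\ge2$, with a constant $C>0$ not depending on $T$.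
   Context: Model. One observes $X^T=(X_t,0\le t\le T)$, $T$ integer, from $$dX_t=fY_t\,dt+\sigma\,dW_t,\quad X_0,\qquad dY_t=-aY_t\,dt+b\,dV_t,\quad Y_0,$$ where $W,V$ are independent Wiener processes, $X_0\sim\mathcal N(0,d_x^2)$ and $Y_0\sim\mathcal N(0,d_y^2)$ do not depend on them, $\sigma\ne0$ and $b\ne0$ are known, $Y$ is not observed and $\vartheta=(a,f)^\top\in\Theta$ is unknown; $\mathbf E_{\vartheta_0}$ refers to the true value $\vartheta_0=(a_0,f_0)^\top$. Statistics. $$R_{1,T}=\frac1T\sum_{k=1}^T[X_k-X_{k-1}]^2,\quad R_{2,T}=\frac1T\sum_{k=2}^T[X_k-X_{k-1}][X_{k-1}-X_{k-2}],$$ $$\Phi_1(\vartheta)=\frac{f^2b^2}{a^3}\left[e^{-a}-1+a\right]+\sigma^2,\quad\Phi_2(\vartheta)=\frac{f^2b^2}{2a^3}\left[1-e^{-a}\right]^2.$$ Estimator. $\vartheta_T^*$ is the solution $\vartheta=\vartheta_T^*$ of the system $\Phi_1(\vartheta)=R_{1,T}$, $\Phi_2(\vartheta)=R_{2,T}$, $\vartheta\in\Theta$, with the usual assumption that these equations have a solution $\vartheta_T^*\in\Theta$. Limit law. Let $(\xi_1,\xi_2)^\top\sim\mathcal N(0,\mathbf K(\vartheta_0))$ be the limit in distribution of $\sqrt T\,(R_{1,T}-\Phi_1(\vartheta_0),R_{2,T}-\Phi_2(\vartheta_0))^\top$, where $\mathbf K(\vartheta)$ is the symmetric $2\times2$ matrix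 with $$K_{1,1}(\vartheta)=\frac{2f^4b^4}{a^6}\left[e^{-a}-1+a\right]^2+\frac{f^4b^4e^{4a}\left[1-e^{-a}\right]^3}{a^6\left[1+e^{-a}\right]}+\frac{4f^2\sigma^2b^2}{a^3}\left[e^{-a}-1+a\right]+2\sigma^4,$$ the entries $K_{1,2}=K_{2,1}$ and $K_{2,2}$ being the corresponding limit covariances $\lim_{T\to\infty}T\,\mathrm{Cov}_\vartheta(R_{i,T},R_{j,T})$. Put $$h(x)=\frac{e^{-x}-1+x}{(1-e^{-x})^2},\qquad n(x)=\frac{\sqrt2\,x^{3/2}}{|b|(1-e^{-x})},\qquad x>0,$$ $$\xi_3=\frac{\xi_1}{2h'(a_0)\Phi_2(\vartheta_0)}-\frac{\left(\Phi_1(\vartheta_0)-\sigma^2\right)\xi_2}{2h'(a_0)\Phi_2(\vartheta_0)^2},\qquad\xi_4=n'(a_0)\Phi_2(\vartheta_0)^{1/2}\xi_3+\frac{n(a_0)}{2\Phi_2(\vartheta_0)^{1/2}}\xi_2 .$$ Then $\xi^*=(\xi_3,\xi_4)^\top$ and $\mathbf Q(\vartheta_0)$ is its covariance matrix.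
   Formalization: The factor e^{4a} in the second summand of K_{1,1} is removed, since it contradicts K as the limit covariance of the statistics; the estimator need solve the system only when it is solvable in Θ (else any value in Θ); uniform consistency is on compacts of Θ. *)

theory Defs
  imports "HOL-Probability.Probability"
begin

text \<open>The centred normal law on the line with variance \<open>v \<ge> 0\<close>; a vanishing variance gives the
  point mass at 0.\<close>

definition centred_normal :: "real \<Rightarrow> real measure" where
  "centred_normal v =
    (if v = 0 then return borel 0 else density lborel (normal_density 0 (sqrt v)))"

text \<open>A possibly degenerate Gaussian vector is one all of whose linear functionals are normal.\<close>

definition centred_gaussian :: "(real^'n) measure \<Rightarrow> real^'n^'n \<Rightarrow> bool" where
  "centred_gaussian \<mu> S \<longleftrightarrow> sets \<mu> = sets borel \<and> transpose S = S \<and>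
    (\<forall>u. 0 \<le> u \<bullet> (S *v u) \<and> distr \<mu> borel (\<lambda>x. u \<bullet> x) = centred_normal (u \<bullet> (S *v u)))"

definition covariance_matrix :: "'w measure \<Rightarrow> ('w \<Rightarrow> real^'n) \<Rightarrow> real^'n^'n" where
  "covariance_matrix M Z =
    (\<chi> i j. \<integral>\<omega>. (Z \<omega> $ i - (\<integral>\<omega>'. Z \<omega>' $ i \<partial>M)) * (Z \<omega> $ j - (\<integral>\<omega>'. Z \<omega>' $ j \<partial>M)) \<partial>M)"

definition process_sigma :: "'w measure \<Rightarrow> 'i set \<Rightarrow> ('i \<Rightarrow> 'w \<Rightarrow> real) \<Rightarrow> 'w set set" where
  "process_sigma M I Z = sigma_sets (space M) {Z t -` B \<inter> space M |t B. t \<in> I \<and> B \<in> sets borel}"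

locale wiener_process = prob_space M for M :: "'w measure" +
  fixes W :: "real \<Rightarrow> 'w \<Rightarrow> real"
  assumes random_variable: "t \<ge> 0 \<Longrightarrow> W t \<in> borel_measurable M"
    and start: "AE \<omega> in M. W 0 \<omega> = 0"
    and continuous_paths: "AE \<omega> in M. continuous_on {0..} (\<lambda>t. W t \<omega>)"
    and normal_increments:
      "0 \<le> s \<Longrightarrow> s \<le> t \<Longrightarrow> distr M borel (\<lambda>\<omega>. W t \<omega> - W s \<omega>) = centred_normal (t - s)"
    and independent_increments:
      "mono \<tau> \<Longrightarrow> 0 \<le> \<tau> 0 \<Longrightarrow>
        indep_vars (\<lambda>_. borel) (\<lambda>k \<omega>. W (\<tau> (Suc k)) \<omega> - W (\<tau> k) \<omega>) {..<n::nat}"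

text \<open>Both noises are additive, so the two stochastic differential equations are pathwise integral
  equations and involve no stochastic integral. Each of the initial values is independent of the
  pair of Wiener processes; nothing is assumed on the joint law of the two initial values.\<close>

locale partially_observed_system =
  prob_space M + W: wiener_process M W + V: wiener_process M V
  for M :: "'w measure" and W V :: "real \<Rightarrow> 'w \<Rightarrow> real" +
  fixes X Y :: "real \<Rightarrow> 'w \<Rightarrow> real" and \<sigma> b d\<^sub>x d\<^sub>y :: real and \<theta> :: "real^2"
  assumes X_random_variable: "t \<ge> 0 \<Longrightarrow> X t \<in> borel_measurable M"
    and Y_random_variable: "t \<ge> 0 \<Longrightarrow> Y t \<in> borel_measurable M"
    and X_start: "distr M borel (X 0) = centred_normal (d\<^sub>x\<^sup>2)"
    and Y_start: "distr M borel (Y 0) = centred_normal (d\<^sub>y\<^sup>2)"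
    and independence:
      "Z \<in> {X, Y} \<Longrightarrow>
        indep_sets (\<lambda>i::nat. if i = 0 then process_sigma M {0} Z
          else if i = 1 then process_sigma M {0..} W else process_sigma M {0..} V) {0, 1, 2}"
    and Y_continuous: "AE \<omega> in M. continuous_on {0..} (\<lambda>t. Y t \<omega>)"
    and state_equation:
      "AE \<omega> in M. \<forall>t\<ge>0. Y t \<omega> = Y 0 \<omega> - \<theta> $ 1 * integral {0..t} (\<lambda>s. Y s \<omega>) + b * V t \<omega>"
    and observation_equation:
      "AE \<omega> in M. \<forall>t\<ge>0. X t \<omega> = X 0 \<omega> + \<theta> $ 2 * integral {0..t} (\<lambda>s. Y s \<omega>) + \<sigma> * W t \<omega>"

definition R1 :: "(real \<Rightarrow> 'w \<Rightarrow> real) \<Rightarrow> nat \<Rightarrow> 'w \<Rightarrow> real" where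
  "R1 X T \<omega> = (\<Sum>k=1..T. (X (real k) \<omega> - X (real k - 1) \<omega>)\<^sup>2) / real T"

definition R2 :: "(real \<Rightarrow> 'w \<Rightarrow> real) \<Rightarrow> nat \<Rightarrow> 'w \<Rightarrow> real" where
  "R2 X T \<omega> =
    (\<Sum>k=2..T. (X (real k) \<omega> - X (real k - 1) \<omega>) * (X (real k - 1) \<omega> - X (real k - 2) \<omega>)) / real T"

definition \<Phi>1 :: "real \<Rightarrow> real \<Rightarrow> real^2 \<Rightarrow> real" where
  "\<Phi>1 \<sigma> b \<theta> = (let a = \<theta> $ 1; f = \<theta> $ 2 in f^2 * b^2 / a^3 * (exp (- a) - 1 + a) + \<sigma>\<^sup>2)"

definition \<Phi>2 :: "real \<Rightarrow> real^2 \<Rightarrow> real" where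
  "\<Phi>2 b \<theta> = (let a = \<theta> $ 1; f = \<theta> $ 2 in f^2 * b^2 / (2 * a^3) * (1 - exp (- a))\<^sup>2)"

definition R_vec :: "(real \<Rightarrow> 'w \<Rightarrow> real) \<Rightarrow> nat \<Rightarrow> 'w \<Rightarrow> real^2" where
  "R_vec X T \<omega> = vector [R1 X T \<omega>, R2 X T \<omega>]"

definition \<Phi> :: "real \<Rightarrow> real \<Rightarrow> real^2 \<Rightarrow> real^2" where
  "\<Phi> \<sigma> b \<theta> = vector [\<Phi>1 \<sigma> b \<theta>, \<Phi>2 b \<theta>]"

text \<open>The estimator solves the moment equations in the parameter set whenever they are solvable
  there. They cannot be solvable almost surely: with positive probability \<^term>\<open>R2 X T\<close> is negative
  or \<^term>\<open>R1 X T\<close> exceeds all values of the bounded function \<^term>\<open>\<Phi>1 \<sigma> b\<close> on a bounded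
  parameter set. On the exceptional event the estimator is any measurable choice of a parameter.\<close>

definition moments_estimator ::
    "'w measure \<Rightarrow> real \<Rightarrow> real \<Rightarrow> (real^2) set \<Rightarrow> (real \<Rightarrow> 'w \<Rightarrow> real) \<Rightarrow> nat \<Rightarrow> ('w \<Rightarrow> real^2) \<Rightarrow> bool"
  where
  "moments_estimator F \<sigma> b \<Theta> X T est \<longleftrightarrow> est \<in> borel_measurable F \<and>
    (\<forall>\<omega>\<in>space F. est \<omega> \<in> \<Theta> \<and>
      ((\<exists>\<theta>\<in>\<Theta>. \<Phi> \<sigma> b \<theta> = R_vec X T \<omega>) \<longrightarrow> \<Phi> \<sigma> b (est \<omega>) = R_vec X T \<omega>))"

definition uniform_weak_convergence ::
    "'p set \<Rightarrow> ('p \<Rightarrow> 'w measure) \<Rightarrow> (nat \<Rightarrow> 'p \<Rightarrow> 'w \<Rightarrow> 'e::topological_space) \<Rightarrow> ('p \<Rightarrow> 'e measure) \<Rightarrow> bool"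
  where
  "uniform_weak_convergence A P Z L \<longleftrightarrow>
    (\<forall>g::'e \<Rightarrow> real. continuous_on UNIV g \<and> bounded (range g) \<longrightarrow>
      uniform_limit A (\<lambda>T \<theta>. \<integral>\<omega>. g (Z T \<theta> \<omega>) \<partial>P \<theta>) (\<lambda>\<theta>. \<integral>x. g x \<partial>L \<theta>) sequentially)"

text \<open>In the stationary regime the increments \<open>X k - X (k - 1)\<close> have variance \<^term>\<open>\<Phi>1 \<sigma> b \<theta>\<close> and
  autocovariances \<open>\<Phi>2 b \<theta> * exp (- a * (j - 1))\<close> at lags \<open>j \<ge> 1\<close>, so that the limit
  variance of the first statistic is \<open>2 * (\<Phi>1 \<sigma> b \<theta>)\<^sup>2 + 4 * (\<Phi>2 b \<theta>)\<^sup>2 / (1 - exp (- 2 * a))\<close>.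
  Expanded, this is the following expression; its second summand carries no factor
  \<open>exp (4 * a)\<close>.\<close>

definition K11 :: "real \<Rightarrow> real \<Rightarrow> real^2 \<Rightarrow> real" where
  "K11 \<sigma> b \<theta> = (let a = \<theta> $ 1; f = \<theta> $ 2 in
    2 * f^4 * b^4 / a^6 * (exp (- a) - 1 + a)\<^sup>2
    + f^4 * b^4 * (1 - exp (- a))^3 / (a^6 * (1 + exp (- a)))
    + 4 * f^2 * \<sigma>^2 * b^2 / a^3 * (exp (- a) - 1 + a) + 2 * \<sigma>^4)"

definition moments_limit_law ::
    "'w measure \<Rightarrow> real \<Rightarrow> real \<Rightarrow> (real \<Rightarrow> 'w \<Rightarrow> real) \<Rightarrow> real^2 \<Rightarrow> real^2^2 \<Rightarrow> (real^2) measure \<Rightarrow> bool"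
  where
  "moments_limit_law M \<sigma> b X \<theta> K \<mu> \<longleftrightarrow>
    (\<lambda>T. real T *\<^sub>R covariance_matrix M (R_vec X T)) \<longlonglongrightarrow> K \<and> K $ 1 $ 1 = K11 \<sigma> b \<theta> \<and>
    centred_gaussian \<mu> K \<and>
    uniform_weak_convergence {\<theta>} (\<lambda>_. M) (\<lambda>T \<theta> \<omega>. sqrt (real T) *\<^sub>R (R_vec X T \<omega> - \<Phi> \<sigma> b \<theta>)) (\<lambda>_. \<mu>)"

definition h_fun :: "real \<Rightarrow> real" where
  "h_fun x = (exp (- x) - 1 + x) / (1 - exp (- x))\<^sup>2"

definition n_fun :: "real \<Rightarrow> real \<Rightarrow> real" where
  "n_fun b x = sqrt 2 * x powr (3/2) / (\<bar>b\<bar> * (1 - exp (- x)))"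

definition xi3 :: "real \<Rightarrow> real \<Rightarrow> real^2 \<Rightarrow> real^2 \<Rightarrow> real" where
  "xi3 \<sigma> b \<theta> \<xi> = \<xi> $ 1 / (2 * deriv h_fun (\<theta> $ 1) * \<Phi>2 b \<theta>)
    - (\<Phi>1 \<sigma> b \<theta> - \<sigma>\<^sup>2) * \<xi> $ 2 / (2 * deriv h_fun (\<theta> $ 1) * (\<Phi>2 b \<theta>)\<^sup>2)"

definition xi4 :: "real \<Rightarrow> real \<Rightarrow> real^2 \<Rightarrow> real^2 \<Rightarrow> real" where
  "xi4 \<sigma> b \<theta> \<xi> = deriv (n_fun b) (\<theta> $ 1) * sqrt (\<Phi>2 b \<theta>) * xi3 \<sigma> b \<theta> \<xi>
    + n_fun b (\<theta> $ 1) / (2 * sqrt (\<Phi>2 b \<theta>)) * \<xi> $ 2"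

definition xi_star :: "real \<Rightarrow> real \<Rightarrow> real^2 \<Rightarrow> real^2 \<Rightarrow> real^2" where
  "xi_star \<sigma> b \<theta> \<xi> = vector [xi3 \<sigma> b \<theta> \<xi>, xi4 \<sigma> b \<theta> \<xi>]"

end

theory Submission
  imports Defs "HOL-Real_Asymp.Real_Asymp"
begin

text \<open>At integer times the hidden state is a Gaussian autoregression and the increments of the
  observation are a linear function of it plus noise, the noise pairs being independent of the past.
  A linear combination of the two statistics is then, up to its mean and boundary terms, a
  sum of martingale differences. The fluctuation of their squares is a coboundary up to a further
  martingale difference, by a quadratic solution of the Poisson equation, and this gives the
  characteristic function of the normalized sum up to \<open>C / sqrt T\<close>, with \<open>C\<close> independent of the
  parameter. Moments of martingale sums grow at the diffusive rate by a discrete Gronwall argument.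
  Trigonometric polynomials of the coordinates approximate bounded continuous functions well enough
  to pass from characteristic functions to uniform weak convergence without tightness along
  subsequences.

  Since \<open>\<Phi>1 - \<sigma>\<^sup>2 = 2 h(a) \<Phi>2\<close> and \<open>f = n(a) sqrt \<Phi>2\<close> with \<open>h\<close> strictly increasing, the moment map is
  injective, hence open by invariance of domain. Therefore, on a compact set of parameters, the
  linearization error of the estimator is bounded pathwise by a multiple of \<open>(norm (R - \<Phi>))\<^sup>2\<close>; on the
  event that the moment equations have no solution \<open>R - \<Phi>\<close> is bounded away from zero, so that the
  bound holds there as well, the parameter set being bounded. The limit law and all moments of the
  estimator follow from those of the statistics.\<close>

section \<open>Martingale differences with uniformly bounded moments\<close>

text \<open>Uniformity in the parameter shapes the development. All measures are treated at once:
  \<open>bounded_moments\<close> asks for one bound per order, valid for every parameter and time.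
  Such arrays form an algebra, and coefficients depending on the parameter alone belong to it as
  constant arrays, so products of noises, states and coefficients are estimated without tracking
  constants. The martingale property is stated as orthogonality to past variables with all moments,
  a form that survives multiplication by past factors.

  The hidden initial state has an arbitrary variance, so the sampled chain need not be stationary.
  Its moments are controlled by contraction, and the means of the statistics agree with
  \<open>\<Phi>\<close> only up to boundary terms of order \<open>1 / T\<close>.

  Because the linearization of the estimator varies with the parameter, characteristic functions are
  estimated along directions that vary with it too. Compactness of the parameter set enters through
  the event without solution, where a positive distance from
  \<open>\<Phi> \<sigma> b \<theta>\<close> to the boundary of the image is required.\<close>

lemma abs_power_add_le:
  fixes x y :: real
  shows "\<bar>x + y\<bar> ^ n \<le> 2 ^ n * (\<bar>x\<bar> ^ n + \<bar>y\<bar> ^ n)"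
proof -
  have "\<bar>x + y\<bar> ^ n \<le> (2 * max \<bar>x\<bar> \<bar>y\<bar>) ^ n"
    by (intro power_mono) auto
  also have "\<dots> = 2 ^ n * (max \<bar>x\<bar> \<bar>y\<bar>) ^ n"
    by (simp add: power_mult_distrib)
  also have "(max \<bar>x\<bar> \<bar>y\<bar>) ^ n \<le> \<bar>x\<bar> ^ n + \<bar>y\<bar> ^ n"
    by (auto simp: max_def)
  finally show ?thesis by simp
qed

lemma abs_power_mult_le:
  fixes x y :: real
  shows "\<bar>x\<bar> ^ m * \<bar>y\<bar> ^ n \<le> \<bar>x\<bar> ^ (m + n) + \<bar>y\<bar> ^ (m + n)"
proof -
  have "\<bar>x\<bar> ^ m * \<bar>y\<bar> ^ n \<le> max \<bar>x\<bar> \<bar>y\<bar> ^ m * max \<bar>x\<bar> \<bar>y\<bar> ^ n"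
    by (intro mult_mono power_mono) auto
  also have "\<dots> = max \<bar>x\<bar> \<bar>y\<bar> ^ (m + n)"
    by (simp add: power_add)
  also have "\<dots> \<le> \<bar>x\<bar> ^ (m + n) + \<bar>y\<bar> ^ (m + n)"
    by (auto simp: max_def)
  finally show ?thesis .
qed

lemma integrable_integral_le:
  fixes f g :: "'a \<Rightarrow> real"
  assumes "integrable M f" "g \<in> borel_measurable M" "\<And>x. \<bar>g x\<bar> \<le> f x"
  shows "integrable M g" "(\<integral>x. g x \<partial>M) \<le> (\<integral>x. f x \<partial>M)"
proof -
  show *: "integrable M g"
    using assms by (intro Bochner_Integration.integrable_bound[OF assms(1)]) (auto intro!: AE_I2 order_trans[OF assms(3)])
  show "(\<integral>x. g x \<partial>M) \<le> (\<integral>x. f x \<partial>M)"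
    by (intro integral_mono * assms(1)) (use assms(3) abs_le_D1 in blast)
qed

section \<open>Arrays whose moments of every order are bounded uniformly in parameter and
  time\<close>

locale prob_family =
  fixes I :: "'i set" and P :: "'i \<Rightarrow> 'w measure"
  assumes prob: "i \<in> I \<Longrightarrow> prob_space (P i)"
begin

text \<open>The bound may depend on the order \<open>n\<close>, but neither on the parameter nor on
  the time. Asking for all orders makes the class closed under products.\<close>

definition bounded_moments :: "('i \<Rightarrow> nat \<Rightarrow> 'w \<Rightarrow> real) \<Rightarrow> bool" where
  "bounded_moments X \<longleftrightarrow> (\<forall>i\<in>I. \<forall>k. X i k \<in> borel_measurable (P i)) \<and>
    (\<forall>n. \<exists>C. \<forall>i\<in>I. \<forall>k. integrable (P i) (\<lambda>\<omega>. \<bar>X i k \<omega>\<bar> ^ n) \<and> (\<integral>\<omega>. \<bar>X i k \<omega>\<bar> ^ n \<partial>P i) \<le> C)"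

lemma bounded_momentsI:
  assumes "\<And>i k. i \<in> I \<Longrightarrow> X i k \<in> borel_measurable (P i)"
    and "\<And>n. \<exists>C. \<forall>i\<in>I. \<forall>k. integrable (P i) (\<lambda>\<omega>. \<bar>X i k \<omega>\<bar> ^ n) \<and> (\<integral>\<omega>. \<bar>X i k \<omega>\<bar> ^ n \<partial>P i) \<le> C"
  shows "bounded_moments X"
  using assms unfolding bounded_moments_def by blast

lemma bounded_momentsE:
  assumes "bounded_moments X"
  obtains C where "\<And>i k. i \<in> I \<Longrightarrow> integrable (P i) (\<lambda>\<omega>. \<bar>X i k \<omega>\<bar> ^ n)"
    "\<And>i k. i \<in> I \<Longrightarrow> (\<integral>\<omega>. \<bar>X i k \<omega>\<bar> ^ n \<partial>P i) \<le> C"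
proof -
  have "\<exists>C. \<forall>i\<in>I. \<forall>k. integrable (P i) (\<lambda>\<omega>. \<bar>X i k \<omega>\<bar> ^ n) \<and> (\<integral>\<omega>. \<bar>X i k \<omega>\<bar> ^ n \<partial>P i) \<le> C"
    using assms by (simp add: bounded_moments_def)
  then show ?thesis using that by blast
qed

lemma bounded_moments_measurable:
  "bounded_moments X \<Longrightarrow> i \<in> I \<Longrightarrow> X i k \<in> borel_measurable (P i)"
  by (auto simp: bounded_moments_def)

lemma bounded_moments_integrable_abs:
  "bounded_moments X \<Longrightarrow> i \<in> I \<Longrightarrow> integrable (P i) (\<lambda>\<omega>. \<bar>X i k \<omega>\<bar> ^ n)"
  by (rule bounded_momentsE[of X n]) auto

lemma bounded_moments_integrable_power:
  assumes "bounded_moments X" "i \<in> I"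
  shows "integrable (P i) (\<lambda>\<omega>. X i k \<omega> ^ n)"
  using bounded_moments_measurable[OF assms]
  by (intro Bochner_Integration.integrable_bound[OF bounded_moments_integrable_abs[OF assms, of k n]])
    (auto simp: power_abs)

lemma bounded_moments_integrable:
  "bounded_moments X \<Longrightarrow> i \<in> I \<Longrightarrow> integrable (P i) (X i k)"
  using bounded_moments_integrable_power[of X i k 1] by simp

lemma bounded_moments_bound:
  assumes "bounded_moments X"
  obtains C where "C \<ge> 0" "\<And>i k. i \<in> I \<Longrightarrow> (\<integral>\<omega>. \<bar>X i k \<omega>\<bar> ^ n \<partial>P i) \<le> C"
proof -
  obtain C where C: "\<And>i k. i \<in> I \<Longrightarrow> (\<integral>\<omega>. \<bar>X i k \<omega>\<bar> ^ n \<partial>P i) \<le> C"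
    by (rule bounded_momentsE[OF assms, of n]) blast
  show ?thesis
    by (rule that[of "max C 0"]) (simp_all add: C le_max_iff_disj)
qed

lemma bounded_moments_dominated:
  assumes Z: "bounded_moments Z"
    and X: "\<And>i k. i \<in> I \<Longrightarrow> X i k \<in> borel_measurable (P i)"
    and le: "\<And>i k \<omega>. i \<in> I \<Longrightarrow> \<bar>X i k \<omega>\<bar> \<le> Z i k \<omega>"
  shows "bounded_moments X"
proof (rule bounded_momentsI)
  fix n
  obtain C where C: "\<And>i k. i \<in> I \<Longrightarrow> (\<integral>\<omega>. \<bar>Z i k \<omega>\<bar> ^ n \<partial>P i) \<le> C"
    by (rule bounded_moments_bound[OF Z, of n]) blast
  have "integrable (P i) (\<lambda>\<omega>. \<bar>X i k \<omega>\<bar> ^ n) \<and> (\<integral>\<omega>. \<bar>X i k \<omega>\<bar> ^ n \<partial>P i) \<le> C" if i: "i \<in> I" for i k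
  proof -
    have "\<bar>X i k \<omega>\<bar> ^ n \<le> \<bar>Z i k \<omega>\<bar> ^ n" for \<omega>
      using le[OF i, of k \<omega>] by (intro power_mono) auto
    note le' = this
    note X[OF i, measurable]
    have "(\<lambda>\<omega>. \<bar>X i k \<omega>\<bar> ^ n) \<in> borel_measurable (P i)" by measurable
    from integrable_integral_le[OF bounded_moments_integrable_abs[OF Z i, of k n] this]
    show ?thesis using C[OF i, of k] le' by (simp add: order_trans[OF _ C[OF i, of k]])
  qed
  then show "\<exists>C. \<forall>i\<in>I. \<forall>k. integrable (P i) (\<lambda>\<omega>. \<bar>X i k \<omega>\<bar> ^ n) \<and> (\<integral>\<omega>. \<bar>X i k \<omega>\<bar> ^ n \<partial>P i) \<le> C"
    by blast
qed (fact X)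

text \<open>Embeds parameter-dependent coefficients as arrays, so that one set of closure rules
  bounds every polynomial expression in coefficients and random variables.\<close>

lemma bounded_moments_const:
  assumes "\<And>i. i \<in> I \<Longrightarrow> \<bar>c i\<bar> \<le> C"
  shows "bounded_moments (\<lambda>i k \<omega>. c i)"
proof (rule bounded_momentsI)
  fix n
  have "integrable (P i) (\<lambda>\<omega>. \<bar>c i\<bar> ^ n) \<and> (\<integral>\<omega>. \<bar>c i\<bar> ^ n \<partial>P i) \<le> C ^ n" if "i \<in> I" for i
  proof -
    interpret prob_space "P i" by (rule prob) fact
    show ?thesis
      using assms[OF that] by (auto simp: prob_space intro: power_mono)
  qed
  then show "\<exists>C. \<forall>i\<in>I. \<forall>k::nat. integrable (P i) (\<lambda>\<omega>. \<bar>c i\<bar> ^ n) \<and> (\<integral>\<omega>. \<bar>c i\<bar> ^ n \<partial>P i) \<le> C"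
    by blast
qed auto

lemma bounded_moments_add:
  assumes X: "bounded_moments X" and Z: "bounded_moments Z"
  shows "bounded_moments (\<lambda>i k \<omega>. X i k \<omega> + Z i k \<omega>)"
proof (rule bounded_momentsI)
  fix i k assume "i \<in> I"
  then show "(\<lambda>\<omega>. X i k \<omega> + Z i k \<omega>) \<in> borel_measurable (P i)"
    using bounded_moments_measurable[OF X] bounded_moments_measurable[OF Z] by simp
next
  fix n
  obtain C where C: "\<And>i k. i \<in> I \<Longrightarrow> (\<integral>\<omega>. \<bar>X i k \<omega>\<bar> ^ n \<partial>P i) \<le> C"
    by (rule bounded_moments_bound[OF X, of n]) blast
  obtain D where D: "\<And>i k. i \<in> I \<Longrightarrow> (\<integral>\<omega>. \<bar>Z i k \<omega>\<bar> ^ n \<partial>P i) \<le> D"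
    by (rule bounded_moments_bound[OF Z, of n]) blast
  have "integrable (P i) (\<lambda>\<omega>. \<bar>X i k \<omega> + Z i k \<omega>\<bar> ^ n) \<and>
      (\<integral>\<omega>. \<bar>X i k \<omega> + Z i k \<omega>\<bar> ^ n \<partial>P i) \<le> 2 ^ n * (C + D)" if i: "i \<in> I" for i k
  proof -
    note bounded_moments_measurable[OF X i, measurable] bounded_moments_measurable[OF Z i, measurable]
    note * = bounded_moments_integrable_abs[OF X i, of k n] bounded_moments_integrable_abs[OF Z i, of k n]
    have "integrable (P i) (\<lambda>\<omega>. 2 ^ n * (\<bar>X i k \<omega>\<bar> ^ n + \<bar>Z i k \<omega>\<bar> ^ n))"
      using * by simp
    from integrable_integral_le[OF this, of "\<lambda>\<omega>. \<bar>X i k \<omega> + Z i k \<omega>\<bar> ^ n"]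
    have "integrable (P i) (\<lambda>\<omega>. \<bar>X i k \<omega> + Z i k \<omega>\<bar> ^ n)"
      "(\<integral>\<omega>. \<bar>X i k \<omega> + Z i k \<omega>\<bar> ^ n \<partial>P i) \<le> (\<integral>\<omega>. 2 ^ n * (\<bar>X i k \<omega>\<bar> ^ n + \<bar>Z i k \<omega>\<bar> ^ n) \<partial>P i)"
      using abs_power_add_le by auto
    moreover have "(\<integral>\<omega>. 2 ^ n * (\<bar>X i k \<omega>\<bar> ^ n + \<bar>Z i k \<omega>\<bar> ^ n) \<partial>P i) \<le> 2 ^ n * (C + D)"
      using C[OF i, of k] D[OF i, of k] * by (simp add: add_mono)
    ultimately show ?thesis by linarith
  qed
  then show "\<exists>C. \<forall>i\<in>I. \<forall>k. integrable (P i) (\<lambda>\<omega>. \<bar>X i k \<omega> + Z i k \<omega>\<bar> ^ n) \<and>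
      (\<integral>\<omega>. \<bar>X i k \<omega> + Z i k \<omega>\<bar> ^ n \<partial>P i) \<le> C"
    by blast
qed

lemma bounded_moments_mult:
  assumes X: "bounded_moments X" and Z: "bounded_moments Z"
  shows "bounded_moments (\<lambda>i k \<omega>. X i k \<omega> * Z i k \<omega>)"
proof (rule bounded_momentsI)
  fix i k assume "i \<in> I"
  then show "(\<lambda>\<omega>. X i k \<omega> * Z i k \<omega>) \<in> borel_measurable (P i)"
    using bounded_moments_measurable[OF X] bounded_moments_measurable[OF Z] by simp
next
  fix n
  obtain C where C: "\<And>i k. i \<in> I \<Longrightarrow> (\<integral>\<omega>. \<bar>X i k \<omega>\<bar> ^ (n + n) \<partial>P i) \<le> C"
    by (rule bounded_moments_bound[OF X, of "n+n"]) blast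
  obtain D where D: "\<And>i k. i \<in> I \<Longrightarrow> (\<integral>\<omega>. \<bar>Z i k \<omega>\<bar> ^ (n + n) \<partial>P i) \<le> D"
    by (rule bounded_moments_bound[OF Z, of "n+n"]) blast
  have "integrable (P i) (\<lambda>\<omega>. \<bar>X i k \<omega> * Z i k \<omega>\<bar> ^ n) \<and>
      (\<integral>\<omega>. \<bar>X i k \<omega> * Z i k \<omega>\<bar> ^ n \<partial>P i) \<le> C + D" if i: "i \<in> I" for i k
  proof -
    note bounded_moments_measurable[OF X i, measurable] bounded_moments_measurable[OF Z i, measurable]
    note * = bounded_moments_integrable_abs[OF X i, of k "n+n"] bounded_moments_integrable_abs[OF Z i, of k "n+n"]
    have "integrable (P i) (\<lambda>\<omega>. \<bar>X i k \<omega>\<bar> ^ (n+n) + \<bar>Z i k \<omega>\<bar> ^ (n+n))"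
      using * by simp
    from integrable_integral_le[OF this, of "\<lambda>\<omega>. \<bar>X i k \<omega> * Z i k \<omega>\<bar> ^ n"]
    have "integrable (P i) (\<lambda>\<omega>. \<bar>X i k \<omega> * Z i k \<omega>\<bar> ^ n)"
      "(\<integral>\<omega>. \<bar>X i k \<omega> * Z i k \<omega>\<bar> ^ n \<partial>P i) \<le> (\<integral>\<omega>. \<bar>X i k \<omega>\<bar> ^ (n+n) + \<bar>Z i k \<omega>\<bar> ^ (n+n) \<partial>P i)"
      using abs_power_mult_le[of _ n _ n] by (auto simp: abs_mult power_mult_distrib)
    moreover have "(\<integral>\<omega>. \<bar>X i k \<omega>\<bar> ^ (n+n) + \<bar>Z i k \<omega>\<bar> ^ (n+n) \<partial>P i) \<le> C + D"
      using C[OF i, of k] D[OF i, of k] * by (simp add: add_mono)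
    ultimately show ?thesis by linarith
  qed
  then show "\<exists>C. \<forall>i\<in>I. \<forall>k. integrable (P i) (\<lambda>\<omega>. \<bar>X i k \<omega> * Z i k \<omega>\<bar> ^ n) \<and>
      (\<integral>\<omega>. \<bar>X i k \<omega> * Z i k \<omega>\<bar> ^ n \<partial>P i) \<le> C"
    by blast
qed

lemma bounded_moments_numeral: "bounded_moments (\<lambda>i k \<omega>. r)"
  by (rule bounded_moments_const[of "\<lambda>_. r" "\<bar>r\<bar>"]) simp

lemma bounded_moments_diff:
  assumes "bounded_moments X" "bounded_moments Z"
  shows "bounded_moments (\<lambda>i k \<omega>. X i k \<omega> - Z i k \<omega>)"
  using bounded_moments_add[OF assms(1) bounded_moments_mult[OF bounded_moments_numeral[of "-1"] assms(2)]]
  by simp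

lemma bounded_moments_power:
  assumes "bounded_moments X"
  shows "bounded_moments (\<lambda>i k \<omega>. X i k \<omega> ^ n)"
  by (induction n) (auto intro: bounded_moments_numeral bounded_moments_mult assms)

lemma bounded_moments_reindex:
  assumes "bounded_moments X"
  shows "bounded_moments (\<lambda>i k. X i (\<phi> k))"
proof (rule bounded_momentsI)
  fix n
  obtain C where "\<And>i k. i \<in> I \<Longrightarrow> (\<integral>\<omega>. \<bar>X i k \<omega>\<bar> ^ n \<partial>P i) \<le> C"
    by (rule bounded_moments_bound[OF assms, of n]) blast
  then show "\<exists>C. \<forall>i\<in>I. \<forall>k. integrable (P i) (\<lambda>\<omega>. \<bar>X i (\<phi> k) \<omega>\<bar> ^ n) \<and>
      (\<integral>\<omega>. \<bar>X i (\<phi> k) \<omega>\<bar> ^ n \<partial>P i) \<le> C"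
    using bounded_moments_integrable_abs[OF assms] by blast
qed (rule bounded_moments_measurable[OF assms])

lemma bounded_moments_abs:
  assumes "bounded_moments X"
  shows "bounded_moments (\<lambda>i k \<omega>. \<bar>X i k \<omega>\<bar>)"
proof (rule bounded_momentsI)
  fix n
  show "\<exists>C. \<forall>i\<in>I. \<forall>k. integrable (P i) (\<lambda>\<omega>. \<bar>\<bar>X i k \<omega>\<bar>\<bar> ^ n) \<and>
      (\<integral>\<omega>. \<bar>\<bar>X i k \<omega>\<bar>\<bar> ^ n \<partial>P i) \<le> C"
    using assms by (simp add: bounded_moments_def)
qed (use bounded_moments_measurable[OF assms] in simp)

lemmas bounded_moments_intros = bounded_moments_add bounded_moments_mult bounded_moments_diff
  bounded_moments_power bounded_moments_numeral

end

section \<open>Filtrations and martingale differences\<close>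

locale filtered_family = prob_family I P
  for I :: "'i set" and P :: "'i \<Rightarrow> 'w measure" +
  fixes F :: "'i \<Rightarrow> nat \<Rightarrow> 'w measure"
  assumes subalg: "i \<in> I \<Longrightarrow> subalgebra (P i) (F i k)"
    and filtration: "i \<in> I \<Longrightarrow> subalgebra (F i (Suc k)) (F i k)"
begin

definition adapted :: "('i \<Rightarrow> nat \<Rightarrow> 'w \<Rightarrow> real) \<Rightarrow> bool" where
  "adapted Z \<longleftrightarrow> (\<forall>i\<in>I. \<forall>k. Z i k \<in> borel_measurable (F i k))"

text \<open>Index convention: the \<open>k\<close>-th difference belongs to the step from time \<open>k\<close> to \<open>k + 1\<close>.\<close>

definition martingale_diff :: "('i \<Rightarrow> nat \<Rightarrow> 'w \<Rightarrow> real) \<Rightarrow> bool" where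
  "martingale_diff X \<longleftrightarrow> bounded_moments X \<and>
    (\<forall>i\<in>I. \<forall>k. X i k \<in> borel_measurable (F i (Suc k)) \<and>
      (\<forall>Z\<in>borel_measurable (F i k). (\<forall>n. integrable (P i) (\<lambda>\<omega>. \<bar>Z \<omega>\<bar> ^ n)) \<longrightarrow> (\<integral>\<omega>. Z \<omega> * X i k \<omega> \<partial>P i) = 0))"

lemma all_moments_mult_integrable:
  fixes Z X :: "'w \<Rightarrow> real"
  assumes [measurable]: "Z \<in> borel_measurable M" "X \<in> borel_measurable M"
    and "\<And>n. integrable M (\<lambda>\<omega>. \<bar>Z \<omega>\<bar> ^ n)" "\<And>n. integrable M (\<lambda>\<omega>. \<bar>X \<omega>\<bar> ^ n)"
  shows "integrable M (\<lambda>\<omega>. \<bar>Z \<omega> * X \<omega>\<bar> ^ n)"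
proof -
  have "integrable M (\<lambda>\<omega>. \<bar>Z \<omega>\<bar> ^ (n+n) + \<bar>X \<omega>\<bar> ^ (n+n))"
    using assms by simp
  from integrable_integral_le(1)[OF this, of "\<lambda>\<omega>. \<bar>Z \<omega> * X \<omega>\<bar> ^ n"]
  show ?thesis
    using abs_power_mult_le[of _ n _ n] by (auto simp: abs_mult power_mult_distrib)
qed

lemma past_measurable: "i \<in> I \<Longrightarrow> Z \<in> borel_measurable (F i k) \<Longrightarrow> Z \<in> borel_measurable (P i)"
  using measurable_from_subalg subalg by blast

lemma filtration_measurable:
  "i \<in> I \<Longrightarrow> Z \<in> borel_measurable (F i k) \<Longrightarrow> Z \<in> borel_measurable (F i (Suc k))"
  using measurable_from_subalg filtration by blast

lemma martingale_diff_integrable: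
  assumes "martingale_diff X" "i \<in> I" "Z \<in> borel_measurable (F i k)"
    "\<And>n. integrable (P i) (\<lambda>\<omega>. \<bar>Z \<omega>\<bar> ^ n)"
  shows "integrable (P i) (\<lambda>\<omega>. Z \<omega> * X i k \<omega>)"
proof -
  have X: "bounded_moments X" using assms(1) by (simp add: martingale_diff_def)
  have [measurable]: "Z \<in> borel_measurable (P i)" "X i k \<in> borel_measurable (P i)"
    using past_measurable[OF assms(2,3)] bounded_moments_measurable[OF X assms(2), of k] by auto
  have "integrable (P i) (\<lambda>\<omega>. \<bar>Z \<omega> * X i k \<omega>\<bar> ^ 1)"
    using assms bounded_moments_integrable_abs[OF X assms(2)]
    by (intro all_moments_mult_integrable) measurable
  moreover have "(\<lambda>\<omega>. Z \<omega> * X i k \<omega>) \<in> borel_measurable (P i)" by measurable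
  ultimately show ?thesis
    using integrable_abs_iff[of "\<lambda>\<omega>. Z \<omega> * X i k \<omega>" "P i"] by simp
qed

lemma martingale_diff_orthogonal:
  assumes "martingale_diff X" "i \<in> I" "Z \<in> borel_measurable (F i k)"
    "\<And>n. integrable (P i) (\<lambda>\<omega>. \<bar>Z \<omega>\<bar> ^ n)"
  shows "(\<integral>\<omega>. Z \<omega> * X i k \<omega> \<partial>P i) = 0"
  using assms by (simp add: martingale_diff_def)

lemma martingale_diff_bounded_moments: "martingale_diff X \<Longrightarrow> bounded_moments X"
  by (simp add: martingale_diff_def)

lemma martingale_diff_measurable:
  "martingale_diff X \<Longrightarrow> i \<in> I \<Longrightarrow> X i k \<in> borel_measurable (F i (Suc k))"
  by (simp add: martingale_diff_def)

lemma martingale_diffI: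
  assumes "bounded_moments X" "\<And>i k. i \<in> I \<Longrightarrow> X i k \<in> borel_measurable (F i (Suc k))"
    "\<And>i k Z. \<lbrakk>i \<in> I; Z \<in> borel_measurable (F i k); \<And>n. integrable (P i) (\<lambda>\<omega>. \<bar>Z \<omega>\<bar> ^ n)\<rbrakk>
      \<Longrightarrow> (\<integral>\<omega>. Z \<omega> * X i k \<omega> \<partial>P i) = 0"
  shows "martingale_diff X"
  using assms by (simp add: martingale_diff_def)

lemma martingale_diff_add:
  assumes X: "martingale_diff X" and Z: "martingale_diff Z"
  shows "martingale_diff (\<lambda>i k \<omega>. X i k \<omega> + Z i k \<omega>)"
proof (rule martingale_diffI)
  fix i k and U :: "'w \<Rightarrow> real" assume *: "i \<in> I" "U \<in> borel_measurable (F i k)" "\<And>n. integrable (P i) (\<lambda>\<omega>. \<bar>U \<omega>\<bar> ^ n)"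
  show "(\<integral>\<omega>. U \<omega> * (X i k \<omega> + Z i k \<omega>) \<partial>P i) = 0"
    using martingale_diff_integrable[OF X *] martingale_diff_integrable[OF Z *]
      martingale_diff_orthogonal[OF X *] martingale_diff_orthogonal[OF Z *]
    by (simp add: distrib_left)
qed (use X Z in \<open>auto simp: martingale_diff_def intro!: bounded_moments_add borel_measurable_add\<close>)

text \<open>The past factor is absorbed into the test variable, which stays measurable with respect
  to the past and keeps all its moments; the test class in \<open>martingale_diff\<close> is chosen
  with this in view.\<close>

lemma martingale_diff_past_mult:
  assumes X: "martingale_diff X" and Z: "bounded_moments Z" "adapted Z"
  shows "martingale_diff (\<lambda>i k \<omega>. Z i k \<omega> * X i k \<omega>)"
proof (rule martingale_diffI)
  fix i k and U :: "'w \<Rightarrow> real" assume *: "i \<in> I" "U \<in> borel_measurable (F i k)" "\<And>n. integrable (P i) (\<lambda>\<omega>. \<bar>U \<omega>\<bar> ^ n)"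
  have [measurable]: "Z i k \<in> borel_measurable (F i k)"
    using Z * by (simp add: adapted_def)
  note [measurable] = *(2)
  have "(\<integral>\<omega>. (U \<omega> * Z i k \<omega>) * X i k \<omega> \<partial>P i) = 0"
  proof (rule martingale_diff_orthogonal[OF X *(1)])
    fix n show "integrable (P i) (\<lambda>\<omega>. \<bar>U \<omega> * Z i k \<omega>\<bar> ^ n)"
      by (intro all_moments_mult_integrable *(3) bounded_moments_integrable_abs[OF Z(1) *(1)]
          past_measurable[OF *(1)] *(2)) measurable
  qed measurable
  then show "(\<integral>\<omega>. U \<omega> * (Z i k \<omega> * X i k \<omega>) \<partial>P i) = 0" by (simp add: mult.assoc)
next
  fix i k assume i: "i \<in> I"
  have [measurable]: "Z i k \<in> borel_measurable (F i (Suc k))"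
    using Z i by (auto simp: adapted_def intro: filtration_measurable)
  note [measurable] = martingale_diff_measurable[OF X i]
  show "(\<lambda>\<omega>. Z i k \<omega> * X i k \<omega>) \<in> borel_measurable (F i (Suc k))" by measurable
qed (use X Z in \<open>auto simp: martingale_diff_def intro: bounded_moments_mult\<close>)

lemma martingale_sum_measurable:
  assumes "martingale_diff m" "i \<in> I"
  shows "(\<lambda>\<omega>. \<Sum>k<T. m i k \<omega>) \<in> borel_measurable (F i T)"
proof (induction T)
  case (Suc T)
  have [measurable]: "(\<lambda>\<omega>. \<Sum>k<T. m i k \<omega>) \<in> borel_measurable (F i (Suc T))"
    by (rule filtration_measurable[OF assms(2) Suc])
  have [measurable]: "m i T \<in> borel_measurable (F i (Suc T))"
    by (rule martingale_diff_measurable[OF assms])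
  show ?case by simp
qed simp

end

section \<open>Moments and characteristic functions of martingale sums\<close>

text \<open>Binomial expansion in which the terms of order zero and one are kept exactly, because
  the latter has mean zero for martingale increments. Every later term carries at least
  \<open>x\<^sup>2\<close>, as \<open>x\<close> lies between 0 and 1, and its mixed power is at most
  the sum of the two pure powers. The factor \<open>4 ^ q\<close> is the sum of the binomial
  coefficients of order \<open>2 * q\<close>.\<close>

lemma even_power_growth:
  fixes s m x :: real
  assumes x: "0 \<le> x" "x \<le> 1" and q: "q \<ge> 1"
  shows "(s + x * m) ^ (2 * q) \<le> s ^ (2 * q) + 2 * real q * x * (s ^ (2 * q - 1) * m)
    + x\<^sup>2 * 4 ^ q * (s ^ (2 * q) + m ^ (2 * q))"
proof -
  define n where "n = 2 * q"
  have n: "n \<ge> 2" "even n" using q by (auto simp: n_def)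
  define c where "c j = x\<^sup>2 * real (n choose j) * (s ^ n + m ^ n)" for j
  have c: "c j \<ge> 0" for j
    using n by (auto simp: c_def intro!: mult_nonneg_nonneg add_nonneg_nonneg zero_le_even_power)
  have "real (n choose j) * (x * m) ^ j * s ^ (n - j) \<le>
      (if j = 0 then s ^ n else 0) + (if j = 1 then real n * x * (s ^ (n - 1) * m) else 0) + c j"
    if "j \<le> n" for j
  proof -
    consider "j = 0" | "j = 1" | "j \<ge> 2" by linarith
    then show ?thesis
    proof cases
      case 3
      have "(x * m) ^ j * s ^ (n - j) \<le> \<bar>x\<bar> ^ j * (\<bar>m\<bar> ^ j * \<bar>s\<bar> ^ (n - j))"
        using abs_ge_self[of "(x * m) ^ j * s ^ (n - j)"]
        by (simp add: abs_mult power_abs power_mult_distrib)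
      also have "\<dots> \<le> x\<^sup>2 * (\<bar>m\<bar> ^ n + \<bar>s\<bar> ^ n)"
      proof (rule mult_mono)
        show "\<bar>x\<bar> ^ j \<le> x\<^sup>2" using x 3 power_decreasing[of 2 j x] by simp
        show "\<bar>m\<bar> ^ j * \<bar>s\<bar> ^ (n - j) \<le> \<bar>m\<bar> ^ n + \<bar>s\<bar> ^ n"
          using abs_power_mult_le[of m j s "n - j"] that by simp
      qed auto
      also have "\<dots> = x\<^sup>2 * (s ^ n + m ^ n)" using n by (simp add: power_even_abs add.commute)
      finally have "real (n choose j) * ((x * m) ^ j * s ^ (n - j)) \<le> real (n choose j) * (x\<^sup>2 * (s ^ n + m ^ n))"
        by (intro mult_left_mono) auto
      then show ?thesis using 3 by (simp add: c_def mult_ac)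
    qed (use c[of 0] c[of 1] in auto)
  qed
  then have "(\<Sum>j\<le>n. real (n choose j) * (x * m) ^ j * s ^ (n - j)) \<le>
      (\<Sum>j\<le>n. (if j = 0 then s ^ n else 0) + (if j = 1 then real n * x * (s ^ (n - 1) * m) else 0) + c j)"
    by (intro sum_mono) auto
  also have "\<dots> = s ^ n + real n * x * (s ^ (n - 1) * m) + (\<Sum>j\<le>n. c j)"
    using n by (simp add: sum.distrib)
  also have "(\<Sum>j\<le>n. c j) = x\<^sup>2 * 4 ^ q * (s ^ n + m ^ n)"
    unfolding c_def sum_distrib_right[symmetric] sum_distrib_left[symmetric]
    using choose_row_sum[of n] by (simp add: n_def power_mult flip: of_nat_sum)
  finally show ?thesis
    using binomial_ring[of "x * m" s n] by (simp add: n_def add.commute)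
qed

lemma abs_exp_minus_one_le:
  fixes y :: real
  shows "\<bar>exp y - 1\<bar> \<le> \<bar>y\<bar> * exp \<bar>y\<bar>"
proof (cases "y \<ge> 0")
  case True
  have "exp y * (1 - y) \<le> exp y * exp (- y)"
    using exp_ge_add_one_self[of "-y"] by (intro mult_left_mono) auto
  also have "\<dots> = 1" by (simp flip: exp_add)
  finally show ?thesis using True by (simp add: algebra_simps)
next
  case False
  have "\<bar>exp y - 1\<bar> \<le> - y"
  proof -
    have "exp y \<le> 1" using False by simp
    with exp_ge_add_one_self[of y] show ?thesis by linarith
  qed
  also have "\<dots> \<le> - y * exp (- y)"
    using False mult_left_mono[of 1 "exp (- y)" "- y"] by simp
  finally show ?thesis using False by simp
qed

lemma abs_exp_minus_one_minus_le:
  fixes y :: real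
  shows "\<bar>exp y - 1 - y\<bar> \<le> y\<^sup>2 * exp \<bar>y\<bar>"
proof -
  have "exp y * (1 - y) \<le> exp y * exp (- y)"
    using exp_ge_add_one_self[of "-y"] by (intro mult_left_mono) auto
  also have "\<dots> = 1" by (simp flip: exp_add)
  finally have "exp y - 1 - y \<le> y * (exp y - 1)" by (simp add: algebra_simps)
  also have "\<dots> \<le> \<bar>y\<bar> * (\<bar>y\<bar> * exp \<bar>y\<bar>)"
  proof -
    have "\<bar>y * (exp y - 1)\<bar> \<le> \<bar>y\<bar> * (\<bar>y\<bar> * exp \<bar>y\<bar>)"
      unfolding abs_mult by (intro mult_left_mono abs_exp_minus_one_le) simp
    then show ?thesis by linarith
  qed
  also have "\<dots> = y\<^sup>2 * exp \<bar>y\<bar>"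
    by (simp add: power2_eq_square abs_mult_self_eq flip: mult.assoc)
  finally show ?thesis
    using exp_ge_add_one_self[of y] by linarith
qed

lemma cmod_iexp_minus_one_le: "cmod (iexp x - 1) \<le> \<bar>x\<bar>"
  using iexp_approx1[of x 0] by simp

lemma cmod_iexp_quadratic_le: "cmod (iexp x - (1 + \<i> * complex_of_real x - complex_of_real (x\<^sup>2) / 2)) \<le> \<bar>x\<bar> ^ 3"
proof -
  have "cmod (iexp x - (\<Sum>k\<le>2. (\<i> * x) ^ k / fact k)) \<le> \<bar>x\<bar> ^ 3 / fact 3"
    using iexp_approx1[of x 2] by (simp add: numeral_3_eq_3 numeral_2_eq_2)
  moreover have "(\<Sum>k\<le>2. (\<i> * complex_of_real x) ^ k / fact k) = 1 + \<i> * complex_of_real x - complex_of_real (x\<^sup>2) / 2"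
    by (simp add: numeral_2_eq_2 power2_eq_square algebra_simps)
  moreover have "\<bar>x\<bar> ^ 3 / fact 3 \<le> \<bar>x\<bar> ^ 3" by (simp add: fact_numeral field_simps)
  ultimately show ?thesis by simp
qed

text \<open>With \<open>x\<close> in the role of \<open>1 / sqrt T\<close>, the factor
  \<open>exp y\<close> compensates the variance \<open>v\<close> in one step of the characteristic
  function. What remains to second order is linear in \<open>m\<close> and in
  \<open>m\<^sup>2 - v\<close>, both of which are treated in mean later; the error is of order
  \<open>x ^ 3\<close> with a coefficient that is a polynomial in the modulus of
  \<open>m\<close>.\<close>

lemma compensated_char_step:
  fixes v x m B :: real
  assumes v: "\<bar>v\<bar> \<le> B" and x: "0 \<le> x" "x \<le> 1"
  defines "y \<equiv> v * x\<^sup>2 / 2"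
  shows "cmod (complex_of_real (exp y) * iexp (x * m) - 1) \<le> x * (B * exp (B / 2) + \<bar>m\<bar>)"
    and "cmod (complex_of_real (exp y) * iexp (x * m) - 1 - \<i> * complex_of_real (x * m) + complex_of_real (x\<^sup>2 / 2 * (m\<^sup>2 - v)))
      \<le> x ^ 3 * (B\<^sup>2 * exp (B / 2) + B * exp (B / 2) * \<bar>m\<bar> + \<bar>m\<bar> ^ 3)"
proof -
  have x2: "x\<^sup>2 \<le> x" using x by (simp add: power2_eq_square mult_left_le)
  have x21: "x\<^sup>2 \<le> 1" using x2 x by linarith
  have B: "B \<ge> 0" using v by linarith
  have "\<bar>v\<bar> * x\<^sup>2 \<le> B * x\<^sup>2" using v by (intro mult_right_mono) auto
  then have yx: "\<bar>y\<bar> \<le> B * x\<^sup>2 / 2" by (simp add: y_def abs_mult)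
  moreover have "B * x\<^sup>2 \<le> B * 1" using B x21 by (intro mult_left_mono) auto
  ultimately have yB: "\<bar>y\<bar> \<le> B / 2" by simp
  have e: "exp \<bar>y\<bar> \<le> exp (B / 2)" using yB by simp
  have yx': "\<bar>y\<bar> \<le> B * x\<^sup>2" using yx B by (smt (verit) field_sum_of_halves zero_le_mult_iff zero_le_power2)
  have e1: "\<bar>exp y - 1\<bar> \<le> x\<^sup>2 * (B * exp (B / 2))"
  proof -
    have "\<bar>exp y - 1\<bar> \<le> (B * x\<^sup>2) * exp (B / 2)"
      using abs_exp_minus_one_le[of y] mult_mono[OF yx' e] B by simp
    then show ?thesis by (simp add: mult_ac)
  qed
  have e2: "\<bar>exp y - 1 - y\<bar> \<le> x ^ 3 * (B\<^sup>2 * exp (B / 2))"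
  proof -
    have "y\<^sup>2 \<le> (B * x\<^sup>2)\<^sup>2" using power_mono[OF yx', of 2] by simp
    also have "\<dots> = B\<^sup>2 * (x ^ 3 * x)" by (simp add: power_mult_distrib power2_eq_square power3_eq_cube)
    also have "\<dots> \<le> B\<^sup>2 * (x ^ 3 * 1)" using x by (intro mult_left_mono) auto
    finally have "y\<^sup>2 * exp \<bar>y\<bar> \<le> (B\<^sup>2 * x ^ 3) * exp (B / 2)" using e x by (intro mult_mono) auto
    then show ?thesis using abs_exp_minus_one_minus_le[of y] by (simp add: mult_ac)
  qed
  have e1': "cmod (complex_of_real (exp y) - 1) \<le> x\<^sup>2 * (B * exp (B / 2))"
    using e1 norm_of_real[of "exp y - 1", where 'a = complex] by simp
  have e2': "cmod (complex_of_real (exp y) - 1 - y) \<le> x ^ 3 * (B\<^sup>2 * exp (B / 2))"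
    using e2 norm_of_real[of "exp y - 1 - y", where 'a = complex] by simp
  have i1: "cmod (iexp (x * m) - 1) \<le> x * \<bar>m\<bar>"
    using cmod_iexp_minus_one_le[of "x * m"] x by (simp add: abs_mult)
  have i2: "cmod (iexp (x * m) - (1 + \<i> * complex_of_real (x * m) - complex_of_real ((x * m)\<^sup>2) / 2)) \<le> x ^ 3 * \<bar>m\<bar> ^ 3"
    using cmod_iexp_quadratic_le[of "x * m"] x by (simp add: abs_mult power_mult_distrib)
  have eq1: "complex_of_real (exp y) * iexp (x * m) - 1 = (complex_of_real (exp y) - 1) * iexp (x * m) + (iexp (x * m) - 1)"
    by (simp add: algebra_simps)
  have "cmod (complex_of_real (exp y) * iexp (x * m) - 1) \<le> cmod ((complex_of_real (exp y) - 1) * iexp (x * m)) + cmod (iexp (x * m) - 1)"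
    unfolding eq1 by (rule norm_triangle_ineq)
  also have "\<dots> \<le> x\<^sup>2 * (B * exp (B / 2)) + x * \<bar>m\<bar>"
    using e1' i1 by (simp add: norm_mult)
  also have "\<dots> \<le> x * (B * exp (B / 2)) + x * \<bar>m\<bar>"
    using x2 B by (intro add_mono mult_right_mono) auto
  finally show "cmod (complex_of_real (exp y) * iexp (x * m) - 1) \<le> x * (B * exp (B / 2) + \<bar>m\<bar>)"
    by (simp add: algebra_simps)
  \<comment> \<open>Three errors, each of order \<open>x ^ 3\<close> or smaller: the quadratic
    remainder of \<open>exp y\<close> with \<open>y\<close> of order \<open>x\<^sup>2\<close>, the
    product of the two first-order deviations, and the cubic remainder of
    \<open>iexp\<close>.\<close>
  have eq2: "complex_of_real (exp y) * iexp (x * m) - 1 - \<i> * complex_of_real (x * m) + complex_of_real (x\<^sup>2 / 2 * (m\<^sup>2 - v)) =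
      (complex_of_real (exp y) - 1 - y) + (complex_of_real (exp y) - 1) * (iexp (x * m) - 1)
      + (iexp (x * m) - (1 + \<i> * complex_of_real (x * m) - complex_of_real ((x * m)\<^sup>2) / 2))"
    by (simp add: y_def field_simps power_mult_distrib)
  have "cmod (complex_of_real (exp y) * iexp (x * m) - 1 - \<i> * complex_of_real (x * m) + complex_of_real (x\<^sup>2 / 2 * (m\<^sup>2 - v))) \<le>
     cmod (complex_of_real (exp y) - 1 - y) + cmod ((complex_of_real (exp y) - 1) * (iexp (x * m) - 1))
      + cmod (iexp (x * m) - (1 + \<i> * complex_of_real (x * m) - complex_of_real ((x * m)\<^sup>2) / 2))"
    unfolding eq2 by (meson add_mono norm_triangle_ineq order_refl order_trans)
  also have "\<dots> \<le> x ^ 3 * (B\<^sup>2 * exp (B / 2)) + (x\<^sup>2 * (B * exp (B / 2))) * (x * \<bar>m\<bar>) + x ^ 3 * \<bar>m\<bar> ^ 3"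
    using e2' i2 mult_mono[OF e1' i1] B by (intro add_mono) (auto simp: norm_mult)
  also have "\<dots> = x ^ 3 * (B\<^sup>2 * exp (B / 2) + B * exp (B / 2) * \<bar>m\<bar> + \<bar>m\<bar> ^ 3)"
    by (simp add: algebra_simps power2_eq_square power3_eq_cube)
  finally show "cmod (complex_of_real (exp y) * iexp (x * m) - 1 - \<i> * complex_of_real (x * m) + complex_of_real (x\<^sup>2 / 2 * (m\<^sup>2 - v)))
      \<le> x ^ 3 * (B\<^sup>2 * exp (B / 2) + B * exp (B / 2) * \<bar>m\<bar> + \<bar>m\<bar> ^ 3)" .
qed

lemma (in prob_family) bounded_moments_sum:
  assumes "bounded_moments m"
  shows "bounded_moments (\<lambda>i k \<omega>. \<Sum>j<T. m i j \<omega>)"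
proof (induction T)
  case (Suc T)
  show ?case
    using bounded_moments_add[OF Suc bounded_moments_reindex[OF assms, of "\<lambda>_. T"]] by simp
qed (simp add: bounded_moments_numeral)

context filtered_family
begin

text \<open>The scale \<open>x = 1 / sqrt T\<close> is fixed before the induction over the partial
  sums. The linear term of \<open>even_power_growth\<close> vanishes by orthogonality, so that each
  step changes the moment of order \<open>2 * q\<close> by a relative amount of order
  \<open>1 / T\<close>, and \<open>T\<close> steps multiply it by at most a constant.\<close>

theorem martingale_moments:
  assumes m: "martingale_diff m"
  shows "bounded_moments (\<lambda>i T \<omega>. (\<Sum>k<T. m i k \<omega>) / sqrt (real T))"
proof (rule bounded_momentsI)
  note mb = martingale_diff_bounded_moments[OF m]
  show meas: "(\<lambda>\<omega>. (\<Sum>k<T. m i k \<omega>) / sqrt (real T)) \<in> borel_measurable (P i)" if "i \<in> I" for i T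
    using bounded_moments_measurable[OF mb that] by measurable
  fix n
  \<comment> \<open>An even order \<open>2 * q\<close> above \<open>n\<close>; at the end the power
    \<open>n\<close> is bounded by one plus the power \<open>2 * q\<close>.\<close>
  define q where "q = Suc n"
  have q: "q \<ge> 1" by (simp add: q_def)
  obtain B where B: "B \<ge> 0" "\<And>i k. i \<in> I \<Longrightarrow> (\<integral>\<omega>. \<bar>m i k \<omega>\<bar> ^ (2 * q) \<partial>P i) \<le> B"
    by (rule bounded_moments_bound[OF mb, of "2 * q"]) blast
  define c :: real where "c = 4 ^ q"
  have "integrable (P i) (\<lambda>\<omega>. \<bar>(\<Sum>k<T. m i k \<omega>) / sqrt (real T)\<bar> ^ n) \<and>
      (\<integral>\<omega>. \<bar>(\<Sum>k<T. m i k \<omega>) / sqrt (real T)\<bar> ^ n \<partial>P i) \<le> 1 + B * exp c" if i: "i \<in> I" for i T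
  proof -
    interpret prob_space "P i" by (rule prob[OF i])
    \<comment> \<open>For \<open>T = 0\<close> the convention \<open>1 / 0 = 0\<close> gives
      \<open>x = 0\<close>, so that this case obeys the same bounds.\<close>
    define x where "x = 1 / sqrt (real T)"
    have x: "0 \<le> x" "x \<le> 1" by (cases "T = 0"; simp add: x_def)+
    define s where "s k \<omega> = x * (\<Sum>j<k. m i j \<omega>)" for k \<omega>
    define a where "a k = (\<integral>\<omega>. s k \<omega> ^ (2 * q) \<partial>P i)" for k
    have sb: "bounded_moments (\<lambda>i' k' \<omega>. x * (\<Sum>j<k. m i' j \<omega>))" for k
      by (intro bounded_moments_mult bounded_moments_numeral bounded_moments_sum mb)
    have s_int: "integrable (P i) (\<lambda>\<omega>. \<bar>s k \<omega>\<bar> ^ r)" for k r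
      using bounded_moments_integrable_abs[OF sb i] by (simp add: s_def)
    have s_int': "integrable (P i) (\<lambda>\<omega>. s k \<omega> ^ r)" for k r
      using bounded_moments_integrable_power[OF sb i] by (simp add: s_def)
    have s_meas: "s k \<in> borel_measurable (F i k)" for k
      using martingale_sum_measurable[OF m i, of k] unfolding s_def by measurable
    have m_int: "integrable (P i) (\<lambda>\<omega>. m i k \<omega> ^ (2 * q))" for k
      by (rule bounded_moments_integrable_power[OF mb i])
    have step: "a (Suc k) \<le> (1 + c * x\<^sup>2) * a k + c * x\<^sup>2 * B" for k
    proof -
      have pm: "(\<lambda>\<omega>. s k \<omega> ^ (2 * q - 1)) \<in> borel_measurable (F i k)"
        using s_meas[of k] by measurable
      have pi: "integrable (P i) (\<lambda>\<omega>. \<bar>s k \<omega> ^ (2 * q - 1)\<bar> ^ r)" for r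
        using s_int[of k "(2 * q - 1) * r"] by (simp add: power_abs flip: power_mult)
      have o: "(\<integral>\<omega>. s k \<omega> ^ (2 * q - 1) * m i k \<omega> \<partial>P i) = 0"
        "integrable (P i) (\<lambda>\<omega>. s k \<omega> ^ (2 * q - 1) * m i k \<omega>)"
        using martingale_diff_orthogonal[OF m i pm pi] martingale_diff_integrable[OF m i pm pi] by auto
      have "a (Suc k) \<le> (\<integral>\<omega>. s k \<omega> ^ (2 * q) + 2 * real q * x * (s k \<omega> ^ (2 * q - 1) * m i k \<omega>)
            + x\<^sup>2 * 4 ^ q * (s k \<omega> ^ (2 * q) + m i k \<omega> ^ (2 * q)) \<partial>P i)"
        unfolding a_def
      proof (rule integral_mono)
        show "s (Suc k) \<omega> ^ (2 * q) \<le> s k \<omega> ^ (2 * q) + 2 * real q * x * (s k \<omega> ^ (2 * q - 1) * m i k \<omega>)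
            + x\<^sup>2 * 4 ^ q * (s k \<omega> ^ (2 * q) + m i k \<omega> ^ (2 * q))" for \<omega>
          using even_power_growth[OF x q, of "s k \<omega>" "m i k \<omega>"] by (simp add: s_def distrib_left)
      qed (use s_int' m_int o in auto)
      also have "\<dots> = a k + x\<^sup>2 * 4 ^ q * (a k + (\<integral>\<omega>. m i k \<omega> ^ (2 * q) \<partial>P i))"
        using s_int' m_int o by (simp add: a_def)
      also have "\<dots> \<le> a k + x\<^sup>2 * 4 ^ q * (a k + B)"
        using B(2)[OF i, of k] by (intro add_left_mono mult_left_mono) (auto simp: power_even_abs)
      finally show ?thesis by (simp add: c_def algebra_simps)
    qed
    \<comment> \<open>The right-hand side solves the recursion of \<open>step\<close> with equality
      and initial value zero.\<close>
    have a_le: "a k \<le> B * ((1 + c * x\<^sup>2) ^ k - 1)" for k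
    proof (induction k)
      case 0
      show ?case using q by (simp add: a_def s_def zero_power)
    next
      case (Suc k)
      have "a (Suc k) \<le> (1 + c * x\<^sup>2) * a k + c * x\<^sup>2 * B" by (rule step)
      also have "\<dots> \<le> (1 + c * x\<^sup>2) * (B * ((1 + c * x\<^sup>2) ^ k - 1)) + c * x\<^sup>2 * B"
        using Suc by (intro add_right_mono mult_left_mono) (auto simp: c_def)
      also have "\<dots> = B * ((1 + c * x\<^sup>2) ^ Suc k - 1)" by (simp add: algebra_simps)
      finally show ?case .
    qed
    have "(1 + c * x\<^sup>2) ^ T \<le> exp (c * x\<^sup>2) ^ T"
      by (intro power_mono) (auto simp: c_def)
    also have "\<dots> = exp (c * (x\<^sup>2 * real T))" by (simp add: mult_ac flip: exp_of_nat_mult)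
    also have "\<dots> \<le> exp c" by (cases "T = 0") (auto simp: x_def power_divide c_def)
    finally have "(1 + c * x\<^sup>2) ^ T \<le> exp c" .
    then have aT: "a T \<le> B * exp c"
      using a_le[of T] mult_left_mono[of "(1 + c * x\<^sup>2) ^ T - 1" "exp c" B] B by linarith
    have sT: "s T \<omega> = (\<Sum>k<T. m i k \<omega>) / sqrt (real T)" for \<omega> by (simp add: s_def x_def)
    have le: "\<bar>s T \<omega>\<bar> ^ n \<le> 1 + s T \<omega> ^ (2 * q)" for \<omega>
    proof (cases "\<bar>s T \<omega>\<bar> \<le> 1")
      case True
      then have "\<bar>s T \<omega>\<bar> ^ n \<le> 1" by (intro power_le_one) auto
      moreover have "0 \<le> s T \<omega> ^ (2 * q)" by (rule zero_le_even_power) simp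
      ultimately show ?thesis by linarith
    next
      case False
      then have "\<bar>s T \<omega>\<bar> ^ n \<le> \<bar>s T \<omega>\<bar> ^ (2 * q)" by (intro power_increasing) (auto simp: q_def)
      then show ?thesis by (simp add: power_even_abs)
    qed
    have "(\<integral>\<omega>. \<bar>s T \<omega>\<bar> ^ n \<partial>P i) \<le> (\<integral>\<omega>. 1 + s T \<omega> ^ (2 * q) \<partial>P i)"
      by (intro integral_mono s_int le) (use s_int' in auto)
    also have "\<dots> = 1 + a T" using s_int' by (simp add: a_def prob_space)
    finally show ?thesis using s_int[of T n] aT by (simp add: sT)
  qed
  then show "\<exists>C. \<forall>i\<in>I. \<forall>T. integrable (P i) (\<lambda>\<omega>. \<bar>(\<Sum>k<T. m i k \<omega>) / sqrt (real T)\<bar> ^ n) \<and>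
      (\<integral>\<omega>. \<bar>(\<Sum>k<T. m i k \<omega>) / sqrt (real T)\<bar> ^ n \<partial>P i) \<le> C"
    by blast
qed

text \<open>The cosine and the sine of a past variable are bounded, hence admissible test variables
  for the real and the imaginary part.\<close>

lemma martingale_diff_iexp_orthogonal:
  assumes X: "martingale_diff X" and i: "i \<in> I" and S: "S \<in> borel_measurable (F i k)"
  shows "integrable (P i) (\<lambda>\<omega>. iexp (S \<omega>) * X i k \<omega>)"
    and "(\<integral>\<omega>. iexp (S \<omega>) * X i k \<omega> \<partial>P i) = 0"
proof -
  interpret prob_space "P i" by (rule prob[OF i])
  have S': "S \<in> borel_measurable (P i)" by (rule past_measurable[OF i S])
  have bd: "integrable (P i) (\<lambda>\<omega>. \<bar>f (S \<omega>)\<bar> ^ n)"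
    if "f \<in> borel_measurable borel" "\<And>x. \<bar>f x\<bar> \<le> 1" for f :: "real \<Rightarrow> real" and n
    by (rule integrable_const_bound[of _ 1]) (use that S' in \<open>auto intro!: power_le_one AE_I2\<close>)
  have c: "(\<lambda>\<omega>. cos (S \<omega>)) \<in> borel_measurable (F i k)" "(\<lambda>\<omega>. sin (S \<omega>)) \<in> borel_measurable (F i k)"
    using S by measurable
  note ic = martingale_diff_integrable[OF X i c(1) bd[of cos]] martingale_diff_orthogonal[OF X i c(1) bd[of cos]]
  note sn = martingale_diff_integrable[OF X i c(2) bd[of sin]] martingale_diff_orthogonal[OF X i c(2) bd[of sin]]
  have eq: "iexp (S \<omega>) * X i k \<omega> = complex_of_real (cos (S \<omega>) * X i k \<omega>) + \<i> * complex_of_real (sin (S \<omega>) * X i k \<omega>)" for \<omega>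
    by (simp add: cis_conv_exp[symmetric] complex_eq_iff)
  have 1: "integrable (P i) (\<lambda>\<omega>. complex_of_real (cos (S \<omega>) * X i k \<omega>))"
    "integrable (P i) (\<lambda>\<omega>. \<i> * complex_of_real (sin (S \<omega>) * X i k \<omega>))"
    using ic(1) sn(1) by (auto intro!: integrable_mult_right integrable_of_real simp del: of_real_mult)
  show "integrable (P i) (\<lambda>\<omega>. iexp (S \<omega>) * X i k \<omega>)"
    unfolding eq by (rule Bochner_Integration.integrable_add[OF 1])
  show "(\<integral>\<omega>. iexp (S \<omega>) * X i k \<omega> \<partial>P i) = 0"
    unfolding eq Bochner_Integration.integral_add[OF 1]
    using ic(2) sn(2) by (simp del: of_real_mult)
qed

text \<open>The martingale differences \<open>m\<close> need not have a constant conditional variance: it suffices that the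
  deviation of \<open>m\<^sup>2\<close> from \<open>v\<close> is a coboundary up to a martingale difference. The compensated
  characteristic functions \<open>exp (v k / (2 T)) * iexp (S k / sqrt T)\<close> are then constant in mean up to
  a total error of order \<open>1 / sqrt T\<close>, the coboundary being removed by summation by parts.\<close>

theorem martingale_char_rate:
  assumes m: "martingale_diff m" and N: "martingale_diff N" and H: "bounded_moments H"
    and v: "\<And>i. i \<in> I \<Longrightarrow> \<bar>v i\<bar> \<le> B"
    and m2: "\<And>i k \<omega>. i \<in> I \<Longrightarrow> (m i k \<omega>)\<^sup>2 - v i = N i k \<omega> + (H i k \<omega> - H i (Suc k) \<omega>)"
  obtains C where "\<And>i T. i \<in> I \<Longrightarrow> T \<ge> 1 \<Longrightarrow>
    cmod ((\<integral>\<omega>. iexp ((\<Sum>k<T. m i k \<omega>) / sqrt (real T)) \<partial>P i) - exp (- v i / 2)) \<le> C / sqrt (real T)"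
proof -
  note mb = martingale_diff_bounded_moments[OF m]
  obtain B1 where B1: "B1 \<ge> 0" "\<And>i k. i \<in> I \<Longrightarrow> (\<integral>\<omega>. \<bar>m i k \<omega>\<bar> ^ 1 \<partial>P i) \<le> B1"
    by (rule bounded_moments_bound[OF mb, of 1]) blast
  obtain B3 where B3: "B3 \<ge> 0" "\<And>i k. i \<in> I \<Longrightarrow> (\<integral>\<omega>. \<bar>m i k \<omega>\<bar> ^ 3 \<partial>P i) \<le> B3"
    by (rule bounded_moments_bound[OF mb, of 3]) blast
  obtain BH where BH: "BH \<ge> 0" "\<And>i k. i \<in> I \<Longrightarrow> (\<integral>\<omega>. \<bar>H i k \<omega>\<bar> ^ 1 \<partial>P i) \<le> BH"
    by (rule bounded_moments_bound[OF H, of 1]) blast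
  have mH: "bounded_moments (\<lambda>i k \<omega>. m i k \<omega> * H i (Suc k) \<omega>)"
    by (intro bounded_moments_mult mb bounded_moments_reindex[OF H])
  obtain BM where BM: "BM \<ge> 0" "\<And>i k. i \<in> I \<Longrightarrow> (\<integral>\<omega>. \<bar>m i k \<omega> * H i (Suc k) \<omega>\<bar> ^ 1 \<partial>P i) \<le> BM"
    by (rule bounded_moments_bound[OF mH, of 1]) blast
  \<comment> \<open>\<open>E\<close> bounds the modulus of the compensated exponentials up to time
    \<open>T\<close>. \<open>C1\<close> collects the cubic remainders, \<open>C2\<close> the
    boundary and increment terms of the coboundary, and the last factor \<open>E\<close> pays for
    removing the compensation.\<close>
  define E where "E = exp (B / 2)"
  define C1 where "C1 = E * (B\<^sup>2 * E + B * E * B1 + B3)"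
  define C2 where "C2 = 2 * E * BH + E * (B * E * BH + BM)"
  define C where "C = E * (C1 + C2)"
  have "cmod ((\<integral>\<omega>. iexp ((\<Sum>k<T. m i k \<omega>) / sqrt (real T)) \<partial>P i) - exp (- v i / 2)) \<le> C / sqrt (real T)"
    if i: "i \<in> I" and T: "T \<ge> 1" for i T
  proof -
    interpret prob_space "P i" by (rule prob[OF i])
    have B: "B \<ge> 0" using v[OF i] by linarith
    have E: "E \<ge> 1" using B by (simp add: E_def)
    define x where "x = 1 / sqrt (real T)"
    have x: "0 \<le> x" "x \<le> 1" using T by (auto simp: x_def)
    have x2: "x\<^sup>2 * real T = 1" using T by (simp add: x_def power_divide)
    define y where "y = v i * x\<^sup>2 / 2"
    define S where "S k \<omega> = (\<Sum>j<k. m i j \<omega>)" for k \<omega>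
    define w where "w k \<omega> = complex_of_real (exp (real k * y)) * iexp (x * S k \<omega>)" for k \<omega>
    define g where "g k \<omega> = complex_of_real (exp y) * iexp (x * m i k \<omega>) - 1 - \<i> * complex_of_real (x * m i k \<omega>)
      + complex_of_real (x\<^sup>2 / 2 * ((m i k \<omega>)\<^sup>2 - v i))" for k \<omega>
    note [measurable] = bounded_moments_measurable[OF mb i] bounded_moments_measurable[OF H i]
    have S_meas: "(\<lambda>\<omega>. x * S k \<omega>) \<in> borel_measurable (F i k)" for k
      using martingale_sum_measurable[OF m i, of k] unfolding S_def by measurable
    have [measurable]: "S k \<in> borel_measurable (P i)" for k unfolding S_def by measurable
    have [measurable]: "w k \<in> borel_measurable (P i)" "g k \<in> borel_measurable (P i)" for k
      unfolding w_def g_def by measurable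
    have w_le: "cmod (w k \<omega>) \<le> E" if "k \<le> T" for k \<omega>
    proof -
      have "real k * y \<le> real k * (B * x\<^sup>2 / 2)"
        using v[OF i] by (intro mult_left_mono) (auto simp: y_def mult_right_mono)
      also have "\<dots> \<le> real T * (B * x\<^sup>2 / 2)"
        using that B by (intro mult_right_mono) auto
      also have "\<dots> = B / 2" using x2 by (simp add: mult_ac)
      finally show ?thesis by (simp add: w_def norm_mult E_def)
    qed
    have w_step: "w (Suc k) \<omega> = w k \<omega> * (complex_of_real (exp y) * iexp (x * m i k \<omega>))" for k \<omega>
      by (simp add: w_def S_def distrib_left distrib_right exp_add mult_ac)
    note st = compensated_char_step[OF v[OF i] x, folded y_def E_def]
    have w_diff: "cmod (w (Suc k) \<omega> - w k \<omega>) \<le> E * (x * (B * E + \<bar>m i k \<omega>\<bar>))" if "k < T" for k \<omega>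
    proof -
      have "w (Suc k) \<omega> - w k \<omega> = w k \<omega> * (complex_of_real (exp y) * iexp (x * m i k \<omega>) - 1)"
        by (simp add: w_step algebra_simps)
      then show ?thesis
        using mult_mono[OF w_le[of k \<omega>] st(1)[of "m i k \<omega>"]] that E by (simp add: norm_mult)
    qed
    have g_le: "cmod (w k \<omega> * g k \<omega>) \<le> E * (x ^ 3 * (B\<^sup>2 * E + B * E * \<bar>m i k \<omega>\<bar> + \<bar>m i k \<omega>\<bar> ^ 3))"
      if "k < T" for k \<omega>
      using mult_mono[OF w_le[of k \<omega>] st(2)[of "m i k \<omega>"]] that E by (simp add: norm_mult g_def)
    note mi = bounded_moments_integrable_abs[OF mb i]
    note mi1 = mi[of _ 1, simplified]
    have Hi: "integrable (P i) (\<lambda>\<omega>. \<bar>H i k \<omega>\<bar>)" for k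
      using bounded_moments_integrable_abs[OF H i, of k 1] by simp
    have mHi: "integrable (P i) (\<lambda>\<omega>. \<bar>m i k \<omega> * H i (Suc k) \<omega>\<bar>)" for k
      using bounded_moments_integrable_abs[OF mH i, of k 1] by simp
    have g_int: "integrable (P i) (\<lambda>\<omega>. w k \<omega> * g k \<omega>)" if "k < T" for k
      by (rule Bochner_Integration.integrable_bound[where f = "\<lambda>\<omega>. E * (x ^ 3 * (B\<^sup>2 * E + B * E * \<bar>m i k \<omega>\<bar> + \<bar>m i k \<omega>\<bar> ^ 3))"])
        (use g_le[OF that] mi mi1 in \<open>auto intro!: AE_I2 order_trans[OF g_le[OF that]]\<close>)
    have g_bd: "cmod (\<integral>\<omega>. w k \<omega> * g k \<omega> \<partial>P i) \<le> x ^ 3 * C1" if "k < T" for k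
    proof -
      have "cmod (\<integral>\<omega>. w k \<omega> * g k \<omega> \<partial>P i) \<le> (\<integral>\<omega>. cmod (w k \<omega> * g k \<omega>) \<partial>P i)"
        by (rule integral_norm_bound)
      also have "\<dots> \<le> (\<integral>\<omega>. E * (x ^ 3 * (B\<^sup>2 * E + B * E * \<bar>m i k \<omega>\<bar> + \<bar>m i k \<omega>\<bar> ^ 3)) \<partial>P i)"
        by (intro integral_mono g_le that) (use g_int[OF that] mi mi1 in auto)
      also have "\<dots> = E * (x ^ 3 * (B\<^sup>2 * E + B * E * (\<integral>\<omega>. \<bar>m i k \<omega>\<bar> \<partial>P i) + (\<integral>\<omega>. \<bar>m i k \<omega>\<bar> ^ 3 \<partial>P i)))"
        using mi mi1 by (simp add: prob_space)
      also have "\<dots> \<le> E * (x ^ 3 * (B\<^sup>2 * E + B * E * B1 + B3))"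
        using B1(2)[OF i, of k] B3(2)[OF i, of k] E B x by (intro mult_left_mono add_mono) auto
      finally show ?thesis by (simp add: C1_def mult_ac)
    qed
    have wm: "integrable (P i) (\<lambda>\<omega>. w k \<omega> * X i k \<omega>)" "(\<integral>\<omega>. w k \<omega> * X i k \<omega> \<partial>P i) = 0"
      if "martingale_diff X" for X k
      using martingale_diff_iexp_orthogonal[OF that i S_meas[of k]] by (auto simp: w_def mult.assoc)
    have w_bint: "integrable (P i) (\<lambda>\<omega>. w k \<omega> * complex_of_real (Z \<omega>))"
      if "k \<le> T" "Z \<in> borel_measurable (P i)" "integrable (P i) (\<lambda>\<omega>. \<bar>Z \<omega>\<bar>)" for k Z
    proof (rule Bochner_Integration.integrable_bound[where f = "\<lambda>\<omega>. E * \<bar>Z \<omega>\<bar>"])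
      show "AE \<omega> in P i. norm (w k \<omega> * complex_of_real (Z \<omega>)) \<le> norm (E * \<bar>Z \<omega>\<bar>)"
        using w_le[OF that(1)] E by (intro AE_I2) (auto simp: norm_mult abs_mult intro!: mult_right_mono)
    qed (use that in auto)
    have w_int: "integrable (P i) (w k)" if "k \<le> T" for k
      using w_bint[OF that, of "\<lambda>_. 1"] by simp
    define dH where "dH k \<omega> = H i k \<omega> - H i (Suc k) \<omega>" for k \<omega>
    have dH_int: "integrable (P i) (\<lambda>\<omega>. w k \<omega> * complex_of_real (dH k \<omega>))" if "k \<le> T" for k
      using w_bint[OF that, of "H i k"] w_bint[OF that, of "H i (Suc k)"] Hi
      by (simp add: dH_def right_diff_distrib)
    \<comment> \<open>The terms linear in \<open>m i k\<close> and in \<open>N i k\<close> have mean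
      zero against \<open>w k\<close>, a function of the past; the cubic remainder and the
      coboundary survive.\<close>
    have step: "(\<integral>\<omega>. w (Suc k) \<omega> \<partial>P i) - (\<integral>\<omega>. w k \<omega> \<partial>P i) =
       (\<integral>\<omega>. w k \<omega> * g k \<omega> \<partial>P i) - complex_of_real (x\<^sup>2 / 2) * (\<integral>\<omega>. w k \<omega> * complex_of_real (dH k \<omega>) \<partial>P i)"
      if "k < T" for k
    proof -
      have eq: "w (Suc k) \<omega> - w k \<omega> = w k \<omega> * g k \<omega> + (\<i> * complex_of_real x) * (w k \<omega> * complex_of_real (m i k \<omega>))
          - complex_of_real (x\<^sup>2 / 2) * (w k \<omega> * complex_of_real (N i k \<omega>))
          - complex_of_real (x\<^sup>2 / 2) * (w k \<omega> * complex_of_real (dH k \<omega>))" for \<omega>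
      proof -
        have "(m i k \<omega>)\<^sup>2 - v i = N i k \<omega> + dH k \<omega>" using m2[OF i] by (simp add: dH_def)
        then show ?thesis unfolding w_step g_def by (simp add: algebra_simps)
      qed
      have "(\<integral>\<omega>. w (Suc k) \<omega> \<partial>P i) - (\<integral>\<omega>. w k \<omega> \<partial>P i) = (\<integral>\<omega>. w (Suc k) \<omega> - w k \<omega> \<partial>P i)"
        using that by (simp add: w_int)
      also have "\<dots> = (\<integral>\<omega>. w k \<omega> * g k \<omega> \<partial>P i) - complex_of_real (x\<^sup>2 / 2) * (\<integral>\<omega>. w k \<omega> * complex_of_real (dH k \<omega>) \<partial>P i)"
        unfolding eq using wm[OF m] wm[OF N] g_int[OF that] dH_int[of k] that
        by (simp del: of_real_divide of_real_power)
      finally show ?thesis .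
    qed
    \<comment> \<open>The differences are moved from \<open>H\<close> to \<open>w\<close>, whose
      increments are of order \<open>x\<close>. The sum of \<open>T\<close> terms is then of order
      \<open>sqrt T\<close>, and the prefactor \<open>x\<^sup>2 / 2\<close> brings it down to order
      \<open>x\<close>.\<close>
    have parts: "(\<Sum>k<n. w k \<omega> * complex_of_real (dH k \<omega>)) = w 0 \<omega> * H i 0 \<omega> - w n \<omega> * H i n \<omega>
        + (\<Sum>k<n. (w (Suc k) \<omega> - w k \<omega>) * H i (Suc k) \<omega>)" for \<omega> n
      by (induction n) (auto simp: dH_def algebra_simps)
    have parts_le: "cmod (\<Sum>k<T. w k \<omega> * complex_of_real (dH k \<omega>)) \<le> E * \<bar>H i 0 \<omega>\<bar> + E * \<bar>H i T \<omega>\<bar>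
        + (\<Sum>k<T. E * x * (B * E * \<bar>H i (Suc k) \<omega>\<bar> + \<bar>m i k \<omega> * H i (Suc k) \<omega>\<bar>))" for \<omega>
    proof -
      have "cmod ((w (Suc k) \<omega> - w k \<omega>) * H i (Suc k) \<omega>) \<le>
          E * x * (B * E * \<bar>H i (Suc k) \<omega>\<bar> + \<bar>m i k \<omega> * H i (Suc k) \<omega>\<bar>)" if "k < T" for k
      proof -
        have "cmod (w (Suc k) \<omega> - w k \<omega>) * \<bar>H i (Suc k) \<omega>\<bar> \<le> E * (x * (B * E + \<bar>m i k \<omega>\<bar>)) * \<bar>H i (Suc k) \<omega>\<bar>"
          by (intro mult_right_mono w_diff[OF that]) auto
        then show ?thesis unfolding norm_mult norm_of_real abs_mult by (simp add: algebra_simps)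
      qed
      then have "cmod (\<Sum>k<T. (w (Suc k) \<omega> - w k \<omega>) * H i (Suc k) \<omega>) \<le>
          (\<Sum>k<T. E * x * (B * E * \<bar>H i (Suc k) \<omega>\<bar> + \<bar>m i k \<omega> * H i (Suc k) \<omega>\<bar>))"
        by (intro order_trans[OF norm_sum] sum_mono) auto
      moreover have "cmod (w 0 \<omega> * H i 0 \<omega>) \<le> E * \<bar>H i 0 \<omega>\<bar>" "cmod (w T \<omega> * H i T \<omega>) \<le> E * \<bar>H i T \<omega>\<bar>"
        using w_le[of 0 \<omega>] w_le[of T \<omega>] by (auto simp: norm_mult intro!: mult_right_mono)
      moreover have "cmod (a - b + c) \<le> cmod a + cmod b + cmod c" for a b c
        by (meson add_mono norm_triangle_ineq norm_triangle_ineq4 order_refl order_trans)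
      ultimately show ?thesis unfolding parts by (smt (verit))
    qed
    have H_bd: "(\<integral>\<omega>. \<bar>H i k \<omega>\<bar> \<partial>P i) \<le> BH" for k using BH(2)[OF i, of k] by simp
    have mH_bd: "(\<integral>\<omega>. \<bar>m i k \<omega> * H i (Suc k) \<omega>\<bar> \<partial>P i) \<le> BM" for k using BM(2)[OF i, of k] by simp
    have dH_bd: "cmod (\<Sum>k<T. \<integral>\<omega>. w k \<omega> * complex_of_real (dH k \<omega>) \<partial>P i) \<le>
        2 * (E * BH) + real T * (E * (x * (B * (E * BH) + BM)))"
    proof -
      have "cmod (\<Sum>k<T. \<integral>\<omega>. w k \<omega> * complex_of_real (dH k \<omega>) \<partial>P i) =
          cmod (\<integral>\<omega>. (\<Sum>k<T. w k \<omega> * complex_of_real (dH k \<omega>)) \<partial>P i)"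
        using dH_int by (simp add: Bochner_Integration.integral_sum)
      also have "\<dots> \<le> (\<integral>\<omega>. cmod (\<Sum>k<T. w k \<omega> * complex_of_real (dH k \<omega>)) \<partial>P i)"
        by (rule integral_norm_bound)
      also have "\<dots> \<le> (\<integral>\<omega>. E * \<bar>H i 0 \<omega>\<bar> + E * \<bar>H i T \<omega>\<bar>
        + (\<Sum>k<T. E * x * (B * E * \<bar>H i (Suc k) \<omega>\<bar> + \<bar>m i k \<omega> * H i (Suc k) \<omega>\<bar>)) \<partial>P i)"
        by (intro integral_mono parts_le integrable_norm Bochner_Integration.integrable_sum dH_int)
          (use Hi mHi in auto)
      also have "\<dots> = E * (\<integral>\<omega>. \<bar>H i 0 \<omega>\<bar> \<partial>P i) + E * (\<integral>\<omega>. \<bar>H i T \<omega>\<bar> \<partial>P i)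
        + (\<Sum>k<T. E * x * (B * E * (\<integral>\<omega>. \<bar>H i (Suc k) \<omega>\<bar> \<partial>P i) + (\<integral>\<omega>. \<bar>m i k \<omega> * H i (Suc k) \<omega>\<bar> \<partial>P i)))"
        using Hi mHi by (simp add: Bochner_Integration.integral_sum)
      also have "\<dots> \<le> E * BH + E * BH + (\<Sum>k<T. E * x * (B * E * BH + BM))"
        using H_bd mH_bd E x B by (intro add_mono sum_mono mult_left_mono) auto
      finally show ?thesis by (simp add: mult_ac)
    qed
    have "(\<integral>\<omega>. w T \<omega> \<partial>P i) - 1 = (\<Sum>k<T. (\<integral>\<omega>. w (Suc k) \<omega> \<partial>P i) - (\<integral>\<omega>. w k \<omega> \<partial>P i))"
    proof -
      have "(\<integral>\<omega>. w 0 \<omega> \<partial>P i) = 1" by (simp add: w_def[abs_def] S_def prob_space)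
      then show ?thesis by (subst sum_lessThan_telescope) simp
    qed
    also have "\<dots> = (\<Sum>k<T. (\<integral>\<omega>. w k \<omega> * g k \<omega> \<partial>P i)) -
        complex_of_real (x\<^sup>2 / 2) * (\<Sum>k<T. \<integral>\<omega>. w k \<omega> * complex_of_real (dH k \<omega>) \<partial>P i)"
      by (simp add: step sum_subtractf sum_distrib_left)
    finally have "cmod ((\<integral>\<omega>. w T \<omega> \<partial>P i) - 1) \<le> cmod (\<Sum>k<T. (\<integral>\<omega>. w k \<omega> * g k \<omega> \<partial>P i)) +
        x\<^sup>2 / 2 * cmod (\<Sum>k<T. \<integral>\<omega>. w k \<omega> * complex_of_real (dH k \<omega>) \<partial>P i)"
      by (metis (no_types, lifting) norm_triangle_ineq4 norm_mult norm_of_real abs_of_nonneg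
          divide_nonneg_nonneg zero_le_power2 zero_le_numeral)
    also have "\<dots> \<le> (\<Sum>k<T. x ^ 3 * C1) + x\<^sup>2 / 2 * (2 * (E * BH) + real T * (E * (x * (B * (E * BH) + BM))))"
      using g_bd by (intro add_mono mult_left_mono dH_bd order_trans[OF norm_sum] sum_mono) auto
    also have "\<dots> = x * (x\<^sup>2 * real T) * C1 + x\<^sup>2 * (E * BH) + x * (x\<^sup>2 * real T) * (E * (B * E * BH + BM) / 2)"
      by (simp add: power2_eq_square power3_eq_cube algebra_simps)
    also have "\<dots> = x * C1 + x\<^sup>2 * (E * BH) + x * (E * (B * E * BH + BM) / 2)"
      by (simp add: x2)
    also have "\<dots> \<le> x * C1 + x * (2 * E * BH) + x * (E * (B * E * BH + BM))"
    proof (intro add_mono order_refl mult_mono)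
      show "x\<^sup>2 \<le> x" using x by (simp add: power2_eq_square mult_left_le)
      have "0 \<le> E * (B * E * BH + BM)" using E B BH(1) BM(1) by (intro mult_nonneg_nonneg add_nonneg_nonneg) auto
      then show "E * (B * E * BH + BM) / 2 \<le> E * (B * E * BH + BM)" by linarith
    qed (use x E B BH(1) BM(1) in auto)
    also have "\<dots> = x * (C1 + C2)" by (simp add: C2_def algebra_simps)
    finally have fin: "cmod ((\<integral>\<omega>. w T \<omega> \<partial>P i) - 1) \<le> x * (C1 + C2)" .
    have Ty: "real T * y = v i / 2" using x2 by (simp add: y_def mult_ac)
    have wT: "w T \<omega> = complex_of_real (exp (v i / 2)) * iexp ((\<Sum>k<T. m i k \<omega>) / sqrt (real T))" for \<omega>
      unfolding w_def Ty by (simp add: x_def S_def)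
    have "(\<integral>\<omega>. iexp ((\<Sum>k<T. m i k \<omega>) / sqrt (real T)) \<partial>P i) - complex_of_real (exp (- v i / 2)) =
        complex_of_real (exp (- v i / 2)) * ((\<integral>\<omega>. w T \<omega> \<partial>P i) - 1)"
      unfolding wT integral_mult_right_zero
      by (simp add: right_diff_distrib mult.assoc[symmetric] exp_minus flip: of_real_mult)
    then have "cmod ((\<integral>\<omega>. iexp ((\<Sum>k<T. m i k \<omega>) / sqrt (real T)) \<partial>P i) - complex_of_real (exp (- v i / 2))) =
        exp (- v i / 2) * cmod ((\<integral>\<omega>. w T \<omega> \<partial>P i) - 1)"
      by (simp add: norm_mult)
    also have "\<dots> \<le> E * (x * (C1 + C2))"
      using v[OF i] E by (intro mult_mono fin) (auto simp: E_def)
    finally show ?thesis by (simp add: C_def x_def)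
  qed
  then show ?thesis by (rule that)
qed

end

section \<open>Quadratic statistics of a hidden autoregression\<close>

text \<open>As a scaled standard normal law the degenerate case is included, and moments and
  characteristic functions reduce to the standard ones.\<close>

lemma centred_normal_eq_distr:
  assumes "v \<ge> 0"
  shows "centred_normal v = distr std_normal_distribution borel (\<lambda>x. sqrt v * x)"
proof (cases "v = 0")
  case True
  interpret prob_space std_normal_distribution
    using real_dist_normal_dist by (simp add: real_distribution_def)
  have "distr std_normal_distribution borel (\<lambda>x. 0) = return borel (0 :: real)"
    by (rule prob_space.distr_const) (auto intro: prob_space_axioms)
  then show ?thesis using True by (simp add: centred_normal_def)
next
  case False
  interpret prob_space std_normal_distribution
    using real_dist_normal_dist by (simp add: real_distribution_def)
  have "distributed std_normal_distribution lborel (\<lambda>x. x) std_normal_density"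
    by (auto simp: distributed_def distr_id2)
  then have "distributed std_normal_distribution lborel (\<lambda>x. 0 + sqrt v * x) (normal_density (0 + sqrt v * 0) (\<bar>sqrt v\<bar> * 1))"
    using False by (intro normal_density_affine) auto
  then have "distr std_normal_distribution lborel (\<lambda>x. sqrt v * x) = density lborel (normal_density 0 (sqrt v))"
    using assms by (simp add: distributed_def)
  moreover have "distr std_normal_distribution lborel (\<lambda>x. sqrt v * x) = distr std_normal_distribution borel (\<lambda>x. sqrt v * x)"
    by (rule distr_cong) auto
  ultimately show ?thesis using False by (simp add: centred_normal_def)
qed

lemma real_distribution_centred_normal:
  assumes "v \<ge> 0" shows "real_distribution (centred_normal v)"
proof -
  interpret prob_space std_normal_distribution
    using real_dist_normal_dist by (simp add: real_distribution_def)
  show ?thesis unfolding centred_normal_eq_distr[OF assms] by (rule real_distribution_distr) simp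
qed

lemma char_centred_normal:
  assumes "v \<ge> 0" shows "char (centred_normal v) t = exp (- v * t\<^sup>2 / 2)"
proof -
  have "char (centred_normal v) t = char std_normal_distribution (t * sqrt v)"
    unfolding centred_normal_eq_distr[OF assms] char_def
    by (subst integral_distr) (auto simp: mult_ac)
  also have "\<dots> = exp (- v * t\<^sup>2 / 2)"
    unfolding char_std_normal_distribution using assms by (simp add: power_mult_distrib mult_ac)
  finally show ?thesis .
qed

lemma centred_normal_moments:
  assumes "v \<ge> 0"
  shows "integrable (centred_normal v) (\<lambda>x. x ^ n)"
    and "integrable (centred_normal v) (\<lambda>x. \<bar>x\<bar> ^ n)"
    and "(\<integral>x. \<bar>x\<bar> ^ n \<partial>centred_normal v) = sqrt v ^ n * (\<integral>x. \<bar>x\<bar> ^ n \<partial>std_normal_distribution)"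
    and "(\<integral>x. x \<partial>centred_normal v) = 0"
    and "(\<integral>x. x ^ 2 \<partial>centred_normal v) = v"
    and "(\<integral>x. x ^ 3 \<partial>centred_normal v) = 0"
    and "(\<integral>x. x ^ 4 \<partial>centred_normal v) = 3 * v\<^sup>2"
proof -
  note eq = centred_normal_eq_distr[OF assms]
  have 1: "integrable std_normal_distribution (\<lambda>x. \<bar>x\<bar> ^ n)" for n
    by (rule Bochner_Integration.integrable_bound[OF integrable_abs[OF integrable_std_normal_distribution_moment[of n]]])
      (auto simp: power_abs)
  show "integrable (centred_normal v) (\<lambda>x. x ^ n)"
    unfolding eq by (subst integrable_distr_eq) (auto simp: power_mult_distrib integrable_std_normal_distribution_moment)
  show "integrable (centred_normal v) (\<lambda>x. \<bar>x\<bar> ^ n)"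
    unfolding eq by (subst integrable_distr_eq) (use 1 assms in \<open>auto simp: power_mult_distrib abs_mult\<close>)
  show "(\<integral>x. \<bar>x\<bar> ^ n \<partial>centred_normal v) = sqrt v ^ n * (\<integral>x. \<bar>x\<bar> ^ n \<partial>std_normal_distribution)"
    unfolding eq by (subst integral_distr) (use assms in \<open>auto simp: power_mult_distrib abs_mult\<close>)
  have pw: "(\<integral>x. x ^ n \<partial>centred_normal v) = sqrt v ^ n * (\<integral>x. x ^ n \<partial>std_normal_distribution)" for n
    unfolding eq by (subst integral_distr) (auto simp: power_mult_distrib)
  show "(\<integral>x. x \<partial>centred_normal v) = 0"
    using pw[of 1] integral_std_normal_distribution_moment_odd[of 1] by simp
  show "(\<integral>x. x ^ 2 \<partial>centred_normal v) = v"
    using pw[of 2] std_normal_distribution_even_moments[of 1] assms by simp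
  show "(\<integral>x. x ^ 3 \<partial>centred_normal v) = 0"
    using pw[of 3] integral_std_normal_distribution_moment_odd[of 3] by simp
  have "(\<integral>x. x ^ 4 \<partial>std_normal_distribution) = 3"
    using std_normal_distribution_even_moments[of 2] by (simp add: fact_numeral)
  then show "(\<integral>x. x ^ 4 \<partial>centred_normal v) = 3 * v\<^sup>2"
    using pw[of 4] assms power_mult[of "sqrt v" 2 2] by simp
qed

text \<open>Convexity of the power function, by induction: the defect in the step is a multiple of
  \<open>(a ^ n - b ^ n) * (a - b)\<close>, a product of two factors of the same sign. It yields the
  contraction of the moments of the autoregression.\<close>

lemma convex_combination_power_le:
  fixes a b r :: real
  assumes "0 \<le> a" "0 \<le> b" "0 \<le> r" "r \<le> 1"
  shows "(r * a + (1 - r) * b) ^ n \<le> r * a ^ n + (1 - r) * b ^ n"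
proof (induction n)
  case (Suc n)
  have "(r * a + (1 - r) * b) ^ Suc n \<le> (r * a + (1 - r) * b) * (r * a ^ n + (1 - r) * b ^ n)"
    using Suc assms by (simp add: mult_left_mono)
  moreover have "(r * a + (1 - r) * b) * (r * a ^ n + (1 - r) * b ^ n) =
      r * a ^ Suc n + (1 - r) * b ^ Suc n - r * (1 - r) * ((a ^ n - b ^ n) * (a - b))"
    by (simp add: algebra_simps)
  moreover have "0 \<le> r * (1 - r) * ((a ^ n - b ^ n) * (a - b))"
  proof -
    have "0 \<le> (a ^ n - b ^ n) * (a - b)"
      using assms power_mono[of a b n] power_mono[of b a n]
      by (cases "a \<le> b") (auto simp: mult_nonpos_nonpos)
    then show ?thesis using assms by simp
  qed
  ultimately show ?case by linarith
qed simp

context prob_family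
begin

text \<open>Converse of \<open>bounded_moments_const\<close>: under a probability measure the first
  absolute moment of a constant is its modulus.\<close>

lemma const_bounded:
  assumes "bounded_moments (\<lambda>i k \<omega>. c i)"
  obtains C where "\<And>i. i \<in> I \<Longrightarrow> \<bar>c i\<bar> \<le> C"
proof -
  obtain C where C: "\<And>i k. i \<in> I \<Longrightarrow> (\<integral>\<omega>. \<bar>c i\<bar> ^ 1 \<partial>P i) \<le> C"
    by (rule bounded_moments_bound[OF assms, of 1]) blast
  have "\<bar>c i\<bar> \<le> C" if i: "i \<in> I" for i
  proof -
    interpret prob_space "P i" by (rule prob[OF i])
    show ?thesis using C[OF i] by (simp add: prob_space)
  qed
  then show ?thesis by (rule that)
qed

lemma normal_bounded_moments:
  assumes X: "\<And>i k. i \<in> I \<Longrightarrow> X i k \<in> borel_measurable (P i)"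
    and law: "\<And>i k. i \<in> I \<Longrightarrow> distr (P i) borel (X i k) = centred_normal (v i)"
    and v: "\<And>i. i \<in> I \<Longrightarrow> v i \<ge> 0" "bounded_moments (\<lambda>i k \<omega>. v i)"
  shows "bounded_moments X"
proof (rule bounded_momentsI)
  fix n
  obtain V where V: "\<And>i. i \<in> I \<Longrightarrow> \<bar>v i\<bar> \<le> V" by (rule const_bounded[OF v(2)]) blast
  define c where "c = (\<integral>x. \<bar>x\<bar> ^ n \<partial>std_normal_distribution)"
  have c: "c \<ge> 0" by (simp add: c_def)
  have "integrable (P i) (\<lambda>\<omega>. \<bar>X i k \<omega>\<bar> ^ n) \<and> (\<integral>\<omega>. \<bar>X i k \<omega>\<bar> ^ n \<partial>P i) \<le> sqrt V ^ n * c"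
    if i: "i \<in> I" for i k
  proof
    note X[OF i, measurable]
    show "integrable (P i) (\<lambda>\<omega>. \<bar>X i k \<omega>\<bar> ^ n)"
      using centred_normal_moments(2)[OF v(1)[OF i], of n] unfolding law[OF i, of k, symmetric]
      by (subst (asm) integrable_distr_eq) auto
    have "(\<integral>\<omega>. \<bar>X i k \<omega>\<bar> ^ n \<partial>P i) = (\<integral>x. \<bar>x\<bar> ^ n \<partial>centred_normal (v i))"
      unfolding law[OF i, of k, symmetric] by (subst integral_distr) auto
    also have "\<dots> = sqrt (v i) ^ n * c"
      using centred_normal_moments(3)[OF v(1)[OF i]] by (simp add: c_def)
    also have "\<dots> \<le> sqrt V ^ n * c"
      using V[OF i] v(1)[OF i] c by (intro mult_right_mono power_mono) auto
    finally show "(\<integral>\<omega>. \<bar>X i k \<omega>\<bar> ^ n \<partial>P i) \<le> sqrt V ^ n * c" .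
  qed
  then show "\<exists>C. \<forall>i\<in>I. \<forall>k. integrable (P i) (\<lambda>\<omega>. \<bar>X i k \<omega>\<bar> ^ n) \<and> (\<integral>\<omega>. \<bar>X i k \<omega>\<bar> ^ n \<partial>P i) \<le> C"
    by blast
qed (rule X)

end

text \<open>The variance of \<open>q1 * \<eta>\<^sup>2 + q2 * \<eta> * \<epsilon> + q3 *
  \<epsilon>\<^sup>2\<close> for a centred Gaussian pair with variances \<open>s11\<close>,
  \<open>s22\<close> and covariance \<open>s12\<close>.\<close>

definition quadratic_noise_variance :: "real \<Rightarrow> real \<Rightarrow> real \<Rightarrow> real \<Rightarrow> real \<Rightarrow> real \<Rightarrow> real" where
  "quadratic_noise_variance s11 s12 s22 q1 q2 q3 =
    2 * q1\<^sup>2 * s11\<^sup>2 + q2\<^sup>2 * (s11 * s22 + s12\<^sup>2) + 2 * q3\<^sup>2 * s22\<^sup>2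
    + 4 * q1 * q2 * s11 * s12 + 4 * q1 * q3 * s12\<^sup>2 + 4 * q2 * q3 * s22 * s12"

text \<open>For the increments \<open>D\<close> of the observation, driven by the autoregression \<open>Y\<close>, the combination
  \<open>u\<^sub>1 D\<^sub>k\<^sub>+\<^sub>1\<^sup>2 + u\<^sub>2 D\<^sub>k\<^sub>+\<^sub>1 D\<^sub>k\<close> is, up to its mean and a coboundary, the martingale difference
  \<open>A Y\<^sub>k \<eta>\<^sub>k + (B Y\<^sub>k + C D\<^sub>k) \<epsilon>\<^sub>k + q(\<eta>\<^sub>k, \<epsilon>\<^sub>k)\<close> with the following coefficients. Its conditional variance
  \<open>\<alpha> Y\<^sub>k\<^sup>2 + \<beta> Y\<^sub>k D\<^sub>k + \<delta> D\<^sub>k\<^sup>2 + const\<close> is reduced to a constant by the function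
  \<open>\<lambda> Y\<^sup>2 + \<beta> Y D + \<delta> D\<^sup>2\<close>, a solution of the Poisson equation.\<close>

definition ar_kappa where "ar_kappa \<rho> p = p\<^sup>2 / (1 - \<rho>\<^sup>2)" for \<rho> p :: real
definition ar_A where "ar_A \<rho> p u1 u2 = 2 * ar_kappa \<rho> p * \<rho> * u1 + (p\<^sup>2 + 2 * \<rho>\<^sup>2 * ar_kappa \<rho> p) * u2" for \<rho> p u1 u2 :: real
definition ar_B where "ar_B \<rho> p u1 u2 = 2 * p * u1 + p * \<rho> * u2" for \<rho> p u1 u2 :: real
definition ar_alpha where "ar_alpha \<rho> p s11 s12 s22 u1 u2 = (ar_A \<rho> p u1 u2)\<^sup>2 * s11
  + 2 * ar_A \<rho> p u1 u2 * ar_B \<rho> p u1 u2 * s12 + (ar_B \<rho> p u1 u2)\<^sup>2 * s22" for \<rho> p s11 s12 s22 u1 u2 :: real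
definition ar_beta where "ar_beta \<rho> p s12 s22 u1 u2 = 2 * ar_A \<rho> p u1 u2 * u2 * s12 + 2 * ar_B \<rho> p u1 u2 * u2 * s22"
  for \<rho> p s12 s22 u1 u2 :: real
definition ar_delta where "ar_delta s22 u2 = u2\<^sup>2 * s22" for s22 u2 :: real
definition ar_lambda where "ar_lambda \<rho> p s11 s12 s22 u1 u2 = (ar_alpha \<rho> p s11 s12 s22 u1 u2
  + ar_beta \<rho> p s12 s22 u1 u2 * \<rho> * p + ar_delta s22 u2 * p\<^sup>2) / (1 - \<rho>\<^sup>2)" for \<rho> p s11 s12 s22 u1 u2 :: real

text \<open>The variance of the quadratic noise part, plus the mean of the Poisson solution
  evaluated at the noise pair \<open>(\<eta>, \<epsilon>)\<close> in place of \<open>(Y, D)\<close>;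
  this is the constant left over when the solution is moved one step ahead.\<close>

definition ar_variance :: "real \<Rightarrow> real \<Rightarrow> real \<Rightarrow> real \<Rightarrow> real \<Rightarrow> real \<Rightarrow> real \<Rightarrow> real" where
  "ar_variance \<rho> p s11 s12 s22 u1 u2 = ar_beta \<rho> p s12 s22 u1 u2 * s12 + ar_delta s22 u2 * s22
    + ar_lambda \<rho> p s11 s12 s22 u1 u2 * s11
    + quadratic_noise_variance s11 s12 s22 (ar_kappa \<rho> p * u1 + \<rho> * ar_kappa \<rho> p * u2) (p * u2) u1"

text \<open>The classical formula for the empirical variance of a stationary Gaussian sequence:
  twice the squared variance plus four times the sum of the squared autocovariances, which here form
  a geometric series of ratio \<open>\<rho>\<^sup>2\<close>.\<close>

lemma ar_variance_first:
  assumes "\<rho>\<^sup>2 \<noteq> 1"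
  shows "ar_variance \<rho> p s11 s12 s22 1 0 =
    2 * (ar_kappa \<rho> p * s11 + s22)\<^sup>2 + 4 * (p * s12 + \<rho> * ar_kappa \<rho> p * s11)\<^sup>2 / (1 - \<rho>\<^sup>2)"
proof -
  define k where "k = ar_kappa \<rho> p"
  have k: "p\<^sup>2 = k * (1 - \<rho>\<^sup>2)" using assms by (simp add: k_def ar_kappa_def)
  define t where "t = 1 / (1 - \<rho>\<^sup>2)"
  have t: "t * (1 - \<rho>\<^sup>2) = 1" using assms by (simp add: t_def)
  have "ar_variance \<rho> p s11 s12 s22 1 0 =
      (4 * k\<^sup>2 * \<rho>\<^sup>2 * s11 + 8 * k * \<rho> * p * s12 + 4 * p\<^sup>2 * s22) * t * s11
      + 2 * k\<^sup>2 * s11\<^sup>2 + 2 * s22\<^sup>2 + 4 * k * s12\<^sup>2"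
    by (simp add: ar_variance_def ar_beta_def ar_delta_def ar_lambda_def ar_alpha_def ar_A_def ar_B_def
        quadratic_noise_variance_def k_def[symmetric] t_def power_mult_distrib mult_ac)
  also have "\<dots> = 2 * (k * s11 + s22)\<^sup>2 + 4 * (p * s12 + \<rho> * k * s11)\<^sup>2 * t"
    using k t by algebra
  finally show ?thesis by (simp add: k_def t_def)
qed

text \<open>All coefficients of the martingale difference are linear in \<open>(u1, u2)\<close>, so
  the variance is a quadratic form, recovered from three of its values by polarization. This is what
  produces a covariance matrix.\<close>

lemma ar_variance_quadratic:
  "ar_variance \<rho> p s11 s12 s22 u1 u2 = u1\<^sup>2 * ar_variance \<rho> p s11 s12 s22 1 0 + u2\<^sup>2 * ar_variance \<rho> p s11 s12 s22 0 1
    + u1 * u2 * (ar_variance \<rho> p s11 s12 s22 1 1 - ar_variance \<rho> p s11 s12 s22 1 0 - ar_variance \<rho> p s11 s12 s22 0 1)"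
proof -
  define k where "k = ar_kappa \<rho> p"
  define t where "t = 1 / (1 - \<rho>\<^sup>2)"
  have "ar_lambda \<rho> p s11 s12 s22 u1 u2 = (ar_alpha \<rho> p s11 s12 s22 u1 u2
      + ar_beta \<rho> p s12 s22 u1 u2 * \<rho> * p + ar_delta s22 u2 * p\<^sup>2) * t" for u1 u2
    by (simp add: ar_lambda_def t_def)
  then show ?thesis
    unfolding ar_variance_def ar_alpha_def ar_beta_def ar_delta_def ar_A_def ar_B_def
      quadratic_noise_variance_def k_def[symmetric]
    by (simp add: power2_eq_square algebra_simps)
qed

text \<open>The law of the noise pair is prescribed through its linear combinations, which suffice
  for all mixed moments. Independence of the past is stated for real functions of the pair, and
  \<open>r\<close> is a contraction bound common to all parameters.\<close>

locale hidden_ar_family = filtered_family I P F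
  for I :: "'i set" and P :: "'i \<Rightarrow> 'w measure" and F :: "'i \<Rightarrow> nat \<Rightarrow> 'w measure" +
  fixes \<eta> \<epsilon> :: "'i \<Rightarrow> nat \<Rightarrow> 'w \<Rightarrow> real" and y0 :: "'i \<Rightarrow> 'w \<Rightarrow> real"
    and \<rho> p s11 s12 s22 :: "'i \<Rightarrow> real" and r :: real
  assumes y0_measurable: "i \<in> I \<Longrightarrow> y0 i \<in> borel_measurable (F i 0)"
    and y0_moments: "bounded_moments (\<lambda>i k. y0 i)"
    and \<eta>_measurable: "i \<in> I \<Longrightarrow> \<eta> i k \<in> borel_measurable (F i (Suc k))"
    and \<epsilon>_measurable: "i \<in> I \<Longrightarrow> \<epsilon> i k \<in> borel_measurable (F i (Suc k))"
    and noise_indep: "i \<in> I \<Longrightarrow> Z \<in> borel_measurable (F i k) \<Longrightarrow> Q \<in> borel_measurable (borel \<Otimes>\<^sub>M borel) \<Longrightarrow>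
      prob_space.indep_var (P i) borel Z borel (\<lambda>\<omega>. Q (\<eta> i k \<omega>, \<epsilon> i k \<omega>) :: real)"
    and noise_nonneg: "i \<in> I \<Longrightarrow> 0 \<le> \<alpha>\<^sup>2 * s11 i + 2 * \<alpha> * \<beta> * s12 i + \<beta>\<^sup>2 * s22 i"
    and noise_law: "i \<in> I \<Longrightarrow> distr (P i) borel (\<lambda>\<omega>. \<alpha> * \<eta> i k \<omega> + \<beta> * \<epsilon> i k \<omega>) =
      centred_normal (\<alpha>\<^sup>2 * s11 i + 2 * \<alpha> * \<beta> * s12 i + \<beta>\<^sup>2 * s22 i)"
    and \<rho>_nonneg: "i \<in> I \<Longrightarrow> 0 \<le> \<rho> i" and \<rho>_le: "i \<in> I \<Longrightarrow> \<rho> i \<le> r" and r: "r < 1"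
    and p_bounded: "bounded_moments (\<lambda>i k \<omega>. p i)"
    and s_bounded: "bounded_moments (\<lambda>i k \<omega>. s11 i)" "bounded_moments (\<lambda>i k \<omega>. s12 i)"
      "bounded_moments (\<lambda>i k \<omega>. s22 i)"
begin

lemma \<rho>_bounded: "bounded_moments (\<lambda>i k \<omega>. \<rho> i)"
  by (rule bounded_moments_const[of _ r]) (use \<rho>_nonneg \<rho>_le in auto)

lemma r_square_le: "i \<in> I \<Longrightarrow> 1 - r\<^sup>2 \<le> 1 - (\<rho> i)\<^sup>2"
  using \<rho>_nonneg \<rho>_le by (simp add: power_mono)

lemma \<rho>_square_less: "i \<in> I \<Longrightarrow> (\<rho> i)\<^sup>2 < 1"
  using \<rho>_nonneg[of i] \<rho>_le[of i] r by (simp add: abs_square_less_1)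

lemma inverse_bounded: "bounded_moments (\<lambda>i k \<omega>. 1 / (1 - (\<rho> i)\<^sup>2))"
proof (rule bounded_moments_const[of _ "1 / (1 - r\<^sup>2)"])
  fix i assume i: "i \<in> I"
  have "r\<^sup>2 < 1" using \<rho>_nonneg[OF i] \<rho>_le[OF i] r by (simp add: abs_square_less_1)
  then show "\<bar>1 / (1 - (\<rho> i)\<^sup>2)\<bar> \<le> 1 / (1 - r\<^sup>2)"
    using r_square_le[OF i] \<rho>_square_less[OF i] by (simp add: frac_le)
qed

lemma \<eta>_random_variable: "i \<in> I \<Longrightarrow> \<eta> i k \<in> borel_measurable (P i)"
  using \<eta>_measurable past_measurable by blast

lemma \<epsilon>_random_variable: "i \<in> I \<Longrightarrow> \<epsilon> i k \<in> borel_measurable (P i)"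
  using \<epsilon>_measurable past_measurable by blast

lemma \<eta>_moments: "bounded_moments \<eta>"
proof (rule normal_bounded_moments[of _ s11])
  fix i k assume "i \<in> I"
  then show "distr (P i) borel (\<eta> i k) = centred_normal (s11 i)" "s11 i \<ge> 0"
    using noise_law[of i 1 k 0] noise_nonneg[of i 1 0] by auto
qed (auto intro: \<eta>_random_variable s_bounded)

lemma \<epsilon>_moments: "bounded_moments \<epsilon>"
proof (rule normal_bounded_moments[of _ s22])
  fix i k assume "i \<in> I"
  then show "distr (P i) borel (\<epsilon> i k) = centred_normal (s22 i)" "s22 i \<ge> 0"
    using noise_law[of i 0 k 1] noise_nonneg[of i 0 1] by auto
qed (auto intro: \<epsilon>_random_variable s_bounded)

lemma noise_monomial_integrable: "i \<in> I \<Longrightarrow> integrable (P i) (\<lambda>\<omega>. \<eta> i k \<omega> ^ a * \<epsilon> i k \<omega> ^ b)"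
  using bounded_moments_integrable[OF bounded_moments_mult[OF bounded_moments_power[OF \<eta>_moments]
      bounded_moments_power[OF \<epsilon>_moments]]] .

text \<open>The powers of \<open>\<alpha> * \<eta> + \<beta> * \<epsilon>\<close> have known means
  for all \<open>\<alpha>\<close>, \<open>\<beta>\<close>. Expanding them gives polynomial
  identities in \<open>\<alpha>\<close>, \<open>\<beta>\<close>, and evaluation at a few points
  isolates each mixed moment.\<close>

lemma noise_moments:
  assumes i: "i \<in> I"
  shows "(\<integral>\<omega>. \<eta> i k \<omega> \<partial>P i) = 0" "(\<integral>\<omega>. \<epsilon> i k \<omega> \<partial>P i) = 0"
    and "(\<integral>\<omega>. \<eta> i k \<omega> ^ 2 \<partial>P i) = s11 i" "(\<integral>\<omega>. \<eta> i k \<omega> * \<epsilon> i k \<omega> \<partial>P i) = s12 i"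
      "(\<integral>\<omega>. \<epsilon> i k \<omega> ^ 2 \<partial>P i) = s22 i"
    and "(\<integral>\<omega>. \<eta> i k \<omega> ^ 3 \<partial>P i) = 0" "(\<integral>\<omega>. \<eta> i k \<omega> ^ 2 * \<epsilon> i k \<omega> \<partial>P i) = 0"
      "(\<integral>\<omega>. \<eta> i k \<omega> * \<epsilon> i k \<omega> ^ 2 \<partial>P i) = 0" "(\<integral>\<omega>. \<epsilon> i k \<omega> ^ 3 \<partial>P i) = 0"
    and "(\<integral>\<omega>. \<eta> i k \<omega> ^ 4 \<partial>P i) = 3 * (s11 i)\<^sup>2" "(\<integral>\<omega>. \<eta> i k \<omega> ^ 3 * \<epsilon> i k \<omega> \<partial>P i) = 3 * s11 i * s12 i"
      "(\<integral>\<omega>. \<eta> i k \<omega> ^ 2 * \<epsilon> i k \<omega> ^ 2 \<partial>P i) = s11 i * s22 i + 2 * (s12 i)\<^sup>2"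
      "(\<integral>\<omega>. \<eta> i k \<omega> * \<epsilon> i k \<omega> ^ 3 \<partial>P i) = 3 * s22 i * s12 i" "(\<integral>\<omega>. \<epsilon> i k \<omega> ^ 4 \<partial>P i) = 3 * (s22 i)\<^sup>2"
proof -
  define e where "e a b = (\<integral>\<omega>. \<eta> i k \<omega> ^ a * \<epsilon> i k \<omega> ^ b \<partial>P i)" for a b
  define V where "V \<alpha> \<beta> = \<alpha>\<^sup>2 * s11 i + 2 * \<alpha> * \<beta> * s12 i + \<beta>\<^sup>2 * s22 i" for \<alpha> \<beta>
  note [measurable] = \<eta>_random_variable[OF i, of k] \<epsilon>_random_variable[OF i, of k]
  note mi = noise_monomial_integrable[OF i, of k]
  note mi' = mi[of 0] mi[of 1] mi[of _ 0] mi[of _ 1]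
  have tr: "(\<integral>\<omega>. (\<alpha> * \<eta> i k \<omega> + \<beta> * \<epsilon> i k \<omega>) ^ n \<partial>P i) = (\<integral>x. x ^ n \<partial>centred_normal (V \<alpha> \<beta>))" for \<alpha> \<beta> n
    unfolding V_def noise_law[OF i, of \<alpha> k \<beta>, symmetric] by (subst integral_distr) auto
  have V: "V \<alpha> \<beta> \<ge> 0" for \<alpha> \<beta> unfolding V_def by (rule noise_nonneg[OF i])
  note cn = centred_normal_moments[OF V]
  have 1: "\<alpha> * e 1 0 + \<beta> * e 0 1 = 0" for \<alpha> \<beta>
  proof -
    have "(\<integral>\<omega>. (\<alpha> * \<eta> i k \<omega> + \<beta> * \<epsilon> i k \<omega>) ^ 1 \<partial>P i) = \<alpha> * e 1 0 + \<beta> * e 0 1"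
      using mi[of 1 0] mi[of 0 1] by (simp add: e_def)
    then show ?thesis using tr[of \<alpha> \<beta> 1] cn by simp
  qed
  have 2: "\<alpha>\<^sup>2 * e 2 0 + 2 * \<alpha> * \<beta> * e 1 1 + \<beta>\<^sup>2 * e 0 2 = V \<alpha> \<beta>" for \<alpha> \<beta>
  proof -
    have "(\<integral>\<omega>. (\<alpha> * \<eta> i k \<omega> + \<beta> * \<epsilon> i k \<omega>) ^ 2 \<partial>P i) =
        (\<integral>\<omega>. \<alpha>\<^sup>2 * (\<eta> i k \<omega> ^ 2 * \<epsilon> i k \<omega> ^ 0) + 2 * \<alpha> * \<beta> * (\<eta> i k \<omega> ^ 1 * \<epsilon> i k \<omega> ^ 1)
          + \<beta>\<^sup>2 * (\<eta> i k \<omega> ^ 0 * \<epsilon> i k \<omega> ^ 2) \<partial>P i)"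
      by (intro Bochner_Integration.integral_cong) (auto simp: algebra_simps power2_eq_square)
    also have "\<dots> = \<alpha>\<^sup>2 * e 2 0 + 2 * \<alpha> * \<beta> * e 1 1 + \<beta>\<^sup>2 * e 0 2"
      unfolding e_def by (simp only: mi Bochner_Integration.integral_add integral_mult_right_zero
          Bochner_Integration.integrable_add integrable_mult_right)
    finally show ?thesis using tr[of \<alpha> \<beta> 2] cn by simp
  qed
  have 3: "\<alpha> ^ 3 * e 3 0 + 3 * \<alpha>\<^sup>2 * \<beta> * e 2 1 + 3 * \<alpha> * \<beta>\<^sup>2 * e 1 2 + \<beta> ^ 3 * e 0 3 = 0" for \<alpha> \<beta>
  proof -
    have "(\<integral>\<omega>. (\<alpha> * \<eta> i k \<omega> + \<beta> * \<epsilon> i k \<omega>) ^ 3 \<partial>P i) =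
        (\<integral>\<omega>. \<alpha> ^ 3 * (\<eta> i k \<omega> ^ 3 * \<epsilon> i k \<omega> ^ 0) + 3 * \<alpha>\<^sup>2 * \<beta> * (\<eta> i k \<omega> ^ 2 * \<epsilon> i k \<omega> ^ 1)
          + 3 * \<alpha> * \<beta>\<^sup>2 * (\<eta> i k \<omega> ^ 1 * \<epsilon> i k \<omega> ^ 2) + \<beta> ^ 3 * (\<eta> i k \<omega> ^ 0 * \<epsilon> i k \<omega> ^ 3) \<partial>P i)"
      by (intro Bochner_Integration.integral_cong) (auto simp: algebra_simps power2_eq_square power3_eq_cube)
    also have "\<dots> = \<alpha> ^ 3 * e 3 0 + 3 * \<alpha>\<^sup>2 * \<beta> * e 2 1 + 3 * \<alpha> * \<beta>\<^sup>2 * e 1 2 + \<beta> ^ 3 * e 0 3"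
      unfolding e_def by (simp only: mi Bochner_Integration.integral_add integral_mult_right_zero
          Bochner_Integration.integrable_add integrable_mult_right)
    finally show ?thesis using tr[of \<alpha> \<beta> 3] cn by simp
  qed
  have 4: "\<alpha> ^ 4 * e 4 0 + 4 * \<alpha> ^ 3 * \<beta> * e 3 1 + 6 * \<alpha>\<^sup>2 * \<beta>\<^sup>2 * e 2 2 + 4 * \<alpha> * \<beta> ^ 3 * e 1 3 + \<beta> ^ 4 * e 0 4
      = 3 * (V \<alpha> \<beta>)\<^sup>2" for \<alpha> \<beta>
  proof -
    have "(\<integral>\<omega>. (\<alpha> * \<eta> i k \<omega> + \<beta> * \<epsilon> i k \<omega>) ^ 4 \<partial>P i) =
        (\<integral>\<omega>. \<alpha> ^ 4 * (\<eta> i k \<omega> ^ 4 * \<epsilon> i k \<omega> ^ 0) + 4 * \<alpha> ^ 3 * \<beta> * (\<eta> i k \<omega> ^ 3 * \<epsilon> i k \<omega> ^ 1)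
          + 6 * \<alpha>\<^sup>2 * \<beta>\<^sup>2 * (\<eta> i k \<omega> ^ 2 * \<epsilon> i k \<omega> ^ 2) + 4 * \<alpha> * \<beta> ^ 3 * (\<eta> i k \<omega> ^ 1 * \<epsilon> i k \<omega> ^ 3)
          + \<beta> ^ 4 * (\<eta> i k \<omega> ^ 0 * \<epsilon> i k \<omega> ^ 4) \<partial>P i)"
      by (intro Bochner_Integration.integral_cong) (auto simp: algebra_simps power2_eq_square power3_eq_cube power4_eq_xxxx)
    also have "\<dots> = \<alpha> ^ 4 * e 4 0 + 4 * \<alpha> ^ 3 * \<beta> * e 3 1 + 6 * \<alpha>\<^sup>2 * \<beta>\<^sup>2 * e 2 2 + 4 * \<alpha> * \<beta> ^ 3 * e 1 3 + \<beta> ^ 4 * e 0 4"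
      unfolding e_def by (simp only: mi Bochner_Integration.integral_add integral_mult_right_zero
          Bochner_Integration.integrable_add integrable_mult_right)
    finally show ?thesis using tr[of \<alpha> \<beta> 4] cn by simp
  qed
  show "(\<integral>\<omega>. \<eta> i k \<omega> \<partial>P i) = 0" "(\<integral>\<omega>. \<epsilon> i k \<omega> \<partial>P i) = 0"
    using 1[of 1 0] 1[of 0 1] by (auto simp: e_def)
  have e2: "e 2 0 = s11 i" "e 0 2 = s22 i" "e 1 1 = s12 i"
    using 2[of 1 0] 2[of 0 1] 2[of 1 1] by (auto simp: V_def)
  then show "(\<integral>\<omega>. \<eta> i k \<omega> ^ 2 \<partial>P i) = s11 i" "(\<integral>\<omega>. \<eta> i k \<omega> * \<epsilon> i k \<omega> \<partial>P i) = s12 i"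
      "(\<integral>\<omega>. \<epsilon> i k \<omega> ^ 2 \<partial>P i) = s22 i" by (auto simp: e_def)
  have "e 3 0 = 0" "e 0 3 = 0" "e 2 1 = 0" "e 1 2 = 0"
    using 3[of 1 0] 3[of 0 1] 3[of 1 1] 3[of 1 "-1"] by auto
  then show "(\<integral>\<omega>. \<eta> i k \<omega> ^ 3 \<partial>P i) = 0" "(\<integral>\<omega>. \<eta> i k \<omega> ^ 2 * \<epsilon> i k \<omega> \<partial>P i) = 0"
      "(\<integral>\<omega>. \<eta> i k \<omega> * \<epsilon> i k \<omega> ^ 2 \<partial>P i) = 0" "(\<integral>\<omega>. \<epsilon> i k \<omega> ^ 3 \<partial>P i) = 0" by (auto simp: e_def)
  have e4: "e 4 0 = 3 * (s11 i)\<^sup>2" "e 0 4 = 3 * (s22 i)\<^sup>2" using 4[of 1 0] 4[of 0 1] by (auto simp: V_def)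
  have sq: "(V 1 1)\<^sup>2 = (s11 i)\<^sup>2 + 4 * (s12 i)\<^sup>2 + (s22 i)\<^sup>2 + 4 * (s11 i * s12 i) + 2 * (s11 i * s22 i) + 4 * (s12 i * s22 i)"
    "(V 1 (-1))\<^sup>2 = (s11 i)\<^sup>2 + 4 * (s12 i)\<^sup>2 + (s22 i)\<^sup>2 - 4 * (s11 i * s12 i) + 2 * (s11 i * s22 i) - 4 * (s12 i * s22 i)"
    "(V 1 2)\<^sup>2 = (s11 i)\<^sup>2 + 16 * (s12 i)\<^sup>2 + 16 * (s22 i)\<^sup>2 + 8 * (s11 i * s12 i) + 8 * (s11 i * s22 i) + 32 * (s12 i * s22 i)"
    by (auto simp: V_def power2_eq_square algebra_simps)
  \<comment> \<open>Three directions for the three unknown mixed moments of order four.\<close>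
  have "e 3 1 = 3 * (s11 i * s12 i)" "e 2 2 = s11 i * s22 i + 2 * (s12 i)\<^sup>2" "e 1 3 = 3 * (s12 i * s22 i)"
    using 4[of 1 1] 4[of 1 "-1"] 4[of 1 2] unfolding sq e4 by auto
  then show "(\<integral>\<omega>. \<eta> i k \<omega> ^ 4 \<partial>P i) = 3 * (s11 i)\<^sup>2" "(\<integral>\<omega>. \<eta> i k \<omega> ^ 3 * \<epsilon> i k \<omega> \<partial>P i) = 3 * s11 i * s12 i"
      "(\<integral>\<omega>. \<eta> i k \<omega> ^ 2 * \<epsilon> i k \<omega> ^ 2 \<partial>P i) = s11 i * s22 i + 2 * (s12 i)\<^sup>2"
      "(\<integral>\<omega>. \<eta> i k \<omega> * \<epsilon> i k \<omega> ^ 3 \<partial>P i) = 3 * s22 i * s12 i" "(\<integral>\<omega>. \<epsilon> i k \<omega> ^ 4 \<partial>P i) = 3 * (s22 i)\<^sup>2"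
    using e4 by (auto simp: e_def)
qed

text \<open>By independence the mean of the product with a past variable factors, so being centred
  is all that orthogonality requires of a function of the noise pair.\<close>

lemma noise_martingale_diff:
  assumes Q: "\<And>i. i \<in> I \<Longrightarrow> Q i \<in> borel_measurable (borel \<Otimes>\<^sub>M borel)"
    and mom: "bounded_moments (\<lambda>i k \<omega>. Q i (\<eta> i k \<omega>, \<epsilon> i k \<omega>))"
    and zero: "\<And>i k. i \<in> I \<Longrightarrow> (\<integral>\<omega>. Q i (\<eta> i k \<omega>, \<epsilon> i k \<omega>) \<partial>P i) = 0"
  shows "martingale_diff (\<lambda>i k \<omega>. Q i (\<eta> i k \<omega>, \<epsilon> i k \<omega>))"
proof (rule martingale_diffI[OF mom])
  fix i k assume i: "i \<in> I"
  note [measurable] = \<eta>_measurable[OF i, of k] \<epsilon>_measurable[OF i, of k] Q[OF i]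
  show "(\<lambda>\<omega>. Q i (\<eta> i k \<omega>, \<epsilon> i k \<omega>)) \<in> borel_measurable (F i (Suc k))"
    by measurable
next
  fix i k and Z :: "'w \<Rightarrow> real"
  assume i: "i \<in> I" and Z: "Z \<in> borel_measurable (F i k)" "\<And>n. integrable (P i) (\<lambda>\<omega>. \<bar>Z \<omega>\<bar> ^ n)"
  interpret prob_space "P i" by (rule prob[OF i])
  note ind = noise_indep[OF i Z(1) Q[OF i]]
  have "integrable (P i) (\<lambda>\<omega>. \<bar>Z \<omega>\<bar>)" using Z(2)[of 1] by simp
  then have "integrable (P i) Z"
    using integrable_abs_iff[OF past_measurable[OF i Z(1)]] by simp
  then show "(\<integral>\<omega>. Z \<omega> * Q i (\<eta> i k \<omega>, \<epsilon> i k \<omega>) \<partial>P i) = 0"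
    using indep_var_lebesgue_integral[OF ind _ bounded_moments_integrable[OF mom i]] zero[OF i] by simp
qed

primrec Y :: "'i \<Rightarrow> nat \<Rightarrow> 'w \<Rightarrow> real" where
  "Y i 0 = y0 i"
| "Y i (Suc k) = (\<lambda>\<omega>. \<rho> i * Y i k \<omega> + \<eta> i k \<omega>)"

text \<open>The increments of the observation are numbered from 1; the value at 0 is a dummy.\<close>

definition D :: "'i \<Rightarrow> nat \<Rightarrow> 'w \<Rightarrow> real" where
  "D i k = (case k of 0 \<Rightarrow> \<lambda>\<omega>. 0 | Suc j \<Rightarrow> \<lambda>\<omega>. p i * Y i j \<omega> + \<epsilon> i j \<omega>)"

lemma D_simps [simp]: "D i 0 = (\<lambda>\<omega>. 0)" "D i (Suc k) = (\<lambda>\<omega>. p i * Y i k \<omega> + \<epsilon> i k \<omega>)"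
  by (simp_all add: D_def)

lemma Y_measurable: "i \<in> I \<Longrightarrow> Y i k \<in> borel_measurable (F i k)"
proof (induction k)
  case (Suc k)
  note [measurable] = filtration_measurable[OF Suc.prems Suc.IH[OF Suc.prems]] \<eta>_measurable[OF Suc.prems, of k]
  show ?case by simp
qed (simp add: y0_measurable)

lemma Y_adapted: "adapted Y"
  by (simp add: adapted_def Y_measurable)

lemma D_adapted: "adapted D"
proof -
  have "D i k \<in> borel_measurable (F i k)" if i: "i \<in> I" for i k
  proof (cases k)
    case (Suc j)
    note [measurable] = filtration_measurable[OF i Y_measurable[OF i, of j]] \<epsilon>_measurable[OF i, of j]
    show ?thesis by (simp add: Suc)
  qed simp
  then show ?thesis by (simp add: adapted_def)
qed

text \<open>One step is bounded by a convex combination of the modulus of \<open>Y\<close> and of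
  the noise divided by \<open>1 - r\<close>, with weights \<open>r\<close> and \<open>1 - r\<close>.
  Convexity of the power then keeps the moment below the larger of its initial value and the
  rescaled noise moment.\<close>

lemma Y_moments: "bounded_moments Y"
proof (rule bounded_momentsI)
  show meas: "Y i k \<in> borel_measurable (P i)" if "i \<in> I" for i k
    using past_measurable[OF that Y_measurable[OF that]] .
  fix n
  obtain C0 where C0: "C0 \<ge> 0" "\<And>i k. i \<in> I \<Longrightarrow> (\<integral>\<omega>. \<bar>y0 i \<omega>\<bar> ^ n \<partial>P i) \<le> C0"
    by (rule bounded_moments_bound[OF y0_moments, of n]) blast
  obtain C1 where C1: "C1 \<ge> 0" "\<And>i k. i \<in> I \<Longrightarrow> (\<integral>\<omega>. \<bar>\<eta> i k \<omega>\<bar> ^ n \<partial>P i) \<le> C1"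
    by (rule bounded_moments_bound[OF \<eta>_moments, of n]) blast
  define C where "C = max C0 (C1 / (1 - r) ^ n)"
  have "integrable (P i) (\<lambda>\<omega>. \<bar>Y i k \<omega>\<bar> ^ n) \<and> (\<integral>\<omega>. \<bar>Y i k \<omega>\<bar> ^ n \<partial>P i) \<le> C" if i: "i \<in> I" for i k
  proof (induction k)
    case 0
    show ?case
      using C0(2)[OF i] bounded_moments_integrable_abs[OF y0_moments i, of n] by (simp add: C_def le_max_iff_disj)
  next
    case (Suc k)
    note [measurable] = meas[OF i, of k] \<eta>_random_variable[OF i, of k]
    have r0: "0 \<le> r" using \<rho>_nonneg[OF i] \<rho>_le[OF i] by linarith
    have le: "\<bar>Y i (Suc k) \<omega>\<bar> ^ n \<le> r * \<bar>Y i k \<omega>\<bar> ^ n + (1 - r) * (\<bar>\<eta> i k \<omega>\<bar> ^ n / (1 - r) ^ n)" for \<omega>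
    proof -
      have "\<bar>\<rho> i * Y i k \<omega> + \<eta> i k \<omega>\<bar> \<le> \<rho> i * \<bar>Y i k \<omega>\<bar> + \<bar>\<eta> i k \<omega>\<bar>"
        using \<rho>_nonneg[OF i] by (metis abs_mult abs_of_nonneg abs_triangle_ineq)
      also have "\<dots> \<le> r * \<bar>Y i k \<omega>\<bar> + (1 - r) * (\<bar>\<eta> i k \<omega>\<bar> / (1 - r))"
        using \<rho>_le[OF i] r by (simp add: mult_right_mono)
      finally have "\<bar>Y i (Suc k) \<omega>\<bar> ^ n \<le> (r * \<bar>Y i k \<omega>\<bar> + (1 - r) * (\<bar>\<eta> i k \<omega>\<bar> / (1 - r))) ^ n"
        by (intro power_mono) auto
      also have "\<dots> \<le> r * \<bar>Y i k \<omega>\<bar> ^ n + (1 - r) * (\<bar>\<eta> i k \<omega>\<bar> / (1 - r)) ^ n"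
        using r r0 by (intro convex_combination_power_le) auto
      finally show ?thesis by (simp add: power_divide)
    qed
    have int: "integrable (P i) (\<lambda>\<omega>. r * \<bar>Y i k \<omega>\<bar> ^ n + (1 - r) * (\<bar>\<eta> i k \<omega>\<bar> ^ n / (1 - r) ^ n))"
      using Suc bounded_moments_integrable_abs[OF \<eta>_moments i, of k n] by auto
    have m: "(\<lambda>\<omega>. \<bar>Y i (Suc k) \<omega>\<bar> ^ n) \<in> borel_measurable (P i)"
      using meas[OF i, of "Suc k"] by measurable
    note b = integrable_integral_le[OF int m]
    have "(\<integral>\<omega>. \<bar>Y i (Suc k) \<omega>\<bar> ^ n \<partial>P i) \<le>
        (\<integral>\<omega>. r * \<bar>Y i k \<omega>\<bar> ^ n + (1 - r) * (\<bar>\<eta> i k \<omega>\<bar> ^ n / (1 - r) ^ n) \<partial>P i)"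
      by (rule b(2)) (use le in simp)
    also have "\<dots> = r * (\<integral>\<omega>. \<bar>Y i k \<omega>\<bar> ^ n \<partial>P i) + (1 - r) * ((\<integral>\<omega>. \<bar>\<eta> i k \<omega>\<bar> ^ n \<partial>P i) / (1 - r) ^ n)"
      using Suc bounded_moments_integrable_abs[OF \<eta>_moments i, of k n] by simp
    also have "\<dots> \<le> r * C + (1 - r) * C"
    proof (intro add_mono mult_left_mono)
      have "(\<integral>\<omega>. \<bar>\<eta> i k \<omega>\<bar> ^ n \<partial>P i) / (1 - r) ^ n \<le> C1 / (1 - r) ^ n"
        using r C1(2)[OF i] by (intro divide_right_mono) auto
      then show "(\<integral>\<omega>. \<bar>\<eta> i k \<omega>\<bar> ^ n \<partial>P i) / (1 - r) ^ n \<le> C" by (simp add: C_def le_max_iff_disj)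
    qed (use Suc r r0 in auto)
    finally have "(\<integral>\<omega>. \<bar>Y i (Suc k) \<omega>\<bar> ^ n \<partial>P i) \<le> C" by (simp add: algebra_simps)
    moreover have "integrable (P i) (\<lambda>\<omega>. \<bar>Y i (Suc k) \<omega>\<bar> ^ n)" by (rule b(1)) (use le in simp)
    ultimately show ?case by blast
  qed
  then show "\<exists>C. \<forall>i\<in>I. \<forall>k. integrable (P i) (\<lambda>\<omega>. \<bar>Y i k \<omega>\<bar> ^ n) \<and> (\<integral>\<omega>. \<bar>Y i k \<omega>\<bar> ^ n \<partial>P i) \<le> C"
    by blast
qed

lemma D_moments: "bounded_moments D"
proof -
  \<comment> \<open>At time 0 the truncated difference \<open>k - 1\<close> repeats index 0; the
    dummy increment there is zero and is dominated trivially.\<close>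
  have *: "bounded_moments (\<lambda>i k \<omega>. p i * Y i (k - 1) \<omega> + \<epsilon> i (k - 1) \<omega>)"
    using bounded_moments_add[OF bounded_moments_mult[OF p_bounded bounded_moments_reindex[OF Y_moments]]
        bounded_moments_reindex[OF \<epsilon>_moments], of "\<lambda>k. k - 1" "\<lambda>k. k - 1"] .
  show ?thesis
  proof (rule bounded_moments_dominated[OF bounded_moments_abs[OF *]])
    fix i k \<omega> assume "i \<in> I"
    then show "D i k \<in> borel_measurable (P i)"
      using D_adapted past_measurable[of i "D i k" k] by (simp add: adapted_def)
    show "\<bar>D i k \<omega>\<bar> \<le> \<bar>p i * Y i (k - 1) \<omega> + \<epsilon> i (k - 1) \<omega>\<bar>" by (cases k) auto
  qed
qed

lemma martingale_diff_const_mult: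
  assumes "bounded_moments (\<lambda>i k \<omega>. c i)" "martingale_diff X"
  shows "martingale_diff (\<lambda>i k \<omega>. c i * X i k \<omega>)"
  by (rule martingale_diff_past_mult[OF assms(2,1)]) (auto simp: adapted_def)

lemma adapted_mult: "adapted X \<Longrightarrow> adapted Z \<Longrightarrow> adapted (\<lambda>i k \<omega>. X i k \<omega> * Z i k \<omega>)"
  and adapted_add: "adapted X \<Longrightarrow> adapted Z \<Longrightarrow> adapted (\<lambda>i k \<omega>. X i k \<omega> + Z i k \<omega>)"
  and adapted_const: "adapted (\<lambda>i k \<omega>. c i)"
  by (auto simp: adapted_def intro!: borel_measurable_times borel_measurable_add)

lemma noise_martingale_diffs:
  shows "martingale_diff \<eta>" "martingale_diff \<epsilon>"
    and "martingale_diff (\<lambda>i k \<omega>. (\<eta> i k \<omega>)\<^sup>2 - s11 i)"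
    and "martingale_diff (\<lambda>i k \<omega>. \<eta> i k \<omega> * \<epsilon> i k \<omega> - s12 i)"
    and "martingale_diff (\<lambda>i k \<omega>. (\<epsilon> i k \<omega>)\<^sup>2 - s22 i)"
proof -
  note [simp] = noise_moments noise_monomial_integrable[of _ _ 1 1, simplified]
    noise_monomial_integrable[of _ _ 2 0, simplified] noise_monomial_integrable[of _ _ 0 2, simplified] prob_space.prob_space[OF prob]
  note bm = bounded_moments_intros \<eta>_moments \<epsilon>_moments s_bounded
  show "martingale_diff \<eta>" using noise_martingale_diff[of "\<lambda>i x. fst x"] \<eta>_moments by simp
  show "martingale_diff \<epsilon>" using noise_martingale_diff[of "\<lambda>i x. snd x"] \<epsilon>_moments by simp
  show "martingale_diff (\<lambda>i k \<omega>. (\<eta> i k \<omega>)\<^sup>2 - s11 i)"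
  proof -
    have "bounded_moments (\<lambda>i k \<omega>. (\<eta> i k \<omega>)\<^sup>2 - s11 i)" by (intro bm)
    then show ?thesis using noise_martingale_diff[of "\<lambda>i x. (fst x)\<^sup>2 - s11 i"]
      by (simp add: prob_space.finite_measure[OF prob] finite_measure.integrable_const)
  qed
  show "martingale_diff (\<lambda>i k \<omega>. \<eta> i k \<omega> * \<epsilon> i k \<omega> - s12 i)"
  proof -
    have "bounded_moments (\<lambda>i k \<omega>. \<eta> i k \<omega> * \<epsilon> i k \<omega> - s12 i)" by (intro bm)
    then show ?thesis using noise_martingale_diff[of "\<lambda>i x. fst x * snd x - s12 i"]
      by (simp add: prob_space.finite_measure[OF prob] finite_measure.integrable_const)
  qed
  show "martingale_diff (\<lambda>i k \<omega>. (\<epsilon> i k \<omega>)\<^sup>2 - s22 i)"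
  proof -
    have "bounded_moments (\<lambda>i k \<omega>. (\<epsilon> i k \<omega>)\<^sup>2 - s22 i)" by (intro bm)
    then show ?thesis using noise_martingale_diff[of "\<lambda>i x. (snd x)\<^sup>2 - s22 i"]
      by (simp add: prob_space.finite_measure[OF prob] finite_measure.integrable_const)
  qed
qed

end

text \<open>The weights are functions of the parameter: a fixed linear functional of the estimator
  becomes, after linearization, a functional of the statistics whose direction varies with the
  parameter.\<close>

locale hidden_ar_functional = hidden_ar_family +
  fixes u1 u2 :: "'a \<Rightarrow> real"
  assumes u_bounded: "bounded_moments (\<lambda>i k \<omega>. u1 i)" "bounded_moments (\<lambda>i k \<omega>. u2 i)"
begin

definition q1 where "q1 i = ar_kappa (\<rho> i) (p i) * u1 i + \<rho> i * ar_kappa (\<rho> i) (p i) * u2 i"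
definition q2 where "q2 i = p i * u2 i"
definition A where "A i = ar_A (\<rho> i) (p i) (u1 i) (u2 i)"
definition B where "B i = ar_B (\<rho> i) (p i) (u1 i) (u2 i)"
definition \<beta> where "\<beta> i = ar_beta (\<rho> i) (p i) (s12 i) (s22 i) (u1 i) (u2 i)"
definition \<delta> where "\<delta> i = ar_delta (s22 i) (u2 i)"
definition lam where "lam i = ar_lambda (\<rho> i) (p i) (s11 i) (s12 i) (s22 i) (u1 i) (u2 i)"
definition q where "q i k \<omega> = q1 i * ((\<eta> i k \<omega>)\<^sup>2 - s11 i) + q2 i * (\<eta> i k \<omega> * \<epsilon> i k \<omega> - s12 i)
  + u1 i * ((\<epsilon> i k \<omega>)\<^sup>2 - s22 i)" for k \<omega>
definition w where "w i = quadratic_noise_variance (s11 i) (s12 i) (s22 i) (q1 i) (q2 i) (u1 i)"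
definition L where "L i k \<omega> = A i * Y i k \<omega>" for k \<omega>
definition R where "R i k \<omega> = B i * Y i k \<omega> + u2 i * D i k \<omega>" for k \<omega>
definition m where "m i k \<omega> = L i k \<omega> * \<eta> i k \<omega> + R i k \<omega> * \<epsilon> i k \<omega> + q i k \<omega>" for k \<omega>
definition H where "H i k \<omega> = \<beta> i * (Y i k \<omega> * D i k \<omega>) + \<delta> i * (D i k \<omega>)\<^sup>2 + lam i * (Y i k \<omega>)\<^sup>2" for k \<omega>
definition v where "v i = ar_variance (\<rho> i) (p i) (s11 i) (s12 i) (s22 i) (u1 i) (u2 i)"

lemma kappa_bounded: "bounded_moments (\<lambda>i k \<omega>. ar_kappa (\<rho> i) (p i))"
proof -
  have "bounded_moments (\<lambda>i k \<omega>. (p i)\<^sup>2 * (1 / (1 - (\<rho> i)\<^sup>2)))"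
    by (intro bounded_moments_intros p_bounded inverse_bounded)
  then show ?thesis by (simp add: ar_kappa_def)
qed

lemma coefficients_bounded:
  "bounded_moments (\<lambda>i k \<omega>. q1 i)" "bounded_moments (\<lambda>i k \<omega>. q2 i)"
  "bounded_moments (\<lambda>i k \<omega>. A i)" "bounded_moments (\<lambda>i k \<omega>. B i)"
  "bounded_moments (\<lambda>i k \<omega>. \<beta> i)" "bounded_moments (\<lambda>i k \<omega>. \<delta> i)" "bounded_moments (\<lambda>i k \<omega>. lam i)"
  "bounded_moments (\<lambda>i k \<omega>. w i)" "bounded_moments (\<lambda>i k \<omega>. v i)"
proof -
  note bm = bounded_moments_intros p_bounded \<rho>_bounded s_bounded u_bounded kappa_bounded inverse_bounded
  show q: "bounded_moments (\<lambda>i k \<omega>. q1 i)" "bounded_moments (\<lambda>i k \<omega>. q2 i)"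
    unfolding q1_def q2_def by (intro bm)+
  show AB: "bounded_moments (\<lambda>i k \<omega>. A i)" "bounded_moments (\<lambda>i k \<omega>. B i)"
    unfolding A_def ar_A_def B_def ar_B_def by (intro bm)+
  show \<beta>\<delta>: "bounded_moments (\<lambda>i k \<omega>. \<beta> i)" "bounded_moments (\<lambda>i k \<omega>. \<delta> i)"
    unfolding \<beta>_def ar_beta_def \<delta>_def ar_delta_def A_def[symmetric] B_def[symmetric] by (intro bm AB)+
  have "bounded_moments (\<lambda>i k \<omega>. ((A i)\<^sup>2 * s11 i + 2 * A i * B i * s12 i + (B i)\<^sup>2 * s22 i
      + \<beta> i * \<rho> i * p i + \<delta> i * (p i)\<^sup>2) * (1 / (1 - (\<rho> i)\<^sup>2)))"
    by (intro bm AB \<beta>\<delta>)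
  then show l: "bounded_moments (\<lambda>i k \<omega>. lam i)"
    by (simp add: lam_def ar_lambda_def ar_alpha_def A_def B_def \<beta>_def \<delta>_def)
  show w: "bounded_moments (\<lambda>i k \<omega>. w i)"
    unfolding w_def quadratic_noise_variance_def by (intro bm q)
  have "bounded_moments (\<lambda>i k \<omega>. \<beta> i * s12 i + \<delta> i * s22 i + lam i * s11 i + w i)"
    by (intro bm \<beta>\<delta> l w)
  then show "bounded_moments (\<lambda>i k \<omega>. v i)"
    by (simp add: v_def ar_variance_def w_def \<beta>_def \<delta>_def lam_def q1_def q2_def)
qed

lemma L_moments: "bounded_moments L" and R_moments: "bounded_moments R"
  unfolding L_def[abs_def] R_def[abs_def]
  by (intro bounded_moments_intros coefficients_bounded u_bounded Y_moments D_moments)+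

lemma q_moments: "bounded_moments q"
  unfolding q_def[abs_def]
  by (intro bounded_moments_intros coefficients_bounded u_bounded s_bounded \<eta>_moments \<epsilon>_moments)

lemma H_moments: "bounded_moments H"
  unfolding H_def[abs_def]
  by (intro bounded_moments_intros coefficients_bounded Y_moments D_moments)

lemma L_adapted: "adapted L" and R_adapted: "adapted R"
  unfolding L_def[abs_def] R_def[abs_def]
  by (intro adapted_mult adapted_add adapted_const Y_adapted D_adapted)+

lemma q_martingale_diff: "martingale_diff q"
  unfolding q_def[abs_def]
  by (intro martingale_diff_add martingale_diff_const_mult noise_martingale_diffs coefficients_bounded u_bounded)

lemma m_martingale_diff: "martingale_diff m"
  unfolding m_def[abs_def]
  by (intro martingale_diff_add martingale_diff_past_mult[OF noise_martingale_diffs(1) L_moments L_adapted]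
      martingale_diff_past_mult[OF noise_martingale_diffs(2) R_moments R_adapted] q_martingale_diff)

text \<open>Odd moments of a centred Gaussian pair vanish, so the quadratic noise part is
  uncorrelated with each noise; its variance comes from the fourth moments.\<close>

lemma q_noise_integrals:
  assumes i: "i \<in> I"
  shows "(\<integral>\<omega>. \<eta> i k \<omega> * q i k \<omega> \<partial>P i) = 0" "(\<integral>\<omega>. \<epsilon> i k \<omega> * q i k \<omega> \<partial>P i) = 0"
    "(\<integral>\<omega>. (q i k \<omega>)\<^sup>2 \<partial>P i) = w i"
proof -
  interpret prob_space "P i" by (rule prob[OF i])
  note mi = noise_monomial_integrable[OF i, of k]
  note mi0 = mi[of 3 0, simplified] mi[of 2 1, simplified] mi[of 1 2, simplified] mi[of 0 3, simplified]
    mi[of 1 0, simplified] mi[of 0 1, simplified]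
    mi[of 2 0, simplified] mi[of 1 1, simplified] mi[of 0 2, simplified]
    mi[of 4 0, simplified] mi[of 3 1, simplified] mi[of 2 2] mi[of 1 3, simplified] mi[of 0 4, simplified]
  note ints = mi0 Bochner_Integration.integral_add Bochner_Integration.integral_diff integral_mult_right_zero
    Bochner_Integration.integrable_add Bochner_Integration.integrable_diff integrable_mult_right noise_moments[OF i]
    integrable_const
  have "(\<integral>\<omega>. \<eta> i k \<omega> * q i k \<omega> \<partial>P i) = (\<integral>\<omega>. q1 i * \<eta> i k \<omega> ^ 3 + q2 i * (\<eta> i k \<omega> ^ 2 * \<epsilon> i k \<omega>)
      + u1 i * (\<eta> i k \<omega> * \<epsilon> i k \<omega> ^ 2) - (q1 i * s11 i + q2 i * s12 i + u1 i * s22 i) * \<eta> i k \<omega> \<partial>P i)"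
    by (intro Bochner_Integration.integral_cong) (auto simp: q_def algebra_simps power2_eq_square power3_eq_cube)
  then show "(\<integral>\<omega>. \<eta> i k \<omega> * q i k \<omega> \<partial>P i) = 0" by (simp only: ints; simp)
  have "(\<integral>\<omega>. \<epsilon> i k \<omega> * q i k \<omega> \<partial>P i) = (\<integral>\<omega>. q1 i * (\<eta> i k \<omega> ^ 2 * \<epsilon> i k \<omega>) + q2 i * (\<eta> i k \<omega> * \<epsilon> i k \<omega> ^ 2)
      + u1 i * \<epsilon> i k \<omega> ^ 3 - (q1 i * s11 i + q2 i * s12 i + u1 i * s22 i) * \<epsilon> i k \<omega> \<partial>P i)"
    by (intro Bochner_Integration.integral_cong) (auto simp: q_def algebra_simps power2_eq_square power3_eq_cube)
  then show "(\<integral>\<omega>. \<epsilon> i k \<omega> * q i k \<omega> \<partial>P i) = 0" by (simp only: ints; simp)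
  define c where "c = q1 i * s11 i + q2 i * s12 i + u1 i * s22 i"
  have "(q i k \<omega>)\<^sup>2 = (q1 i)\<^sup>2 * \<eta> i k \<omega> ^ 4 + (2 * q1 i * q2 i) * (\<eta> i k \<omega> ^ 3 * \<epsilon> i k \<omega>)
      + ((q2 i)\<^sup>2 + 2 * q1 i * u1 i) * (\<eta> i k \<omega> ^ 2 * \<epsilon> i k \<omega> ^ 2) + (2 * q2 i * u1 i) * (\<eta> i k \<omega> * \<epsilon> i k \<omega> ^ 3)
      + (u1 i)\<^sup>2 * \<epsilon> i k \<omega> ^ 4
      - (2 * c * q1 i) * \<eta> i k \<omega> ^ 2 - (2 * c * q2 i) * (\<eta> i k \<omega> * \<epsilon> i k \<omega>) - (2 * c * u1 i) * \<epsilon> i k \<omega> ^ 2 + c\<^sup>2" for \<omega>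
  proof -
    have qe: "q i k \<omega> = q1 i * \<eta> i k \<omega> ^ 2 + q2 i * (\<eta> i k \<omega> * \<epsilon> i k \<omega>) + u1 i * \<epsilon> i k \<omega> ^ 2 - c"
      by (simp add: q_def c_def algebra_simps)
    show ?thesis unfolding qe by (simp add: algebra_simps power2_eq_square power3_eq_cube power4_eq_xxxx)
  qed
  then have "(\<integral>\<omega>. (q i k \<omega>)\<^sup>2 \<partial>P i) = (q1 i)\<^sup>2 * (3 * (s11 i)\<^sup>2) + (2 * q1 i * q2 i) * (3 * s11 i * s12 i)
      + ((q2 i)\<^sup>2 + 2 * q1 i * u1 i) * (s11 i * s22 i + 2 * (s12 i)\<^sup>2) + (2 * q2 i * u1 i) * (3 * s22 i * s12 i)
      + (u1 i)\<^sup>2 * (3 * (s22 i)\<^sup>2)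
      - (2 * c * q1 i) * s11 i - (2 * c * q2 i) * s12 i - (2 * c * u1 i) * s22 i + c\<^sup>2"
    by (simp only: ints; simp add: prob_space)
  also have "\<dots> = w i"
    by (simp add: w_def quadratic_noise_variance_def c_def algebra_simps power2_eq_square)
  finally show "(\<integral>\<omega>. (q i k \<omega>)\<^sup>2 \<partial>P i) = w i" .
qed

lemma q_noise_martingale_diffs:
  "martingale_diff (\<lambda>i k \<omega>. \<eta> i k \<omega> * q i k \<omega>)" "martingale_diff (\<lambda>i k \<omega>. \<epsilon> i k \<omega> * q i k \<omega>)"
  "martingale_diff (\<lambda>i k \<omega>. (q i k \<omega>)\<^sup>2 - w i)"
proof -
  define Q where "Q i x = q1 i * ((fst x)\<^sup>2 - s11 i) + q2 i * (fst x * snd x - s12 i)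
    + u1 i * ((snd x)\<^sup>2 - s22 i)" for i and x :: "real \<times> real"
  have Q: "q i k \<omega> = Q i (\<eta> i k \<omega>, \<epsilon> i k \<omega>)" for i k \<omega> by (simp add: q_def Q_def)
  have [measurable]: "Q i \<in> borel_measurable (borel \<Otimes>\<^sub>M borel)" for i unfolding Q_def[abs_def] by measurable
  have "bounded_moments (\<lambda>i k \<omega>. \<eta> i k \<omega> * q i k \<omega>)" by (intro bounded_moments_mult \<eta>_moments q_moments)
  then show "martingale_diff (\<lambda>i k \<omega>. \<eta> i k \<omega> * q i k \<omega>)"
    using noise_martingale_diff[of "\<lambda>i x. fst x * Q i x"] q_noise_integrals(1) by (simp add: Q)
  have "bounded_moments (\<lambda>i k \<omega>. \<epsilon> i k \<omega> * q i k \<omega>)" by (intro bounded_moments_mult \<epsilon>_moments q_moments)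
  then show "martingale_diff (\<lambda>i k \<omega>. \<epsilon> i k \<omega> * q i k \<omega>)"
    using noise_martingale_diff[of "\<lambda>i x. snd x * Q i x"] q_noise_integrals(2) by (simp add: Q)
  have "bounded_moments (\<lambda>i k \<omega>. (q i k \<omega>)\<^sup>2 - w i)"
    by (intro bounded_moments_intros q_moments coefficients_bounded)
  moreover have "(\<integral>\<omega>. (q i k \<omega>)\<^sup>2 - w i \<partial>P i) = 0" if i: "i \<in> I" for i k
  proof -
    interpret prob_space "P i" by (rule prob[OF i])
    show ?thesis using q_noise_integrals(3)[OF i, of k] bounded_moments_integrable_power[OF q_moments i, of k 2]
      by (simp add: prob_space)
  qed
  ultimately show "martingale_diff (\<lambda>i k \<omega>. (q i k \<omega>)\<^sup>2 - w i)"
    using noise_martingale_diff[of "\<lambda>i x. (Q i x)\<^sup>2 - w i"] by (simp add: Q)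
qed

text \<open>The martingale part of \<open>(m i k \<omega>)\<^sup>2\<close>: past factors times
  centred functions of the noise. The last two lines are the fluctuation in one step of the Poisson
  solution \<open>H\<close>.\<close>

definition N where "N i k \<omega> = (L i k \<omega>)\<^sup>2 * ((\<eta> i k \<omega>)\<^sup>2 - s11 i)
    + (2 * L i k \<omega> * R i k \<omega>) * (\<eta> i k \<omega> * \<epsilon> i k \<omega> - s12 i) + (R i k \<omega>)\<^sup>2 * ((\<epsilon> i k \<omega>)\<^sup>2 - s22 i)
    + (2 * L i k \<omega>) * (\<eta> i k \<omega> * q i k \<omega>) + (2 * R i k \<omega>) * (\<epsilon> i k \<omega> * q i k \<omega>) + ((q i k \<omega>)\<^sup>2 - w i)
    + (\<beta> i * \<rho> i + 2 * \<delta> i * p i) * (Y i k \<omega> * \<epsilon> i k \<omega>) + (\<beta> i * p i + 2 * lam i * \<rho> i) * (Y i k \<omega> * \<eta> i k \<omega>)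
    + \<beta> i * (\<eta> i k \<omega> * \<epsilon> i k \<omega> - s12 i) + \<delta> i * ((\<epsilon> i k \<omega>)\<^sup>2 - s22 i) + lam i * ((\<eta> i k \<omega>)\<^sup>2 - s11 i)" for k \<omega>

lemma N_martingale_diff: "martingale_diff N"
  unfolding N_def[abs_def] power2_eq_square[of "L _ _ _"] power2_eq_square[of "R _ _ _"]
  by (intro martingale_diff_add martingale_diff_const_mult noise_martingale_diffs q_noise_martingale_diffs
      martingale_diff_past_mult[OF noise_martingale_diffs(1) Y_moments Y_adapted]
      martingale_diff_past_mult[OF noise_martingale_diffs(2) Y_moments Y_adapted]
      martingale_diff_past_mult[OF noise_martingale_diffs(3)]
      martingale_diff_past_mult[OF noise_martingale_diffs(4)]
      martingale_diff_past_mult[OF noise_martingale_diffs(5)]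
      martingale_diff_past_mult[OF q_noise_martingale_diffs(1)]
      martingale_diff_past_mult[OF q_noise_martingale_diffs(2)]
      bounded_moments_intros coefficients_bounded \<rho>_bounded p_bounded L_moments R_moments
      adapted_mult adapted_add L_adapted R_adapted adapted_const)

text \<open>A comparison of coefficients. All fluctuations due to the noise are in \<open>N\<close>;
  the remaining coefficients of \<open>Y\<^sup>2\<close>, \<open>Y * D\<close> and
  \<open>D\<^sup>2\<close> vanish by the choice of \<open>lam\<close>, \<open>\<beta>\<close> and
  \<open>\<delta>\<close> respectively.\<close>

lemma m_square_decomposition:
  assumes i: "i \<in> I"
  shows "(m i k \<omega>)\<^sup>2 - v i = N i k \<omega> + (H i k \<omega> - H i (Suc k) \<omega>)"
proof -
  have lam: "lam i * (1 - (\<rho> i)\<^sup>2) = (A i)\<^sup>2 * s11 i + 2 * A i * B i * s12 i + (B i)\<^sup>2 * s22 i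
      + \<beta> i * \<rho> i * p i + \<delta> i * (p i)\<^sup>2"
    using \<rho>_square_less[OF i] by (simp add: lam_def ar_lambda_def ar_alpha_def A_def B_def \<beta>_def \<delta>_def)
  have v: "v i = \<beta> i * s12 i + \<delta> i * s22 i + lam i * s11 i + w i"
    by (simp add: v_def ar_variance_def w_def \<beta>_def \<delta>_def lam_def q1_def q2_def)
  have \<beta>: "\<beta> i = 2 * A i * u2 i * s12 i + 2 * B i * u2 i * s22 i"
    by (simp add: \<beta>_def ar_beta_def A_def B_def)
  have \<delta>: "\<delta> i = u2 i * u2 i * s22 i" by (simp add: \<delta>_def ar_delta_def power2_eq_square)
  have "(m i k \<omega>)\<^sup>2 - v i - (N i k \<omega> + (H i k \<omega> - H i (Suc k) \<omega>)) =
      (Y i k \<omega>)\<^sup>2 * ((A i)\<^sup>2 * s11 i + 2 * A i * B i * s12 i + (B i)\<^sup>2 * s22 i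
      + \<beta> i * \<rho> i * p i + \<delta> i * (p i)\<^sup>2 - lam i * (1 - (\<rho> i)\<^sup>2))
      + Y i k \<omega> * D i k \<omega> * (2 * A i * u2 i * s12 i + 2 * B i * u2 i * s22 i - \<beta> i)
      + (D i k \<omega>)\<^sup>2 * (u2 i * u2 i * s22 i - \<delta> i)"
    unfolding m_def N_def H_def v L_def R_def by (simp add: algebra_simps power2_eq_square)
  also have "\<dots> = 0" unfolding lam \<beta> \<delta> by simp
  finally show ?thesis by simp
qed

text \<open>Difference between the two ends of a Poisson solution for the centred summands
  themselves, as opposed to \<open>H\<close>, which serves their conditional variance. The product
  \<open>Y * D\<close> contributes nothing at time 0 because of the dummy
  \<open>D i 0\<close>.\<close>

definition boundary where "boundary i T \<omega> = q1 i * ((Y i T \<omega>)\<^sup>2 - (y0 i \<omega>)\<^sup>2) + q2 i * (Y i T \<omega> * D i T \<omega>)"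
  for T \<omega>

lemma boundary_moments: "bounded_moments boundary"
  unfolding boundary_def[abs_def]
  by (intro bounded_moments_intros coefficients_bounded Y_moments D_moments y0_moments)

end

section \<open>Normalized statistics as martingale sums up to boundary terms\<close>

context hidden_ar_family
begin

text \<open>\<open>r0\<close> and \<open>r1\<close> are the stationary variance and lag-one
  covariance of the increments; the stationary variance of the hidden state is
  \<open>s11 i / (1 - (\<rho> i)\<^sup>2)\<close>.\<close>

definition r0 where "r0 i = ar_kappa (\<rho> i) (p i) * s11 i + s22 i"
definition r1 where "r1 i = p i * s12 i + \<rho> i * ar_kappa (\<rho> i) (p i) * s11 i"
definition Z1 where "Z1 i T \<omega> = ((\<Sum>k<T. (D i (Suc k) \<omega>)\<^sup>2) - real T * r0 i) / sqrt (real T)" for T \<omega>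
text \<open>The product at \<open>k = 0\<close> is zero by the dummy \<open>D i 0\<close>, which
  matches a statistic that divides \<open>T - 1\<close> products by \<open>T\<close>.\<close>

definition Z2 where "Z2 i T \<omega> = ((\<Sum>k<T. D i (Suc k) \<omega> * D i k \<omega>) - real T * r1 i) / sqrt (real T)" for T \<omega>

end

context hidden_ar_functional
begin

text \<open>Both sides vanish for \<open>T = 0\<close>, and their increments differ by a multiple of
  \<open>(p i)\<^sup>2 - \<kappa> * (1 - (\<rho> i)\<^sup>2)\<close>, which is zero by the
  definition of \<open>ar_kappa\<close>.\<close>

lemma sum_decomposition:
  assumes i: "i \<in> I"
  shows "u1 i * ((\<Sum>k<T. (D i (Suc k) \<omega>)\<^sup>2) - real T * r0 i) + u2 i * ((\<Sum>k<T. D i (Suc k) \<omega> * D i k \<omega>) - real T * r1 i)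
    = (\<Sum>k<T. m i k \<omega>) - boundary i T \<omega>"
proof (induction T)
  case 0
  show ?case by (simp add: boundary_def)
next
  case (Suc T)
  define \<kappa> where "\<kappa> = ar_kappa (\<rho> i) (p i)"
  have \<kappa>: "(p i)\<^sup>2 = \<kappa> * (1 - (\<rho> i)\<^sup>2)" using \<rho>_square_less[OF i] by (simp add: \<kappa>_def ar_kappa_def)
  have "u1 i * ((D i (Suc T) \<omega>)\<^sup>2 - r0 i) + u2 i * (D i (Suc T) \<omega> * D i T \<omega> - r1 i)
      - (m i T \<omega> - (boundary i (Suc T) \<omega> - boundary i T \<omega>)) =
      (Y i T \<omega>)\<^sup>2 * (u1 i + \<rho> i * u2 i) * ((p i)\<^sup>2 - \<kappa> * (1 - (\<rho> i)\<^sup>2))"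
    unfolding m_def L_def R_def q_def q1_def q2_def A_def ar_A_def B_def ar_B_def boundary_def r0_def r1_def
      \<kappa>_def[symmetric]
    by (simp add: algebra_simps power2_eq_square)
  also have "\<dots> = 0" unfolding \<kappa> by simp
  finally show ?case using Suc by (simp add: algebra_simps)
qed

lemma Z_decomposition:
  assumes "i \<in> I"
  shows "u1 i * Z1 i T \<omega> + u2 i * Z2 i T \<omega> = (\<Sum>k<T. m i k \<omega>) / sqrt (real T) - boundary i T \<omega> / sqrt (real T)"
  using arg_cong[OF sum_decomposition[OF assms, where T = T and \<omega> = \<omega>], of "\<lambda>x. x / sqrt (real T)"]
  unfolding Z1_def Z2_def by (simp add: add_divide_distrib diff_divide_distrib right_diff_distrib)

lemma Z_moments: "bounded_moments (\<lambda>i T \<omega>. u1 i * Z1 i T \<omega> + u2 i * Z2 i T \<omega>)"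
proof -
  have "bounded_moments (\<lambda>i T \<omega>. boundary i T \<omega> / sqrt (real T))"
  proof (rule bounded_moments_dominated[OF bounded_moments_abs[OF boundary_moments]])
    fix i T \<omega> assume i: "i \<in> I"
    show "(\<lambda>\<omega>. boundary i T \<omega> / sqrt (real T)) \<in> borel_measurable (P i)"
      using bounded_moments_measurable[OF boundary_moments i] by measurable
    show "\<bar>boundary i T \<omega> / sqrt (real T)\<bar> \<le> \<bar>boundary i T \<omega>\<bar>"
      by (cases "T = 0") (auto simp: abs_divide divide_le_eq mult_le_cancel_left1)
  qed
  from bounded_moments_diff[OF martingale_moments[OF m_martingale_diff] this]
  show ?thesis
    by (rule bounded_moments_dominated[OF bounded_moments_abs])
      (auto simp: Z_decomposition dest: bounded_moments_measurable[OF bounded_moments_diff[OF martingale_moments[OF m_martingale_diff]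
        \<open>bounded_moments (\<lambda>i T \<omega>. boundary i T \<omega> / sqrt (real T))\<close>]])
qed

text \<open>Since \<open>iexp\<close> is Lipschitz, dropping the boundary term costs at most its
  mean modulus divided by \<open>sqrt T\<close>, the same order as the martingale rate.\<close>

theorem Z_char_rate:
  obtains C where "\<And>i T. i \<in> I \<Longrightarrow> T \<ge> 1 \<Longrightarrow>
    cmod ((\<integral>\<omega>. iexp (u1 i * Z1 i T \<omega> + u2 i * Z2 i T \<omega>) \<partial>P i) - exp (- v i / 2)) \<le> C / sqrt (real T)"
proof -
  obtain V where V: "\<And>i. i \<in> I \<Longrightarrow> \<bar>v i\<bar> \<le> V" by (rule const_bounded[OF coefficients_bounded(9)]) blast
  obtain C where C: "\<And>i T. i \<in> I \<Longrightarrow> T \<ge> 1 \<Longrightarrow>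
      cmod ((\<integral>\<omega>. iexp ((\<Sum>k<T. m i k \<omega>) / sqrt (real T)) \<partial>P i) - exp (- v i / 2)) \<le> C / sqrt (real T)"
    by (rule martingale_char_rate[OF m_martingale_diff N_martingale_diff H_moments V m_square_decomposition]) blast+
  obtain C' where C': "\<And>i k. i \<in> I \<Longrightarrow> (\<integral>\<omega>. \<bar>boundary i k \<omega>\<bar> ^ 1 \<partial>P i) \<le> C'"
    by (rule bounded_moments_bound[OF boundary_moments, of 1]) blast
  have "cmod ((\<integral>\<omega>. iexp (u1 i * Z1 i T \<omega> + u2 i * Z2 i T \<omega>) \<partial>P i) - exp (- v i / 2)) \<le> (C + C') / sqrt (real T)"
    if i: "i \<in> I" and T: "T \<ge> 1" for i T
  proof -
    interpret prob_space "P i" by (rule prob[OF i])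
    define S where "S \<omega> = (\<Sum>k<T. m i k \<omega>) / sqrt (real T)" for \<omega>
    define b where "b \<omega> = boundary i T \<omega> / sqrt (real T)" for \<omega>
    have [measurable]: "S \<in> borel_measurable (P i)" "b \<in> borel_measurable (P i)"
      using bounded_moments_measurable[OF martingale_moments[OF m_martingale_diff] i]
        bounded_moments_measurable[OF boundary_moments i] unfolding S_def b_def by (auto intro!: borel_measurable_divide)
    have Z: "u1 i * Z1 i T \<omega> + u2 i * Z2 i T \<omega> = S \<omega> - b \<omega>" for \<omega>
      unfolding S_def b_def by (rule Z_decomposition[OF i])
    have bint: "integrable (P i) b"
      unfolding b_def using bounded_moments_integrable[OF boundary_moments i] by auto
    have e: "integrable (P i) (\<lambda>\<omega>. iexp (X \<omega>))" if "X \<in> borel_measurable (P i)" for X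
      using that by (intro integrable_iexp) auto
    have "cmod ((\<integral>\<omega>. iexp (S \<omega> - b \<omega>) \<partial>P i) - (\<integral>\<omega>. iexp (S \<omega>) \<partial>P i)) =
        cmod (\<integral>\<omega>. iexp (S \<omega> - b \<omega>) - iexp (S \<omega>) \<partial>P i)"
    proof -
      have "integrable (P i) (\<lambda>\<omega>. iexp (S \<omega> - b \<omega>))" "integrable (P i) (\<lambda>\<omega>. iexp (S \<omega>))"
        by (rule e, measurable)+
      then show ?thesis by (simp only: Bochner_Integration.integral_diff)
    qed
    also have "\<dots> \<le> (\<integral>\<omega>. cmod (iexp (S \<omega> - b \<omega>) - iexp (S \<omega>)) \<partial>P i)"
      by (rule integral_norm_bound)
    also have "\<dots> \<le> (\<integral>\<omega>. \<bar>b \<omega>\<bar> \<partial>P i)"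
    proof (rule integral_mono)
      show "integrable (P i) (\<lambda>\<omega>. cmod (iexp (S \<omega> - b \<omega>) - iexp (S \<omega>)))"
        by (intro integrable_norm Bochner_Integration.integrable_diff e) measurable
      show "cmod (iexp (S \<omega> - b \<omega>) - iexp (S \<omega>)) \<le> \<bar>b \<omega>\<bar>" for \<omega>
      proof -
        have "iexp (S \<omega> - b \<omega>) - iexp (S \<omega>) = iexp (S \<omega>) * (iexp (- b \<omega>) - 1)"
          by (simp add: right_diff_distrib exp_diff exp_minus divide_inverse)
        then show ?thesis using cmod_iexp_minus_one_le[of "- b \<omega>"] by (simp add: norm_mult)
      qed
    qed (use bint in auto)
    also have "\<dots> = (\<integral>\<omega>. \<bar>boundary i T \<omega>\<bar> \<partial>P i) / sqrt (real T)"
      by (simp add: b_def abs_divide)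
    also have "\<dots> \<le> C' / sqrt (real T)"
      using C'[OF i, of T] by (intro divide_right_mono) auto
    finally have "cmod ((\<integral>\<omega>. iexp (S \<omega> - b \<omega>) \<partial>P i) - (\<integral>\<omega>. iexp (S \<omega>) \<partial>P i)) \<le> C' / sqrt (real T)" .
    moreover have "cmod ((\<integral>\<omega>. iexp (S \<omega>) \<partial>P i) - exp (- v i / 2)) \<le> C / sqrt (real T)"
      unfolding S_def by (rule C[OF i T])
    ultimately show ?thesis unfolding Z add_divide_distrib
      using norm_triangle_ineq[of "(\<integral>\<omega>. iexp (S \<omega> - b \<omega>) \<partial>P i) - (\<integral>\<omega>. iexp (S \<omega>) \<partial>P i)"
          "(\<integral>\<omega>. iexp (S \<omega>) \<partial>P i) - complex_of_real (exp (- v i / 2))"] by simp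
  qed
  then show ?thesis by (rule that)
qed

end

section \<open>The noise of the sampled system\<close>

text \<open>Pathwise variation of constants: the driving increments are expressed through the
  equation and weighted by the integrating factor. The sum telescopes to the right-hand side up to
  local errors, which are of smaller order than \<open>1 / n\<close> uniformly in the step.\<close>

lemma linear_equation_noise_limit:
  fixes y v :: "real \<Rightarrow> real" and k :: nat
  assumes cont: "continuous_on {0..} y" and a: "a > 0"
    and eq: "\<And>t. t \<ge> 0 \<Longrightarrow> y t = y 0 - a * integral {0..t} y + b * v t"
  defines "t \<equiv> \<lambda>n i. real k + real i / real n"
  shows "(\<lambda>n. b * (\<Sum>i<n. exp (- a * real (n - 1 - i) / real n) * (v (t n (Suc i)) - v (t n i))))
    \<longlonglongrightarrow> y (real k + 1) - exp (- a) * y (real k)"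
proof -
  have cont': "continuous_on {real k..real k + 1} y"
    by (rule continuous_on_subset[OF cont]) auto
  obtain Mb where Mb: "\<And>s. s \<in> {real k..real k + 1} \<Longrightarrow> \<bar>y s\<bar> \<le> Mb"
  proof -
    have "bounded (y ` {real k..real k + 1})"
      by (intro compact_imp_bounded compact_continuous_image cont') auto
    then obtain c where "\<forall>x\<in>y ` {real k..real k + 1}. norm x \<le> c" by (auto simp: bounded_iff)
    then show ?thesis by (intro that[of c]) auto
  qed
  have Mb0: "Mb \<ge> 0" using Mb[of "real k"] by auto
  have unif: "uniformly_continuous_on {real k..real k + 1} y"
    by (rule compact_uniformly_continuous[OF cont']) auto
  \<comment> \<open>Local error from freezing the path at the left end of a step. It is bounded by
    the modulus of continuity of \<open>y\<close> times \<open>a / n\<close>, plus the quadratic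
    remainder of the exponential.\<close>
  define r where "r n i = a * integral {t n i..t n (Suc i)} y - (1 - exp (- a / real n)) * y (t n i)" for n i
  have int: "y integrable_on {s..s'}" if "0 \<le> s" for s s'
    by (rule integrable_continuous_interval, rule continuous_on_subset[OF cont]) (use that in auto)
  have t_nonneg: "0 \<le> t n i" for n i by (simp add: t_def)
  have t_step: "t n i \<le> t n (Suc i)" "t n (Suc i) - t n i = 1 / real n" for n i
    by (auto simp: t_def divide_right_mono diff_divide_distrib[symmetric])
  have decomp: "b * (\<Sum>i<n. exp (- a * real (n - 1 - i) / real n) * (v (t n (Suc i)) - v (t n i)))
      - (y (real k + 1) - exp (- a) * y (real k)) = (\<Sum>i<n. exp (- a * real (n - 1 - i) / real n) * r n i)"
    if n: "n > 0" for n
  proof -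
    \<comment> \<open>The integrating factor at the grid point \<open>i\<close>; with the natural
      difference \<open>n - 1 - i\<close> the weight of step \<open>i\<close> is its value at the
      right end \<open>Suc i\<close>.\<close>
    define e where "e i = exp (- a * (real n - real i) / real n)" for i
    have w: "exp (- a * real (n - 1 - i) / real n) = e (Suc i)" if "i < n" for i
      using that by (simp add: e_def of_nat_diff)
    have we: "e i = e (Suc i) * exp (- a / real n)" for i
      using n by (simp add: e_def add_divide_distrib diff_divide_distrib right_diff_distrib flip: exp_add)
        (simp add: field_simps)
    have "b * (v (t n (Suc i)) - v (t n i)) = y (t n (Suc i)) - y (t n i) + a * integral {t n i..t n (Suc i)} y" for i
    proof -
      have "integral {0..t n i} y + integral {t n i..t n (Suc i)} y = integral {0..t n (Suc i)} y"
        by (rule Henstock_Kurzweil_Integration.integral_combine) (use t_nonneg t_step int in auto)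
      then have I: "a * integral {0..t n (Suc i)} y = a * integral {0..t n i} y + a * integral {t n i..t n (Suc i)} y"
        by (simp add: distrib_left[symmetric])
      show ?thesis
        using eq[OF t_nonneg, of n i] eq[OF t_nonneg, of n "Suc i"] I by (simp add: right_diff_distrib)
    qed
    then have "e (Suc i) * (b * (v (t n (Suc i)) - v (t n i))) =
        e (Suc i) * (y (t n (Suc i)) - y (t n i) + a * integral {t n i..t n (Suc i)} y)" for i
      by (rule arg_cong)
    moreover have "e (Suc i) * (y (t n (Suc i)) - y (t n i) + a * integral {t n i..t n (Suc i)} y) =
        (e (Suc i) * y (t n (Suc i)) - e i * y (t n i)) + e (Suc i) * r n i" for i
      unfolding r_def we[of i] by (simp add: algebra_simps)
    ultimately have "e (Suc i) * (b * (v (t n (Suc i)) - v (t n i))) =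
        (e (Suc i) * y (t n (Suc i)) - e i * y (t n i)) + e (Suc i) * r n i" for i
      by simp
    then have "(\<Sum>i<n. e (Suc i) * (b * (v (t n (Suc i)) - v (t n i)))) =
        (\<Sum>i<n. e (Suc i) * y (t n (Suc i)) - e i * y (t n i)) + (\<Sum>i<n. e (Suc i) * r n i)"
      by (simp add: sum.distrib)
    also have "(\<Sum>i<n. e (Suc i) * y (t n (Suc i)) - e i * y (t n i)) = y (real k + 1) - exp (- a) * y (real k)"
      by (subst sum_lessThan_telescope) (use n in \<open>simp add: e_def t_def\<close>)
    finally have "(\<Sum>i<n. e (Suc i) * (b * (v (t n (Suc i)) - v (t n i)))) - (y (real k + 1) - exp (- a) * y (real k)) =
        (\<Sum>i<n. e (Suc i) * r n i)" by simp
    moreover have "b * (\<Sum>i<n. exp (- a * real (n - 1 - i) / real n) * (v (t n (Suc i)) - v (t n i))) =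
        (\<Sum>i<n. e (Suc i) * (b * (v (t n (Suc i)) - v (t n i))))"
      unfolding sum_distrib_left by (intro sum.cong refl) (simp only: lessThan_iff w mult_ac)
    moreover have "(\<Sum>i<n. exp (- a * real (n - 1 - i) / real n) * r n i) = (\<Sum>i<n. e (Suc i) * r n i)"
      by (intro sum.cong refl) (simp only: lessThan_iff w)
    ultimately show ?thesis by simp
  qed
  have r_le: "\<bar>r n i\<bar> \<le> a * d / real n + a\<^sup>2 * exp a * Mb / (real n)\<^sup>2"
    if n: "n > 0" and i: "i < n" and d: "\<And>s. s \<in> {t n i..t n (Suc i)} \<Longrightarrow> \<bar>y s - y (t n i)\<bar> \<le> d" for n i d
  proof -
    have r_eq: "r n i = a * (integral {t n i..t n (Suc i)} (\<lambda>s. y s - y (t n i)))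
        + (exp (- a / real n) - 1 - (- a / real n)) * y (t n i)"
    proof -
      have *: "integral {t n i..t n (Suc i)} (\<lambda>s. y s - y (t n i)) = integral {t n i..t n (Suc i)} y - 1 / real n * y (t n i)"
        using int[OF t_nonneg] t_step by (subst Henstock_Kurzweil_Integration.integral_diff) auto
      show ?thesis unfolding r_def * by (simp add: algebra_simps)
    qed
    have "\<bar>integral {t n i..t n (Suc i)} (\<lambda>s. y s - y (t n i))\<bar> \<le> d * (t n (Suc i) - t n i)"
      using integral_bound[of "t n i" "t n (Suc i)" "\<lambda>s. y s - y (t n i)" d] d t_step(1)[of n i]
        continuous_on_diff[OF continuous_on_subset[OF cont, of "{t n i..t n (Suc i)}"] continuous_on_const] t_nonneg[of n i]
      by force
    then have 1: "\<bar>a * (integral {t n i..t n (Suc i)} (\<lambda>s. y s - y (t n i)))\<bar> \<le> a * (d / real n)"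
      unfolding abs_mult
      using mult_left_mono[of "\<bar>integral {t n i..t n (Suc i)} (\<lambda>s. y s - y (t n i))\<bar>" "d / real n" a] a t_step(2)[of n i] by simp
    have "\<bar>exp (- a / real n) - 1 - (- a / real n)\<bar> \<le> (- a / real n)\<^sup>2 * exp \<bar>- a / real n\<bar>"
      by (rule abs_exp_minus_one_minus_le)
    also have "\<dots> \<le> (- a / real n)\<^sup>2 * exp a"
      using n a by (intro mult_left_mono) (auto simp: abs_divide divide_le_eq mult_le_cancel_left1)
    finally have 2: "\<bar>exp (- a / real n) - 1 - (- a / real n)\<bar> \<le> a\<^sup>2 / (real n)\<^sup>2 * exp a"
      by (simp add: power_divide)
    have "t n i \<in> {real k..real k + 1}" using i n by (auto simp: t_def divide_le_eq)
    then have "\<bar>(exp (- a / real n) - 1 - (- a / real n)) * y (t n i)\<bar> \<le> (a\<^sup>2 / (real n)\<^sup>2 * exp a) * Mb"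
      unfolding abs_mult using 2 Mb by (intro mult_mono) auto
    with 1 show ?thesis unfolding r_eq by (simp add: mult_ac)
  qed
  show ?thesis
  proof (rule LIM_zero_cancel, rule LIMSEQ_I)
    fix e :: real assume e: "e > 0"
    \<comment> \<open>The oscillation part of the errors then adds up to
      \<open>a * d = e / 4\<close>, while the exponential remainders stay below
      \<open>e / 2\<close>.\<close>
    define d where "d = e / (4 * a)"
    have d: "d > 0" using e a by (simp add: d_def)
    obtain \<delta> where \<delta>: "\<delta> > 0" "\<And>s s'. s \<in> {real k..real k + 1} \<Longrightarrow> s' \<in> {real k..real k + 1} \<Longrightarrow> dist s' s < \<delta> \<Longrightarrow> dist (y s') (y s) < d"
      using unif d unfolding uniformly_continuous_on_def by metis
    have lim: "(\<lambda>n. 1 / real n) \<longlonglongrightarrow> 0" "(\<lambda>n. a\<^sup>2 * exp a * Mb / real n) \<longlonglongrightarrow> 0"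
      by real_asymp+
    then have "eventually (\<lambda>n. 1 / real n < \<delta>) sequentially" "eventually (\<lambda>n. a\<^sup>2 * exp a * Mb / real n < e / 2) sequentially"
      using order_tendstoD(2)[OF lim(1) \<delta>(1)] order_tendstoD(2)[OF lim(2), of "e / 2"] e by auto
    then have "eventually (\<lambda>n. n > 0 \<and> 1 / real n < \<delta> \<and> a\<^sup>2 * exp a * Mb / real n < e / 2) sequentially"
      using eventually_gt_at_top[of 0] by eventually_elim auto
    then obtain N where N: "\<And>n. n \<ge> N \<Longrightarrow> n > 0 \<and> 1 / real n < \<delta> \<and> a\<^sup>2 * exp a * Mb / real n < e / 2"
      unfolding eventually_sequentially by blast
    have "norm (b * (\<Sum>i<n. exp (- a * real (n - 1 - i) / real n) * (v (t n (Suc i)) - v (t n i)))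
      - (y (real k + 1) - exp (- a) * y (real k)) - 0) < e" if "n \<ge> N" for n
    proof -
      have n: "n > 0" "1 / real n < \<delta>" "a\<^sup>2 * exp a * Mb / real n < e / 2" using N[OF that] by auto
      have "\<bar>exp (- a * real (n - 1 - i) / real n) * r n i\<bar> \<le> a * d / real n + a\<^sup>2 * exp a * Mb / (real n)\<^sup>2"
        if i: "i < n" for i
      proof -
        have "\<bar>y s - y (t n i)\<bar> \<le> d" if s: "s \<in> {t n i..t n (Suc i)}" for s
        proof -
          have "t n i \<in> {real k..real k + 1}" "t n (Suc i) \<le> real k + 1"
            using i n by (auto simp: t_def divide_le_eq)
          moreover have "dist s (t n i) < \<delta>" using s t_step(2)[of n i] n by (auto simp: dist_real_def)
          ultimately show ?thesis using \<delta>(2)[of "t n i" s] s by (auto simp: dist_real_def)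
        qed
        then have "\<bar>r n i\<bar> \<le> a * d / real n + a\<^sup>2 * exp a * Mb / (real n)\<^sup>2" by (rule r_le[OF n(1) i])
        moreover have "exp (- a * real (n - 1 - i) / real n) \<le> 1" using a by simp
        ultimately show ?thesis
          unfolding abs_mult using mult_mono[of "\<bar>exp (- a * real (n - 1 - i) / real n)\<bar>" 1 "\<bar>r n i\<bar>"] by fastforce
      qed
      then have "\<bar>\<Sum>i<n. exp (- a * real (n - 1 - i) / real n) * r n i\<bar> \<le>
          (\<Sum>i<n. a * d / real n + a\<^sup>2 * exp a * Mb / (real n)\<^sup>2)"
        by (intro order_trans[OF sum_abs] sum_mono) auto
      also have "\<dots> = a * d + a\<^sup>2 * exp a * Mb / real n" using n by (simp add: power2_eq_square distrib_left)
      also have "\<dots> < e" using n(3) a e by (simp add: d_def)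
      finally show ?thesis unfolding decomp[OF n(1)] by simp
    qed
    then show "\<exists>N. \<forall>n\<ge>N. norm (b * (\<Sum>i<n. exp (- a * real (n - 1 - i) / real n) * (v (t n (Suc i)) - v (t n i)))
      - (y (real k + 1) - exp (- a) * y (real k)) - 0) < e" by blast
  qed
qed

section \<open>Dyadic increments and the events of unit time blocks\<close>

definition dyadic_incr :: "(real \<Rightarrow> 'w \<Rightarrow> real) \<Rightarrow> nat \<Rightarrow> nat \<Rightarrow> 'w \<Rightarrow> real" where
  "dyadic_incr V l j \<omega> = V (real (Suc j) / 2 ^ l) \<omega> - V (real j / 2 ^ l) \<omega>"

text \<open>Generated by the finitely many increments of level \<open>l\<close> between the times
  \<open>m\<close> and \<open>n\<close>; independence is read off level by level.\<close>

definition block_level :: "'w measure \<Rightarrow> (real \<Rightarrow> 'w \<Rightarrow> real) \<Rightarrow> nat \<Rightarrow> nat \<Rightarrow> nat \<Rightarrow> 'w set set" where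
  "block_level M V m n l = sigma_sets (space M)
    (\<Union>j\<in>{m * 2 ^ l..<n * 2 ^ l}. {dyadic_incr V l j -` B \<inter> space M |B. B \<in> sets borel})"

text \<open>The union over all dyadic levels is a \<open>\<pi>\<close>-system, not a \<open>\<sigma>\<close>-algebra.\<close>

definition block_events :: "'w measure \<Rightarrow> (real \<Rightarrow> 'w \<Rightarrow> real) \<Rightarrow> nat \<Rightarrow> nat \<Rightarrow> 'w set set" where
  "block_events M V m n = (\<Union>l. block_level M V m n l)"

text \<open>The weighted sum of \<open>linear_equation_noise_limit\<close> over a grid of
  \<open>2 ^ l\<close> steps.\<close>

definition ou_level :: "(real \<Rightarrow> 'w \<Rightarrow> real) \<Rightarrow> real \<Rightarrow> real \<Rightarrow> nat \<Rightarrow> nat \<Rightarrow> 'w \<Rightarrow> real" where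
  "ou_level V a b k l \<omega> =
    b * (\<Sum>i<2 ^ l. exp (- a * real (2 ^ l - 1 - i) / 2 ^ l) * dyadic_incr V l (k * 2 ^ l + i) \<omega>)"

text \<open>The Wiener integral of \<open>b * exp (- a * (k + 1 - t))\<close> over \<open>{k..k + 1}\<close>. Taking a pathwise limit
  makes it measurable with respect to the increments of the block, without completion.\<close>

definition ou_noise :: "(real \<Rightarrow> 'w \<Rightarrow> real) \<Rightarrow> real \<Rightarrow> real \<Rightarrow> nat \<Rightarrow> 'w \<Rightarrow> real" where
  "ou_noise V a b k \<omega> = lim (\<lambda>l. ou_level V a b k l \<omega>)"

lemma dyadic_incr_telescope:
  "(\<Sum>i<2 ^ l. dyadic_incr V l (k * 2 ^ l + i) \<omega>) = V (real k + 1) \<omega> - V (real k) \<omega>"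
proof -
  have "(\<Sum>i<2 ^ l. dyadic_incr V l (k * 2 ^ l + i) \<omega>) =
      (\<Sum>i<2 ^ l. V (real (k * 2 ^ l + Suc i) / 2 ^ l) \<omega> - V (real (k * 2 ^ l + i) / 2 ^ l) \<omega>)"
    by (simp add: dyadic_incr_def)
  also have "\<dots> = V (real (k * 2 ^ l + 2 ^ l) / 2 ^ l) \<omega> - V (real (k * 2 ^ l + 0) / 2 ^ l) \<omega>"
    by (rule sum_lessThan_telescope)
  finally show ?thesis by (simp add: add_divide_distrib)
qed

lemma dyadic_incr_refine:
  "dyadic_incr V l j \<omega> = dyadic_incr V (Suc l) (2 * j) \<omega> + dyadic_incr V (Suc l) (Suc (2 * j)) \<omega>"
proof -
  have "real (Suc (Suc (2 * j))) / 2 ^ Suc l = real (Suc j) / 2 ^ l" "real (2 * j) / 2 ^ Suc l = real j / 2 ^ l"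
    by (simp_all add: field_simps)
  then show ?thesis by (simp add: dyadic_incr_def)
qed

lemma block_level_Pow: "block_level M V m n l \<subseteq> Pow (space M)"
  unfolding block_level_def by (rule subsetI, drule sigma_sets_into_sp[rotated]) auto

lemma block_events_Pow: "block_events M V m n \<subseteq> Pow (space M)"
  unfolding block_events_def using block_level_Pow by blast

lemma sets_sigma_block_level: "sets (sigma (space M) (block_level M V m n l)) = block_level M V m n l"
proof -
  have *: "sigma_sets (space M) (block_level M V m n l) = block_level M V m n l"
    unfolding block_level_def by (rule sigma_sets_sigma_sets_eq) auto
  show ?thesis unfolding sets_measure_of[OF block_level_Pow] by (rule *)
qed

lemma block_level_measurable:
  assumes "m * 2 ^ l \<le> j" "j < n * 2 ^ l"
  shows "dyadic_incr V l j \<in> borel_measurable (sigma (space M) (block_level M V m n l))"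
proof (rule measurableI)
  fix B :: "real set" assume "B \<in> sets borel"
  then have "dyadic_incr V l j -` B \<inter> space M \<in> block_level M V m n l"
    using assms unfolding block_level_def
    by (intro sigma_sets.Basic UN_I[of j] CollectI exI[of _ B] conjI refl) auto
  then show "dyadic_incr V l j -` B \<inter> space (sigma (space M) (block_level M V m n l)) \<in>
      sets (sigma (space M) (block_level M V m n l))"
    by (simp add: space_measure_of_conv sets_sigma_block_level)
qed auto

lemma block_level_least:
  assumes sp: "space N = space M"
    and "\<And>j. m * 2 ^ l \<le> j \<Longrightarrow> j < n * 2 ^ l \<Longrightarrow> dyadic_incr V l j \<in> borel_measurable N"
  shows "block_level M V m n l \<subseteq> sets N"
  unfolding block_level_def sp[symmetric]
proof (rule sets.sigma_sets_subset, rule subsetI)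
  fix A assume "A \<in> (\<Union>j\<in>{m * 2 ^ l..<n * 2 ^ l}. {dyadic_incr V l j -` B \<inter> space N |B. B \<in> sets borel})"
  then obtain j B where "m * 2 ^ l \<le> j" "j < n * 2 ^ l" "B \<in> sets borel" "A = dyadic_incr V l j -` B \<inter> space N"
    by auto
  then show "A \<in> sets N" using measurable_sets[OF assms(2)] by blast
qed

lemma block_level_mono_index:
  assumes "m' \<le> m" "n \<le> n'"
  shows "block_level M V m n l \<subseteq> block_level M V m' n' l"
proof -
  have "dyadic_incr V l j \<in> borel_measurable (sigma (space M) (block_level M V m' n' l))"
    if "m * 2 ^ l \<le> j" "j < n * 2 ^ l" for j
  proof (rule block_level_measurable)
    show "m' * 2 ^ l \<le> j" using that(1) assms(1) by (meson mult_le_mono1 order_trans)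
    show "j < n' * 2 ^ l" using that(2) assms(2) by (meson mult_le_mono1 order_less_le_trans)
  qed
  then show ?thesis
    using block_level_least[of "sigma (space M) (block_level M V m' n' l)" M m l n V]
    by (simp add: space_measure_of_conv sets_sigma_block_level)
qed

text \<open>A coarse increment is the sum of two finer ones. Hence the levels increase, and two
  events of different levels have their intersection at the finer one.\<close>

lemma block_level_Suc: "block_level M V m n l \<subseteq> block_level M V m n (Suc l)"
proof -
  let ?N = "sigma (space M) (block_level M V m n (Suc l))"
  have "dyadic_incr V l j \<in> borel_measurable ?N" if j: "m * 2 ^ l \<le> j" "j < n * 2 ^ l" for j
  proof -
    have "m * 2 ^ Suc l \<le> 2 * j" "2 * j < n * 2 ^ Suc l" "Suc (2 * j) < n * 2 ^ Suc l"
      using j by auto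
    then have "dyadic_incr V (Suc l) (2 * j) \<in> borel_measurable ?N" "dyadic_incr V (Suc l) (Suc (2 * j)) \<in> borel_measurable ?N"
      by (auto intro!: block_level_measurable)
    then have "(\<lambda>\<omega>. dyadic_incr V (Suc l) (2 * j) \<omega> + dyadic_incr V (Suc l) (Suc (2 * j)) \<omega>) \<in> borel_measurable ?N"
      by simp
    then show ?thesis by (simp flip: dyadic_incr_refine)
  qed
  then show ?thesis
    using block_level_least[of ?N M m l n V] by (simp add: space_measure_of_conv sets_sigma_block_level)
qed

lemma block_level_mono: "l \<le> l' \<Longrightarrow> block_level M V m n l \<subseteq> block_level M V m n l'"
  by (rule lift_Suc_mono_le[of "block_level M V m n"]) (rule block_level_Suc)

lemma block_events_Int_stable: "Int_stable (block_events M V m n)"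
proof (rule Int_stableI)
  fix A B assume "A \<in> block_events M V m n" "B \<in> block_events M V m n"
  then obtain l l' where "A \<in> block_level M V m n l" "B \<in> block_level M V m n l'"
    by (auto simp: block_events_def)
  then have "A \<in> block_level M V m n (max l l')" "B \<in> block_level M V m n (max l l')"
    by (auto intro: subsetD[OF block_level_mono[OF max.cobounded1]] subsetD[OF block_level_mono[OF max.cobounded2]])
  then have "A \<inter> B \<in> block_level M V m n (max l l')"
    using sets.Int[of A "sigma (space M) (block_level M V m n (max l l'))" B]
    by (simp add: sets_sigma_block_level)
  then show "A \<inter> B \<in> block_events M V m n" by (auto simp: block_events_def)
qed

lemma block_events_mono: "m' \<le> m \<Longrightarrow> n \<le> n' \<Longrightarrow> block_events M V m n \<subseteq> block_events M V m' n'"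
  unfolding block_events_def using block_level_mono_index[of m' m n n'] by blast

lemma space_in_block_events: "space M \<in> block_events M V m n"
  unfolding block_events_def block_level_def using sigma_sets_top by blast

lemma dyadic_incr_block_measurable:
  assumes N: "space N = space M" "block_events M V m n \<subseteq> sets N" and j: "m * 2 ^ l \<le> j" "j < n * 2 ^ l"
  shows "dyadic_incr V l j \<in> borel_measurable N"
proof (rule measurableI)
  fix B :: "real set" assume "B \<in> sets borel"
  then have "dyadic_incr V l j -` B \<inter> space M \<in> block_level M V m n l"
    using j unfolding block_level_def
    by (intro sigma_sets.Basic UN_I[of j] CollectI exI[of _ B] conjI refl) auto
  then show "dyadic_incr V l j -` B \<inter> space N \<in> sets N"
    using N by (auto simp: block_events_def)
qed auto

text \<open>Stated for any measurable space on the same carrier that contains the block events,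
  since it is applied to the whole space, to the history and to the algebras of single
  blocks.\<close>

lemma block_measurable:
  assumes N: "space N = space M" "block_events M V k (Suc k) \<subseteq> sets N"
  shows "ou_level V a b k l \<in> borel_measurable N" "ou_noise V a b k \<in> borel_measurable N"
    and "(\<lambda>\<omega>. V (real k + 1) \<omega> - V (real k) \<omega>) \<in> borel_measurable N"
proof -
  have d: "dyadic_incr V l (k * 2 ^ l + i) \<in> borel_measurable N" if "i \<in> {..<2 ^ l}" for l i
    by (rule dyadic_incr_block_measurable[OF N]) (use that in auto)
  show o: "ou_level V a b k l \<in> borel_measurable N" for l
    unfolding ou_level_def[abs_def] using d by (intro borel_measurable_times borel_measurable_sum) auto
  show "ou_noise V a b k \<in> borel_measurable N"
    unfolding ou_noise_def[abs_def] using o by (rule borel_measurable_lim_metric)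
  show "(\<lambda>\<omega>. V (real k + 1) \<omega> - V (real k) \<omega>) \<in> borel_measurable N"
    unfolding dyadic_incr_telescope[of V 0 k, symmetric] by (intro borel_measurable_sum d)
qed

lemma (in prob_space) normal_char:
  assumes "X \<in> borel_measurable M" "distr M borel X = centred_normal v" "v \<ge> 0"
  shows "(\<integral>\<omega>. iexp (t * X \<omega>) \<partial>M) = exp (- v * t\<^sup>2 / 2)"
  using assms(1) char_centred_normal[OF assms(3), of t] unfolding assms(2)[symmetric] char_def
  by (subst (asm) integral_distr) auto

lemma (in prob_space) normalI_char:
  assumes "X \<in> borel_measurable M" "v \<ge> 0" "\<And>t. (\<integral>\<omega>. iexp (t * X \<omega>) \<partial>M) = exp (- v * t\<^sup>2 / 2)"
  shows "distr M borel X = centred_normal v"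
proof (rule Levy_uniqueness)
  show "char (distr M borel X) = char (centred_normal v)"
  proof
    fix t
    have "char (distr M borel X) t = (\<integral>\<omega>. iexp (t * X \<omega>) \<partial>M)"
      unfolding char_def using assms(1) by (subst integral_distr) auto
    then show "char (distr M borel X) t = char (centred_normal v) t"
      using assms(3)[of t] char_centred_normal[OF assms(2), of t] by simp
  qed
qed (use assms real_distribution_centred_normal in auto)

lemma (in prob_space) normal_add_indep:
  assumes X: "distr M borel X = centred_normal v" "v \<ge> 0" and Z: "distr M borel Z = centred_normal w" "w \<ge> 0"
    and ind: "indep_var borel X borel Z"
  shows "distr M borel (\<lambda>\<omega>. X \<omega> + Z \<omega>) = centred_normal (v + w)"
proof (rule Levy_uniqueness)
  have [measurable]: "X \<in> borel_measurable M" "Z \<in> borel_measurable M"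
    using ind by (auto elim: indep_var_rv1 indep_var_rv2)
  show "real_distribution (distr M borel (\<lambda>\<omega>. X \<omega> + Z \<omega>))" by (rule real_distribution_distr) simp
  show "char (distr M borel (\<lambda>\<omega>. X \<omega> + Z \<omega>)) = char (centred_normal (v + w))"
    using assms by (auto simp: char_distr_add[OF ind] char_centred_normal exp_add[symmetric] algebra_simps
        add_divide_distrib diff_divide_distrib simp flip: of_real_mult)
qed (use assms real_distribution_centred_normal in auto)

section \<open>Independence of adjacent blocks and the law of the block noise\<close>

context wiener_process
begin

lemma dyadic_incr_random_variable: "random_variable borel (dyadic_incr W l j)"
  unfolding dyadic_incr_def[abs_def] by (intro borel_measurable_diff random_variable) auto

lemma block_events_subset: "block_events M W m n \<subseteq> events"
  unfolding block_events_def using block_level_least[of M M] dyadic_incr_random_variable by blast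

lemma block_events_process_sigma: "block_events M W m n \<subseteq> process_sigma M {0..} W"
proof -
  let ?G = "{W t -` B \<inter> space M |t B. t \<in> {0..} \<and> B \<in> sets borel}"
  have Pow: "?G \<subseteq> Pow (space M)" by auto
  let ?N = "sigma (space M) ?G"
  have sets: "sets ?N = process_sigma M {0..} W" using Pow by (simp add: process_sigma_def sets_measure_of)
  have "W t \<in> borel_measurable ?N" if "t \<ge> 0" for t
  proof (rule measurableI)
    fix B :: "real set" assume "B \<in> sets borel"
    then have "W t -` B \<inter> space M \<in> process_sigma M {0..} W"
      using that unfolding process_sigma_def by (intro sigma_sets.Basic) auto
    then show "W t -` B \<inter> space ?N \<in> sets ?N" unfolding sets by (simp add: space_measure_of_conv)
  qed auto
  then have "dyadic_incr W l j \<in> borel_measurable ?N" for l j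
    unfolding dyadic_incr_def[abs_def] by (intro borel_measurable_diff) auto
  then show ?thesis
    unfolding block_events_def sets[symmetric]
    by (intro UN_least block_level_least) (auto simp: space_measure_of_conv)
qed

lemma dyadic_indep: "indep_vars (\<lambda>_. borel) (\<lambda>i. dyadic_incr W l (c + i)) {..<n}"
proof -
  have "indep_vars (\<lambda>_. borel) (\<lambda>i \<omega>. W ((\<lambda>i. real (c + i) / 2 ^ l) (Suc i)) \<omega> - W ((\<lambda>i. real (c + i) / 2 ^ l) i) \<omega>) {..<n}"
    by (rule independent_increments) (auto intro!: monoI divide_right_mono)
  then show ?thesis by (simp add: dyadic_incr_def[abs_def])
qed

text \<open>At a common level the two blocks use disjoint sets of indices from one family of
  independent increments, so grouping applies. \<open>True\<close> indexes the earlier block, as in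
  \<open>indep_set\<close>.\<close>

lemma block_level_indep: "indep_set (block_level M W m n l) (block_level M W n k l)"
proof -
  define E where "E j = {dyadic_incr W l j -` B \<inter> space M |B. B \<in> sets borel}" for j
  define J where "J c = (if c then {m * 2 ^ l..<n * 2 ^ l} else {n * 2 ^ l..<k * 2 ^ l})" for c
  have "indep_sets E {..<max n k * 2 ^ l}"
    using dyadic_indep[of l 0 "max n k * 2 ^ l"] unfolding indep_vars_def2 E_def[abs_def] by simp
  moreover have "(\<Union>c\<in>UNIV. J c) \<subseteq> {..<max n k * 2 ^ l}"
  proof (rule UN_least)
    fix c
    have "J c \<subseteq> {..<n * 2 ^ l} \<union> {..<k * 2 ^ l}" by (auto simp: J_def split: if_splits)
    moreover have "n * 2 ^ l \<le> max n k * 2 ^ l" "k * 2 ^ l \<le> max n k * 2 ^ l" by simp_all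
    ultimately show "J c \<subseteq> {..<max n k * 2 ^ l}"
      unfolding subset_iff Un_iff lessThan_iff by (meson order_less_le_trans)
  qed
  ultimately have "indep_sets E (\<Union>c\<in>UNIV. J c)"
    using indep_sets_mono_index by blast
  moreover have "Int_stable (E i)" for i
  proof (rule Int_stableI)
    fix A B assume "A \<in> E i" "B \<in> E i"
    then obtain A' B' where "A' \<in> sets borel" "B' \<in> sets borel" "A = dyadic_incr W l i -` A' \<inter> space M" "B = dyadic_incr W l i -` B' \<inter> space M"
      by (auto simp: E_def)
    then have "A \<inter> B = dyadic_incr W l i -` (A' \<inter> B') \<inter> space M" "A' \<inter> B' \<in> sets borel" by auto
    then show "A \<inter> B \<in> E i" unfolding E_def by blast
  qed
  moreover have "disjoint_family_on J UNIV" by (auto simp: disjoint_family_on_def J_def)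
  ultimately have "indep_sets (\<lambda>c. sigma_sets (space M) (\<Union>i\<in>J c. E i)) UNIV"
    by (intro indep_sets_collect_sigma)
  then show ?thesis
    unfolding indep_set_def
    by (rule indep_sets_mono_sets) (auto simp: block_level_def J_def E_def split: bool.split)
qed

lemma block_events_indep: "indep_set (block_events M W m n) (block_events M W n k)"
proof (rule indep_setI)
  fix A B assume "A \<in> block_events M W m n" "B \<in> block_events M W n k"
  then obtain l l' where "A \<in> block_level M W m n l" "B \<in> block_level M W n k l'"
    by (auto simp: block_events_def)
  then have "A \<in> block_level M W m n (max l l')" "B \<in> block_level M W n k (max l l')"
    by (auto intro: subsetD[OF block_level_mono[OF max.cobounded1]] subsetD[OF block_level_mono[OF max.cobounded2]])
  then show "prob (A \<inter> B) = prob A * prob B" by (rule indep_setD[OF block_level_indep])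
qed (rule block_events_subset)+

lemma dyadic_incr_normal: "distr M borel (dyadic_incr W l j) = centred_normal (1 / 2 ^ l)"
proof -
  have "distr M borel (\<lambda>\<omega>. W (real (Suc j) / 2 ^ l) \<omega> - W (real j / 2 ^ l) \<omega>) = centred_normal (real (Suc j) / 2 ^ l - real j / 2 ^ l)"
    by (rule normal_increments) (auto simp: divide_right_mono)
  then show ?thesis by (simp add: dyadic_incr_def[abs_def] diff_divide_distrib[symmetric])
qed

lemma block_sum_char:
  "(\<integral>\<omega>. iexp (t * (\<Sum>i<2 ^ l. c i * dyadic_incr W l (k * 2 ^ l + i) \<omega>)) \<partial>M) =
    exp (- ((\<Sum>i<2 ^ l. (c i)\<^sup>2) / 2 ^ l) * t\<^sup>2 / 2)"
proof -
  let ?X = "\<lambda>i \<omega>. dyadic_incr W l (k * 2 ^ l + i) \<omega>"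
  have m: "random_variable borel (?X i)" for i using dyadic_incr_random_variable[of l] by (simp add: eta_contract_eq)
  have "indep_vars (\<lambda>_. borel) ?X {..<2 ^ l}"
    using dyadic_indep[of l "k * 2 ^ l"] by (simp add: eta_contract_eq)
  then have ind: "indep_vars (\<lambda>_. borel) (\<lambda>i \<omega>. c i * ?X i \<omega>) {..<2 ^ l}"
    by (rule indep_vars_compose2) auto
  have "(\<integral>\<omega>. iexp (t * (\<Sum>i<2 ^ l. c i * ?X i \<omega>)) \<partial>M) = char (distr M borel (\<lambda>\<omega>. \<Sum>i<2 ^ l. c i * ?X i \<omega>)) t"
    unfolding char_def using m by (subst integral_distr) auto
  also have "\<dots> = (\<Prod>i<2 ^ l. char (distr M borel (\<lambda>\<omega>. c i * ?X i \<omega>)) t)"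
    by (rule char_distr_sum[OF ind])
  also have "\<dots> = (\<Prod>i<2 ^ l. complex_of_real (exp (- (c i)\<^sup>2 / 2 ^ l * t\<^sup>2 / 2)))"
  proof (rule prod.cong[OF refl])
    fix i
    have "char (distr M borel (\<lambda>\<omega>. c i * ?X i \<omega>)) t = (\<integral>\<omega>. iexp ((t * c i) * ?X i \<omega>) \<partial>M)"
      unfolding char_def using m by (subst integral_distr) (auto simp: mult_ac)
    also have "\<dots> = exp (- (1 / 2 ^ l) * (t * c i)\<^sup>2 / 2)"
      by (rule normal_char[OF m]) (auto simp: dyadic_incr_normal)
    finally show "char (distr M borel (\<lambda>\<omega>. c i * ?X i \<omega>)) t = complex_of_real (exp (- (c i)\<^sup>2 / 2 ^ l * t\<^sup>2 / 2))"
      by (simp add: power_mult_distrib mult_ac)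
  qed
  also have "\<dots> = complex_of_real (exp (\<Sum>i<2 ^ l. - (c i)\<^sup>2 / 2 ^ l * t\<^sup>2 / 2))"
    by (simp only: exp_sum finite_lessThan of_real_prod)
  also have "(\<Sum>i<2 ^ l. - (c i)\<^sup>2 / 2 ^ l * t\<^sup>2 / 2) = - ((\<Sum>i<2 ^ l. (c i)\<^sup>2) / 2 ^ l) * t\<^sup>2 / 2"
    by (simp add: sum_divide_distrib sum_distrib_right sum_negf)
  finally show ?thesis .
qed

text \<open>On every dyadic level the combination is a sum of independent normal variables whose
  variance is a geometric sum; dominated convergence carries the characteristic function to the
  limit. The limit variance is the integral over the unit interval of the square of
  \<open>\<alpha> * b * exp (- a * s) + \<beta>\<close>.\<close>

lemma ou_combination_law:
  fixes \<alpha> \<beta> :: real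
  assumes a: "a > 0" and conv: "AE \<omega> in M. convergent (\<lambda>l. ou_level W a b k l \<omega>)"
  defines "v \<equiv> \<alpha>\<^sup>2 * b\<^sup>2 * (1 - exp (- 2 * a)) / (2 * a) + 2 * \<alpha> * \<beta> * b * (1 - exp (- a)) / a + \<beta>\<^sup>2"
  shows "distr M borel (\<lambda>\<omega>. \<alpha> * ou_noise W a b k \<omega> + \<beta> * (W (real k + 1) \<omega> - W (real k) \<omega>)) = centred_normal v"
    and "v \<ge> 0"
proof -
  \<comment> \<open>Joint weight of a dyadic increment: the increment over the whole block is also a
    sum of dyadic increments, which contributes the summand \<open>\<beta>\<close>.\<close>
  define c where "c l i = \<alpha> * b * exp (- a * real (2 ^ l - 1 - i) / 2 ^ l) + \<beta>" for l i
  define s where "s l = (\<Sum>i<2 ^ l. (c l i)\<^sup>2) / 2 ^ l" for l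
  have s_eq: "s l = \<alpha>\<^sup>2 * b\<^sup>2 * ((1 - exp (- 2 * a)) / (2 ^ l * (1 - exp (- 2 * a / 2 ^ l))))
      + 2 * \<alpha> * \<beta> * b * ((1 - exp (- a)) / (2 ^ l * (1 - exp (- a / 2 ^ l)))) + \<beta>\<^sup>2" for l
  proof -
    define N :: nat where "N = 2 ^ l"
    have N: "N > 0" "real N = 2 ^ l" by (auto simp: N_def)
    define e where "e = exp (- a / real N)"
    have e: "e \<noteq> 1" "e\<^sup>2 \<noteq> 1" "e\<^sup>2 = exp (- 2 * a / real N)" "e ^ N = exp (- a)" "(e\<^sup>2) ^ N = exp (- 2 * a)"
      using a N by (auto simp: e_def power2_eq_square exp_of_nat_mult[symmetric] exp_add[symmetric])
    have ce: "c l i = \<alpha> * b * e ^ (N - Suc i) + \<beta>" for i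
      by (simp add: c_def e_def N_def exp_of_nat_mult[symmetric] mult_ac)
    have "(\<Sum>i<N. (c l i)\<^sup>2) = (\<Sum>i<N. (\<alpha> * b * e ^ i + \<beta>)\<^sup>2)"
      unfolding ce by (rule sum.nat_diff_reindex)
    also have "\<dots> = (\<Sum>i<N. \<alpha>\<^sup>2 * b\<^sup>2 * (e\<^sup>2) ^ i + 2 * \<alpha> * \<beta> * b * e ^ i + \<beta>\<^sup>2)"
      by (intro sum.cong refl) (simp add: power2_eq_square algebra_simps power_mult_distrib)
    also have "\<dots> = \<alpha>\<^sup>2 * b\<^sup>2 * (\<Sum>i<N. (e\<^sup>2) ^ i) + 2 * \<alpha> * \<beta> * b * (\<Sum>i<N. e ^ i) + real N * \<beta>\<^sup>2"
      by (simp add: sum.distrib sum_distrib_left)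
    also have "\<dots> = \<alpha>\<^sup>2 * b\<^sup>2 * ((1 - exp (- 2 * a)) / (1 - e\<^sup>2)) + 2 * \<alpha> * \<beta> * b * ((1 - exp (- a)) / (1 - e)) + real N * \<beta>\<^sup>2"
      using e by (simp add: sum_gp_strict)
    finally have "s l = (\<alpha>\<^sup>2 * b\<^sup>2 * ((1 - exp (- 2 * a)) / (1 - e\<^sup>2)) + 2 * \<alpha> * \<beta> * b * ((1 - exp (- a)) / (1 - e)) + real N * \<beta>\<^sup>2) / real N"
      by (simp add: s_def N_def)
    also have "\<dots> = \<alpha>\<^sup>2 * b\<^sup>2 * ((1 - exp (- 2 * a)) / (real N * (1 - e\<^sup>2))) + 2 * \<alpha> * \<beta> * b * ((1 - exp (- a)) / (real N * (1 - e))) + \<beta>\<^sup>2"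
      using N by (simp add: add_divide_distrib mult.commute)
    finally show ?thesis using e(3) N(2) by (simp add: e_def)
  qed
  \<comment> \<open>Turns the denominators of the geometric sums into \<open>2 * a\<close> and
    \<open>a\<close>.\<close>
  have lim1: "(\<lambda>l. (2::real) ^ l * (1 - exp (- d / 2 ^ l))) \<longlonglongrightarrow> d" for d :: real
    by real_asymp
  have "s \<longlonglongrightarrow> \<alpha>\<^sup>2 * b\<^sup>2 * ((1 - exp (- 2 * a)) / (2 * a)) + 2 * \<alpha> * \<beta> * b * ((1 - exp (- a)) / a) + \<beta>\<^sup>2"
    unfolding s_eq[abs_def]
    by (intro tendsto_add tendsto_mult tendsto_divide tendsto_const lim1 lim1[of "2 * a", unfolded mult_minus_left[symmetric]])
      (use a in auto)
  then have s_lim: "s \<longlonglongrightarrow> v" by (simp add: v_def)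
  show v: "v \<ge> 0"
    by (rule LIMSEQ_le_const[OF s_lim]) (auto simp: s_def intro!: exI[of _ 0] divide_nonneg_nonneg sum_nonneg)
  define X where "X = (\<lambda>\<omega>. \<alpha> * ou_noise W a b k \<omega> + \<beta> * (W (real k + 1) \<omega> - W (real k) \<omega>))"
  define Xl where "Xl l \<omega> = \<alpha> * ou_level W a b k l \<omega> + \<beta> * (W (real k + 1) \<omega> - W (real k) \<omega>)" for l \<omega>
  note [measurable] = block_measurable[OF refl block_events_subset]
  have [measurable]: "random_variable borel X" "random_variable borel (Xl l)" for l
    unfolding X_def Xl_def[abs_def] by measurable
  have Xl: "Xl l \<omega> = (\<Sum>i<2 ^ l. c l i * dyadic_incr W l (k * 2 ^ l + i) \<omega>)" for l \<omega>
    unfolding Xl_def ou_level_def dyadic_incr_telescope[of W l k \<omega>, symmetric] c_def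
    by (simp add: sum_distrib_left sum.distrib distrib_right mult.assoc)
  have Xl_lim: "AE \<omega> in M. (\<lambda>l. Xl l \<omega>) \<longlonglongrightarrow> X \<omega>"
    using conv
  proof eventually_elim
    case (elim \<omega>)
    then have "(\<lambda>l. ou_level W a b k l \<omega>) \<longlonglongrightarrow> ou_noise W a b k \<omega>"
      unfolding ou_noise_def by (simp add: convergent_LIMSEQ_iff)
    then show ?case unfolding Xl_def X_def by (intro tendsto_intros)
  qed
  have "distr M borel X = centred_normal v"
  proof (rule normalI_char[OF _ v])
    fix t
    have "(\<lambda>l. \<integral>\<omega>. iexp (t * Xl l \<omega>) \<partial>M) \<longlonglongrightarrow> (\<integral>\<omega>. iexp (t * X \<omega>) \<partial>M)"
    proof (rule integral_dominated_convergence[where w = "\<lambda>_. 1"])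
      show "AE \<omega> in M. (\<lambda>l. iexp (t * Xl l \<omega>)) \<longlonglongrightarrow> iexp (t * X \<omega>)"
        using Xl_lim by eventually_elim (intro tendsto_intros)
    qed (auto intro!: AE_I2)
    moreover have "(\<integral>\<omega>. iexp (t * Xl l \<omega>) \<partial>M) = exp (- s l * t\<^sup>2 / 2)" for l
      unfolding Xl s_def by (rule block_sum_char)
    ultimately have "(\<lambda>l. complex_of_real (exp (- s l * t\<^sup>2 / 2))) \<longlonglongrightarrow> (\<integral>\<omega>. iexp (t * X \<omega>) \<partial>M)" by simp
    moreover have "(\<lambda>l. complex_of_real (exp (- s l * t\<^sup>2 / 2))) \<longlonglongrightarrow> complex_of_real (exp (- v * t\<^sup>2 / 2))"
      by (intro tendsto_intros s_lim) simp
    ultimately show "(\<integral>\<omega>. iexp (t * X \<omega>) \<partial>M) = exp (- v * t\<^sup>2 / 2)" by (rule LIMSEQ_unique)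
  qed measurable
  then show "distr M borel (\<lambda>\<omega>. \<alpha> * ou_noise W a b k \<omega> + \<beta> * (W (real k + 1) \<omega> - W (real k) \<omega>)) = centred_normal v"
    by (simp add: X_def)
qed

end

text \<open>The part of the increment of \<open>X\<close> not determined by the hidden state at time
  \<open>k\<close>. Solving the state equation for the integral of \<open>Y\<close> over the step,
  and replacing its end value by the recursion, gives the factor \<open>f / a\<close>.\<close>

definition obs_noise :: "(real \<Rightarrow> 'w \<Rightarrow> real) \<Rightarrow> (real \<Rightarrow> 'w \<Rightarrow> real) \<Rightarrow> real \<Rightarrow> real \<Rightarrow> real \<Rightarrow> real \<Rightarrow> nat \<Rightarrow> 'w \<Rightarrow> real" where
  "obs_noise W V a b f \<sigma> k \<omega> = f / a * (b * (V (real k + 1) \<omega> - V (real k) \<omega>) - ou_noise V a b k \<omega>)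
    + \<sigma> * (W (real k + 1) \<omega> - W (real k) \<omega>)"

text \<open>Rectangles built from the initial state and the past of each Wiener process. They form a
  system closed under intersections, on which independence can be checked by multiplying
  probabilities.\<close>

definition history_events :: "'w measure \<Rightarrow> (real \<Rightarrow> 'w \<Rightarrow> real) \<Rightarrow> (real \<Rightarrow> 'w \<Rightarrow> real) \<Rightarrow> (real \<Rightarrow> 'w \<Rightarrow> real) \<Rightarrow> nat \<Rightarrow> 'w set set" where
  "history_events M W V Y n =
    {A \<inter> w \<inter> v |A w v. A \<in> process_sigma M {0} Y \<and> w \<in> block_events M W 0 n \<and> v \<in> block_events M V 0 n}"

definition history :: "'w measure \<Rightarrow> (real \<Rightarrow> 'w \<Rightarrow> real) \<Rightarrow> (real \<Rightarrow> 'w \<Rightarrow> real) \<Rightarrow> (real \<Rightarrow> 'w \<Rightarrow> real) \<Rightarrow> nat \<Rightarrow> 'w measure" where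
  "history M W V Y n = sigma (space M) (history_events M W V Y n)"

definition fresh_events :: "'w measure \<Rightarrow> (real \<Rightarrow> 'w \<Rightarrow> real) \<Rightarrow> (real \<Rightarrow> 'w \<Rightarrow> real) \<Rightarrow> nat \<Rightarrow> 'w set set" where
  "fresh_events M W V n = {w \<inter> v |w v. w \<in> block_events M W n (Suc n) \<and> v \<in> block_events M V n (Suc n)}"

section \<open>The history of the sampled system, its independence of the next noise, and the law of
  the noise\<close>

context partially_observed_system
begin

lemma process_sigma_Y: "process_sigma M {0} Y \<subseteq> events"
  unfolding process_sigma_def
  by (rule sets.sigma_sets_subset) (auto intro!: measurable_sets[OF Y_random_variable])

lemma space_in_process_sigma: "space M \<in> process_sigma M I Z"
  unfolding process_sigma_def by (rule sigma_sets_top)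

lemma process_sigma_Int: "A \<in> process_sigma M I Z \<Longrightarrow> B \<in> process_sigma M I Z \<Longrightarrow> A \<inter> B \<in> process_sigma M I Z"
proof -
  interpret sigma_algebra "space M" "process_sigma M I Z"
    unfolding process_sigma_def by (rule sigma_algebra_sigma_sets) auto
  show "A \<in> process_sigma M I Z \<Longrightarrow> B \<in> process_sigma M I Z \<Longrightarrow> A \<inter> B \<in> process_sigma M I Z"
    by (rule Int)
qed

lemma triple_independence:
  assumes "A \<in> process_sigma M {0} Y" "w \<in> process_sigma M {0..} W" "v \<in> process_sigma M {0..} V"
  shows "prob (A \<inter> w \<inter> v) = prob A * prob w * prob v"
proof -
  have "prob (\<Inter>j\<in>{0, 1, 2::nat}. (if j = 0 then A else if j = 1 then w else v)) =
      (\<Prod>j\<in>{0, 1, 2::nat}. prob (if j = 0 then A else if j = 1 then w else v))"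
    by (rule indep_setsD[OF independence[of Y]]) (use assms in auto)
  then show ?thesis by (simp add: Int_ac mult_ac)
qed

lemma history_events_subset: "history_events M W V Y n \<subseteq> events"
  unfolding history_events_def
  using process_sigma_Y W.block_events_subset[of 0 n] V.block_events_subset[of 0 n] by blast

lemma fresh_events_subset: "fresh_events M W V n \<subseteq> events"
  unfolding fresh_events_def
  using W.block_events_subset[of n "Suc n"] V.block_events_subset[of n "Suc n"] by blast

lemma history_events_Int_stable: "Int_stable (history_events M W V Y n)"
proof (rule Int_stableI)
  fix a b assume "a \<in> history_events M W V Y n" "b \<in> history_events M W V Y n"
  then obtain A w v A' w' v' where *: "A \<in> process_sigma M {0} Y" "w \<in> block_events M W 0 n" "v \<in> block_events M V 0 n"
    "A' \<in> process_sigma M {0} Y" "w' \<in> block_events M W 0 n" "v' \<in> block_events M V 0 n"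
    "a = A \<inter> w \<inter> v" "b = A' \<inter> w' \<inter> v'" unfolding history_events_def by auto
  have "a \<inter> b = (A \<inter> A') \<inter> (w \<inter> w') \<inter> (v \<inter> v')" using * by auto
  moreover have "A \<inter> A' \<in> process_sigma M {0} Y" by (rule process_sigma_Int[OF *(1,4)])
  moreover have "w \<inter> w' \<in> block_events M W 0 n" by (rule Int_stableD[OF block_events_Int_stable *(2,5)])
  moreover have "v \<inter> v' \<in> block_events M V 0 n" by (rule Int_stableD[OF block_events_Int_stable *(3,6)])
  ultimately show "a \<inter> b \<in> history_events M W V Y n" unfolding history_events_def by blast
qed

lemma fresh_events_Int_stable: "Int_stable (fresh_events M W V n)"
proof (rule Int_stableI)
  fix a b assume "a \<in> fresh_events M W V n" "b \<in> fresh_events M W V n"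
  then obtain w v w' v' where *: "w \<in> block_events M W n (Suc n)" "v \<in> block_events M V n (Suc n)"
    "w' \<in> block_events M W n (Suc n)" "v' \<in> block_events M V n (Suc n)"
    "a = w \<inter> v" "b = w' \<inter> v'" unfolding fresh_events_def by auto
  have "a \<inter> b = (w \<inter> w') \<inter> (v \<inter> v')" using * by auto
  moreover have "w \<inter> w' \<in> block_events M W n (Suc n)" by (rule Int_stableD[OF block_events_Int_stable *(1,3)])
  moreover have "v \<inter> v' \<in> block_events M V n (Suc n)" by (rule Int_stableD[OF block_events_Int_stable *(2,4)])
  ultimately show "a \<inter> b \<in> fresh_events M W V n" unfolding fresh_events_def by blast
qed

text \<open>The probability of an intersection factors first over the three sources of randomness,
  then over past and next block within each Wiener process; regrouping the five factors gives the
  product for the two rectangles.\<close>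

lemma history_fresh_indep: "indep_set (history_events M W V Y n) (fresh_events M W V n)"
proof (rule indep_setI[OF history_events_subset fresh_events_subset])
  fix a b assume "a \<in> history_events M W V Y n" "b \<in> fresh_events M W V n"
  then obtain A w v w' v' where *: "A \<in> process_sigma M {0} Y" "w \<in> block_events M W 0 n" "v \<in> block_events M V 0 n"
    "w' \<in> block_events M W n (Suc n)" "v' \<in> block_events M V n (Suc n)"
    "a = A \<inter> w \<inter> v" "b = w' \<inter> v'" unfolding history_events_def fresh_events_def by auto
  have ps: "w \<in> process_sigma M {0..} W" "v \<in> process_sigma M {0..} V" "w' \<in> process_sigma M {0..} W" "v' \<in> process_sigma M {0..} V"
    using * W.block_events_process_sigma V.block_events_process_sigma by blast+
  have "a \<inter> b = A \<inter> (w \<inter> w') \<inter> (v \<inter> v')" using * by auto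
  then have "prob (a \<inter> b) = prob A * prob (w \<inter> w') * prob (v \<inter> v')"
    using triple_independence[OF *(1) process_sigma_Int[OF ps(1,3)] process_sigma_Int[OF ps(2,4)]] by simp
  also have "prob (w \<inter> w') = prob w * prob w'" by (rule indep_setD[OF W.block_events_indep *(2,4)])
  also have "prob (v \<inter> v') = prob v * prob v'" by (rule indep_setD[OF V.block_events_indep *(3,5)])
  \<comment> \<open>The factor \<open>prob (space M)\<close> is inserted so that the fresh rectangle
    is again a triple, with a trivial initial event.\<close>
  also have "prob A * (prob w * prob w') * (prob v * prob v') = (prob A * prob w * prob v) * (prob (space M) * prob w' * prob v')"
    by (simp add: prob_space)
  also have "\<dots> = prob a * prob (space M \<inter> w' \<inter> v')"
    using triple_independence[OF *(1) ps(1,2)] triple_independence[OF space_in_process_sigma ps(3,4)] * by simp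
  also have "space M \<inter> w' \<inter> v' = b" using * block_events_Pow[of M W n "Suc n"] by auto
  finally show "prob (a \<inter> b) = prob a * prob b" .
qed

lemma history_Pow: "history_events M W V Y n \<subseteq> Pow (space M)"
  using history_events_subset sets.sets_into_space by blast

lemma space_history [simp]: "space (history M W V Y n) = space M"
  by (simp add: history_def space_measure_of_conv)

lemma sets_history: "sets (history M W V Y n) = sigma_sets (space M) (history_events M W V Y n)"
  unfolding history_def by (rule sets_measure_of[OF history_Pow])

lemma history_subalgebra: "subalgebra M (history M W V Y n)"
  unfolding subalgebra_def sets_history using sets.sigma_sets_subset[OF history_events_subset] by simp

lemma history_mono: "subalgebra (history M W V Y (Suc n)) (history M W V Y n)"
proof -
  have "history_events M W V Y n \<subseteq> history_events M W V Y (Suc n)"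
  proof -
    have "block_events M W 0 n \<subseteq> block_events M W 0 (Suc n)" "block_events M V 0 n \<subseteq> block_events M V 0 (Suc n)"
      by (rule block_events_mono; simp)+
    then show ?thesis unfolding history_events_def by blast
  qed
  then show ?thesis unfolding subalgebra_def sets_history by (simp add: sigma_sets_subseteq)
qed

lemma history_contains:
  "process_sigma M {0} Y \<subseteq> sets (history M W V Y n)"
  "block_events M W 0 n \<subseteq> sets (history M W V Y n)" "block_events M V 0 n \<subseteq> sets (history M W V Y n)"
proof -
  have *: "A \<inter> w \<inter> v \<in> sets (history M W V Y n)"
    if "A \<in> process_sigma M {0} Y" "w \<in> block_events M W 0 n" "v \<in> block_events M V 0 n" for A w v
  proof -
    have "A \<inter> w \<inter> v \<in> history_events M W V Y n" unfolding history_events_def using that by blast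
    then show ?thesis unfolding sets_history by (rule sigma_sets.Basic)
  qed
  show "process_sigma M {0} Y \<subseteq> sets (history M W V Y n)"
  proof
    fix A assume A: "A \<in> process_sigma M {0} Y"
    then have "A \<inter> space M \<inter> space M = A" using process_sigma_Y sets.sets_into_space by blast
    then show "A \<in> sets (history M W V Y n)" using *[OF A space_in_block_events space_in_block_events] by simp
  qed
  show "block_events M W 0 n \<subseteq> sets (history M W V Y n)"
  proof
    fix A assume A: "A \<in> block_events M W 0 n"
    then have "space M \<inter> A \<inter> space M = A" using block_events_Pow[of M W 0 n] by auto
    then show "A \<in> sets (history M W V Y n)" using *[OF space_in_process_sigma A space_in_block_events] by simp
  qed
  show "block_events M V 0 n \<subseteq> sets (history M W V Y n)"
  proof
    fix A assume A: "A \<in> block_events M V 0 n"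
    then have "space M \<inter> space M \<inter> A = A" using block_events_Pow[of M V 0 n] by auto
    then show "A \<in> sets (history M W V Y n)" using *[OF space_in_process_sigma space_in_block_events A] by simp
  qed
qed

lemma initial_value_history: "Y 0 \<in> borel_measurable (history M W V Y n)"
proof (rule measurableI)
  fix B :: "real set" assume "B \<in> sets borel"
  then have "Y 0 -` B \<inter> space M \<in> process_sigma M {0} Y"
    unfolding process_sigma_def by (intro sigma_sets.Basic) auto
  then show "Y 0 -` B \<inter> space (history M W V Y n) \<in> sets (history M W V Y n)"
    using history_contains(1)[of n] by auto
qed auto

lemma noise_measurable:
  assumes "space N = space M" "block_events M W k (Suc k) \<subseteq> sets N" "block_events M V k (Suc k) \<subseteq> sets N"
  shows "ou_noise V a b k \<in> borel_measurable N" "obs_noise W V a b f s k \<in> borel_measurable N"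
proof -
  note [measurable] = block_measurable[OF assms(1,2)] block_measurable[OF assms(1,3)]
  show "ou_noise V a b k \<in> borel_measurable N" by measurable
  show "obs_noise W V a b f s k \<in> borel_measurable N" unfolding obs_noise_def[abs_def] by measurable
qed

lemma noise_history:
  "ou_noise V a b k \<in> borel_measurable (history M W V Y (Suc k))"
  "obs_noise W V a b f s k \<in> borel_measurable (history M W V Y (Suc k))"
proof -
  have "block_events M W k (Suc k) \<subseteq> sets (history M W V Y (Suc k))"
    "block_events M V k (Suc k) \<subseteq> sets (history M W V Y (Suc k))"
    using block_events_mono[of 0 k "Suc k" "Suc k"] history_contains[of "Suc k"] by (meson le0 order_refl order_trans)+
  then show "ou_noise V a b k \<in> borel_measurable (history M W V Y (Suc k))"
    "obs_noise W V a b f s k \<in> borel_measurable (history M W V Y (Suc k))"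
    by (auto intro: noise_measurable)
qed

text \<open>Independence passes from the intersection-stable generators to the generated algebras;
  both noises are measurable with respect to the fresh one, and so is any Borel function of the
  pair.\<close>

lemma noise_independent_of_history:
  assumes Z: "Z \<in> borel_measurable (history M W V Y k)" and Q: "Q \<in> borel_measurable (borel \<Otimes>\<^sub>M borel)"
  shows "indep_var borel Z borel (\<lambda>\<omega>. Q (ou_noise V a b k \<omega>, obs_noise W V a b f s k \<omega>) :: real)"
proof -
  have Pow: "fresh_events M W V k \<subseteq> Pow (space M)" using fresh_events_subset sets.sets_into_space by blast
  let ?N = "sigma (space M) (fresh_events M W V k)"
  have setsN: "sets ?N = sigma_sets (space M) (fresh_events M W V k)" by (rule sets_measure_of[OF Pow])
  have spN: "space ?N = space M" by (simp add: space_measure_of_conv)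
  have *: "w \<inter> v \<in> sets ?N" if "w \<in> block_events M W k (Suc k)" "v \<in> block_events M V k (Suc k)" for w v
  proof -
    have "w \<inter> v \<in> fresh_events M W V k" using that by (auto simp: fresh_events_def)
    then show ?thesis unfolding setsN by (rule sigma_sets.Basic)
  qed
  have "block_events M W k (Suc k) \<subseteq> sets ?N"
  proof
    fix A assume A: "A \<in> block_events M W k (Suc k)"
    then have "A \<inter> space M = A" using block_events_Pow[of M W k "Suc k"] by auto
    then show "A \<in> sets ?N" using *[OF A space_in_block_events] by simp
  qed
  moreover have "block_events M V k (Suc k) \<subseteq> sets ?N"
  proof
    fix A assume A: "A \<in> block_events M V k (Suc k)"
    then have "space M \<inter> A = A" using block_events_Pow[of M V k "Suc k"] by auto
    then show "A \<in> sets ?N" using *[OF space_in_block_events A] by simp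
  qed
  ultimately have n: "ou_noise V a b k \<in> borel_measurable ?N" "obs_noise W V a b f s k \<in> borel_measurable ?N"
    by (auto intro!: noise_measurable simp: spN)
  define R where "R = (\<lambda>\<omega>. Q (ou_noise V a b k \<omega>, obs_noise W V a b f s k \<omega>))"
  note [measurable] = n Q
  have R: "R \<in> borel_measurable ?N" unfolding R_def by measurable
  have ind: "indep_set (sets (history M W V Y k)) (sets ?N)"
    unfolding sets_history setsN
    by (rule indep_set_sigma_sets[OF history_fresh_indep history_events_Int_stable fresh_events_Int_stable])
  have RM: "R \<in> borel_measurable M"
    using R indep_setD_ev2[OF ind] spN unfolding measurable_def by auto
  have ZM: "Z \<in> borel_measurable M" using measurable_from_subalg[OF history_subalgebra Z] .
  have sub1: "sigma_sets (space M) {Z -` A \<inter> space M |A. A \<in> sets borel} \<subseteq> sets (history M W V Y k)"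
    using sets.sigma_sets_subset[of "{Z -` A \<inter> space M |A. A \<in> sets borel}" "history M W V Y k"] measurable_sets[OF Z] by auto
  have sub2: "sigma_sets (space M) {R -` A \<inter> space M |A. A \<in> sets borel} \<subseteq> sets ?N"
    using sets.sigma_sets_subset[of "{R -` A \<inter> space M |A. A \<in> sets borel}" ?N] measurable_sets[OF R] spN by auto
  have "indep_set (sigma_sets (space M) {Z -` A \<inter> space M |A. A \<in> sets borel})
      (sigma_sets (space M) {R -` A \<inter> space M |A. A \<in> sets borel})"
    using ind unfolding indep_set_def
    by (rule indep_sets_mono_sets) (use sub1 sub2 in \<open>auto split: bool.split\<close>)
  then show ?thesis using ZM RM unfolding indep_var_eq R_def by blast
qed

text \<open>\<open>linear_equation_noise_limit\<close> along the subsequence of dyadic grids. The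
  path properties hold for all times at once, so a single exceptional set serves all
  \<open>k\<close>.\<close>

lemma ou_level_limit:
  assumes a: "\<theta> $ 1 > 0"
  shows "AE \<omega> in M. \<forall>k. (\<lambda>l. ou_level V (\<theta> $ 1) b k l \<omega>) \<longlonglongrightarrow> Y (real k + 1) \<omega> - exp (- \<theta> $ 1) * Y (real k) \<omega>"
  using Y_continuous state_equation
proof eventually_elim
  case (elim \<omega>)
  show ?case
  proof
    fix k :: nat
    have "(\<lambda>n. b * (\<Sum>i<n. exp (- \<theta> $ 1 * real (n - 1 - i) / real n) *
        (V (real k + real (Suc i) / real n) \<omega> - V (real k + real i / real n) \<omega>)))
      \<longlonglongrightarrow> Y (real k + 1) \<omega> - exp (- \<theta> $ 1) * Y (real k) \<omega>"
      by (rule linear_equation_noise_limit[where y = "\<lambda>t. Y t \<omega>" and v = "\<lambda>t. V t \<omega>"]) (use elim a in blast)+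
    moreover have "filterlim (\<lambda>l::nat. 2 ^ l :: nat) at_top sequentially"
      by (rule filterlim_subseq) (simp add: strict_mono_def)
    ultimately have "(\<lambda>l. b * (\<Sum>i<2 ^ l. exp (- \<theta> $ 1 * real (2 ^ l - 1 - i) / real (2 ^ l)) *
        (V (real k + real (Suc i) / real (2 ^ l)) \<omega> - V (real k + real i / real (2 ^ l)) \<omega>)))
      \<longlonglongrightarrow> Y (real k + 1) \<omega> - exp (- \<theta> $ 1) * Y (real k) \<omega>"
      by (rule filterlim_compose)
    moreover have "real (k * 2 ^ l + i) / 2 ^ l = real k + real i / 2 ^ l" for l i by (simp add: add_divide_distrib)
    moreover have "real (Suc (k * 2 ^ l + i)) / 2 ^ l = real k + real (Suc i) / 2 ^ l" for l i by (simp add: add_divide_distrib)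
    ultimately show "(\<lambda>l. ou_level V (\<theta> $ 1) b k l \<omega>) \<longlonglongrightarrow> Y (real k + 1) \<omega> - exp (- \<theta> $ 1) * Y (real k) \<omega>"
      by (simp only: ou_level_def dyadic_incr_def of_nat_power of_nat_numeral)
  qed
qed

lemma hidden_recursion:
  assumes a: "\<theta> $ 1 > 0"
  shows "AE \<omega> in M. \<forall>k. Y (real k + 1) \<omega> = exp (- \<theta> $ 1) * Y (real k) \<omega> + ou_noise V (\<theta> $ 1) b k \<omega> \<and>
    X (real k + 1) \<omega> - X (real k) \<omega> = \<theta> $ 2 * (1 - exp (- \<theta> $ 1)) / \<theta> $ 1 * Y (real k) \<omega>
      + obs_noise W V (\<theta> $ 1) b (\<theta> $ 2) \<sigma> k \<omega>"
  using ou_level_limit[OF a] state_equation observation_equation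
proof eventually_elim
  case (elim \<omega>)
  show ?case
  proof
    fix k :: nat
    have n: "ou_noise V (\<theta> $ 1) b k \<omega> = Y (real k + 1) \<omega> - exp (- \<theta> $ 1) * Y (real k) \<omega>"
      unfolding ou_noise_def using elim(1) by (auto intro: limI)
    define I where "I t = integral {0..t} (\<lambda>s. Y s \<omega>)" for t
    have y: "Y t \<omega> = Y 0 \<omega> - \<theta> $ 1 * I t + b * V t \<omega>" "X t \<omega> = X 0 \<omega> + \<theta> $ 2 * I t + \<sigma> * W t \<omega>" if "t \<ge> 0" for t
      using elim(2,3) that unfolding I_def by blast+
    have "\<theta> $ 1 * (I (real k + 1) - I (real k)) = Y (real k) \<omega> - Y (real k + 1) \<omega> + b * (V (real k + 1) \<omega> - V (real k) \<omega>)"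
      using y(1)[of "real k + 1"] y(1)[of "real k"] by (simp add: algebra_simps)
    then have i: "I (real k + 1) - I (real k) = (Y (real k) \<omega> - Y (real k + 1) \<omega> + b * (V (real k + 1) \<omega> - V (real k) \<omega>)) / \<theta> $ 1"
      using a by (simp add: field_simps)
    have "X (real k + 1) \<omega> - X (real k) \<omega> = \<theta> $ 2 * (I (real k + 1) - I (real k)) + \<sigma> * (W (real k + 1) \<omega> - W (real k) \<omega>)"
      using y(2)[of "real k + 1"] y(2)[of "real k"] by (simp add: algebra_simps)
    then have "X (real k + 1) \<omega> - X (real k) \<omega> = \<theta> $ 2 * (1 - exp (- \<theta> $ 1)) / \<theta> $ 1 * Y (real k) \<omega>
      + obs_noise W V (\<theta> $ 1) b (\<theta> $ 2) \<sigma> k \<omega>"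
      unfolding i obs_noise_def n using a by (simp add: field_simps)
    with n show "Y (real k + 1) \<omega> = exp (- \<theta> $ 1) * Y (real k) \<omega> + ou_noise V (\<theta> $ 1) b k \<omega> \<and>
    X (real k + 1) \<omega> - X (real k) \<omega> = \<theta> $ 2 * (1 - exp (- \<theta> $ 1)) / \<theta> $ 1 * Y (real k) \<omega>
      + obs_noise W V (\<theta> $ 1) b (\<theta> $ 2) \<sigma> k \<omega>" by simp
  qed
qed

lemma ou_noise_convergent:
  assumes "\<theta> $ 1 > 0"
  shows "AE \<omega> in M. convergent (\<lambda>l. ou_level V (\<theta> $ 1) b k l \<omega>)"
  using ou_level_limit[OF assms] by eventually_elim (auto simp: convergent_def)

text \<open>The combination is the sum of a part driven by \<open>V\<close>, covered by
  \<open>ou_combination_law\<close>, and a part driven by \<open>W\<close>; the two are independent,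
  so their variances add.\<close>

lemma noise_combination_law:
  fixes \<alpha> \<beta> :: real
  assumes a: "\<theta> $ 1 > 0"
  defines "e \<equiv> exp (- \<theta> $ 1)"
  defines "v \<equiv> \<alpha>\<^sup>2 * (b\<^sup>2 * (1 - e\<^sup>2) / (2 * \<theta> $ 1)) + 2 * \<alpha> * \<beta> * (\<theta> $ 2 * b\<^sup>2 * (1 - e)\<^sup>2 / (2 * (\<theta> $ 1)\<^sup>2))
      + \<beta>\<^sup>2 * ((\<theta> $ 2)\<^sup>2 * b\<^sup>2 / (\<theta> $ 1)\<^sup>2 * ((1 - e\<^sup>2) / (2 * \<theta> $ 1) - 2 * (1 - e) / \<theta> $ 1 + 1) + \<sigma>\<^sup>2)"
  shows "distr M borel (\<lambda>\<omega>. \<alpha> * ou_noise V (\<theta> $ 1) b k \<omega> + \<beta> * obs_noise W V (\<theta> $ 1) b (\<theta> $ 2) \<sigma> k \<omega>) = centred_normal v"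
    and "v \<ge> 0"
proof -
  define a where "a = \<theta> $ 1"
  define f where "f = \<theta> $ 2"
  have a: "a > 0" using assms by (simp add: a_def)
  \<comment> \<open>Coefficients of \<open>ou_noise\<close> and of the increment of \<open>V\<close>
    once \<open>obs_noise\<close> is expanded.\<close>
  define \<alpha>' where "\<alpha>' = \<alpha> - \<beta> * f / a"
  define \<beta>' where "\<beta>' = \<beta> * f * b / a"
  define U where "U \<omega> = \<alpha>' * ou_noise V a b k \<omega> + \<beta>' * (V (real k + 1) \<omega> - V (real k) \<omega>)" for \<omega>
  define R where "R \<omega> = (\<beta> * \<sigma>) * (W (real k + 1) \<omega> - W (real k) \<omega>)" for \<omega>
  define vU where "vU = \<alpha>'\<^sup>2 * b\<^sup>2 * (1 - exp (- 2 * a)) / (2 * a) + 2 * \<alpha>' * \<beta>' * b * (1 - exp (- a)) / a + \<beta>'\<^sup>2"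
  have e2: "exp (- 2 * a) = e\<^sup>2" by (simp add: e_def a_def power2_eq_square flip: exp_add)
  have conv: "AE \<omega> in M. convergent (\<lambda>l. ou_level V a b k l \<omega>)"
    using ou_noise_convergent[OF assms(1)] by (simp add: a_def)
  have U: "distr M borel U = centred_normal vU" "vU \<ge> 0"
    using V.ou_combination_law[OF a conv, of \<alpha>' \<beta>'] by (auto simp: U_def[abs_def] vU_def)
  note mV = block_measurable[OF refl V.block_events_subset]
  note mW = block_measurable[OF refl W.block_events_subset]
  have dW: "distr M borel (\<lambda>\<omega>. W (real k + 1) \<omega> - W (real k) \<omega>) = centred_normal 1"
    using W.normal_increments[of "real k" "real k + 1"] by simp
  have Rm: "R \<in> borel_measurable M" unfolding R_def[abs_def] using mW(3)[of k] by measurable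
  have R: "distr M borel R = centred_normal ((\<beta> * \<sigma>)\<^sup>2)"
  proof (rule normalI_char[OF Rm])
    fix t
    have "(\<integral>\<omega>. iexp (t * R \<omega>) \<partial>M) = (\<integral>\<omega>. iexp ((t * (\<beta> * \<sigma>)) * (W (real k + 1) \<omega> - W (real k) \<omega>)) \<partial>M)"
      unfolding R_def by (simp only: mult.assoc)
    also have "\<dots> = exp (- 1 * (t * (\<beta> * \<sigma>))\<^sup>2 / 2)"
      by (rule normal_char[OF mW(3) dW]) simp
    finally show "(\<integral>\<omega>. iexp (t * R \<omega>) \<partial>M) = exp (- ((\<beta> * \<sigma>)\<^sup>2) * t\<^sup>2 / 2)"
      by (simp add: power_mult_distrib mult_ac)
  qed simp
  have ind: "indep_var borel U borel R"
  proof -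
    have V_sub: "block_events M V k (Suc k) \<subseteq> process_sigma M {0..} V" "block_events M W k (Suc k) \<subseteq> process_sigma M {0..} W"
      using V.block_events_process_sigma W.block_events_process_sigma by blast+
    have Um: "U \<in> borel_measurable M" unfolding U_def[abs_def] using mV by measurable
    have iset: "indep_set (block_events M V k (Suc k)) (block_events M W k (Suc k))"
    proof (rule indep_setI[OF V.block_events_subset W.block_events_subset])
      fix v w assume *: "v \<in> block_events M V k (Suc k)" "w \<in> block_events M W k (Suc k)"
      have "v \<subseteq> space M" "w \<subseteq> space M" using * block_events_Pow by blast+
      then have "space M \<inter> w \<inter> v = v \<inter> w" by auto
      moreover have "prob (space M \<inter> w \<inter> v) = prob (space M) * prob w * prob v"
        using triple_independence[OF space_in_process_sigma, of w v] V_sub * by blast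
      ultimately show "prob (v \<inter> w) = prob v * prob w" by (simp add: prob_space)
    qed
    let ?NV = "sigma (space M) (block_events M V k (Suc k))" and ?NW = "sigma (space M) (block_events M W k (Suc k))"
    have sp: "space ?NV = space M" "space ?NW = space M" by (simp_all add: space_measure_of_conv)
    have st: "sets ?NV = sigma_sets (space M) (block_events M V k (Suc k))" "sets ?NW = sigma_sets (space M) (block_events M W k (Suc k))"
      by (rule sets_measure_of[OF block_events_Pow])+
    have sub: "block_events M V k (Suc k) \<subseteq> sets ?NV" "block_events M W k (Suc k) \<subseteq> sets ?NW"
      unfolding st by (auto intro: sigma_sets.Basic)
    note [measurable] = block_measurable[OF sp(1) sub(1)] block_measurable[OF sp(2) sub(2)]
    have "U \<in> borel_measurable ?NV" unfolding U_def[abs_def] by measurable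
    then have sU: "sigma_sets (space M) {U -` A \<inter> space M |A. A \<in> sets borel} \<subseteq> sets ?NV"
      using sets.sigma_sets_subset[of "{U -` A \<inter> space M |A. A \<in> sets borel}" ?NV] measurable_sets[of U ?NV] sp by auto
    have "R \<in> borel_measurable ?NW" unfolding R_def[abs_def] by measurable
    then have sR: "sigma_sets (space M) {R -` A \<inter> space M |A. A \<in> sets borel} \<subseteq> sets ?NW"
      using sets.sigma_sets_subset[of "{R -` A \<inter> space M |A. A \<in> sets borel}" ?NW] measurable_sets[of R ?NW] sp by auto
    have "indep_set (sets ?NV) (sets ?NW)"
      unfolding st by (rule indep_set_sigma_sets[OF iset block_events_Int_stable block_events_Int_stable])
    then have "indep_set (sigma_sets (space M) {U -` A \<inter> space M |A. A \<in> sets borel}) (sigma_sets (space M) {R -` A \<inter> space M |A. A \<in> sets borel})"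
      unfolding indep_set_def by (rule indep_sets_mono_sets) (use sU sR in \<open>auto split: bool.split\<close>)
    then show ?thesis using Um Rm unfolding indep_var_eq by blast
  qed
  have law: "distr M borel (\<lambda>\<omega>. U \<omega> + R \<omega>) = centred_normal (vU + (\<beta> * \<sigma>)\<^sup>2)"
    by (rule normal_add_indep[OF U R _ ind]) simp
  have v: "vU + (\<beta> * \<sigma>)\<^sup>2 = v"
    unfolding vU_def v_def \<alpha>'_def \<beta>'_def e2 e_def[symmetric] a_def[symmetric] f_def[symmetric]
    using a by (simp add: e_def a_def[symmetric] field_simps power2_eq_square)
  have UR: "U \<omega> + R \<omega> = \<alpha> * ou_noise V a b k \<omega> + \<beta> * obs_noise W V a b f \<sigma> k \<omega>" for \<omega>
    unfolding U_def R_def obs_noise_def \<alpha>'_def \<beta>'_def using a by (simp add: field_simps)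
  show "distr M borel (\<lambda>\<omega>. \<alpha> * ou_noise V (\<theta> $ 1) b k \<omega> + \<beta> * obs_noise W V (\<theta> $ 1) b (\<theta> $ 2) \<sigma> k \<omega>) = centred_normal v"
    using law unfolding UR v a_def f_def .
  show "v \<ge> 0" using U(2) unfolding v[symmetric] by simp
qed

end

section \<open>Uniform weak convergence from characteristic functions\<close>

text \<open>The linear span of the characters. It is an algebra by the addition rule of the
  exponential, and convergence of characteristic functions extends to it by induction.\<close>

inductive trigonometric :: "('e::euclidean_space \<Rightarrow> complex) \<Rightarrow> bool" where
  iexp: "trigonometric (\<lambda>x. iexp (u \<bullet> x))"
| add: "trigonometric f \<Longrightarrow> trigonometric g \<Longrightarrow> trigonometric (\<lambda>x. f x + g x)"
| scale: "trigonometric f \<Longrightarrow> trigonometric (\<lambda>x. c * f x)"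

lemma trigonometric_const: "trigonometric (\<lambda>x. c)"
  using trigonometric.scale[OF trigonometric.iexp[of 0], of c] by simp

lemma trigonometric_mult:
  assumes "trigonometric f" "trigonometric g"
  shows "trigonometric (\<lambda>x. f x * g x)"
  using assms(1)
proof induction
  case (iexp u)
  show ?case using assms(2)
  proof induction
    case (iexp v)
    have "trigonometric (\<lambda>x. iexp ((u + v) \<bullet> x))" by (rule trigonometric.iexp)
    then show ?case by (simp add: inner_add_left distrib_left exp_add)
  next
    case (add f g)
    then show ?case using trigonometric.add by (fastforce simp: distrib_left)
  next
    case (scale f c)
    from trigonometric.scale[OF scale.IH, of c] show ?case by (simp add: mult_ac)
  qed
next
  case (add f h)
  then show ?case using trigonometric.add by (fastforce simp: distrib_right)
next
  case (scale f c)
  from trigonometric.scale[OF scale.IH, of c] show ?case by (simp add: mult_ac)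
qed

lemma trigonometric_sum:
  assumes "\<And>i. i \<in> J \<Longrightarrow> trigonometric (f i)"
  shows "trigonometric (\<lambda>x. \<Sum>i\<in>J. f i x)"
  using assms by (induction J rule: infinite_finite_induct) (auto intro: trigonometric_const trigonometric.add)

lemma trigonometric_sin: "trigonometric (\<lambda>x. complex_of_real (sin (u \<bullet> x)))"
proof -
  have "trigonometric (\<lambda>x. (1 / (2 * \<i>)) * iexp (u \<bullet> x) + (- 1 / (2 * \<i>)) * iexp ((- u) \<bullet> x))"
    by (intro trigonometric.add trigonometric.scale trigonometric.iexp)
  moreover have "(1 / (2 * \<i>)) * iexp (u \<bullet> x) + (- 1 / (2 * \<i>)) * iexp ((- u) \<bullet> x) = complex_of_real (sin (u \<bullet> x))" for x
    by (simp add: sin_exp_eq sin_of_real[symmetric] field_simps)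
  ultimately show ?thesis by simp
qed

lemma trigonometric_continuous: "trigonometric f \<Longrightarrow> continuous_on UNIV f"
  by (induction rule: trigonometric.induct) (auto intro!: continuous_intros)

lemma trigonometric_bounded: "trigonometric f \<Longrightarrow> \<exists>B. \<forall>x. cmod (f x) \<le> B"
proof (induction rule: trigonometric.induct)
  case (iexp u)
  show ?case by (intro exI[of _ 1]) simp
next
  case (add f g)
  then obtain B C where "\<forall>x. cmod (f x) \<le> B" "\<forall>x. cmod (g x) \<le> C" by blast
  then show ?case by (intro exI[of _ "B + C"]) (meson add_mono norm_triangle_ineq order_trans)
next
  case (scale f c)
  then obtain B where "\<forall>x. cmod (f x) \<le> B" by blast
  then show ?case by (intro exI[of _ "cmod c * B"]) (simp add: norm_mult mult_left_mono)
qed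

lemma trigonometric_integrable:
  assumes "prob_space M" "trigonometric f" "Z \<in> borel_measurable M"
  shows "integrable M (\<lambda>\<omega>. f (Z \<omega>))"
proof -
  interpret prob_space M by fact
  obtain B where "\<forall>x. cmod (f x) \<le> B" using trigonometric_bounded[OF assms(2)] by blast
  moreover have "(\<lambda>\<omega>. f (Z \<omega>)) \<in> borel_measurable M"
    using measurable_compose[OF assms(3) borel_measurable_continuous_onI[OF trigonometric_continuous[OF assms(2)]]] .
  ultimately show ?thesis by (intro integrable_const_bound[of _ B]) auto
qed

lemma polynomial_of_sines_trigonometric:
  assumes "real_polynomial_function p"
  shows "trigonometric (\<lambda>x::'e::euclidean_space. complex_of_real (p (\<Sum>b\<in>Basis. sin (c * (x \<bullet> b)) *\<^sub>R (b :: 'e))))"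
  using assms
proof induction
  case (linear f)
  then interpret bounded_linear f .
  have "trigonometric (\<lambda>x::'e. \<Sum>b\<in>Basis. complex_of_real (f b) * complex_of_real (sin ((c *\<^sub>R b) \<bullet> x)))"
    by (intro trigonometric_sum trigonometric.scale trigonometric_sin)
  moreover have "complex_of_real (f (\<Sum>b\<in>Basis. sin (c * (x \<bullet> b)) *\<^sub>R b)) =
      (\<Sum>b\<in>Basis. complex_of_real (f b) * complex_of_real (sin ((c *\<^sub>R b) \<bullet> x)))" for x
    by (simp add: sum scale inner_commute mult_ac)
  ultimately show ?case by simp
next
  case (const c)
  show ?case by (rule trigonometric_const)
next
  case (add f g)
  from trigonometric.add[OF add.IH] show ?case by simp
next
  case (mult f g)
  from trigonometric_mult[OF mult.IH] show ?case by simp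
qed

text \<open>Inside a large box a bounded continuous function agrees with a continuous function of the sines
  of the coordinates; the latter is, on the whole space, uniformly close to a trigonometric polynomial.\<close>

lemma trigonometric_approximation:
  fixes g :: "'e::euclidean_space \<Rightarrow> real"
  assumes g: "continuous_on UNIV g" and B: "\<And>x. \<bar>g x\<bar> \<le> B" and e: "e > 0" and L: "L > 0"
  obtains h where "trigonometric (\<lambda>x. complex_of_real (h x))" "\<And>x. \<bar>g x - h x\<bar> \<le> e + 2 * B * (norm x)\<^sup>2 / L\<^sup>2"
proof -
  \<comment> \<open>Scales the interval from \<open>- L\<close> to \<open>L\<close> onto the range
    where \<open>arcsin\<close> inverts the sine.\<close>
  define c where "c = pi / (2 * L)"
  have c: "c > 0" using L by (simp add: c_def)
  define s where "s x = (\<Sum>b\<in>Basis. sin (c * (x \<bullet> b)) *\<^sub>R b)" for x :: 'e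
  \<comment> \<open>Inverts \<open>s\<close> on the ball of radius \<open>L\<close>; being
    continuous on the whole cube, it lets Stone-Weierstrass be applied to \<open>g\<close> composed
    with \<open>t\<close>.\<close>
  define t where "t y = (\<Sum>b\<in>Basis. (arcsin (y \<bullet> b) / c) *\<^sub>R b)" for y :: 'e
  define S :: "'e set" where "S = cbox (- One) One"
  have S: "y \<in> S \<longleftrightarrow> (\<forall>b\<in>Basis. \<bar>y \<bullet> b\<bar> \<le> 1)" for y
    by (auto simp: S_def mem_box abs_le_iff)
  have sS: "s x \<in> S" for x by (auto simp: S s_def inner_sum_left inner_Basis if_distrib sum.If_cases cong: if_cong)
  have "continuous_on S t" unfolding t_def
    by (intro continuous_intros) (use c in \<open>auto simp: S abs_le_iff\<close>)
  then have "continuous_on S (\<lambda>y. g (t y))"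
    by (rule continuous_on_compose2[OF g]) auto
  then obtain p where p: "real_polynomial_function p" "\<And>y. y \<in> S \<Longrightarrow> \<bar>g (t y) - p y\<bar> < e"
    using Stone_Weierstrass_real_polynomial_function[of S "\<lambda>y. g (t y)" e] e compact_cbox unfolding S_def by blast
  show ?thesis
  proof (rule that[of "\<lambda>x. p (s x)"])
    show "trigonometric (\<lambda>x. complex_of_real (p (s x)))"
      unfolding s_def by (rule polynomial_of_sines_trigonometric[OF p(1)])
    fix x
    have B0: "B \<ge> 0" using B[of x] by linarith
    show "\<bar>g x - p (s x)\<bar> \<le> e + 2 * B * (norm x)\<^sup>2 / L\<^sup>2"
    proof (cases "norm x \<le> L")
      case True
      have "arcsin (s x \<bullet> b) / c = x \<bullet> b" if b: "b \<in> Basis" for b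
      proof -
        have "\<bar>x \<bullet> b\<bar> \<le> L" using Basis_le_norm[OF b, of x] True by linarith
        then have "\<bar>c * (x \<bullet> b)\<bar> \<le> c * L" using c by (simp add: abs_mult)
        also have "c * L = pi / 2" using L by (simp add: c_def)
        finally have "arcsin (sin (c * (x \<bullet> b))) = c * (x \<bullet> b)" by (intro arcsin_sin) auto
        moreover have "s x \<bullet> b = sin (c * (x \<bullet> b))"
          using b by (simp add: s_def inner_sum_left inner_Basis if_distrib cong: if_cong)
        ultimately show ?thesis using c by simp
      qed
      then have "t (s x) = x" unfolding t_def using euclidean_representation[of x] by simp
      then have "\<bar>g x - p (s x)\<bar> < e" using p(2)[OF sS, of x] by simp
      moreover have "0 \<le> 2 * B * (norm x)\<^sup>2 / L\<^sup>2" using B0 by simp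
      ultimately show ?thesis by linarith
    next
      case False
      \<comment> \<open>Outside the ball the error is at most \<open>2 * B + e\<close>, and the
        quadratic term exceeds \<open>2 * B\<close>.\<close>
      have "1 \<le> (norm x)\<^sup>2 / L\<^sup>2" using False L by (simp add: power_mono)
      then have "2 * B * 1 \<le> 2 * B * ((norm x)\<^sup>2 / L\<^sup>2)" using B0 by (intro mult_left_mono) auto
      moreover have "\<bar>g (t (s x)) - p (s x)\<bar> < e" by (rule p(2)[OF sS])
      ultimately show ?thesis using B[of x] B[of "t (s x)"] by simp
    qed
  qed
qed

text \<open>The approximation error grows only quadratically, so a common bound on second moments
  makes its mean small under all the laws simultaneously, the limits included. With the
  approximating polynomial thus fixed, uniform convergence of finitely many characteristic functions
  finishes the estimate.\<close>

theorem uniform_weak_convergence_of_char: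
  fixes Z :: "nat \<Rightarrow> 'i \<Rightarrow> 'w \<Rightarrow> 'e::euclidean_space"
  assumes P: "\<And>i. i \<in> A \<Longrightarrow> prob_space (P i)" and L: "\<And>i. i \<in> A \<Longrightarrow> prob_space (L i)" "\<And>i. i \<in> A \<Longrightarrow> sets (L i) = sets borel"
    and Z: "\<And>T i. i \<in> A \<Longrightarrow> Z T i \<in> borel_measurable (P i)"
    and tight: "\<And>T i. i \<in> A \<Longrightarrow> integrable (P i) (\<lambda>\<omega>. (norm (Z T i \<omega>))\<^sup>2)"
      "\<And>T i. i \<in> A \<Longrightarrow> (\<integral>\<omega>. (norm (Z T i \<omega>))\<^sup>2 \<partial>P i) \<le> C"
    and tight_limit: "\<And>i. i \<in> A \<Longrightarrow> integrable (L i) (\<lambda>x. (norm x)\<^sup>2)" "\<And>i. i \<in> A \<Longrightarrow> (\<integral>x. (norm x)\<^sup>2 \<partial>L i) \<le> C"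
    and char: "\<And>u. uniform_limit A (\<lambda>T i. \<integral>\<omega>. iexp (u \<bullet> Z T i \<omega>) \<partial>P i) (\<lambda>i. \<integral>x. iexp (u \<bullet> x) \<partial>L i) sequentially"
  shows "uniform_weak_convergence A P Z L"
  unfolding uniform_weak_convergence_def
proof (intro allI impI, elim conjE)
  fix g :: "'e \<Rightarrow> real"
  assume g: "continuous_on UNIV g" "bounded (range g)"
  have idm: "(\<lambda>x. x) \<in> borel_measurable (L i)" if "i \<in> A" for i
    using measurable_ident_sets[OF L(2)[OF that]] by simp
  have trig: "uniform_limit A (\<lambda>T i. \<integral>\<omega>. f (Z T i \<omega>) \<partial>P i) (\<lambda>i. \<integral>x. f x \<partial>L i) sequentially"
    if "trigonometric f" for f
    using that
  proof induction
    case (iexp u)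
    show ?case by (rule char)
  next
    case (add f h)
    have "uniform_limit A (\<lambda>T i. (\<integral>\<omega>. f (Z T i \<omega>) \<partial>P i) + (\<integral>\<omega>. h (Z T i \<omega>) \<partial>P i))
        (\<lambda>i. (\<integral>x. f x \<partial>L i) + (\<integral>x. h x \<partial>L i)) sequentially"
      by (rule uniform_limit_add[OF add.IH])
    moreover have "(\<integral>\<omega>. f (Z T i \<omega>) + h (Z T i \<omega>) \<partial>P i) = (\<integral>\<omega>. f (Z T i \<omega>) \<partial>P i) + (\<integral>\<omega>. h (Z T i \<omega>) \<partial>P i)"
      "(\<integral>x. f x + h x \<partial>L i) = (\<integral>x. f x \<partial>L i) + (\<integral>x. h x \<partial>L i)" if i: "i \<in> A" for i T
      using trigonometric_integrable[OF P[OF i] _ Z[OF i]] trigonometric_integrable[OF L(1)[OF i] _ idm[OF i]] add.hyps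
      by (auto intro!: Bochner_Integration.integral_add)
    ultimately show ?case by (simp cong: uniform_limit_cong')
  next
    case (scale f c)
    have "uniform_limit A (\<lambda>T i. c * (\<integral>\<omega>. f (Z T i \<omega>) \<partial>P i)) (\<lambda>i. c * (\<integral>x. f x \<partial>L i)) sequentially"
      by (rule bounded_linear.uniform_limit[OF bounded_linear_mult_right scale.IH])
    then show ?case by simp
  qed
  obtain B where B: "\<And>x. \<bar>g x\<bar> \<le> B" using g(2) by (auto simp: bounded_iff)
  have B0: "B \<ge> 0" using B[of 0] by linarith
  have gint: "integrable (P i) (\<lambda>\<omega>. g (Z T i \<omega>))" "integrable (L i) g" if i: "i \<in> A" for i T
  proof -
    interpret Pi: prob_space "P i" by (rule P[OF i])
    interpret Li: prob_space "L i" by (rule L(1)[OF i])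
    note gm = borel_measurable_continuous_onI[OF g(1)]
    show "integrable (P i) (\<lambda>\<omega>. g (Z T i \<omega>))"
      using measurable_compose[OF Z[OF i] gm] B by (intro Pi.integrable_const_bound[of _ B]) auto
    show "integrable (L i) g"
      using measurable_compose[OF idm[OF i] gm] B by (intro Li.integrable_const_bound[of _ B]) auto
  qed
  show "uniform_limit A (\<lambda>T i. \<integral>\<omega>. g (Z T i \<omega>) \<partial>P i) (\<lambda>i. \<integral>x. g x \<partial>L i) sequentially"
  proof (rule uniform_limitI)
    fix e :: real assume e: "e > 0"
    define D where "D = max C 0"
    \<comment> \<open>Chosen so that \<open>2 * B * D / R\<^sup>2\<close> is at most
      \<open>e / 8\<close>; the summand 1 keeps \<open>R\<close> positive when
      \<open>B = 0\<close>.\<close>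
    define R where "R = sqrt (16 * B * (D + 1) / e + 1)"
    have R: "R > 0" "R\<^sup>2 = 16 * B * (D + 1) / e + 1"
      using B0 e by (auto simp: R_def D_def intro!: add_nonneg_pos divide_nonneg_pos mult_nonneg_nonneg)
    obtain h where h: "trigonometric (\<lambda>x. complex_of_real (h x))" "\<And>x. \<bar>g x - h x\<bar> \<le> e / 8 + 2 * B * (norm x)\<^sup>2 / R\<^sup>2"
      using trigonometric_approximation[OF g(1) B, of "e / 8" R] e R(1) by auto
    have small: "2 * B * D / R\<^sup>2 \<le> e / 8"
    proof -
      have "16 * B * D / e \<le> 16 * B * (D + 1) / e + 1"
        using B0 e by (simp add: add_increasing2 divide_right_mono mult_left_mono add_nonneg_nonneg)
      then have "16 * B * D / e \<le> R\<^sup>2" using R(2) by simp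
      then show ?thesis using e R(1) by (simp add: field_simps)
    qed
    have hint: "integrable (P i) (\<lambda>\<omega>. h (Z T i \<omega>))" "integrable (L i) h" if i: "i \<in> A" for i T
      using trigonometric_integrable[OF P[OF i] h(1) Z[OF i]] trigonometric_integrable[OF L(1)[OF i] h(1) idm[OF i]]
      by (simp_all add: complex_of_real_integrable_eq)
    have close: "\<bar>(\<integral>\<omega>. g (X \<omega>) \<partial>M) - (\<integral>\<omega>. h (X \<omega>) \<partial>M)\<bar> \<le> e / 4"
      if M: "prob_space M" and "integrable M (\<lambda>\<omega>. g (X \<omega>))" "integrable M (\<lambda>\<omega>. h (X \<omega>))"
        "integrable M (\<lambda>\<omega>. (norm (X \<omega>))\<^sup>2)" "(\<integral>\<omega>. (norm (X \<omega>))\<^sup>2 \<partial>M) \<le> C" for M :: "'y measure" and X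
    proof -
      interpret prob_space M by (rule M)
      have "\<bar>(\<integral>\<omega>. g (X \<omega>) \<partial>M) - (\<integral>\<omega>. h (X \<omega>) \<partial>M)\<bar> = \<bar>\<integral>\<omega>. g (X \<omega>) - h (X \<omega>) \<partial>M\<bar>"
        using that by simp
      also have "\<dots> \<le> (\<integral>\<omega>. \<bar>g (X \<omega>) - h (X \<omega>)\<bar> \<partial>M)"
        using integral_norm_bound[of M "\<lambda>\<omega>. g (X \<omega>) - h (X \<omega>)"] by simp
      also have "\<dots> \<le> (\<integral>\<omega>. e / 8 + 2 * B * (norm (X \<omega>))\<^sup>2 / R\<^sup>2 \<partial>M)"
        by (intro integral_mono h(2)) (use that in auto)
      also have "\<dots> = e / 8 + 2 * B * (\<integral>\<omega>. (norm (X \<omega>))\<^sup>2 \<partial>M) / R\<^sup>2"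
        using that by (simp add: prob_space)
      also have "\<dots> \<le> e / 8 + 2 * B * D / R\<^sup>2"
        using that B0 by (intro add_left_mono divide_right_mono mult_left_mono) (auto simp: D_def)
      also have "\<dots> \<le> e / 4" using small by simp
      finally show ?thesis .
    qed
    have "\<forall>\<^sub>F T in sequentially. \<forall>i\<in>A. dist (\<integral>\<omega>. complex_of_real (h (Z T i \<omega>)) \<partial>P i) (\<integral>x. complex_of_real (h x) \<partial>L i) < e / 4"
      using uniform_limitD[OF trig[OF h(1)], of "e / 4"] e by simp
    then show "\<forall>\<^sub>F T in sequentially. \<forall>i\<in>A. dist (\<integral>\<omega>. g (Z T i \<omega>) \<partial>P i) (\<integral>x. g x \<partial>L i) < e"
    proof eventually_elim
      case (elim T)
      show ?case
      proof
        fix i assume i: "i \<in> A"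
        have "\<bar>(\<integral>\<omega>. h (Z T i \<omega>) \<partial>P i) - (\<integral>x. h x \<partial>L i)\<bar> < e / 4"
          using elim i by (simp add: dist_norm del: of_real_diff flip: of_real_diff)
        moreover have "\<bar>(\<integral>\<omega>. g (Z T i \<omega>) \<partial>P i) - (\<integral>\<omega>. h (Z T i \<omega>) \<partial>P i)\<bar> \<le> e / 4"
          by (rule close[OF P[OF i] gint(1)[OF i] hint(1)[OF i] tight[OF i]])
        moreover have "\<bar>(\<integral>x. g x \<partial>L i) - (\<integral>x. h x \<partial>L i)\<bar> \<le> e / 4"
          by (rule close[OF L(1)[OF i] gint(2)[OF i] hint(2)[OF i] tight_limit[OF i]])
        ultimately show "dist (\<integral>\<omega>. g (Z T i \<omega>) \<partial>P i) (\<integral>x. g x \<partial>L i) < e"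
          using e unfolding dist_real_def by linarith
      qed
    qed
  qed
qed

text \<open>Truncating \<open>f\<close> at the level \<open>n\<close> changes it by at most
  \<open>(f x)\<^sup>2 / n\<close>, hence the means by at most \<open>C / n\<close> for all laws.
  The limit laws inherit the bound \<open>C\<close> from bounded truncations of the square, by
  monotone convergence.\<close>

theorem uniform_weak_convergence_unbounded:
  fixes Z :: "nat \<Rightarrow> 'i \<Rightarrow> 'w \<Rightarrow> 'e::topological_space" and f :: "'e \<Rightarrow> real"
  assumes P: "\<And>i. i \<in> A \<Longrightarrow> prob_space (P i)" and L: "\<And>i. i \<in> A \<Longrightarrow> prob_space (L i)" "\<And>i. i \<in> A \<Longrightarrow> sets (L i) = sets borel"
    and Z: "\<And>T i. i \<in> A \<Longrightarrow> Z T i \<in> borel_measurable (P i)"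
    and conv: "uniform_weak_convergence A P Z L" and f: "continuous_on UNIV f"
    and bd: "\<And>T i. i \<in> A \<Longrightarrow> integrable (P i) (\<lambda>\<omega>. (f (Z T i \<omega>))\<^sup>2)" "\<And>T i. i \<in> A \<Longrightarrow> (\<integral>\<omega>. (f (Z T i \<omega>))\<^sup>2 \<partial>P i) \<le> C"
  shows "uniform_limit A (\<lambda>T i. \<integral>\<omega>. f (Z T i \<omega>) \<partial>P i) (\<lambda>i. \<integral>x. f x \<partial>L i) sequentially"
    and "\<And>i. i \<in> A \<Longrightarrow> integrable (L i) f" "\<And>i. i \<in> A \<Longrightarrow> integrable (L i) (\<lambda>x. (f x)\<^sup>2)"
    and "\<And>i. i \<in> A \<Longrightarrow> (\<integral>x. (f x)\<^sup>2 \<partial>L i) \<le> C"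
proof -
  have fm: "f \<in> borel_measurable borel" by (rule borel_measurable_continuous_onI[OF f])
  have fL [measurable]: "f \<in> borel_measurable (L i)" if "i \<in> A" for i
    using fm measurable_cong_sets[OF L(2)[OF that] refl, of borel] by blast
  have fP: "(\<lambda>\<omega>. f (Z T i \<omega>)) \<in> borel_measurable (P i)" if "i \<in> A" for T i
    by (rule measurable_compose[OF Z[OF that] fm])
  have D: "f x - max (- n) (min n (f x)) \<le> (f x)\<^sup>2 / n" "max (- n) (min n (f x)) - f x \<le> (f x)\<^sup>2 / n" if "n > 0" for n x
  proof -
    have "\<bar>f x - max (- n) (min n (f x))\<bar> \<le> (f x)\<^sup>2 / n"
    proof (cases "\<bar>f x\<bar> \<le> n")
      case True
      then have "max (- n) (min n (f x)) = f x" by (auto simp: max_def min_def)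
      then show ?thesis using that by simp
    next
      case False
      then have "\<bar>f x - max (- n) (min n (f x))\<bar> \<le> \<bar>f x\<bar>" using that by (auto simp: max_def min_def)
      also have "\<dots> = \<bar>f x\<bar> * n / n" using that by simp
      also have "\<dots> \<le> \<bar>f x\<bar> * \<bar>f x\<bar> / n" using that False by (intro divide_right_mono mult_left_mono) auto
      finally show ?thesis by (simp add: power2_eq_square)
    qed
    then show "f x - max (- n) (min n (f x)) \<le> (f x)\<^sup>2 / n" "max (- n) (min n (f x)) - f x \<le> (f x)\<^sup>2 / n" by linarith+
  qed
  have second: "integrable (L i) (\<lambda>x. (f x)\<^sup>2)" "(\<integral>x. (f x)\<^sup>2 \<partial>L i) \<le> C" if i: "i \<in> A" for i
  proof -
    interpret Pi: prob_space "P i" by (rule P[OF i])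
    interpret Li: prob_space "L i" by (rule L(1)[OF i])
    note [measurable] = fL[OF i]
    have C0: "C \<ge> 0" by (rule order_trans[OF _ bd(2)[OF i, of 0]]) simp
    define h where "h n x = min ((f x)\<^sup>2) (real n)" for n x
    have hb: "\<bar>h n x\<bar> \<le> real n" for n x by (auto simp: h_def min_def)
    have hc: "continuous_on UNIV (h n)" for n unfolding h_def by (intro continuous_intros f)
    have hi: "integrable (L i) (h n)" for n
      using hb by (intro Li.integrable_const_bound[of _ "real n"]) (auto simp: h_def[abs_def])
    have "(\<lambda>T. \<integral>\<omega>. h n (Z T i \<omega>) \<partial>P i) \<longlonglongrightarrow> (\<integral>x. h n x \<partial>L i)" for n
    proof (rule tendsto_uniform_limitI[OF _ i])
      show "uniform_limit A (\<lambda>T i. \<integral>\<omega>. h n (Z T i \<omega>) \<partial>P i) (\<lambda>i. \<integral>x. h n x \<partial>L i) sequentially"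
      proof -
        have "bounded (range (h n))" using hb[of n] by (auto simp: bounded_iff)
        then show ?thesis using conv hc[of n] unfolding uniform_weak_convergence_def by blast
      qed
    qed
    moreover have "(\<integral>\<omega>. h n (Z T i \<omega>) \<partial>P i) \<le> C" for n T
    proof -
      have "(\<lambda>\<omega>. h n (Z T i \<omega>)) \<in> borel_measurable (P i)"
        unfolding h_def using fP[OF i] by measurable
      then have "integrable (P i) (\<lambda>\<omega>. h n (Z T i \<omega>))"
        using hb by (intro Pi.integrable_const_bound[of _ "real n"]) auto
      then have "(\<integral>\<omega>. h n (Z T i \<omega>) \<partial>P i) \<le> (\<integral>\<omega>. (f (Z T i \<omega>))\<^sup>2 \<partial>P i)"
        using bd(1)[OF i] by (intro integral_mono) (auto simp: h_def)
      then show ?thesis using bd(2)[OF i, of T] by linarith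
    qed
    ultimately have hC: "(\<integral>x. h n x \<partial>L i) \<le> C" for n
      by (meson LIMSEQ_le_const2)
    have "(\<integral>\<^sup>+x. ennreal ((f x)\<^sup>2) \<partial>L i) = (\<integral>\<^sup>+x. (SUP n. ennreal (h n x)) \<partial>L i)"
    proof (rule nn_integral_cong)
      fix x
      obtain N :: nat where "(f x)\<^sup>2 \<le> real N" using real_arch_simple by blast
      then have N: "h N x = (f x)\<^sup>2" by (simp add: h_def)
      show "ennreal ((f x)\<^sup>2) = (SUP n. ennreal (h n x))"
      proof (rule antisym)
        show "ennreal ((f x)\<^sup>2) \<le> (SUP n. ennreal (h n x))"
          by (rule SUP_upper2[of N]) (simp_all add: N)
        show "(SUP n. ennreal (h n x)) \<le> ennreal ((f x)\<^sup>2)"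
          by (rule SUP_least, rule ennreal_leI) (simp add: h_def)
      qed
    qed
    also have "\<dots> = (SUP n. \<integral>\<^sup>+x. ennreal (h n x) \<partial>L i)"
      by (rule nn_integral_monotone_convergence_SUP)
        (auto simp: h_def incseq_def le_fun_def intro!: ennreal_leI)
    also have "\<dots> \<le> ennreal C"
    proof (rule SUP_least)
      fix n
      have "(\<integral>\<^sup>+x. ennreal (h n x) \<partial>L i) = ennreal (\<integral>x. h n x \<partial>L i)"
        by (rule nn_integral_eq_integral[OF hi]) (auto simp: h_def)
      then show "(\<integral>\<^sup>+x. ennreal (h n x) \<partial>L i) \<le> ennreal C" using hC[of n] by (simp add: ennreal_leI)
    qed
    finally have nn: "(\<integral>\<^sup>+x. ennreal ((f x)\<^sup>2) \<partial>L i) \<le> ennreal C" .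
    then show int: "integrable (L i) (\<lambda>x. (f x)\<^sup>2)"
      by (intro integrableI_bounded) (auto intro: le_less_trans)
    have "ennreal (\<integral>x. (f x)\<^sup>2 \<partial>L i) = (\<integral>\<^sup>+x. ennreal ((f x)\<^sup>2) \<partial>L i)"
      by (rule nn_integral_eq_integral[OF int, symmetric]) auto
    then have "ennreal (\<integral>x. (f x)\<^sup>2 \<partial>L i) \<le> ennreal C" using nn by simp
    then show "(\<integral>x. (f x)\<^sup>2 \<partial>L i) \<le> C" using ennreal_le_iff[OF C0] by blast
  qed
  then show "\<And>i. i \<in> A \<Longrightarrow> integrable (L i) (\<lambda>x. (f x)\<^sup>2)" "\<And>i. i \<in> A \<Longrightarrow> (\<integral>x. (f x)\<^sup>2 \<partial>L i) \<le> C" by auto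
  have sqi: "integrable M X" if "prob_space M" "X \<in> borel_measurable M" "integrable M (\<lambda>\<omega>. (X \<omega>)\<^sup>2)" for M :: "'y measure" and X :: "'y \<Rightarrow> real"
  proof -
    interpret prob_space M by fact
    show ?thesis by (rule square_integrable_imp_integrable) (use that in auto)
  qed
  show fi: "\<And>i. i \<in> A \<Longrightarrow> integrable (L i) f" by (rule sqi[OF L(1) fL second(1)])
  have fPi: "integrable (P i) (\<lambda>\<omega>. f (Z T i \<omega>))" if "i \<in> A" for i T by (rule sqi[OF P fP bd(1)]) (use that in auto)
  show "uniform_limit A (\<lambda>T i. \<integral>\<omega>. f (Z T i \<omega>) \<partial>P i) (\<lambda>i. \<integral>x. f x \<partial>L i) sequentially"
  proof (rule uniform_limitI)
    fix e :: real assume e: "e > 0"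
    \<comment> \<open>Positive and strictly above \<open>C\<close>, so that truncation at
      \<open>n = 3 * k / e\<close> costs strictly less than \<open>e / 3\<close>.\<close>
    define k where "k = max C 0 + 1"
    have k: "k > 0" "C < k" by (auto simp: k_def)
    define n where "n = 3 * k / e"
    have n: "n > 0" using e k by (simp add: n_def)
    have Cn: "C / n < e / 3"
    proof -
      have "C / n < k / n" using k(2) n by (rule divide_strict_right_mono)
      also have "\<dots> = e / 3" using e k by (simp add: n_def)
      finally show ?thesis .
    qed
    define h where "h x = max (- n) (min n (f x))" for x
    have hb: "\<bar>h x\<bar> \<le> n" for x using n by (auto simp: h_def)
    have hc: "continuous_on UNIV h" unfolding h_def by (intro continuous_intros f)
    have close: "\<bar>(\<integral>\<omega>. f (X \<omega>) \<partial>M) - (\<integral>\<omega>. h (X \<omega>) \<partial>M)\<bar> < e / 3"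
      if M: "prob_space M" and m: "(\<lambda>\<omega>. f (X \<omega>)) \<in> borel_measurable M" and i: "integrable M (\<lambda>\<omega>. f (X \<omega>))"
        "integrable M (\<lambda>\<omega>. (f (X \<omega>))\<^sup>2)" "(\<integral>\<omega>. (f (X \<omega>))\<^sup>2 \<partial>M) \<le> C" for M :: "'y measure" and X
    proof -
      interpret prob_space M by (rule M)
      have hi: "integrable M (\<lambda>\<omega>. h (X \<omega>))"
        using hb m by (intro integrable_const_bound[of _ n]) (auto simp: h_def)
      have "\<bar>(\<integral>\<omega>. f (X \<omega>) \<partial>M) - (\<integral>\<omega>. h (X \<omega>) \<partial>M)\<bar> = \<bar>\<integral>\<omega>. f (X \<omega>) - h (X \<omega>) \<partial>M\<bar>"
        using i hi by simp
      also have "\<dots> \<le> (\<integral>\<omega>. \<bar>f (X \<omega>) - h (X \<omega>)\<bar> \<partial>M)"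
        using integral_norm_bound[of M "\<lambda>\<omega>. f (X \<omega>) - h (X \<omega>)"] by simp
      also have "\<dots> \<le> (\<integral>\<omega>. (f (X \<omega>))\<^sup>2 / n \<partial>M)"
        using D[OF n] by (intro integral_mono) (use i hi in \<open>auto simp: h_def abs_le_iff\<close>)
      also have "\<dots> \<le> C / n" using i(3) n by (simp add: divide_right_mono)
      finally show ?thesis using Cn by linarith
    qed
    have "\<forall>\<^sub>F T in sequentially. \<forall>i\<in>A. dist (\<integral>\<omega>. h (Z T i \<omega>) \<partial>P i) (\<integral>x. h x \<partial>L i) < e / 3"
    proof (rule uniform_limitD)
      show "uniform_limit A (\<lambda>T i. \<integral>\<omega>. h (Z T i \<omega>) \<partial>P i) (\<lambda>i. \<integral>x. h x \<partial>L i) sequentially"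
        using conv hc hb unfolding uniform_weak_convergence_def by (auto simp: bounded_iff)
    qed (use e in simp)
    then show "\<forall>\<^sub>F T in sequentially. \<forall>i\<in>A. dist (\<integral>\<omega>. f (Z T i \<omega>) \<partial>P i) (\<integral>x. f x \<partial>L i) < e"
    proof eventually_elim
      case (elim T)
      show ?case
      proof
        fix i assume i: "i \<in> A"
        have "\<bar>(\<integral>\<omega>. f (Z T i \<omega>) \<partial>P i) - (\<integral>\<omega>. h (Z T i \<omega>) \<partial>P i)\<bar> < e / 3"
          by (rule close[OF P[OF i] fP[OF i] fPi[OF i] bd[OF i]])
        moreover have "\<bar>(\<integral>x. f x \<partial>L i) - (\<integral>x. h x \<partial>L i)\<bar> < e / 3"
          by (rule close[OF L(1)[OF i] fL[OF i] fi[OF i] second[OF i]])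
        moreover have "dist (\<integral>\<omega>. h (Z T i \<omega>) \<partial>P i) (\<integral>x. h x \<partial>L i) < e / 3" using elim i by blast
        ultimately show "dist (\<integral>\<omega>. f (Z T i \<omega>) \<partial>P i) (\<integral>x. f x \<partial>L i) < e"
          unfolding dist_real_def by linarith
      qed
    qed
  qed
qed

section \<open>Possibly degenerate Gaussian vectors\<close>

lemma borel_measurable_vec_iff:
  fixes f :: "'a \<Rightarrow> real^'n"
  shows "f \<in> borel_measurable M \<longleftrightarrow> (\<forall>i. (\<lambda>x. f x $ i) \<in> borel_measurable M)"
  by (subst borel_measurable_euclidean_space) (simp add: Basis_vec_def inner_axis)

lemma borel_measurable_vector2:
  fixes f g :: "'a \<Rightarrow> real"
  assumes "f \<in> borel_measurable M" "g \<in> borel_measurable M"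
  shows "(\<lambda>x. vector [f x, g x] :: real^2) \<in> borel_measurable M"
  using assms by (simp add: borel_measurable_vec_iff forall_2)

text \<open>All facts descend from the one-dimensional laws of linear functionals; mixed second
  moments follow by polarization and the symmetry of \<open>S\<close>.\<close>

lemma centred_gaussian_facts:
  assumes "centred_gaussian \<mu> S"
  shows "prob_space \<mu>" "sets \<mu> = sets borel"
    and "(\<integral>x. iexp (u \<bullet> x) \<partial>\<mu>) = exp (- (u \<bullet> (S *v u)) / 2)"
    and "integrable \<mu> (\<lambda>x. u \<bullet> x)" "(\<integral>x. u \<bullet> x \<partial>\<mu>) = 0"
    and "integrable \<mu> (\<lambda>x. (u \<bullet> x)\<^sup>2)" "(\<integral>x. (u \<bullet> x)\<^sup>2 \<partial>\<mu>) = u \<bullet> (S *v u)"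
    and "integrable \<mu> (\<lambda>x. (u \<bullet> x) * (w \<bullet> x))" "(\<integral>x. (u \<bullet> x) * (w \<bullet> x) \<partial>\<mu>) = u \<bullet> (S *v w)"
proof -
  show sets: "sets \<mu> = sets borel" using assms by (simp add: centred_gaussian_def)
  have nn: "u \<bullet> (S *v u) \<ge> 0" and law: "distr \<mu> borel (\<lambda>x. u \<bullet> x) = centred_normal (u \<bullet> (S *v u))" for u
    using assms by (auto simp: centred_gaussian_def)
  have [measurable]: "(\<lambda>x. u \<bullet> x) \<in> borel_measurable \<mu>" for u
  proof -
    have "(\<lambda>x. u \<bullet> x) \<in> borel_measurable borel" by measurable
    then show ?thesis using measurable_cong_sets[OF sets refl, of borel] by blast
  qed
  have "prob_space (distr \<mu> borel (\<lambda>x. u \<bullet> x))"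
    using real_distribution_centred_normal[OF nn[of u]] by (simp add: law real_distribution_def)
  then show "prob_space \<mu>" by (rule prob_space_distrD[rotated]) measurable
  show "(\<integral>x. iexp (u \<bullet> x) \<partial>\<mu>) = exp (- (u \<bullet> (S *v u)) / 2)"
    using char_centred_normal[OF nn[of u], of 1] unfolding law[symmetric] char_def
    by (subst (asm) integral_distr) auto
  have i: "integrable \<mu> (\<lambda>x. (u \<bullet> x) ^ n)" for n u
    using centred_normal_moments(1)[OF nn[of u], of n] unfolding law[symmetric]
    by (subst (asm) integrable_distr_eq) auto
  show "integrable \<mu> (\<lambda>x. u \<bullet> x)" using i[of u 1] by simp
  show "integrable \<mu> (\<lambda>x. (u \<bullet> x)\<^sup>2)" by (rule i)
  show "(\<integral>x. u \<bullet> x \<partial>\<mu>) = 0"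
    using centred_normal_moments(4)[OF nn[of u]] unfolding law[symmetric]
    by (subst (asm) integral_distr) auto
  have sq: "(\<integral>x. (u \<bullet> x)\<^sup>2 \<partial>\<mu>) = u \<bullet> (S *v u)" for u
    using centred_normal_moments(5)[OF nn[of u]] unfolding law[symmetric]
    by (subst (asm) integral_distr) auto
  show "(\<integral>x. (u \<bullet> x)\<^sup>2 \<partial>\<mu>) = u \<bullet> (S *v u)" by (rule sq)
  have eq: "(u \<bullet> x) * (w \<bullet> x) = (((u + w) \<bullet> x)\<^sup>2 - ((u - w) \<bullet> x)\<^sup>2) / 4" for x
    by (simp add: inner_add_left inner_diff_left power2_eq_square algebra_simps)
  show "integrable \<mu> (\<lambda>x. (u \<bullet> x) * (w \<bullet> x))"
    unfolding eq by (intro integrable_divide Bochner_Integration.integrable_diff i)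
  have sym: "w \<bullet> (S *v u) = u \<bullet> (S *v w)"
    using assms by (metis centred_gaussian_def dot_lmul_matrix inner_commute transpose_matrix_vector)
  have "(\<integral>x. (u \<bullet> x) * (w \<bullet> x) \<partial>\<mu>) = ((\<integral>x. ((u + w) \<bullet> x)\<^sup>2 \<partial>\<mu>) - (\<integral>x. ((u - w) \<bullet> x)\<^sup>2 \<partial>\<mu>)) / 4"
    unfolding eq by (simp add: i)
  also have "\<dots> = u \<bullet> (S *v w)"
    unfolding sq using sym
    by (simp add: inner_add_left inner_diff_left matrix_vector_right_distrib matrix_vector_mult_diff_distrib
        inner_add_right inner_diff_right)
  finally show "(\<integral>x. (u \<bullet> x) * (w \<bullet> x) \<partial>\<mu>) = u \<bullet> (S *v w)" .
qed

text \<open>The functional \<open>u\<close> of the image is the functional \<open>u v* B\<close> of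
  the original vector, whose law is known; the covariance entries are those of the functionals given
  by the rows of \<open>B\<close>.\<close>

lemma centred_gaussian_linear_image:
  fixes B :: "real^'n^'m"
  assumes G: "centred_gaussian \<mu> S"
  shows "centred_gaussian (distr \<mu> borel (\<lambda>x. B *v x)) (covariance_matrix \<mu> (\<lambda>x. B *v x))"
    and "u \<bullet> (covariance_matrix \<mu> (\<lambda>x. B *v x) *v u) = (u v* B) \<bullet> (S *v (u v* B))"
proof -
  note f = centred_gaussian_facts[OF G]
  have comp: "(B *v x) $ i = row i B \<bullet> x" for x i
    by (simp add: matrix_vector_mult_def inner_vec_def row_def)
  have Q: "covariance_matrix \<mu> (\<lambda>x. B *v x) $ i $ j = row i B \<bullet> (S *v row j B)" for i j
    unfolding covariance_matrix_def comp f(5) by (simp add: f(9))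
  have rows: "u v* B = (\<Sum>i\<in>UNIV. u $ i *\<^sub>R row i B)" for u
    by (simp add: vector_matrix_mult_def vec_eq_iff row_def)
  show quad: "u \<bullet> (covariance_matrix \<mu> (\<lambda>x. B *v x) *v u) = (u v* B) \<bullet> (S *v (u v* B))" for u
  proof -
    have "(u v* B) \<bullet> (S *v (u v* B)) = (\<Sum>i\<in>UNIV. \<Sum>j\<in>UNIV. u $ i * (u $ j * (row i B \<bullet> (S *v row j B))))"
      unfolding rows
      by (simp add: inner_sum_left inner_sum_right linear_sum[OF matrix_vector_mul_linear]
          matrix_vector_mult_scaleR sum_distrib_left) (subst sum.swap, simp add: mult.left_commute)
    also have "\<dots> = u \<bullet> (covariance_matrix \<mu> (\<lambda>x. B *v x) *v u)"
    proof -
      have "u \<bullet> (C *v u) = (\<Sum>i\<in>UNIV. \<Sum>j\<in>UNIV. u $ i * (u $ j * C $ i $ j))" for C :: "real^'m^'m"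
        by (simp add: inner_vec_def matrix_vector_mult_def sum_distrib_left mult_ac)
      then show ?thesis by (simp only: Q)
    qed
    finally show ?thesis by simp
  qed
  have m: "(\<lambda>x. B *v x) \<in> borel_measurable \<mu>"
  proof -
    have "(\<lambda>x. B *v x) \<in> borel_measurable borel"
      by (intro borel_measurable_continuous_onI matrix_vector_mult_linear_continuous_on)
    then show ?thesis using measurable_cong_sets[OF f(2) refl, of borel] by blast
  qed
  show "centred_gaussian (distr \<mu> borel (\<lambda>x. B *v x)) (covariance_matrix \<mu> (\<lambda>x. B *v x))"
    unfolding centred_gaussian_def
  proof (intro conjI allI)
    show "transpose (covariance_matrix \<mu> (\<lambda>x. B *v x)) = covariance_matrix \<mu> (\<lambda>x. B *v x)"
      by (simp add: vec_eq_iff transpose_def covariance_matrix_def mult.commute)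
    fix u
    show "0 \<le> u \<bullet> (covariance_matrix \<mu> (\<lambda>x. B *v x) *v u)"
      unfolding quad using G by (simp add: centred_gaussian_def)
    have "distr (distr \<mu> borel (\<lambda>x. B *v x)) borel (\<lambda>x. u \<bullet> x) = distr \<mu> borel (\<lambda>x. (u v* B) \<bullet> x)"
      by (subst distr_distr) (auto simp: m comp_def simp flip: dot_lmul_matrix)
    also have "\<dots> = centred_normal ((u v* B) \<bullet> (S *v (u v* B)))"
      using G by (simp add: centred_gaussian_def)
    finally show "distr (distr \<mu> borel (\<lambda>x. B *v x)) borel (\<lambda>x. u \<bullet> x) = centred_normal (u \<bullet> (covariance_matrix \<mu> (\<lambda>x. B *v x) *v u))"
      unfolding quad .
  qed simp
qed

text \<open>Cholesky factorization: a lower triangular matrix applied to two independent standard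
  normal variables. The Schur complement \<open>d\<close> may vanish, the second row then being a
  multiple of the first.\<close>

lemma centred_gaussian_exists_2:
  fixes K :: "real^2^2"
  assumes sym: "transpose K = K" and nn: "\<And>u. 0 \<le> u \<bullet> (K *v u)" and pos: "K $ 1 $ 1 > 0"
  obtains \<mu> where "centred_gaussian \<mu> K"
proof -
  define k11 k12 k22 where k: "k11 = K $ 1 $ 1" "k12 = K $ 1 $ 2" "k22 = K $ 2 $ 2"
  have k21: "K $ 2 $ 1 = k12" using sym by (simp add: k vec_eq_iff transpose_def)
  have quad: "u \<bullet> (K *v u) = k11 * (u $ 1)\<^sup>2 + 2 * k12 * (u $ 1 * u $ 2) + k22 * (u $ 2)\<^sup>2" for u
    by (simp add: inner_vec_def matrix_vector_mult_def sum_2 k21 k[symmetric] power2_eq_square algebra_simps)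
  have k11: "k11 > 0" using pos by (simp add: k)
  define d where "d = k22 - k12\<^sup>2 / k11"
  have d: "d \<ge> 0"
  proof -
    \<comment> \<open>The quadratic form at its minimum over vectors with second component 1, where
      its value is the Schur complement.\<close>
    have "0 \<le> k11 * (- k12 / k11)\<^sup>2 + 2 * k12 * (- k12 / k11) + k22"
      using nn[of "vector [- k12 / k11, 1]"] by (simp add: quad)
    then show ?thesis using k11 by (simp add: d_def field_simps power2_eq_square)
  qed
  let ?N = "std_normal_distribution"
  let ?M = "?N \<Otimes>\<^sub>M ?N"
  interpret N: prob_space ?N using real_dist_normal_dist by (simp add: real_distribution_def)
  interpret NN: pair_prob_space ?N ?N by unfold_locales
  have setsN: "sets ?N = sets borel" by simp
  have setsM: "sets ?M = sets (borel \<Otimes>\<^sub>M borel)" by (rule sets_pair_measure_cong) auto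
  have [measurable]: "fst \<in> borel_measurable ?M" "snd \<in> borel_measurable ?M"
    unfolding measurable_cong_sets[OF setsM refl] by measurable
  have dN: "distr ?M borel fst = ?N" "distr ?M borel snd = ?N"
  proof -
    have f: "distr ?M ?N fst = ?N" by (rule N.distr_pair_fst)
    then show "distr ?M borel fst = ?N" using distr_cong[OF refl setsN, of ?M fst fst] by simp
    have "distr ?M ?N snd = distr (distr ?M ?M (\<lambda>(x, y). (y, x))) ?N snd"
      by (subst NN.distr_pair_swap) simp
    also have "\<dots> = distr ?M ?N fst" by (subst distr_distr) (auto simp: comp_def case_prod_beta)
    finally have "distr ?M ?N snd = ?N" using f by simp
    then show "distr ?M borel snd = ?N" using distr_cong[OF refl setsN, of ?M snd snd] by simp
  qed
  have ind: "NN.indep_var borel fst borel snd"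
    unfolding NN.indep_var_distribution_eq dN
    by (auto intro!: distr_id2[symmetric] simp: setsM)
  define X where "X z = (vector [sqrt k11 * fst z, k12 / sqrt k11 * fst z + sqrt d * snd z] :: real^2)" for z :: "real \<times> real"
  have Xm: "X \<in> borel_measurable ?M"
    unfolding X_def[abs_def] by (intro borel_measurable_vector2) measurable
  have "centred_gaussian (distr ?M borel X) K"
    unfolding centred_gaussian_def
  proof (intro conjI allI)
    fix u :: "real^2"
    define c1 where "c1 = u $ 1 * sqrt k11 + u $ 2 * k12 / sqrt k11"
    define c2 where "c2 = u $ 2 * sqrt d"
    have q: "u \<bullet> (K *v u) = c1\<^sup>2 + c2\<^sup>2"
    proof -
      have "c1\<^sup>2 = k11 * (u $ 1)\<^sup>2 + 2 * k12 * (u $ 1 * u $ 2) + (u $ 2)\<^sup>2 * (k12\<^sup>2 / k11)"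
        using k11 by (simp add: c1_def power2_sum power_mult_distrib power_divide)
      moreover have "c2\<^sup>2 = (u $ 2)\<^sup>2 * d" using d by (simp add: c2_def power_mult_distrib)
      ultimately show ?thesis by (simp add: quad d_def algebra_simps)
    qed
    have uX: "u \<bullet> X z = c1 * fst z + c2 * snd z" for z
      by (simp add: inner_vec_def sum_2 X_def c1_def c2_def algebra_simps)
    have law: "distr ?M borel (\<lambda>z. c * p z) = centred_normal (c\<^sup>2)"
      if p: "distr ?M borel p = ?N" "p \<in> borel_measurable ?M" for c p
    proof (rule NN.normalI_char)
      note [measurable] = p(2)
      show "(\<lambda>z. c * p z) \<in> borel_measurable ?M" by measurable
      fix t
      have "(\<integral>z. iexp (t * (c * p z)) \<partial>?M) = char (distr ?M borel p) (t * c)"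
        unfolding char_def by (subst integral_distr) (auto simp: mult_ac)
      then show "(\<integral>z. iexp (t * (c * p z)) \<partial>?M) = exp (- (c\<^sup>2) * t\<^sup>2 / 2)"
        unfolding p(1) char_std_normal_distribution by (simp add: power_mult_distrib mult_ac)
    qed simp
    have "NN.indep_var borel ((\<lambda>x. c1 * x) \<circ> fst) borel ((\<lambda>x. c2 * x) \<circ> snd)"
      by (rule NN.indep_var_compose[OF ind]) auto
    then have "distr ?M borel (\<lambda>z. c1 * fst z + c2 * snd z) = centred_normal (c1\<^sup>2 + c2\<^sup>2)"
      by (intro NN.normal_add_indep law dN) (auto simp: comp_def)
    then show "distr (distr ?M borel X) borel (\<lambda>x. u \<bullet> x) = centred_normal (u \<bullet> (K *v u))"
      by (subst distr_distr) (auto simp: Xm comp_def uX q)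
  qed (use sym nn in auto)
  then show ?thesis by (rule that)
qed

section \<open>Linearization of the inverse moment map\<close>

lemma mean_value_interval:
  fixes k k' :: "real \<Rightarrow> real"
  assumes k: "\<And>x. x \<in> {\<alpha>..\<beta>} \<Longrightarrow> (k has_real_derivative k' x) (at x)"
    and uv: "u \<in> {\<alpha>..\<beta>}" "v \<in> {\<alpha>..\<beta>}"
  obtains z where "z \<in> {\<alpha>..\<beta>}" "\<bar>z - u\<bar> \<le> \<bar>v - u\<bar>" "k v - k u = k' z * (v - u)"
proof (cases u v rule: linorder_cases)
  case less
  then obtain z where "u < z" "z < v" "k v - k u = (v - u) * k' z"
    using MVT2[of u v k k'] k uv by auto
  then show ?thesis using uv by (intro that[of z]) auto
next
  case equal
  then show ?thesis using uv that[of u] by auto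
next
  case greater
  then obtain z where "v < z" "z < u" "k u - k v = (u - v) * k' z"
    using MVT2[of v u k k'] k uv by auto
  then show ?thesis using uv by (intro that[of z]) (auto simp: algebra_simps)
qed

text \<open>Two applications of the mean value theorem, the second between \<open>x\<close> and the
  intermediate point of the first; the constant \<open>M\<close> in place of \<open>M / 2\<close> is
  harmless here.\<close>

lemma second_order_remainder:
  fixes g g' g'' :: "real \<Rightarrow> real"
  assumes g: "\<And>x. x \<in> {\<alpha>..\<beta>} \<Longrightarrow> (g has_real_derivative g' x) (at x)"
    and g': "\<And>x. x \<in> {\<alpha>..\<beta>} \<Longrightarrow> (g' has_real_derivative g'' x) (at x)"
    and g'': "\<And>x. x \<in> {\<alpha>..\<beta>} \<Longrightarrow> \<bar>g'' x\<bar> \<le> M"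
    and x: "x \<in> {\<alpha>..\<beta>}" "y \<in> {\<alpha>..\<beta>}"
  shows "\<bar>g y - g x - g' x * (y - x)\<bar> \<le> M * (y - x)\<^sup>2"
proof -
  obtain z where z: "z \<in> {\<alpha>..\<beta>}" "\<bar>z - x\<bar> \<le> \<bar>y - x\<bar>" "g y - g x = g' z * (y - x)"
    by (rule mean_value_interval[OF g x])
  obtain t where t: "t \<in> {\<alpha>..\<beta>}" "g' z - g' x = g'' t * (z - x)"
    by (rule mean_value_interval[OF g' x(1) z(1)])
  have "g y - g x - g' x * (y - x) = (g' z - g' x) * (y - x)"
    unfolding z(3) by (simp add: algebra_simps)
  then have "\<bar>g y - g x - g' x * (y - x)\<bar> = \<bar>g'' t\<bar> * (\<bar>z - x\<bar> * \<bar>y - x\<bar>)"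
    unfolding t(2) by (simp add: abs_mult)
  also have "\<dots> \<le> M * (\<bar>y - x\<bar> * \<bar>y - x\<bar>)"
  proof (intro mult_mono)
    show "0 \<le> M" using g''[OF t(1)] by linarith
  qed (use g''[OF t(1)] z(2) in auto)
  finally show ?thesis by (simp add: power2_eq_square abs_mult_self_eq)
qed

text \<open>Closed forms, with common powers of \<open>1 - exp (- x)\<close> cancelled. They make
  bounds for first and second derivatives on a compact interval a matter of continuity.\<close>

definition h_deriv :: "real \<Rightarrow> real" where
  "h_deriv x = (1 - exp (- x) * exp (- x) - 2 * x * exp (- x)) / (1 - exp (- x)) ^ 3"

definition h_deriv2 :: "real \<Rightarrow> real" where
  "h_deriv2 x = (2 * exp (- x) * (exp (- x) - 1 + x) * (1 - exp (- x))
     - 3 * exp (- x) * (1 - exp (- x) * exp (- x) - 2 * x * exp (- x))) / (1 - exp (- x)) ^ 4"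

definition n_deriv :: "real \<Rightarrow> real \<Rightarrow> real" where
  "n_deriv b x = sqrt 2 / \<bar>b\<bar> * (3 / 2 * x powr (1 / 2) / (1 - exp (- x))
     - x powr (3 / 2) * exp (- x) / (1 - exp (- x))\<^sup>2)"

definition n_deriv2 :: "real \<Rightarrow> real \<Rightarrow> real" where
  "n_deriv2 b x = sqrt 2 / \<bar>b\<bar> * (3 / 4 * x powr (- 1 / 2) / (1 - exp (- x))
     - 3 * x powr (1 / 2) * exp (- x) / (1 - exp (- x))\<^sup>2
     + x powr (3 / 2) * exp (- x) / (1 - exp (- x))\<^sup>2
     + 2 * x powr (3 / 2) * (exp (- x))\<^sup>2 / (1 - exp (- x)) ^ 3)"

lemma exp_minus_derivatives:
  "((\<lambda>x::real. 1 - exp (- x)) has_real_derivative exp (- x)) (at x)"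
  "((\<lambda>x::real. (1 - exp (- x))\<^sup>2) has_real_derivative 2 * (1 - exp (- x)) * exp (- x)) (at x)"
  "((\<lambda>x::real. (1 - exp (- x)) ^ 3) has_real_derivative 3 * (1 - exp (- x))\<^sup>2 * exp (- x)) (at x)"
  by (auto intro!: derivative_eq_intros)

lemma h_has_derivative:
  assumes "x > 0" shows "(h_fun has_real_derivative h_deriv x) (at x)"
proof -
  have N: "((\<lambda>x::real. exp (- x) - 1 + x) has_real_derivative 1 - exp (- x)) (at x)"
    by (auto intro!: derivative_eq_intros)
  have quot: "(d * d\<^sup>2 - n * (2 * d * e)) / (d\<^sup>2 * d\<^sup>2) = (d * d - 2 * n * e) / d ^ 3" if "d \<noteq> 0" for d n e :: real
    using that by (simp add: field_simps eval_nat_numeral)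
  have "(h_fun has_real_derivative (1 - exp (- x)) * (1 - exp (- x))\<^sup>2 / ((1 - exp (- x))\<^sup>2 * (1 - exp (- x))\<^sup>2)
      - (exp (- x) - 1 + x) * (2 * (1 - exp (- x)) * exp (- x)) / ((1 - exp (- x))\<^sup>2 * (1 - exp (- x))\<^sup>2)) (at x)"
    unfolding h_fun_def[abs_def] diff_divide_distrib[symmetric]
    by (rule DERIV_divide[OF N exp_minus_derivatives(2)]) (use assms in simp)
  then have "(h_fun has_real_derivative ((1 - exp (- x)) * (1 - exp (- x)) - 2 * (exp (- x) - 1 + x) * exp (- x)) / (1 - exp (- x)) ^ 3) (at x)"
    unfolding diff_divide_distrib[symmetric] using assms by (subst (asm) quot) auto
  moreover have "(1 - exp (- x)) * (1 - exp (- x)) - 2 * (exp (- x) - 1 + x) * exp (- x) = 1 - exp (- x) * exp (- x) - 2 * x * exp (- x)"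
    by (simp add: algebra_simps)
  ultimately show ?thesis unfolding h_deriv_def by (simp only:)
qed

lemma h_deriv_has_derivative:
  assumes "x > 0" shows "(h_deriv has_real_derivative h_deriv2 x) (at x)"
proof -
  have N: "((\<lambda>x::real. 1 - exp (- x) * exp (- x) - 2 * x * exp (- x)) has_real_derivative 2 * exp (- x) * (exp (- x) - 1 + x)) (at x)"
    by (auto intro!: derivative_eq_intros simp: algebra_simps)
  have quot: "(n' * d ^ 3 - n * (3 * d\<^sup>2 * e)) / (d ^ 3 * d ^ 3) = (n' * d - 3 * e * n) / d ^ 4" if "d \<noteq> 0" for d n n' e :: real
    using that by (simp add: field_simps eval_nat_numeral)
  have "(h_deriv has_real_derivative ((2 * exp (- x) * (exp (- x) - 1 + x)) * (1 - exp (- x)) ^ 3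
      - (1 - exp (- x) * exp (- x) - 2 * x * exp (- x)) * (3 * (1 - exp (- x))\<^sup>2 * exp (- x))) / ((1 - exp (- x)) ^ 3 * (1 - exp (- x)) ^ 3)) (at x)"
    unfolding h_deriv_def[abs_def]
    by (rule DERIV_divide[OF N exp_minus_derivatives(3)]) (use assms in simp)
  then show ?thesis unfolding h_deriv2_def using assms by (subst (asm) quot) auto
qed

lemma powr_quotient_derivative:
  fixes x r :: real
  assumes "x > 0"
  shows "((\<lambda>x. x powr r / (1 - exp (- x))) has_real_derivative
    r * x powr (r - 1) / (1 - exp (- x)) - x powr r * exp (- x) / (1 - exp (- x))\<^sup>2) (at x)"
proof -
  have N: "((\<lambda>x. x powr r) has_real_derivative r * x powr (r - 1)) (at x)"
    using has_real_derivative_powr[OF assms, of r] by simp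
  have quot: "(n' * d - n * e) / (d * d) = n' / d - n * e / d\<^sup>2" if "d \<noteq> 0" for d n n' e :: real
    using that by (simp add: field_simps eval_nat_numeral)
  have "((\<lambda>x. x powr r / (1 - exp (- x))) has_real_derivative
    (r * x powr (r - 1) * (1 - exp (- x)) - x powr r * exp (- x)) / ((1 - exp (- x)) * (1 - exp (- x)))) (at x)"
    by (rule DERIV_divide[OF N exp_minus_derivatives(1)]) (use assms in simp)
  then show ?thesis using assms by (subst (asm) quot) auto
qed

lemma n_has_derivative:
  assumes "x > 0" shows "(n_fun b has_real_derivative n_deriv b x) (at x)"
proof -
  have "((\<lambda>x. sqrt 2 / \<bar>b\<bar> * (x powr (3 / 2) / (1 - exp (- x)))) has_real_derivative n_deriv b x) (at x)"
    unfolding n_deriv_def using DERIV_cmult[OF powr_quotient_derivative[OF assms, of "3 / 2"], of "sqrt 2 / \<bar>b\<bar>"] by simp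
  then show ?thesis unfolding n_fun_def[abs_def] by simp
qed

lemma n_deriv_has_derivative:
  assumes "x > 0" shows "(n_deriv b has_real_derivative n_deriv2 b x) (at x)"
proof -
  have 1: "((\<lambda>x. 3 / 2 * (x powr (1 / 2) / (1 - exp (- x)))) has_real_derivative
      3 / 2 * (1 / 2 * x powr (- 1 / 2) / (1 - exp (- x)) - x powr (1 / 2) * exp (- x) / (1 - exp (- x))\<^sup>2)) (at x)"
    using DERIV_cmult[OF powr_quotient_derivative[OF assms, of "1 / 2"], of "3 / 2"] by simp
  have N: "((\<lambda>x. x powr (3 / 2) * exp (- x)) has_real_derivative
      3 / 2 * x powr (1 / 2) * exp (- x) - x powr (3 / 2) * exp (- x)) (at x)"
  proof -
    have "((\<lambda>x::real. exp (- x)) has_real_derivative - exp (- x)) (at x)"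
      by (auto intro!: derivative_eq_intros)
    from DERIV_mult[OF has_real_derivative_powr[OF assms, of "3 / 2"] this]
    show ?thesis by (simp add: mult_ac)
  qed
  have quot: "(n' * d\<^sup>2 - n * (2 * d * e)) / (d\<^sup>2 * d\<^sup>2) = n' / d\<^sup>2 - 2 * n * e / d ^ 3" if "d \<noteq> 0" for d n n' e :: real
    using that by (simp add: field_simps eval_nat_numeral)
  have "((\<lambda>x. x powr (3 / 2) * exp (- x) / (1 - exp (- x))\<^sup>2) has_real_derivative
      ((3 / 2 * x powr (1 / 2) * exp (- x) - x powr (3 / 2) * exp (- x)) * (1 - exp (- x))\<^sup>2
      - x powr (3 / 2) * exp (- x) * (2 * (1 - exp (- x)) * exp (- x))) / ((1 - exp (- x))\<^sup>2 * (1 - exp (- x))\<^sup>2)) (at x)"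
    by (rule DERIV_divide[OF N exp_minus_derivatives(2)]) (use assms in simp)
  then have 2: "((\<lambda>x. x powr (3 / 2) * exp (- x) / (1 - exp (- x))\<^sup>2) has_real_derivative
      (3 / 2 * x powr (1 / 2) * exp (- x) - x powr (3 / 2) * exp (- x)) / (1 - exp (- x))\<^sup>2
      - 2 * (x powr (3 / 2) * exp (- x)) * exp (- x) / (1 - exp (- x)) ^ 3) (at x)"
    using assms by (subst (asm) quot) auto
  have "((\<lambda>x. sqrt 2 / \<bar>b\<bar> * (3 / 2 * (x powr (1 / 2) / (1 - exp (- x))) - x powr (3 / 2) * exp (- x) / (1 - exp (- x))\<^sup>2))
      has_real_derivative n_deriv2 b x) (at x)"
  proof (rule DERIV_cong[OF DERIV_cmult[OF DERIV_diff[OF 1 2], of "sqrt 2 / \<bar>b\<bar>"]])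
    have alg: "3 / 2 * (1 / 2 * p / d - q * e / d\<^sup>2) - ((3 / 2 * q * e - s * e) / d\<^sup>2 - 2 * (s * e) * e / d ^ 3) =
        3 / 4 * p / d - 3 * q * e / d\<^sup>2 + s * e / d\<^sup>2 + 2 * s * e\<^sup>2 / d ^ 3" if "d \<noteq> 0" for p q s d e :: real
      using that by (simp add: field_simps eval_nat_numeral)
    have nz: "1 - exp (- x) \<noteq> 0" using assms by simp
    show "sqrt 2 / \<bar>b\<bar> * (3 / 2 * (1 / 2 * x powr (- 1 / 2) / (1 - exp (- x)) - x powr (1 / 2) * exp (- x) / (1 - exp (- x))\<^sup>2)
        - ((3 / 2 * x powr (1 / 2) * exp (- x) - x powr (3 / 2) * exp (- x)) / (1 - exp (- x))\<^sup>2
        - 2 * (x powr (3 / 2) * exp (- x)) * exp (- x) / (1 - exp (- x)) ^ 3)) = n_deriv2 b x"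
      unfolding n_deriv2_def alg[OF nz] ..
  qed
  then show ?thesis unfolding n_deriv_def[abs_def] by (simp only: times_divide_eq_right)
qed

text \<open>The numerator vanishes at zero and increases, its derivative being a positive multiple
  of \<open>exp (- y) - 1 + y\<close>.\<close>

lemma h_deriv_pos:
  assumes "x > 0" shows "h_deriv x > 0"
proof -
  define k where "k x = 1 - exp (- x) * exp (- x) - 2 * x * exp (- x)" for x :: real
  have "k 0 < k x"
  proof (rule DERIV_pos_imp_increasing_open[OF assms])
    fix y :: real assume y: "0 < y"
    have "(k has_real_derivative 2 * exp (- y) * (exp (- y) - 1 + y)) (at y)"
      unfolding k_def[abs_def] by (auto intro!: derivative_eq_intros simp: algebra_simps)
    moreover have "exp (- y) - 1 + y > 0" using exp_minus_greater[of y] y by simp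
    ultimately show "\<exists>z. (k has_real_derivative z) (at y) \<and> 0 < z" 
      by (intro exI[of _ "2 * exp (- y) * (exp (- y) - 1 + y)"]) simp
  qed (auto simp: k_def intro!: continuous_intros)
  then have "k x > 0" by (simp add: k_def)
  then show ?thesis using assms by (simp add: h_deriv_def k_def)
qed

lemma ratio_eq_h:
  assumes "\<theta> $ 1 > 0" "\<theta> $ 2 > 0" "b \<noteq> 0"
  shows "(\<Phi>1 \<sigma> b \<theta> - \<sigma>\<^sup>2) / (2 * \<Phi>2 b \<theta>) = h_fun (\<theta> $ 1)"
proof -
  have "1 - exp (- \<theta> $ 1) \<noteq> 0" using assms by simp
  then show ?thesis using assms by (simp add: \<Phi>1_def \<Phi>2_def h_fun_def Let_def field_simps)
qed

lemma second_component_eq: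
  assumes "\<theta> $ 1 > 0" "\<theta> $ 2 > 0" "b \<noteq> 0"
  shows "n_fun b (\<theta> $ 1) * sqrt (\<Phi>2 b \<theta>) = \<theta> $ 2"
proof -
  define a f where "a = \<theta> $ 1" and "f = \<theta> $ 2"
  have a: "a > 0" "f > 0" using assms by (auto simp: a_def f_def)
  have p: "a powr (3 / 2) > 0" "(a powr (3 / 2))\<^sup>2 = a ^ 3"
    using a by (auto simp: power2_eq_square powr_add[symmetric] powr_numeral)
  have "\<Phi>2 b \<theta> = (f * \<bar>b\<bar> * (1 - exp (- a)) / (sqrt 2 * a powr (3 / 2)))\<^sup>2"
    using a by (simp add: \<Phi>2_def Let_def a_def[symmetric] f_def[symmetric] power_divide power_mult_distrib p)
  then have "sqrt (\<Phi>2 b \<theta>) = f * \<bar>b\<bar> * (1 - exp (- a)) / (sqrt 2 * a powr (3 / 2))"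
    using a by simp
  then show ?thesis using a assms(3) p(1) by (simp add: n_fun_def a_def[symmetric] f_def[symmetric] field_simps)
qed

section \<open>Uniform estimates on a box of parameters bounded away from zero\<close>

locale estimation_box =
  fixes \<alpha>a \<beta>a \<alpha>f \<beta>f \<sigma> b :: real
  assumes \<alpha>a: "\<alpha>a > 0" and \<alpha>f: "\<alpha>f > 0" and b: "b \<noteq> 0" and nonempty: "\<alpha>a < \<beta>a" "\<alpha>f < \<beta>f"
begin

definition \<Theta> :: "(real^2) set" where
  "\<Theta> = {\<theta>. \<theta> $ 1 \<in> {\<alpha>a<..<\<beta>a} \<and> \<theta> $ 2 \<in> {\<alpha>f<..<\<beta>f}}"

lemma \<Theta>D: "\<theta> \<in> \<Theta> \<Longrightarrow> \<theta> $ 1 \<in> {\<alpha>a..\<beta>a}" "\<theta> \<in> \<Theta> \<Longrightarrow> \<theta> $ 1 > 0" "\<theta> \<in> \<Theta> \<Longrightarrow> \<theta> $ 2 > 0"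
  "\<theta> \<in> \<Theta> \<Longrightarrow> \<theta> $ 2 \<in> {\<alpha>f..\<beta>f}"
  using \<alpha>a \<alpha>f by (auto simp: \<Theta>_def)

lemma continuous_bounded_on_interval:
  fixes g :: "real \<Rightarrow> real"
  assumes "continuous_on {\<alpha>a..\<beta>a} g"
  obtains M where "M > 0" "\<And>x. x \<in> {\<alpha>a..\<beta>a} \<Longrightarrow> \<bar>g x\<bar> \<le> M"
proof -
  have "bounded (g ` {\<alpha>a..\<beta>a})"
    by (intro compact_imp_bounded compact_continuous_image assms) auto
  then obtain M where "\<forall>y\<in>g ` {\<alpha>a..\<beta>a}. norm y \<le> M" by (auto simp: bounded_iff)
  then show ?thesis by (intro that[of "max M 1"]) (auto simp: le_max_iff_disj)
qed

lemma deriv_h: "x \<in> {\<alpha>a..\<beta>a} \<Longrightarrow> deriv h_fun x = h_deriv x"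
  using \<alpha>a h_has_derivative by (intro DERIV_imp_deriv) auto

lemma deriv_n: "x \<in> {\<alpha>a..\<beta>a} \<Longrightarrow> deriv (n_fun b) x = n_deriv b x"
  using \<alpha>a b n_has_derivative by (intro DERIV_imp_deriv) auto

lemma continuous_derivs:
  "continuous_on {\<alpha>a..\<beta>a} h_deriv" "continuous_on {\<alpha>a..\<beta>a} h_deriv2"
  "continuous_on {\<alpha>a..\<beta>a} (n_fun b)" "continuous_on {\<alpha>a..\<beta>a} (n_deriv b)" "continuous_on {\<alpha>a..\<beta>a} (n_deriv2 b)"
proof -
  have nz: "exp (- x) \<noteq> 1" if "\<alpha>a \<le> x" for x using that \<alpha>a by simp
  show "continuous_on {\<alpha>a..\<beta>a} h_deriv" "continuous_on {\<alpha>a..\<beta>a} h_deriv2"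
    "continuous_on {\<alpha>a..\<beta>a} (n_fun b)" "continuous_on {\<alpha>a..\<beta>a} (n_deriv b)" "continuous_on {\<alpha>a..\<beta>a} (n_deriv2 b)"
    unfolding h_deriv_def[abs_def] h_deriv2_def[abs_def] n_fun_def[abs_def] n_deriv_def[abs_def] n_deriv2_def[abs_def]
    using \<alpha>a b nz by (auto intro!: continuous_intros)
qed

lemma h_deriv_lower:
  obtains m where "m > 0" "\<And>x. x \<in> {\<alpha>a..\<beta>a} \<Longrightarrow> m \<le> h_deriv x"
proof -
  obtain x0 where "x0 \<in> {\<alpha>a..\<beta>a}" "\<And>x. x \<in> {\<alpha>a..\<beta>a} \<Longrightarrow> h_deriv x0 \<le> h_deriv x"
    using continuous_attains_inf[OF _ _ continuous_derivs(1)] nonempty by auto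
  then show ?thesis using \<alpha>a h_deriv_pos[of x0] by (intro that[of "h_deriv x0"]) auto
qed

text \<open>The closed box is compact and stays within positive coordinates, so both moment
  functions are bounded and the second attains a positive minimum.\<close>

lemma \<Phi>_bounds:
  obtains c C where "c > 0" "C > 0" "\<And>\<theta>. \<theta> \<in> \<Theta> \<Longrightarrow> c \<le> \<Phi>2 b \<theta> \<and> \<Phi>2 b \<theta> \<le> C"
    "\<And>\<theta>. \<theta> \<in> \<Theta> \<Longrightarrow> \<bar>\<Phi>1 \<sigma> b \<theta> - \<sigma>\<^sup>2\<bar> \<le> C"
proof -
  define S where "S = {\<alpha>a..\<beta>a} \<times> {\<alpha>f..\<beta>f}"
  have S: "compact S" "S \<noteq> {}" using nonempty by (auto simp: S_def intro: compact_Times)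
  define g1 where "g1 = (\<lambda>(a, f). f\<^sup>2 * b\<^sup>2 / a ^ 3 * (exp (- a) - 1 + a))"
  define g2 where "g2 = (\<lambda>(a, f). f\<^sup>2 * b\<^sup>2 / (2 * a ^ 3) * (1 - exp (- a))\<^sup>2)"
  have c: "continuous_on S g1" "continuous_on S g2"
    using \<alpha>a by (auto simp: g1_def g2_def S_def case_prod_beta intro!: continuous_intros)
  obtain z where z: "z \<in> S" "\<And>y. y \<in> S \<Longrightarrow> g2 z \<le> g2 y"
    using continuous_attains_inf[OF S c(2)] by blast
  have pos: "g2 z > 0" using z(1) \<alpha>a \<alpha>f b by (auto simp: g2_def S_def)
  have "bounded (g1 ` S)" "bounded (g2 ` S)"
    using S c by (auto intro!: compact_imp_bounded compact_continuous_image)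
  then obtain C1 C2 where C: "\<forall>y\<in>S. \<bar>g1 y\<bar> \<le> C1" "\<forall>y\<in>S. \<bar>g2 y\<bar> \<le> C2" by (auto simp: bounded_iff)
  show ?thesis
  proof (rule that[OF pos, of "max 1 (max C1 C2)"])
    fix \<theta> assume "\<theta> \<in> \<Theta>"
    then have s: "(\<theta> $ 1, \<theta> $ 2) \<in> S" by (auto simp: S_def \<Theta>_def)
    have e: "\<Phi>2 b \<theta> = g2 (\<theta> $ 1, \<theta> $ 2)" "\<Phi>1 \<sigma> b \<theta> - \<sigma>\<^sup>2 = g1 (\<theta> $ 1, \<theta> $ 2)"
      by (auto simp: \<Phi>1_def \<Phi>2_def g1_def g2_def Let_def)
    show "g2 z \<le> \<Phi>2 b \<theta> \<and> \<Phi>2 b \<theta> \<le> max 1 (max C1 C2)"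
      unfolding e using z(2)[OF s] C(2)[rule_format, OF s] by auto
    show "\<bar>\<Phi>1 \<sigma> b \<theta> - \<sigma>\<^sup>2\<bar> \<le> max 1 (max C1 C2)"
      unfolding e using C(1)[rule_format, OF s] by auto
  qed simp
qed

lemma xi_bounded:
  obtains C where "C > 0" "\<And>\<theta> \<xi>. \<theta> \<in> \<Theta> \<Longrightarrow> \<bar>xi3 \<sigma> b \<theta> \<xi>\<bar> \<le> C * norm \<xi>" "\<And>\<theta> \<xi>. \<theta> \<in> \<Theta> \<Longrightarrow> \<bar>xi4 \<sigma> b \<theta> \<xi>\<bar> \<le> C * norm \<xi>"
proof -
  obtain m where m: "m > 0" "\<And>x. x \<in> {\<alpha>a..\<beta>a} \<Longrightarrow> m \<le> h_deriv x" by (rule h_deriv_lower) blast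
  obtain c C where c: "c > 0" "C > 0" "\<And>\<theta>. \<theta> \<in> \<Theta> \<Longrightarrow> c \<le> \<Phi>2 b \<theta> \<and> \<Phi>2 b \<theta> \<le> C"
    "\<And>\<theta>. \<theta> \<in> \<Theta> \<Longrightarrow> \<bar>\<Phi>1 \<sigma> b \<theta> - \<sigma>\<^sup>2\<bar> \<le> C" by (rule \<Phi>_bounds) blast
  obtain Mn where Mn: "Mn > 0" "\<And>x. x \<in> {\<alpha>a..\<beta>a} \<Longrightarrow> \<bar>n_fun b x\<bar> \<le> Mn"
    by (rule continuous_bounded_on_interval[OF continuous_derivs(3)]) blast
  obtain Mn' where Mn': "Mn' > 0" "\<And>x. x \<in> {\<alpha>a..\<beta>a} \<Longrightarrow> \<bar>n_deriv b x\<bar> \<le> Mn'"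
    by (rule continuous_bounded_on_interval[OF continuous_derivs(4)]) blast
  define C3 where "C3 = 1 / (2 * m * c) + C / (2 * m * c\<^sup>2)"
  define C4 where "C4 = Mn' * sqrt C * C3 + Mn / (2 * sqrt c)"
  have C3: "C3 > 0" using m c by (auto simp: C3_def intro!: add_pos_pos divide_pos_pos mult_pos_pos)
  have C4: "C4 > 0" using c Mn Mn' C3 by (auto simp: C4_def intro!: add_pos_pos divide_pos_pos mult_pos_pos)
  have x3: "\<bar>xi3 \<sigma> b \<theta> \<xi>\<bar> \<le> C3 * norm \<xi>" if \<theta>: "\<theta> \<in> \<Theta>" for \<theta> \<xi>
  proof -
    have n: "\<bar>\<xi> $ 1\<bar> \<le> norm \<xi>" "\<bar>\<xi> $ 2\<bar> \<le> norm \<xi>" using component_le_norm_cart by (auto simp: real_norm_def)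
    note h = m(2)[OF \<Theta>D(1)[OF \<theta>]] c(3)[OF \<theta>]
    have "\<bar>\<xi> $ 1 / (2 * h_deriv (\<theta> $ 1) * \<Phi>2 b \<theta>)\<bar> \<le> norm \<xi> / (2 * m * c)"
      unfolding abs_divide using h m c n by (intro frac_le) (auto simp: abs_mult intro!: mult_mono)
    moreover have "\<bar>(\<Phi>1 \<sigma> b \<theta> - \<sigma>\<^sup>2) * \<xi> $ 2 / (2 * h_deriv (\<theta> $ 1) * (\<Phi>2 b \<theta>)\<^sup>2)\<bar> \<le> C * norm \<xi> / (2 * m * c\<^sup>2)"
      unfolding abs_divide using h m c c(4)[OF \<theta>] n by (intro frac_le) (auto simp: abs_mult intro!: mult_mono power_mono)
    ultimately have "\<bar>xi3 \<sigma> b \<theta> \<xi>\<bar> \<le> norm \<xi> / (2 * m * c) + C * norm \<xi> / (2 * m * c\<^sup>2)"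
      unfolding xi3_def deriv_h[OF \<Theta>D(1)[OF \<theta>]] by linarith
    then show ?thesis by (simp add: C3_def distrib_right)
  qed
  have x4: "\<bar>xi4 \<sigma> b \<theta> \<xi>\<bar> \<le> C4 * norm \<xi>" if \<theta>: "\<theta> \<in> \<Theta>" for \<theta> \<xi>
  proof -
    have n: "\<bar>\<xi> $ 2\<bar> \<le> norm \<xi>" using component_le_norm_cart by (auto simp: real_norm_def)
    note h = c(3)[OF \<theta>]
    have "\<bar>n_deriv b (\<theta> $ 1) * sqrt (\<Phi>2 b \<theta>) * xi3 \<sigma> b \<theta> \<xi>\<bar> \<le> Mn' * sqrt C * (C3 * norm \<xi>)"
      unfolding abs_mult using h c Mn'(2)[OF \<Theta>D(1)[OF \<theta>]] Mn'(1) x3[OF \<theta>] C3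
      by (intro mult_mono) auto
    moreover have "\<bar>n_fun b (\<theta> $ 1) / (2 * sqrt (\<Phi>2 b \<theta>)) * \<xi> $ 2\<bar> \<le> Mn / (2 * sqrt c) * norm \<xi>"
      unfolding abs_mult abs_divide using h c Mn(2)[OF \<Theta>D(1)[OF \<theta>]] Mn(1) n
      by (intro mult_mono frac_le) auto
    ultimately have "\<bar>xi4 \<sigma> b \<theta> \<xi>\<bar> \<le> Mn' * sqrt C * (C3 * norm \<xi>) + Mn / (2 * sqrt c) * norm \<xi>"
      unfolding xi4_def deriv_n[OF \<Theta>D(1)[OF \<theta>]] by linarith
    then show ?thesis by (simp add: C4_def distrib_right)
  qed
  show ?thesis
  proof (rule that[of "C3 + C4"])
    fix \<theta> \<xi> :: "real^2" assume \<theta>: "\<theta> \<in> \<Theta>"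
    have "C3 * norm \<xi> \<le> (C3 + C4) * norm \<xi>" "C4 * norm \<xi> \<le> (C3 + C4) * norm \<xi>"
      using C3 C4 by (auto intro!: mult_right_mono)
    then show "\<bar>xi3 \<sigma> b \<theta> \<xi>\<bar> \<le> (C3 + C4) * norm \<xi>" "\<bar>xi4 \<sigma> b \<theta> \<xi>\<bar> \<le> (C3 + C4) * norm \<xi>"
      using x3[OF \<theta>, of \<xi>] x4[OF \<theta>, of \<xi>] by linarith+
  qed (use C3 C4 in simp)
qed

text \<open>The first coordinate is recovered from a quotient of the moments through
  \<open>h_fun\<close>, the second from \<open>n_fun\<close> times a square root. Each ingredient is
  expanded to second order, and the positive lower bound of \<open>h_deriv\<close> converts an error
  in \<open>h_fun\<close> into one in its argument.\<close>

lemma inverse_second_order: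
  obtains C where "C > 0" "\<And>\<theta> \<phi>. \<theta> \<in> \<Theta> \<Longrightarrow> \<phi> \<in> \<Theta> \<Longrightarrow>
    \<bar>(\<phi> - \<theta>) $ 1 - xi3 \<sigma> b \<theta> (\<Phi> \<sigma> b \<phi> - \<Phi> \<sigma> b \<theta>)\<bar> \<le> C * (norm (\<Phi> \<sigma> b \<phi> - \<Phi> \<sigma> b \<theta>))\<^sup>2 \<and>
    \<bar>(\<phi> - \<theta>) $ 2 - xi4 \<sigma> b \<theta> (\<Phi> \<sigma> b \<phi> - \<Phi> \<sigma> b \<theta>)\<bar> \<le> C * (norm (\<Phi> \<sigma> b \<phi> - \<Phi> \<sigma> b \<theta>))\<^sup>2 \<and>
    \<bar>(\<phi> - \<theta>) $ 1\<bar> \<le> C * norm (\<Phi> \<sigma> b \<phi> - \<Phi> \<sigma> b \<theta>)"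
proof -
  obtain m where m: "m > 0" "\<And>x. x \<in> {\<alpha>a..\<beta>a} \<Longrightarrow> m \<le> h_deriv x" by (rule h_deriv_lower) blast
  obtain c C where c: "c > 0" "C > 0" "\<And>\<theta>. \<theta> \<in> \<Theta> \<Longrightarrow> c \<le> \<Phi>2 b \<theta> \<and> \<Phi>2 b \<theta> \<le> C"
    "\<And>\<theta>. \<theta> \<in> \<Theta> \<Longrightarrow> \<bar>\<Phi>1 \<sigma> b \<theta> - \<sigma>\<^sup>2\<bar> \<le> C" by (rule \<Phi>_bounds) blast
  obtain Mh where Mh: "Mh > 0" "\<And>x. x \<in> {\<alpha>a..\<beta>a} \<Longrightarrow> \<bar>h_deriv2 x\<bar> \<le> Mh"
    by (rule continuous_bounded_on_interval[OF continuous_derivs(2)]) blast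
  obtain Mn where Mn: "Mn > 0" "\<And>x. x \<in> {\<alpha>a..\<beta>a} \<Longrightarrow> \<bar>n_fun b x\<bar> \<le> Mn"
    by (rule continuous_bounded_on_interval[OF continuous_derivs(3)]) blast
  obtain Mn1 where Mn1: "Mn1 > 0" "\<And>x. x \<in> {\<alpha>a..\<beta>a} \<Longrightarrow> \<bar>n_deriv b x\<bar> \<le> Mn1"
    by (rule continuous_bounded_on_interval[OF continuous_derivs(4)]) blast
  obtain Mn2 where Mn2: "Mn2 > 0" "\<And>x. x \<in> {\<alpha>a..\<beta>a} \<Longrightarrow> \<bar>n_deriv2 b x\<bar> \<le> Mn2"
    by (rule continuous_bounded_on_interval[OF continuous_derivs(5)]) blast
  \<comment> \<open>\<open>Ca\<close> is a Lipschitz constant for the first coordinate as a function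
    of the moments; \<open>C3\<close> and \<open>C4\<close> are the second-order constants of the
    two coordinates.\<close>
  define Ca where "Ca = C / c\<^sup>2 / m"
  define C3 where "C3 = (Mh * Ca\<^sup>2 + C / c ^ 3) / m"
  define C4 where "C4 = sqrt C * (Mn2 * Ca\<^sup>2 + Mn1 * C3) + Mn / (2 * c * sqrt c) + Mn1 * Ca / sqrt c"
  have Ca: "Ca > 0" using c m by (simp add: Ca_def)
  have C3: "C3 > 0" using c m Mh Ca by (auto simp: C3_def intro!: add_pos_pos divide_pos_pos mult_pos_pos)
  have C4: "C4 > 0" using c Mn Mn1 Mn2 Ca C3 by (auto simp: C4_def intro!: add_pos_pos divide_pos_pos mult_pos_pos)
  have main: "\<bar>(\<phi> - \<theta>) $ 1 - xi3 \<sigma> b \<theta> (\<Phi> \<sigma> b \<phi> - \<Phi> \<sigma> b \<theta>)\<bar> \<le> C3 * (norm (\<Phi> \<sigma> b \<phi> - \<Phi> \<sigma> b \<theta>))\<^sup>2"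
    "\<bar>(\<phi> - \<theta>) $ 2 - xi4 \<sigma> b \<theta> (\<Phi> \<sigma> b \<phi> - \<Phi> \<sigma> b \<theta>)\<bar> \<le> C4 * (norm (\<Phi> \<sigma> b \<phi> - \<Phi> \<sigma> b \<theta>))\<^sup>2"
    "\<bar>(\<phi> - \<theta>) $ 1\<bar> \<le> Ca * norm (\<Phi> \<sigma> b \<phi> - \<Phi> \<sigma> b \<theta>)"
    if \<theta>: "\<theta> \<in> \<Theta>" and \<phi>: "\<phi> \<in> \<Theta>" for \<theta> \<phi>
  proof -
    define d where "d = norm (\<Phi> \<sigma> b \<phi> - \<Phi> \<sigma> b \<theta>)"
    have d0: "d \<ge> 0" by (simp add: d_def)
    define a a0 where "a = \<phi> $ 1" and "a0 = \<theta> $ 1"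
    define x x0 where "x = \<Phi>1 \<sigma> b \<phi> - \<sigma>\<^sup>2" and "x0 = \<Phi>1 \<sigma> b \<theta> - \<sigma>\<^sup>2"
    define y y0 where "y = \<Phi>2 b \<phi>" and "y0 = \<Phi>2 b \<theta>"
    have a: "a \<in> {\<alpha>a..\<beta>a}" "a0 \<in> {\<alpha>a..\<beta>a}" using \<Theta>D \<theta> \<phi> by (auto simp: a_def a0_def)
    have comp: "(\<Phi> \<sigma> b \<phi> - \<Phi> \<sigma> b \<theta>) $ 1 = x - x0" "(\<Phi> \<sigma> b \<phi> - \<Phi> \<sigma> b \<theta>) $ 2 = y - y0"
      by (auto simp: \<Phi>_def x_def x0_def y_def y0_def)
    have dx: "\<bar>x - x0\<bar> \<le> d" "\<bar>y - y0\<bar> \<le> d"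
      using component_le_norm_cart[of "\<Phi> \<sigma> b \<phi> - \<Phi> \<sigma> b \<theta>" 1] component_le_norm_cart[of "\<Phi> \<sigma> b \<phi> - \<Phi> \<sigma> b \<theta>" 2]
      unfolding comp d_def by auto
    have y: "c \<le> y" "c \<le> y0" "y \<le> C" "y0 \<le> C" using c(3) \<theta> \<phi> by (auto simp: y_def y0_def)
    have y_pos: "y > 0" "y0 > 0" using y c(1) by auto
    have x_le: "\<bar>x0\<bar> \<le> C" using c(4)[OF \<theta>] by (simp add: x0_def)
    have z: "x / (2 * y) = h_fun a" "x0 / (2 * y0) = h_fun a0"
      using ratio_eq_h[OF \<Theta>D(2)[OF \<phi>] \<Theta>D(3)[OF \<phi>] b] ratio_eq_h[OF \<Theta>D(2)[OF \<theta>] \<Theta>D(3)[OF \<theta>] b]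
      by (auto simp: x_def x0_def y_def y0_def a_def a0_def)
    \<comment> \<open>The differential at \<open>(x0, y0)\<close> of the quotient
      \<open>x / (2 * y)\<close>.\<close>
    define lin where "lin = (x - x0) / (2 * y0) - x0 * (y - y0) / (2 * y0\<^sup>2)"
    have num: "\<bar>x0 * (y - y0) - y0 * (x - x0)\<bar> \<le> 2 * C * d"
    proof -
      have "\<bar>x0 * (y - y0)\<bar> \<le> C * d" "\<bar>y0 * (x - x0)\<bar> \<le> C * d"
        unfolding abs_mult using x_le dx y y_pos c by (auto intro!: mult_mono)
      then show ?thesis by linarith
    qed
    have hz: "\<bar>h_fun a - h_fun a0\<bar> \<le> C / c\<^sup>2 * d"
    proof -
      have "h_fun a - h_fun a0 = - (x0 * (y - y0) - y0 * (x - x0)) / (2 * (y * y0))"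
        unfolding z[symmetric] using y_pos by (simp add: field_simps)
      then have "\<bar>h_fun a - h_fun a0\<bar> = \<bar>x0 * (y - y0) - y0 * (x - x0)\<bar> / (2 * (y * y0))"
        using y_pos by (simp add: abs_mult)
      also have "\<dots> \<le> 2 * C * d / (2 * (c * c))"
        using num y c by (intro frac_le mult_left_mono mult_mono) auto
      finally show ?thesis by (simp add: power2_eq_square)
    qed
    have hq: "\<bar>h_fun a - h_fun a0 - lin\<bar> \<le> C / c ^ 3 * d\<^sup>2"
    proof -
      have "h_fun a - h_fun a0 - lin = (y - y0) * (x0 * (y - y0) - y0 * (x - x0)) / (2 * (y0 * y0 * y))"
        unfolding z[symmetric] lin_def using y_pos by (simp add: field_simps power2_eq_square)
      then have "\<bar>h_fun a - h_fun a0 - lin\<bar> = \<bar>y - y0\<bar> * \<bar>x0 * (y - y0) - y0 * (x - x0)\<bar> / (2 * (y0 * y0 * y))"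
        using y_pos by (simp add: abs_mult)
      also have "\<dots> \<le> d * (2 * C * d) / (2 * (c * c * c))"
        using num dx y c d0 by (intro frac_le mult_left_mono mult_mono) auto
      finally show ?thesis by (simp add: power2_eq_square power3_eq_cube mult_ac)
    qed
    have hd: "(h_fun has_real_derivative h_deriv x) (at x)" "(h_deriv has_real_derivative h_deriv2 x) (at x)"
      "(n_fun b has_real_derivative n_deriv b x) (at x)" "(n_deriv b has_real_derivative n_deriv2 b x) (at x)"
      if "x \<in> {\<alpha>a..\<beta>a}" for x
      using that \<alpha>a b h_has_derivative h_deriv_has_derivative n_has_derivative n_deriv_has_derivative by auto
    have ad: "\<bar>a - a0\<bar> \<le> Ca * d"
    proof -
      obtain t where t: "t \<in> {\<alpha>a..\<beta>a}" "h_fun a - h_fun a0 = h_deriv t * (a - a0)"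
        by (rule mean_value_interval[OF hd(1) a(2,1)])
      have "m * \<bar>a - a0\<bar> \<le> \<bar>h_deriv t\<bar> * \<bar>a - a0\<bar>"
        using m(2)[OF t(1)] by (intro mult_right_mono) auto
      also have "\<dots> \<le> C / c\<^sup>2 * d" using hz unfolding t(2) abs_mult .
      finally have "\<bar>a - a0\<bar> * m \<le> C / c\<^sup>2 * d" by (simp only: mult.commute[of m])
      then have "\<bar>a - a0\<bar> \<le> C / c\<^sup>2 * d / m" by (rule pos_le_divide_eq[OF m(1), THEN iffD2])
      then show ?thesis by (simp add: Ca_def mult_ac)
    qed
    then show "\<bar>(\<phi> - \<theta>) $ 1\<bar> \<le> Ca * norm (\<Phi> \<sigma> b \<phi> - \<Phi> \<sigma> b \<theta>)" by (simp add: a_def a0_def d_def)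
    have ad2: "(a - a0)\<^sup>2 \<le> Ca\<^sup>2 * d\<^sup>2"
      using power_mono[OF ad abs_ge_zero, of 2] by (simp add: power_mult_distrib)
    define X3 where "X3 = xi3 \<sigma> b \<theta> (\<Phi> \<sigma> b \<phi> - \<Phi> \<sigma> b \<theta>)"
    have h0: "h_deriv a0 \<ge> m" "h_deriv a0 > 0" using m(2)[OF a(2)] m(1) by auto
    \<comment> \<open>\<open>xi3\<close> is the solution of the linearized equation for the first
      coordinate.\<close>
    have X3: "h_deriv a0 * X3 = lin"
      unfolding X3_def xi3_def comp a0_def[symmetric] x0_def[symmetric] y0_def[symmetric] deriv_h[OF a(2)] lin_def
      using h0 y_pos by (simp add: field_simps power2_eq_square)
    have e3: "\<bar>a - a0 - X3\<bar> \<le> C3 * d\<^sup>2"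
    proof -
      have "\<bar>h_fun a - h_fun a0 - h_deriv a0 * (a - a0)\<bar> \<le> Mh * (a - a0)\<^sup>2"
        by (rule second_order_remainder[OF hd(1,2) Mh(2) a(2,1)])
      also have "\<dots> \<le> Mh * (Ca\<^sup>2 * d\<^sup>2)" using ad2 Mh(1) by (intro mult_left_mono) auto
      finally have "\<bar>h_deriv a0 * (a - a0) - lin\<bar> \<le> Mh * (Ca\<^sup>2 * d\<^sup>2) + C / c ^ 3 * d\<^sup>2"
        using hq by linarith
      also have "h_deriv a0 * (a - a0) - lin = h_deriv a0 * (a - a0 - X3)"
        unfolding X3[symmetric] by (simp add: right_diff_distrib)
      finally have "h_deriv a0 * \<bar>a - a0 - X3\<bar> \<le> Mh * (Ca\<^sup>2 * d\<^sup>2) + C / c ^ 3 * d\<^sup>2"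
        using h0 by (simp add: abs_mult)
      moreover have "m * \<bar>a - a0 - X3\<bar> \<le> h_deriv a0 * \<bar>a - a0 - X3\<bar>"
        using h0 by (intro mult_right_mono) auto
      ultimately have "m * \<bar>a - a0 - X3\<bar> \<le> (Mh * Ca\<^sup>2 + C / c ^ 3) * d\<^sup>2" by (simp add: distrib_right mult.assoc)
      then show ?thesis using m(1) by (simp add: C3_def field_simps)
    qed
    then show "\<bar>(\<phi> - \<theta>) $ 1 - xi3 \<sigma> b \<theta> (\<Phi> \<sigma> b \<phi> - \<Phi> \<sigma> b \<theta>)\<bar> \<le> C3 * (norm (\<Phi> \<sigma> b \<phi> - \<Phi> \<sigma> b \<theta>))\<^sup>2"
      by (simp add: a_def a0_def X3_def d_def)
    define dn where "dn = n_fun b a - n_fun b a0"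
    define ds where "ds = sqrt y - sqrt y0"
    define rn where "rn = dn - n_deriv b a0 * (a - a0)"
    have rn: "\<bar>rn\<bar> \<le> Mn2 * Ca\<^sup>2 * d\<^sup>2"
    proof -
      have "\<bar>rn\<bar> \<le> Mn2 * (a - a0)\<^sup>2"
        unfolding rn_def dn_def by (rule second_order_remainder[OF hd(3,4) Mn2(2) a(2,1)])
      also have "\<dots> \<le> Mn2 * (Ca\<^sup>2 * d\<^sup>2)" using ad2 Mn2(1) by (intro mult_left_mono) auto
      finally show ?thesis by (simp add: mult.assoc)
    qed
    have dn: "\<bar>dn\<bar> \<le> Mn1 * Ca * d"
    proof -
      obtain t where t: "t \<in> {\<alpha>a..\<beta>a}" "n_fun b a - n_fun b a0 = n_deriv b t * (a - a0)"
        by (rule mean_value_interval[OF hd(3) a(2,1)])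
      have "\<bar>dn\<bar> \<le> Mn1 * (Ca * d)"
        unfolding dn_def t(2) abs_mult using Mn1(2)[OF t(1)] Mn1(1) ad by (intro mult_mono) auto
      then show ?thesis by (simp add: mult.assoc)
    qed
    have ds_eq: "ds * (sqrt y + sqrt y0) = y - y0"
      using y_pos by (simp add: ds_def algebra_simps)
    have ds: "\<bar>ds\<bar> \<le> d / sqrt c"
    proof -
      have "sqrt c * \<bar>ds\<bar> \<le> (sqrt y + sqrt y0) * \<bar>ds\<bar>"
        using y c by (intro mult_right_mono add_increasing2) auto
      also have "\<dots> = \<bar>y - y0\<bar>"
        unfolding ds_eq[symmetric] abs_mult using y_pos by (simp add: mult.commute)
      finally show ?thesis using dx c by (simp add: field_simps)
    qed
    define rs where "rs = ds - (y - y0) / (2 * sqrt y0)"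
    have rs: "\<bar>rs\<bar> \<le> d\<^sup>2 / (2 * c * sqrt c)"
    proof -
      \<comment> \<open>The remainder of the square root is exact, because the difference
        \<open>y - y0\<close> factors through the sum of the two roots.\<close>
      have "rs = - ds\<^sup>2 / (2 * sqrt y0)"
        unfolding rs_def ds_eq[symmetric] using y_pos by (simp add: ds_def field_simps power2_eq_square)
      then have "\<bar>rs\<bar> = ds\<^sup>2 / (2 * sqrt y0)" using y_pos by simp
      also have "\<dots> \<le> (d / sqrt c)\<^sup>2 / (2 * sqrt c)"
        using power_mono[OF ds abs_ge_zero, of 2] y c by (intro frac_le) auto
      also have "\<dots> = d\<^sup>2 / (2 * c * sqrt c)" using c by (simp add: power_divide)
      finally show ?thesis .
    qed
    have ff: "(\<phi> - \<theta>) $ 2 = n_fun b a * sqrt y - n_fun b a0 * sqrt y0"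
      using second_component_eq[OF \<Theta>D(2)[OF \<phi>] \<Theta>D(3)[OF \<phi>] b] second_component_eq[OF \<Theta>D(2)[OF \<theta>] \<Theta>D(3)[OF \<theta>] b]
      by (simp add: a_def a0_def y_def y0_def)
    have X4: "xi4 \<sigma> b \<theta> (\<Phi> \<sigma> b \<phi> - \<Phi> \<sigma> b \<theta>) = n_deriv b a0 * sqrt y0 * X3 + n_fun b a0 * ((y - y0) / (2 * sqrt y0))"
      unfolding xi4_def comp a0_def[symmetric] y0_def[symmetric] deriv_n[OF a(2)] X3_def by simp
    \<comment> \<open>The product rule with all remainders kept; the last summand is the product of
      the two increments, each of order \<open>d\<close>.\<close>
    have "(\<phi> - \<theta>) $ 2 - xi4 \<sigma> b \<theta> (\<Phi> \<sigma> b \<phi> - \<Phi> \<sigma> b \<theta>) =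
        sqrt y0 * (rn + n_deriv b a0 * (a - a0 - X3)) + n_fun b a0 * rs + dn * ds"
      unfolding ff X4 rn_def rs_def dn_def ds_def by (simp add: algebra_simps)
    moreover have "\<bar>sqrt y0 * (rn + n_deriv b a0 * (a - a0 - X3))\<bar> \<le> sqrt C * (Mn2 * Ca\<^sup>2 * d\<^sup>2 + Mn1 * (C3 * d\<^sup>2))"
    proof -
      have "\<bar>n_deriv b a0 * (a - a0 - X3)\<bar> \<le> Mn1 * (C3 * d\<^sup>2)"
        unfolding abs_mult using Mn1(2)[OF a(2)] Mn1(1) e3 by (intro mult_mono) auto
      then have "\<bar>rn + n_deriv b a0 * (a - a0 - X3)\<bar> \<le> Mn2 * Ca\<^sup>2 * d\<^sup>2 + Mn1 * (C3 * d\<^sup>2)"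
        using rn by linarith
      then show ?thesis unfolding abs_mult using y y_pos c by (intro mult_mono) auto
    qed
    moreover have "\<bar>n_fun b a0 * rs\<bar> \<le> Mn * (d\<^sup>2 / (2 * c * sqrt c))"
      unfolding abs_mult using Mn(2)[OF a(2)] Mn(1) rs by (intro mult_mono) auto
    moreover have "\<bar>dn * ds\<bar> \<le> (Mn1 * Ca * d) * (d / sqrt c)"
      unfolding abs_mult using dn ds Mn1(1) Ca d0 by (intro mult_mono) auto
    ultimately have "\<bar>(\<phi> - \<theta>) $ 2 - xi4 \<sigma> b \<theta> (\<Phi> \<sigma> b \<phi> - \<Phi> \<sigma> b \<theta>)\<bar> \<le>
        sqrt C * (Mn2 * Ca\<^sup>2 * d\<^sup>2 + Mn1 * (C3 * d\<^sup>2)) + Mn * (d\<^sup>2 / (2 * c * sqrt c)) + (Mn1 * Ca * d) * (d / sqrt c)"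
      by linarith
    also have "\<dots> = C4 * d\<^sup>2" by (simp add: C4_def algebra_simps power2_eq_square add_divide_distrib)
    finally show "\<bar>(\<phi> - \<theta>) $ 2 - xi4 \<sigma> b \<theta> (\<Phi> \<sigma> b \<phi> - \<Phi> \<sigma> b \<theta>)\<bar> \<le> C4 * (norm (\<Phi> \<sigma> b \<phi> - \<Phi> \<sigma> b \<theta>))\<^sup>2"
      by (simp add: d_def)
  qed
  have mono: "C3 * t \<le> (Ca + C3 + C4) * t" "C4 * t \<le> (Ca + C3 + C4) * t" "Ca * t \<le> (Ca + C3 + C4) * t" if "t \<ge> 0" for t
    using that Ca C3 C4 by (auto intro!: mult_right_mono)
  show ?thesis
  proof (rule that[of "Ca + C3 + C4"])
    show "Ca + C3 + C4 > 0" using Ca C3 C4 by simp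
    fix \<theta> \<phi> assume "\<theta> \<in> \<Theta>" "\<phi> \<in> \<Theta>"
    from main[OF this] mono show "\<bar>(\<phi> - \<theta>) $ 1 - xi3 \<sigma> b \<theta> (\<Phi> \<sigma> b \<phi> - \<Phi> \<sigma> b \<theta>)\<bar> \<le> (Ca + C3 + C4) * (norm (\<Phi> \<sigma> b \<phi> - \<Phi> \<sigma> b \<theta>))\<^sup>2 \<and>
      \<bar>(\<phi> - \<theta>) $ 2 - xi4 \<sigma> b \<theta> (\<Phi> \<sigma> b \<phi> - \<Phi> \<sigma> b \<theta>)\<bar> \<le> (Ca + C3 + C4) * (norm (\<Phi> \<sigma> b \<phi> - \<Phi> \<sigma> b \<theta>))\<^sup>2 \<and>
      \<bar>(\<phi> - \<theta>) $ 1\<bar> \<le> (Ca + C3 + C4) * norm (\<Phi> \<sigma> b \<phi> - \<Phi> \<sigma> b \<theta>)"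
      by (meson norm_ge_zero order_trans zero_le_power2)
  qed
qed

lemma xi_star_linear: "xi_star \<sigma> b \<theta> \<xi> = (\<chi> i j. xi_star \<sigma> b \<theta> (axis j 1) $ i) *v \<xi>"
  by (simp add: vec_eq_iff forall_2 matrix_vector_mult_def sum_2 xi_star_def xi4_def xi3_def axis_def algebra_simps
      add_divide_distrib diff_divide_distrib)

lemma norm_vector2_le: "norm v \<le> \<bar>v $ 1\<bar> + \<bar>v $ 2\<bar>" for v :: "real^2"
  using norm_le_l1_cart[of v] by (simp add: sum_2)

lemma \<Theta>_open: "open \<Theta>"
proof -
  have "\<Theta> = {\<theta>. \<alpha>a < \<theta> $ 1} \<inter> {\<theta>. \<theta> $ 1 < \<beta>a} \<inter> {\<theta>. \<alpha>f < \<theta> $ 2} \<inter> {\<theta>. \<theta> $ 2 < \<beta>f}"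
    by (auto simp: \<Theta>_def)
  also have "open \<dots>" by (intro open_Int open_Collect_less continuous_intros)
  finally show ?thesis .
qed

lemma \<Phi>_continuous: "continuous_on \<Theta> (\<Phi> \<sigma> b)"
proof -
  have nz: "\<theta> $ 1 \<noteq> 0" if "\<theta> \<in> \<Theta>" for \<theta> using \<Theta>D(2)[OF that] by simp
  have "continuous_on \<Theta> (\<Phi>1 \<sigma> b)" "continuous_on \<Theta> (\<Phi>2 b)"
    unfolding \<Phi>1_def[abs_def] \<Phi>2_def[abs_def] Let_def using nz by (auto intro!: continuous_intros)
  then have "continuous_on \<Theta> (\<lambda>\<theta>. \<Phi> \<sigma> b \<theta> $ i)" for i
    using exhaust_2[of i] by (auto simp: \<Phi>_def)
  then show ?thesis by (subst continuous_on_componentwise) (auto simp: Basis_vec_def inner_axis)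
qed

text \<open>A deterministic statement to be applied at each sample point: \<open>R\<close> stands
  for the observed statistics and \<open>\<phi>\<close> for the estimate, and the implication
  required of \<open>\<phi>\<close> is the one in \<open>moments_estimator\<close>.\<close>

theorem delta_method:
  assumes K: "compact K" "K \<subseteq> \<Theta>"
  obtains C where "C > 0" "\<And>\<theta> \<phi> R. \<theta> \<in> K \<Longrightarrow> \<phi> \<in> \<Theta> \<Longrightarrow> (\<exists>\<theta>'\<in>\<Theta>. \<Phi> \<sigma> b \<theta>' = R) \<longrightarrow> \<Phi> \<sigma> b \<phi> = R \<Longrightarrow>
    norm (\<phi> - \<theta> - xi_star \<sigma> b \<theta> (R - \<Phi> \<sigma> b \<theta>)) \<le> C * (norm (R - \<Phi> \<sigma> b \<theta>))\<^sup>2"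
proof -
  obtain C1 where C1: "C1 > 0" "\<And>\<theta> \<phi>. \<theta> \<in> \<Theta> \<Longrightarrow> \<phi> \<in> \<Theta> \<Longrightarrow>
    \<bar>(\<phi> - \<theta>) $ 1 - xi3 \<sigma> b \<theta> (\<Phi> \<sigma> b \<phi> - \<Phi> \<sigma> b \<theta>)\<bar> \<le> C1 * (norm (\<Phi> \<sigma> b \<phi> - \<Phi> \<sigma> b \<theta>))\<^sup>2 \<and>
    \<bar>(\<phi> - \<theta>) $ 2 - xi4 \<sigma> b \<theta> (\<Phi> \<sigma> b \<phi> - \<Phi> \<sigma> b \<theta>)\<bar> \<le> C1 * (norm (\<Phi> \<sigma> b \<phi> - \<Phi> \<sigma> b \<theta>))\<^sup>2 \<and>
    \<bar>(\<phi> - \<theta>) $ 1\<bar> \<le> C1 * norm (\<Phi> \<sigma> b \<phi> - \<Phi> \<sigma> b \<theta>)"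
    by (rule inverse_second_order) blast
  obtain C2 where C2: "C2 > 0" "\<And>\<theta> \<xi>. \<theta> \<in> \<Theta> \<Longrightarrow> \<bar>xi3 \<sigma> b \<theta> \<xi>\<bar> \<le> C2 * norm \<xi>" "\<And>\<theta> \<xi>. \<theta> \<in> \<Theta> \<Longrightarrow> \<bar>xi4 \<sigma> b \<theta> \<xi>\<bar> \<le> C2 * norm \<xi>"
    by (rule xi_bounded) blast
  have xs: "xi_star \<sigma> b \<theta> \<xi> $ 1 = xi3 \<sigma> b \<theta> \<xi>" "xi_star \<sigma> b \<theta> \<xi> $ 2 = xi4 \<sigma> b \<theta> \<xi>" for \<theta> \<xi>
    by (auto simp: xi_star_def)
  \<comment> \<open>Injectivity is the second-order estimate read for equal moments.\<close>
  have inj: "inj_on (\<Phi> \<sigma> b) \<Theta>"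
  proof (rule inj_onI)
    fix \<theta> \<phi> assume *: "\<theta> \<in> \<Theta>" "\<phi> \<in> \<Theta>" "\<Phi> \<sigma> b \<theta> = \<Phi> \<sigma> b \<phi>"
    then have "\<bar>(\<phi> - \<theta>) $ 1 - xi3 \<sigma> b \<theta> 0\<bar> \<le> 0" "\<bar>(\<phi> - \<theta>) $ 2 - xi4 \<sigma> b \<theta> 0\<bar> \<le> 0"
      using C1(2)[OF *(1,2)] by auto
    moreover have "xi3 \<sigma> b \<theta> 0 = 0" "xi4 \<sigma> b \<theta> 0 = 0" by (auto simp: xi3_def xi4_def)
    ultimately show "\<theta> = \<phi>" by (simp add: vec_eq_iff forall_2)
  qed
  have "open (\<Phi> \<sigma> b ` \<Theta>)" by (rule invariance_of_domain[OF \<Phi>_continuous \<Theta>_open inj])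
  moreover have "compact (\<Phi> \<sigma> b ` K)"
    by (rule compact_continuous_image[OF continuous_on_subset[OF \<Phi>_continuous K(2)] K(1)])
  \<comment> \<open>A radius such that every point within distance \<open>e\<close> of the image of
    \<open>K\<close> is the moment vector of some parameter in the box.\<close>
  ultimately obtain e where e: "e > 0" "(\<Union>x\<in>\<Phi> \<sigma> b ` K. ball x e) \<subseteq> \<Phi> \<sigma> b ` \<Theta>"
    using compact_subset_open_imp_ball_epsilon_subset[of "\<Phi> \<sigma> b ` K" "\<Phi> \<sigma> b ` \<Theta>"] K(2) by (metis image_mono)
  define Dm where "Dm = (\<beta>a - \<alpha>a) + (\<beta>f - \<alpha>f)"
  have Dm: "Dm > 0" using nonempty by (simp add: Dm_def)
  \<comment> \<open>The first summand serves the solvable case. In the other case \<open>d\<close>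
    is at least \<open>e\<close>, which turns the diameter bound \<open>Dm\<close> and the linear
    bound \<open>2 * C2 * d\<close> into multiples of \<open>d\<^sup>2\<close>.\<close>
  define C where "C = 2 * C1 + (Dm / e\<^sup>2 + 2 * C2 / e)"
  have Cp: "C > 0" using C1(1) Dm C2(1) e(1) by (auto simp: C_def intro!: add_pos_pos)
  show ?thesis
  proof (rule that[OF Cp])
    fix \<theta> \<phi> R assume \<theta>: "\<theta> \<in> K" and \<phi>: "\<phi> \<in> \<Theta>" and sol: "(\<exists>\<theta>'\<in>\<Theta>. \<Phi> \<sigma> b \<theta>' = R) \<longrightarrow> \<Phi> \<sigma> b \<phi> = R"
    have \<theta>': "\<theta> \<in> \<Theta>" using \<theta> K by auto
    define d where "d = norm (R - \<Phi> \<sigma> b \<theta>)"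
    show "norm (\<phi> - \<theta> - xi_star \<sigma> b \<theta> (R - \<Phi> \<sigma> b \<theta>)) \<le> C * (norm (R - \<Phi> \<sigma> b \<theta>))\<^sup>2"
    proof (cases "R \<in> \<Phi> \<sigma> b ` \<Theta>")
      case True
      then have R: "\<Phi> \<sigma> b \<phi> = R" using sol by auto
      have "norm (\<phi> - \<theta> - xi_star \<sigma> b \<theta> (R - \<Phi> \<sigma> b \<theta>)) \<le>
          \<bar>(\<phi> - \<theta>) $ 1 - xi3 \<sigma> b \<theta> (R - \<Phi> \<sigma> b \<theta>)\<bar> + \<bar>(\<phi> - \<theta>) $ 2 - xi4 \<sigma> b \<theta> (R - \<Phi> \<sigma> b \<theta>)\<bar>"
        using norm_vector2_le[of "\<phi> - \<theta> - xi_star \<sigma> b \<theta> (R - \<Phi> \<sigma> b \<theta>)"] by (simp add: xs)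
      also have "\<dots> \<le> 2 * C1 * d\<^sup>2" using C1(2)[OF \<theta>' \<phi>] unfolding R d_def by auto
      also have "\<dots> \<le> C * d\<^sup>2"
        using Dm C2(1) e(1) by (intro mult_right_mono) (auto simp: C_def)
      finally show ?thesis by (simp add: d_def)
    next
      case False
      moreover have "ball (\<Phi> \<sigma> b \<theta>) e \<subseteq> \<Phi> \<sigma> b ` \<Theta>" using e(2) \<theta> by blast
      ultimately have "R \<notin> ball (\<Phi> \<sigma> b \<theta>) e" by blast
      then have de: "e \<le> d" by (simp add: d_def dist_norm norm_minus_commute)
      have "norm (\<phi> - \<theta>) \<le> Dm"
      proof -
        have "\<bar>(\<phi> - \<theta>) $ 1\<bar> \<le> \<beta>a - \<alpha>a" "\<bar>(\<phi> - \<theta>) $ 2\<bar> \<le> \<beta>f - \<alpha>f"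
          using \<phi> \<theta>' by (auto simp: \<Theta>_def abs_le_iff)
        then show ?thesis using norm_vector2_le[of "\<phi> - \<theta>"] by (simp add: Dm_def)
      qed
      also have "Dm \<le> Dm / e\<^sup>2 * d\<^sup>2"
      proof -
        have "1 \<le> d\<^sup>2 / e\<^sup>2" using de e(1) by (simp add: power_mono)
        then show ?thesis using mult_left_mono[of 1 "d\<^sup>2 / e\<^sup>2" Dm] Dm by simp
      qed
      finally have 1: "norm (\<phi> - \<theta>) \<le> Dm / e\<^sup>2 * d\<^sup>2" .
      have "norm (xi_star \<sigma> b \<theta> (R - \<Phi> \<sigma> b \<theta>)) \<le> 2 * C2 * d"
        using norm_vector2_le[of "xi_star \<sigma> b \<theta> (R - \<Phi> \<sigma> b \<theta>)"] C2(2)[OF \<theta>', of "R - \<Phi> \<sigma> b \<theta>"] C2(3)[OF \<theta>', of "R - \<Phi> \<sigma> b \<theta>"]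
        by (simp add: xs d_def)
      also have "\<dots> \<le> 2 * C2 * (d * (d / e))"
      proof -
        have "1 \<le> d / e" using de e(1) by simp
        then show ?thesis using mult_left_mono[of 1 "d / e" "2 * C2 * d"] C2(1) de e(1) by (simp add: mult_ac)
      qed
      finally have 2: "norm (xi_star \<sigma> b \<theta> (R - \<Phi> \<sigma> b \<theta>)) \<le> 2 * C2 / e * d\<^sup>2" by (simp add: power2_eq_square)
      have "norm (\<phi> - \<theta> - xi_star \<sigma> b \<theta> (R - \<Phi> \<sigma> b \<theta>)) \<le> (Dm / e\<^sup>2 + 2 * C2 / e) * d\<^sup>2"
        using norm_triangle_ineq4[of "\<phi> - \<theta>" "xi_star \<sigma> b \<theta> (R - \<Phi> \<sigma> b \<theta>)"] 1 2 by (simp add: distrib_right)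
      also have "\<dots> \<le> C * d\<^sup>2" using C1(1) by (intro mult_right_mono) (auto simp: C_def)
      finally show ?thesis by (simp add: d_def)
    qed
  qed
qed

end

section \<open>The limit law of the statistics\<close>

lemma (in prob_family) bounded_moments_cong_AE:
  assumes X: "bounded_moments X" and Z: "\<And>i k. i \<in> I \<Longrightarrow> Z i k \<in> borel_measurable (P i)"
    and eq: "\<And>i k. i \<in> I \<Longrightarrow> AE \<omega> in P i. Z i k \<omega> = X i k \<omega>"
  shows "bounded_moments Z"
proof (rule bounded_momentsI[OF Z])
  fix n
  obtain C where C: "\<And>i k. i \<in> I \<Longrightarrow> (\<integral>\<omega>. \<bar>X i k \<omega>\<bar> ^ n \<partial>P i) \<le> C"
    by (rule bounded_moments_bound[OF X, of n]) blast
  have "integrable (P i) (\<lambda>\<omega>. \<bar>Z i k \<omega>\<bar> ^ n) \<and> (\<integral>\<omega>. \<bar>Z i k \<omega>\<bar> ^ n \<partial>P i) \<le> C" if i: "i \<in> I" for i k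
  proof -
    note [measurable] = Z[OF i, of k] bounded_moments_measurable[OF X i, of k]
    have "AE \<omega> in P i. \<bar>X i k \<omega>\<bar> ^ n = \<bar>Z i k \<omega>\<bar> ^ n"
      using eq[OF i, of k] by eventually_elim simp
    then have "integrable (P i) (\<lambda>\<omega>. \<bar>Z i k \<omega>\<bar> ^ n) \<longleftrightarrow> integrable (P i) (\<lambda>\<omega>. \<bar>X i k \<omega>\<bar> ^ n)"
      "(\<integral>\<omega>. \<bar>Z i k \<omega>\<bar> ^ n \<partial>P i) = (\<integral>\<omega>. \<bar>X i k \<omega>\<bar> ^ n \<partial>P i)"
      by (intro integrable_cong_AE integral_cong_AE; simp; eventually_elim; simp)+
    then show ?thesis using C[OF i, of k] bounded_moments_integrable_abs[OF X i, of k n] by simp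
  qed
  then show "\<exists>C. \<forall>i\<in>I. \<forall>k. integrable (P i) (\<lambda>\<omega>. \<bar>Z i k \<omega>\<bar> ^ n) \<and> (\<integral>\<omega>. \<bar>Z i k \<omega>\<bar> ^ n \<partial>P i) \<le> C"
    by blast
qed

text \<open>Passes from the whole box, where the statistics are controlled, to the compact set on
  which the estimator is.\<close>

lemma bounded_moments_subset:
  assumes "prob_family I P" "prob_family.bounded_moments I P X" "J \<subseteq> I"
  shows "prob_family.bounded_moments J P X"
proof -
  interpret I: prob_family I P by fact
  interpret J: prob_family J P by (rule prob_family.intro) (use I.prob assms(3) in auto)
  show ?thesis
  proof (rule J.bounded_momentsI)
    fix n
    obtain C where C: "\<And>i k. i \<in> I \<Longrightarrow> (\<integral>\<omega>. \<bar>X i k \<omega>\<bar> ^ n \<partial>P i) \<le> C"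
      by (rule I.bounded_moments_bound[OF assms(2), of n]) blast
    have "integrable (P i) (\<lambda>\<omega>. \<bar>X i k \<omega>\<bar> ^ n) \<and> (\<integral>\<omega>. \<bar>X i k \<omega>\<bar> ^ n \<partial>P i) \<le> C" if "i \<in> J" for i k
      using C[of i k] I.bounded_moments_integrable_abs[OF assms(2), of i k n] assms(3) that by blast
    then show "\<exists>C. \<forall>i\<in>J. \<forall>k. integrable (P i) (\<lambda>\<omega>. \<bar>X i k \<omega>\<bar> ^ n) \<and> (\<integral>\<omega>. \<bar>X i k \<omega>\<bar> ^ n \<partial>P i) \<le> C"
      by blast
  qed (use I.bounded_moments_measurable[OF assms(2)] assms(3) in auto)
qed

lemma uniform_limit_of_rate:
  fixes f :: "nat \<Rightarrow> 'i \<Rightarrow> 'b::real_normed_vector"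
  assumes "\<And>i T. i \<in> A \<Longrightarrow> T \<ge> 1 \<Longrightarrow> norm (f T i - g i) \<le> C / sqrt (real T)"
  shows "uniform_limit A f g sequentially"
proof (rule uniform_limitI)
  fix e :: real assume "e > 0"
  moreover have "(\<lambda>T. C / sqrt (real T)) \<longlonglongrightarrow> 0" by real_asymp
  ultimately have "eventually (\<lambda>T. C / sqrt (real T) < e) sequentially" by (auto intro: order_tendstoD)
  with eventually_ge_at_top[of 1] show "\<forall>\<^sub>F T in sequentially. \<forall>i\<in>A. dist (f T i) (g i) < e"
  proof eventually_elim
    case (elim T)
    then show ?case using assms[of _ T] by (auto simp: dist_norm intro: le_less_trans)
  qed
qed

text \<open>Reduces real exponents to the natural ones for which moments are controlled.\<close>

lemma abs_powr_le: "(x :: real) \<ge> 0 \<Longrightarrow> p \<ge> 0 \<Longrightarrow> x powr p \<le> 1 + x ^ nat \<lceil>p\<rceil>"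
proof (cases "x \<le> 1")
  case True
  assume "x \<ge> 0" "p \<ge> 0"
  then have "x powr p \<le> 1" using True by (simp add: powr_le1)
  then show ?thesis using \<open>x \<ge> 0\<close> by (smt (verit) zero_le_power)
next
  case False
  assume "x \<ge> 0" "p \<ge> 0"
  then have "x powr p \<le> x powr real (nat \<lceil>p\<rceil>)" using False by (intro powr_mono) (auto simp: real_nat_ceiling_ge)
  also have "\<dots> = x ^ nat \<lceil>p\<rceil>" using False by (simp add: powr_realpow)
  finally show ?thesis by simp
qed

locale observed_family = estimation_box \<alpha>a \<beta>a \<alpha>f \<beta>f \<sigma> b
  for \<alpha>a \<beta>a \<alpha>f \<beta>f \<sigma> b :: real +
  fixes P :: "real^2 \<Rightarrow> 'w measure" and X :: "real \<Rightarrow> 'w \<Rightarrow> real"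
    and Y W V :: "real^2 \<Rightarrow> real \<Rightarrow> 'w \<Rightarrow> real" and dx dy :: real
  assumes \<sigma>: "\<sigma> \<noteq> 0"
    and model: "\<And>\<theta>. \<theta> \<in> \<Theta> \<Longrightarrow> partially_observed_system (P \<theta>) (W \<theta>) (V \<theta>) X (Y \<theta>) \<sigma> b dx dy \<theta>"
begin

definition noise1 where "noise1 \<theta> = ou_noise (V \<theta>) (\<theta> $ 1) b"
definition noise2 where "noise2 \<theta> = obs_noise (W \<theta>) (V \<theta>) (\<theta> $ 1) b (\<theta> $ 2) \<sigma>"
definition past where "past \<theta> = history (P \<theta>) (W \<theta>) (V \<theta>) (Y \<theta>)"
definition rho where "rho \<theta> = exp (- \<theta> $ 1)" for \<theta> :: "real^2"
text \<open>The weight of the hidden state in the next increment: \<open>\<theta> $ 2\<close> times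
  the integral of \<open>exp (- \<theta> $ 1 * s)\<close> over the unit interval.\<close>

definition gain where "gain \<theta> = \<theta> $ 2 * (1 - exp (- \<theta> $ 1)) / \<theta> $ 1" for \<theta> :: "real^2"
text \<open>\<open>v11\<close>, \<open>v12\<close>, \<open>v22\<close> are the entries of the
  covariance of the noise pair as they appear in \<open>noise_combination_law\<close>.\<close>

definition v11 where "v11 \<theta> = b\<^sup>2 * (1 - (rho \<theta>)\<^sup>2) / (2 * \<theta> $ 1)" for \<theta> :: "real^2"
definition v12 where "v12 \<theta> = \<theta> $ 2 * b\<^sup>2 * (1 - rho \<theta>)\<^sup>2 / (2 * (\<theta> $ 1)\<^sup>2)" for \<theta> :: "real^2"
definition v22 where "v22 \<theta> = (\<theta> $ 2)\<^sup>2 * b\<^sup>2 / (\<theta> $ 1)\<^sup>2 * ((1 - (rho \<theta>)\<^sup>2) / (2 * \<theta> $ 1)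
  - 2 * (1 - rho \<theta>) / \<theta> $ 1 + 1) + \<sigma>\<^sup>2" for \<theta> :: "real^2"

sublocale prob_family \<Theta> P
proof (rule prob_family.intro)
  fix \<theta> assume "\<theta> \<in> \<Theta>"
  then interpret partially_observed_system "P \<theta>" "W \<theta>" "V \<theta>" X "Y \<theta>" \<sigma> b dx dy \<theta> by (rule model)
  show "prob_space (P \<theta>)" by (rule prob_space_axioms)
qed

sublocale filtered_family \<Theta> P past
proof
  fix \<theta> k assume "\<theta> \<in> \<Theta>"
  then interpret partially_observed_system "P \<theta>" "W \<theta>" "V \<theta>" X "Y \<theta>" \<sigma> b dx dy \<theta> by (rule model)
  show "subalgebra (P \<theta>) (past \<theta> k)" unfolding past_def by (rule history_subalgebra)
  show "subalgebra (past \<theta> (Suc k)) (past \<theta> k)" unfolding past_def by (rule history_mono)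
qed

text \<open>The sampled diffusion as an instance of the autoregression. The lower bound
  \<open>\<alpha>a\<close> on the drift coefficient gives the common contraction factor
  \<open>exp (- \<alpha>a)\<close> and bounds the reciprocals of \<open>\<theta> $ 1\<close> in the
  coefficients.\<close>

sublocale hidden_ar_family \<Theta> P past noise1 noise2 "\<lambda>\<theta>. Y \<theta> 0" rho gain v11 v12 v22 "exp (- \<alpha>a)"
proof
  have f: "bounded_moments (\<lambda>\<theta> k \<omega>. \<theta> $ 2)"
    by (rule bounded_moments_const[of _ "\<beta>f"]) (use \<alpha>f in \<open>auto simp: \<Theta>_def\<close>)
  have ia: "bounded_moments (\<lambda>\<theta> k \<omega>. 1 / \<theta> $ 1)"
    by (rule bounded_moments_const[of _ "1 / \<alpha>a"]) (use \<alpha>a in \<open>auto simp: \<Theta>_def frac_le\<close>)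
  have r: "bounded_moments (\<lambda>\<theta> k \<omega>. rho \<theta>)"
    by (rule bounded_moments_const[of _ 1]) (use \<alpha>a in \<open>auto simp: \<Theta>_def rho_def\<close>)
  note bm = bounded_moments_intros f ia r
  show g: "bounded_moments (\<lambda>\<theta> k \<omega>. gain \<theta>)"
  proof -
    have "bounded_moments (\<lambda>\<theta> k \<omega>. \<theta> $ 2 * (1 - rho \<theta>) * (1 / \<theta> $ 1))" by (intro bm)
    then show ?thesis by (simp add: gain_def rho_def)
  qed
  show "bounded_moments (\<lambda>\<theta> k \<omega>. v11 \<theta>)"
  proof -
    have "bounded_moments (\<lambda>\<theta> k \<omega>. b\<^sup>2 * (1 - (rho \<theta>)\<^sup>2) * (1 / 2) * (1 / \<theta> $ 1))" by (intro bm)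
    then show ?thesis by (simp add: v11_def)
  qed
  show "bounded_moments (\<lambda>\<theta> k \<omega>. v12 \<theta>)"
  proof -
    have "bounded_moments (\<lambda>\<theta> k \<omega>. \<theta> $ 2 * b\<^sup>2 * (1 - rho \<theta>)\<^sup>2 * (1 / 2) * (1 / \<theta> $ 1)\<^sup>2)" by (intro bm)
    then show ?thesis by (simp add: v12_def power_divide)
  qed
  show "bounded_moments (\<lambda>\<theta> k \<omega>. v22 \<theta>)"
  proof -
    have "bounded_moments (\<lambda>\<theta> k \<omega>. (\<theta> $ 2)\<^sup>2 * b\<^sup>2 * (1 / \<theta> $ 1)\<^sup>2 * ((1 - (rho \<theta>)\<^sup>2) * (1 / 2) * (1 / \<theta> $ 1)
      - 2 * (1 - rho \<theta>) * (1 / \<theta> $ 1) + 1) + \<sigma>\<^sup>2)" by (intro bm)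
    then show ?thesis by (simp add: v22_def power_divide)
  qed
  show "exp (- \<alpha>a) < 1" using \<alpha>a by simp
  show "bounded_moments (\<lambda>\<theta> k. Y \<theta> 0)"
  proof (rule normal_bounded_moments[of _ "\<lambda>_. dy\<^sup>2"])
    fix \<theta> assume "\<theta> \<in> \<Theta>"
    then interpret partially_observed_system "P \<theta>" "W \<theta>" "V \<theta>" X "Y \<theta>" \<sigma> b dx dy \<theta> by (rule model)
    show "Y \<theta> 0 \<in> borel_measurable (P \<theta>)" by (rule Y_random_variable) simp
    show "distr (P \<theta>) borel (Y \<theta> 0) = centred_normal (dy\<^sup>2)" by (rule Y_start)
  qed (auto intro: bounded_moments_numeral)
next
  fix \<theta> :: "real^2" and k :: nat assume \<theta>: "\<theta> \<in> \<Theta>"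
  then interpret S: partially_observed_system "P \<theta>" "W \<theta>" "V \<theta>" X "Y \<theta>" \<sigma> b dx dy \<theta> by (rule model)
  show "Y \<theta> 0 \<in> borel_measurable (past \<theta> 0)" unfolding past_def by (rule S.initial_value_history)
  show "noise1 \<theta> k \<in> borel_measurable (past \<theta> (Suc k))" "noise2 \<theta> k \<in> borel_measurable (past \<theta> (Suc k))"
    unfolding past_def noise1_def noise2_def by (rule S.noise_history)+
  show "0 \<le> rho \<theta>" "rho \<theta> \<le> exp (- \<alpha>a)" using \<theta> by (auto simp: rho_def \<Theta>_def)
  {
    fix Z :: "'w \<Rightarrow> real" and Q :: "real \<times> real \<Rightarrow> real"
    assume "Z \<in> borel_measurable (past \<theta> k)" "Q \<in> borel_measurable (borel \<Otimes>\<^sub>M borel)"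
    then show "S.indep_var borel Z borel (\<lambda>\<omega>. Q (noise1 \<theta> k \<omega>, noise2 \<theta> k \<omega>))"
      unfolding past_def noise1_def noise2_def by (rule S.noise_independent_of_history)
  }
  fix \<alpha> \<beta> :: real
  note l = S.noise_combination_law[OF \<Theta>D(2)[OF \<theta>], where \<alpha> = \<alpha> and \<beta> = \<beta>]
  show "0 \<le> \<alpha>\<^sup>2 * v11 \<theta> + 2 * \<alpha> * \<beta> * v12 \<theta> + \<beta>\<^sup>2 * v22 \<theta>"
    using l(2) by (simp add: v11_def v12_def v22_def rho_def)
  show "distr (P \<theta>) borel (\<lambda>\<omega>. \<alpha> * noise1 \<theta> k \<omega> + \<beta> * noise2 \<theta> k \<omega>) =
      centred_normal (\<alpha>\<^sup>2 * v11 \<theta> + 2 * \<alpha> * \<beta> * v12 \<theta> + \<beta>\<^sup>2 * v22 \<theta>)"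
    using l(1) by (simp add: v11_def v12_def v22_def rho_def noise1_def noise2_def)
qed

abbreviation "AR_Y \<equiv> hidden_ar_family.Y noise1 (\<lambda>\<theta>. Y \<theta> 0) rho"

lemma r0_eq: "\<theta> \<in> \<Theta> \<Longrightarrow> r0 \<theta> = \<Phi>1 \<sigma> b \<theta>" and r1_eq: "\<theta> \<in> \<Theta> \<Longrightarrow> r1 \<theta> = \<Phi>2 b \<theta>"
proof -
  assume \<theta>: "\<theta> \<in> \<Theta>"
  define a f e where "a = \<theta> $ 1" and "f = \<theta> $ 2" and "e = rho \<theta>"
  have a: "a > 0" using \<Theta>D(2)[OF \<theta>] by (simp add: a_def)
  have e: "1 - e\<^sup>2 \<noteq> 0" "e = exp (- a)" using \<rho>_square_less[OF \<theta>] by (auto simp: e_def rho_def a_def)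
  \<comment> \<open>The stationary variance of the hidden process is
    \<open>b\<^sup>2 / (2 * a)\<close>, independent of the sampling.\<close>
  have k: "ar_kappa (rho \<theta>) (gain \<theta>) * v11 \<theta> = (gain \<theta>)\<^sup>2 * (b\<^sup>2 / (2 * a))"
    using e by (simp add: ar_kappa_def v11_def a_def e_def)
  have g: "gain \<theta> = f * (1 - e) / a" by (simp add: gain_def f_def a_def e_def rho_def)
  show "r0 \<theta> = \<Phi>1 \<sigma> b \<theta>"
    unfolding r0_def k unfolding g v22_def \<Phi>1_def Let_def a_def[symmetric] f_def[symmetric] e_def[symmetric] e(2)[symmetric]
    using a by (simp add: field_simps power2_eq_square power3_eq_cube)
  have "r1 \<theta> = gain \<theta> * v12 \<theta> + rho \<theta> * (ar_kappa (rho \<theta>) (gain \<theta>) * v11 \<theta>)" by (simp add: r1_def)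
  also have "\<dots> = gain \<theta> * v12 \<theta> + rho \<theta> * ((gain \<theta>)\<^sup>2 * (b\<^sup>2 / (2 * a)))" unfolding k ..
  also have "\<dots> = \<Phi>2 b \<theta>"
    unfolding g v12_def \<Phi>2_def Let_def a_def[symmetric] f_def[symmetric] e_def[symmetric] e(2)[symmetric]
    using a by (simp add: field_simps power2_eq_square power3_eq_cube)
  finally show "r1 \<theta> = \<Phi>2 b \<theta>" .
qed

text \<open>The quadratic form of the limit covariance of the statistics. The matrix of the limit
  law of the estimator is \<open>Q_star\<close>.\<close>

definition Q where "Q \<theta> u1 u2 = ar_variance (rho \<theta>) (gain \<theta>) (v11 \<theta>) (v12 \<theta>) (v22 \<theta>) u1 u2" for u1 u2 :: real

text \<open>An expansion of \<open>ar_variance_first\<close>. Positivity comes from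
  \<open>\<sigma> \<noteq> 0\<close>, which keeps the variance of the increments positive.\<close>

lemma Q_first: "\<theta> \<in> \<Theta> \<Longrightarrow> Q \<theta> 1 0 = K11 \<sigma> b \<theta>" and Q_first_pos: "\<theta> \<in> \<Theta> \<Longrightarrow> Q \<theta> 1 0 > 0"
proof -
  assume \<theta>: "\<theta> \<in> \<Theta>"
  have ne: "(rho \<theta>)\<^sup>2 \<noteq> 1" using \<rho>_square_less[OF \<theta>] by simp
  have eq: "Q \<theta> 1 0 = 2 * (\<Phi>1 \<sigma> b \<theta>)\<^sup>2 + 4 * (\<Phi>2 b \<theta>)\<^sup>2 / (1 - (rho \<theta>)\<^sup>2)"
    unfolding Q_def ar_variance_first[OF ne] using r0_eq[OF \<theta>] r1_eq[OF \<theta>] by (simp add: r0_def r1_def)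
  define a f e where "a = \<theta> $ 1" and "f = \<theta> $ 2" and "e = exp (- a)"
  have a: "a > 0" using \<Theta>D(2)[OF \<theta>] by (simp add: a_def)
  have e: "0 < e" "e < 1" using a by (auto simp: e_def)
  have "2 * (\<Phi>1 \<sigma> b \<theta>)\<^sup>2 = 2 * f ^ 4 * b ^ 4 / a ^ 6 * (e - 1 + a)\<^sup>2 + 4 * f\<^sup>2 * \<sigma>\<^sup>2 * b\<^sup>2 / a ^ 3 * (e - 1 + a) + 2 * \<sigma> ^ 4"
    unfolding \<Phi>1_def Let_def a_def[symmetric] f_def[symmetric] e_def[symmetric]
    using a by (simp add: field_simps power2_eq_square power3_eq_cube eval_nat_numeral)
  moreover have "4 * (\<Phi>2 b \<theta>)\<^sup>2 / (1 - (rho \<theta>)\<^sup>2) = f ^ 4 * b ^ 4 * (1 - e) ^ 3 / (a ^ 6 * (1 + e))"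
  proof -
    have "1 - (rho \<theta>)\<^sup>2 = (1 - e) * (1 + e)" by (simp add: rho_def a_def e_def power2_eq_square algebra_simps)
    moreover have "4 * (\<Phi>2 b \<theta>)\<^sup>2 = f ^ 4 * b ^ 4 * (1 - e) ^ 3 / a ^ 6 * (1 - e)"
      unfolding \<Phi>2_def Let_def a_def[symmetric] f_def[symmetric] e_def[symmetric]
      by (simp add: power_mult_distrib power_divide eval_nat_numeral)
    ultimately show ?thesis using e by simp
  qed
  ultimately show "Q \<theta> 1 0 = K11 \<sigma> b \<theta>"
    unfolding eq K11_def Let_def a_def[symmetric] f_def[symmetric] e_def[symmetric] by simp
  have "\<Phi>1 \<sigma> b \<theta> > 0"
  proof -
    have "e - 1 + a \<ge> 0" using exp_ge_add_one_self[of "- a"] by (simp add: e_def)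
    then show ?thesis using \<sigma> a unfolding \<Phi>1_def Let_def a_def[symmetric] f_def[symmetric] e_def[symmetric]
      by (intro add_nonneg_pos mult_nonneg_nonneg divide_nonneg_nonneg) auto
  qed
  moreover have "4 * (\<Phi>2 b \<theta>)\<^sup>2 / (1 - (rho \<theta>)\<^sup>2) \<ge> 0" using \<rho>_square_less[OF \<theta>] by simp
  ultimately show "Q \<theta> 1 0 > 0" unfolding eq by (simp add: add_pos_nonneg)
qed

definition Zv :: "nat \<Rightarrow> real^2 \<Rightarrow> 'w \<Rightarrow> real^2" where
  "Zv T \<theta> \<omega> = sqrt (real T) *\<^sub>R (R_vec X T \<omega> - \<Phi> \<sigma> b \<theta>)"

lemma X_measurable: "\<theta> \<in> \<Theta> \<Longrightarrow> t \<ge> 0 \<Longrightarrow> X t \<in> borel_measurable (P \<theta>)"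
  using partially_observed_system.X_random_variable[OF model] .

lemma R_vec_measurable:
  assumes \<theta>: "\<theta> \<in> \<Theta>" shows "R_vec X T \<in> borel_measurable (P \<theta>)"
proof -
  have m: "(\<lambda>\<omega>. X (real k - c) \<omega>) \<in> borel_measurable (P \<theta>)" if "c \<le> real k" for k c
    using X_measurable[OF \<theta>, of "real k - c"] that by simp
  have "R1 X T \<in> borel_measurable (P \<theta>)"
    unfolding R1_def[abs_def]
    by (intro borel_measurable_divide borel_measurable_sum borel_measurable_power borel_measurable_diff borel_measurable_const)
      (use m[of 0] m[of 1] in auto)
  moreover have "R2 X T \<in> borel_measurable (P \<theta>)"
    unfolding R2_def[abs_def]
    by (intro borel_measurable_divide borel_measurable_sum borel_measurable_times borel_measurable_diff borel_measurable_const)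
      (use m[of 0] m[of 1] m[of 2] in auto)
  ultimately show ?thesis unfolding R_vec_def[abs_def] by (rule borel_measurable_vector2)
qed

lemma Zv_measurable: "\<theta> \<in> \<Theta> \<Longrightarrow> Zv T \<theta> \<in> borel_measurable (P \<theta>)"
  unfolding Zv_def[abs_def] using R_vec_measurable by measurable

text \<open>On one set of probability one and for all \<open>T\<close> at once, the observed
  statistics are those of the autoregression rebuilt from its noises, so that the abstract limit
  theorem applies to the data.\<close>

lemma Zv_eq:
  assumes \<theta>: "\<theta> \<in> \<Theta>"
  shows "AE \<omega> in P \<theta>. \<forall>T. Zv T \<theta> \<omega> $ 1 = Z1 \<theta> T \<omega> \<and> Zv T \<theta> \<omega> $ 2 = Z2 \<theta> T \<omega>"
proof -
  interpret S: partially_observed_system "P \<theta>" "W \<theta>" "V \<theta>" X "Y \<theta>" \<sigma> b dx dy \<theta> by (rule model[OF \<theta>])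
  note th = r0_eq[OF \<theta>] r1_eq[OF \<theta>]
  show ?thesis
    using S.hidden_recursion[OF \<Theta>D(2)[OF \<theta>]]
  proof eventually_elim
    case (elim \<omega>)
    have Y: "AR_Y \<theta> k \<omega> = Y \<theta> (real k) \<omega>" for k
    proof (induction k)
      case (Suc k)
      have "Y \<theta> (real k + 1) \<omega> = rho \<theta> * Y \<theta> (real k) \<omega> + noise1 \<theta> k \<omega>"
        using elim[rule_format, of k] by (simp add: rho_def noise1_def)
      then show ?case using Suc by (simp add: add.commute)
    qed simp
    have D: "X (real (Suc k)) \<omega> - X (real k) \<omega> = D \<theta> (Suc k) \<omega>" for k
    proof -
      have "X (real k + 1) \<omega> - X (real k) \<omega> = gain \<theta> * Y \<theta> (real k) \<omega> + noise2 \<theta> k \<omega>"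
        using elim[rule_format, of k] by (simp add: gain_def noise2_def)
      then show ?thesis using Y by (simp add: add.commute)
    qed
    have s1: "(\<Sum>k=1..T. (X (real k) \<omega> - X (real k - 1) \<omega>)\<^sup>2) = (\<Sum>k<T. (D \<theta> (Suc k) \<omega>)\<^sup>2)" for T
      by (simp add: sum.atLeast1_atMost_eq D[symmetric] del: D_simps)
    \<comment> \<open>The sum on the left starts at 2; on the right the term \<open>k = 0\<close> is
      zero by the dummy increment, which accounts for the shift.\<close>
    have s2: "(\<Sum>k=2..T. (X (real k) \<omega> - X (real k - 1) \<omega>) * (X (real k - 1) \<omega> - X (real k - 2) \<omega>)) =
        (\<Sum>k<T. D \<theta> (Suc k) \<omega> * D \<theta> k \<omega>)" for T
    proof (induction T)
      case (Suc T)
      show ?case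
      proof (cases "T = 0")
        case False
        then obtain j where j: "T = Suc j" by (cases T) auto
        have "D \<theta> (Suc T) \<omega> = X (real (Suc T)) \<omega> - X (real (Suc T) - 1) \<omega>"
          "D \<theta> T \<omega> = X (real (Suc T) - 1) \<omega> - X (real (Suc T) - 2) \<omega>"
          using D[of T, symmetric] D[of j, symmetric] by (simp_all add: j del: D_simps)
        then show ?thesis using Suc False by (simp del: D_simps)
      qed simp
    qed simp
    have sq: "sqrt (real T) * (x / real T - c) = (x - real T * c) / sqrt (real T)" for T x c
    proof (cases "T = 0")
      case False
      then have "sqrt (real T) * sqrt (real T) = real T" "sqrt (real T) > 0" by auto
      then show ?thesis by (simp add: field_simps)
    qed simp
    show ?case
    proof (intro allI conjI)
      fix T
      show "Zv T \<theta> \<omega> $ 1 = Z1 \<theta> T \<omega>"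
        unfolding Zv_def Z1_def vector_scaleR_component vector_minus_component R_vec_def \<Phi>_def vector_2 R1_def s1 th
        by (simp add: sq del: D_simps)
      show "Zv T \<theta> \<omega> $ 2 = Z2 \<theta> T \<omega>"
        unfolding Zv_def Z2_def vector_scaleR_component vector_minus_component R_vec_def \<Phi>_def vector_2 R2_def s2 th
        by (simp add: sq del: D_simps)
    qed
  qed
qed

lemma Zv_moments: "bounded_moments (\<lambda>\<theta> T \<omega>. Zv T \<theta> \<omega> $ 1)" "bounded_moments (\<lambda>\<theta> T \<omega>. Zv T \<theta> \<omega> $ 2)"
  "bounded_moments (\<lambda>\<theta> T \<omega>. norm (Zv T \<theta> \<omega>))"
proof -
  interpret U1: hidden_ar_functional \<Theta> P past noise1 noise2 "\<lambda>\<theta>. Y \<theta> 0" rho gain v11 v12 v22 "exp (- \<alpha>a)" "\<lambda>_. 1" "\<lambda>_. 0"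
    by unfold_locales (rule bounded_moments_numeral)+
  interpret U2: hidden_ar_functional \<Theta> P past noise1 noise2 "\<lambda>\<theta>. Y \<theta> 0" rho gain v11 v12 v22 "exp (- \<alpha>a)" "\<lambda>_. 0" "\<lambda>_. 1"
    by unfold_locales (rule bounded_moments_numeral)+
  have m: "(\<lambda>\<omega>. Zv T \<theta> \<omega> $ i) \<in> borel_measurable (P \<theta>)" if "\<theta> \<in> \<Theta>" for \<theta> T i
    using Zv_measurable[OF that] by (simp add: borel_measurable_vec_iff)
  show 1: "bounded_moments (\<lambda>\<theta> T \<omega>. Zv T \<theta> \<omega> $ 1)"
  proof (rule bounded_moments_cong_AE[OF U1.Z_moments m])
    fix \<theta> T assume "\<theta> \<in> \<Theta>"
    from Zv_eq[OF this] show "AE \<omega> in P \<theta>. Zv T \<theta> \<omega> $ 1 = 1 * Z1 \<theta> T \<omega> + 0 * Z2 \<theta> T \<omega>" by eventually_elim simp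
  qed
  show 2: "bounded_moments (\<lambda>\<theta> T \<omega>. Zv T \<theta> \<omega> $ 2)"
  proof (rule bounded_moments_cong_AE[OF U2.Z_moments m])
    fix \<theta> T assume "\<theta> \<in> \<Theta>"
    from Zv_eq[OF this] show "AE \<omega> in P \<theta>. Zv T \<theta> \<omega> $ 2 = 0 * Z1 \<theta> T \<omega> + 1 * Z2 \<theta> T \<omega>" by eventually_elim simp
  qed
  show "bounded_moments (\<lambda>\<theta> T \<omega>. norm (Zv T \<theta> \<omega>))"
    by (rule bounded_moments_dominated[OF bounded_moments_add[OF bounded_moments_abs[OF 1] bounded_moments_abs[OF 2]]])
      (use Zv_measurable norm_vector2_le in auto)
qed

lemma Zv_char_rate:
  assumes "bounded_moments (\<lambda>\<theta> k \<omega>. u1 \<theta>)" "bounded_moments (\<lambda>\<theta> k \<omega>. u2 \<theta>)"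
  obtains C where "\<And>\<theta> T. \<theta> \<in> \<Theta> \<Longrightarrow> T \<ge> 1 \<Longrightarrow>
    cmod ((\<integral>\<omega>. iexp (u1 \<theta> * Zv T \<theta> \<omega> $ 1 + u2 \<theta> * Zv T \<theta> \<omega> $ 2) \<partial>P \<theta>) - exp (- Q \<theta> (u1 \<theta>) (u2 \<theta>) / 2)) \<le> C / sqrt (real T)"
proof -
  interpret U: hidden_ar_functional \<Theta> P past noise1 noise2 "\<lambda>\<theta>. Y \<theta> 0" rho gain v11 v12 v22 "exp (- \<alpha>a)" u1 u2
    by unfold_locales (rule assms)+
  obtain C where C: "\<And>\<theta> T. \<theta> \<in> \<Theta> \<Longrightarrow> T \<ge> 1 \<Longrightarrow>
    cmod ((\<integral>\<omega>. iexp (u1 \<theta> * Z1 \<theta> T \<omega> + u2 \<theta> * Z2 \<theta> T \<omega>) \<partial>P \<theta>) - exp (- U.v \<theta> / 2)) \<le> C / sqrt (real T)"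
    by (rule U.Z_char_rate) blast
  have "(\<integral>\<omega>. iexp (u1 \<theta> * Zv T \<theta> \<omega> $ 1 + u2 \<theta> * Zv T \<theta> \<omega> $ 2) \<partial>P \<theta>) =
      (\<integral>\<omega>. iexp (u1 \<theta> * Z1 \<theta> T \<omega> + u2 \<theta> * Z2 \<theta> T \<omega>) \<partial>P \<theta>)" if \<theta>: "\<theta> \<in> \<Theta>" for \<theta> T
  proof (rule integral_cong_AE)
    have [measurable]: "(\<lambda>\<omega>. Zv T \<theta> \<omega> $ i) \<in> borel_measurable (P \<theta>)" for i
      using Zv_measurable[OF \<theta>, of T] by (simp add: borel_measurable_vec_iff)
    show "(\<lambda>\<omega>. iexp (u1 \<theta> * Zv T \<theta> \<omega> $ 1 + u2 \<theta> * Zv T \<theta> \<omega> $ 2)) \<in> borel_measurable (P \<theta>)" by measurable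
    have [measurable]: "(\<lambda>\<omega>. u1 \<theta> * Z1 \<theta> T \<omega> + u2 \<theta> * Z2 \<theta> T \<omega>) \<in> borel_measurable (P \<theta>)"
      by (rule bounded_moments_measurable[OF U.Z_moments \<theta>])
    show "(\<lambda>\<omega>. iexp (u1 \<theta> * Z1 \<theta> T \<omega> + u2 \<theta> * Z2 \<theta> T \<omega>)) \<in> borel_measurable (P \<theta>)" by measurable
    show "AE \<omega> in P \<theta>. iexp (u1 \<theta> * Zv T \<theta> \<omega> $ 1 + u2 \<theta> * Zv T \<theta> \<omega> $ 2) = iexp (u1 \<theta> * Z1 \<theta> T \<omega> + u2 \<theta> * Z2 \<theta> T \<omega>)"
      using Zv_eq[OF \<theta>] by eventually_elim simp
  qed
  with C show ?thesis by (intro that[of C]) (simp add: Q_def U.v_def)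
qed

lemma Q_bounded:
  obtains C where "\<And>\<theta>. \<theta> \<in> \<Theta> \<Longrightarrow> Q \<theta> 1 0 + Q \<theta> 0 1 \<le> C"
proof -
  interpret U1: hidden_ar_functional \<Theta> P past noise1 noise2 "\<lambda>\<theta>. Y \<theta> 0" rho gain v11 v12 v22 "exp (- \<alpha>a)" "\<lambda>_. 1" "\<lambda>_. 0"
    by unfold_locales (rule bounded_moments_numeral)+
  interpret U2: hidden_ar_functional \<Theta> P past noise1 noise2 "\<lambda>\<theta>. Y \<theta> 0" rho gain v11 v12 v22 "exp (- \<alpha>a)" "\<lambda>_. 0" "\<lambda>_. 1"
    by unfold_locales (rule bounded_moments_numeral)+
  obtain C where C: "\<And>\<theta>. \<theta> \<in> \<Theta> \<Longrightarrow> \<bar>U1.v \<theta> + U2.v \<theta>\<bar> \<le> C"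
    by (rule const_bounded[OF bounded_moments_add[OF U1.coefficients_bounded(9) U2.coefficients_bounded(9)]]) blast
  then show ?thesis by (intro that[of C]) (force simp: Q_def U1.v_def U2.v_def abs_le_iff)
qed

text \<open>Characteristic functions have modulus at most 1, hence so does the limit
  \<open>exp (- Q \<theta> u1 u2 / 2)\<close>. The limit theorem itself thus shows that the form is
  nonnegative.\<close>

lemma Q_nonneg:
  assumes \<theta>: "\<theta> \<in> \<Theta>" shows "Q \<theta> u1 u2 \<ge> 0"
proof -
  interpret S: prob_space "P \<theta>" by (rule prob[OF \<theta>])
  obtain C where C: "\<And>T. T \<ge> 1 \<Longrightarrow>
    cmod ((\<integral>\<omega>. iexp (u1 * Zv T \<theta> \<omega> $ 1 + u2 * Zv T \<theta> \<omega> $ 2) \<partial>P \<theta>) - exp (- Q \<theta> u1 u2 / 2)) \<le> C / sqrt (real T)"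
    by (rule Zv_char_rate[OF bounded_moments_numeral[of u1] bounded_moments_numeral[of u2]]) (use \<theta> in blast)
  have "exp (- Q \<theta> u1 u2 / 2) \<le> 1 + C / sqrt (real T)" if "T \<ge> 1" for T
  proof -
    have "cmod (\<integral>\<omega>. iexp (u1 * Zv T \<theta> \<omega> $ 1 + u2 * Zv T \<theta> \<omega> $ 2) \<partial>P \<theta>) \<le>
        (\<integral>\<omega>. cmod (iexp (u1 * Zv T \<theta> \<omega> $ 1 + u2 * Zv T \<theta> \<omega> $ 2)) \<partial>P \<theta>)"
      by (rule integral_norm_bound)
    also have "\<dots> = 1" by (simp add: S.prob_space)
    finally have 1: "cmod (\<integral>\<omega>. iexp (u1 * Zv T \<theta> \<omega> $ 1 + u2 * Zv T \<theta> \<omega> $ 2) \<partial>P \<theta>) \<le> 1" .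
    have "cmod (complex_of_real (exp (- Q \<theta> u1 u2 / 2))) \<le> 1 + C / sqrt (real T)"
      using norm_triangle_sub[of "complex_of_real (exp (- Q \<theta> u1 u2 / 2))"] 1 C[OF that]
      by (smt (verit) norm_minus_commute)
    then show ?thesis by (simp del: of_real_exp)
  qed
  moreover have "(\<lambda>T. 1 + C / sqrt (real T)) \<longlonglongrightarrow> 1" by real_asymp
  ultimately have "exp (- Q \<theta> u1 u2 / 2) \<le> 1" by (intro LIMSEQ_le_const) auto
  then show ?thesis by simp
qed

text \<open>The symmetric matrix of the form \<open>Q \<theta>\<close>, its off-diagonal entry by
  polarization.\<close>

definition Kmat :: "real^2 \<Rightarrow> real^2^2" where
  "Kmat \<theta> = (let c = (Q \<theta> 1 1 - Q \<theta> 1 0 - Q \<theta> 0 1) / 2 in vector [vector [Q \<theta> 1 0, c], vector [c, Q \<theta> 0 1]])"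

lemma Kmat_quadratic: "u \<bullet> (Kmat \<theta> *v u) = Q \<theta> (u $ 1) (u $ 2)"
  unfolding Q_def[of \<theta> "u $ 1"] ar_variance_quadratic[of _ _ _ _ _ "u $ 1"]
  by (simp add: Kmat_def Let_def inner_vec_def matrix_vector_mult_def sum_2 Q_def[symmetric] power2_eq_square algebra_simps)

lemma limit_law_exists:
  assumes \<theta>: "\<theta> \<in> \<Theta>" obtains \<mu> where "centred_gaussian \<mu> (Kmat \<theta>)"
proof (rule centred_gaussian_exists_2[of "Kmat \<theta>"])
  show "transpose (Kmat \<theta>) = Kmat \<theta>" by (simp add: Kmat_def Let_def vec_eq_iff forall_2 transpose_def)
  show "0 \<le> u \<bullet> (Kmat \<theta> *v u)" for u unfolding Kmat_quadratic by (rule Q_nonneg[OF \<theta>])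
  show "0 < Kmat \<theta> $ 1 $ 1" using Q_first_pos[OF \<theta>] by (simp add: Kmat_def Let_def)
qed

definition law where "law \<theta> = (SOME \<mu>. centred_gaussian \<mu> (Kmat \<theta>))"

lemma law_gaussian: "\<theta> \<in> \<Theta> \<Longrightarrow> centred_gaussian (law \<theta>) (Kmat \<theta>)"
  unfolding law_def by (rule someI_ex) (use limit_law_exists in blast)

lemmas law_facts = centred_gaussian_facts[OF law_gaussian]

lemma component_inner: "x $ i = axis i 1 \<bullet> x" for x :: "real^2"
  by (simp add: inner_axis inner_commute)

lemma law_second_moment:
  assumes \<theta>: "\<theta> \<in> \<Theta>"
  shows "integrable (law \<theta>) (\<lambda>x. (norm x)\<^sup>2)" "(\<integral>x. (norm x)\<^sup>2 \<partial>law \<theta>) = Q \<theta> 1 0 + Q \<theta> 0 1"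
proof -
  have eq: "(norm x)\<^sup>2 = (axis 1 1 \<bullet> x)\<^sup>2 + (axis 2 1 \<bullet> x)\<^sup>2" for x :: "real^2"
    unfolding component_inner[symmetric] unfolding power2_norm_eq_inner
    by (simp add: inner_vec_def sum_2 power2_eq_square)
  show "integrable (law \<theta>) (\<lambda>x. (norm x)\<^sup>2)" unfolding eq using law_facts(6)[OF \<theta>] by simp
  show "(\<integral>x. (norm x)\<^sup>2 \<partial>law \<theta>) = Q \<theta> 1 0 + Q \<theta> 0 1"
    unfolding eq using law_facts(6,7)[OF \<theta>] by (simp add: Kmat_quadratic) (simp add: axis_def)
qed

text \<open>Uniform on the whole open box, since the rate for characteristic functions and the
  bounds on second moments depend only on the box.\<close>

lemma Zv_weak: "uniform_weak_convergence \<Theta> P Zv law"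
proof -
  obtain C1 where C1: "\<And>\<theta>. \<theta> \<in> \<Theta> \<Longrightarrow> Q \<theta> 1 0 + Q \<theta> 0 1 \<le> C1" by (rule Q_bounded) blast
  obtain C2 where C2: "\<And>\<theta> k. \<theta> \<in> \<Theta> \<Longrightarrow> (\<integral>\<omega>. \<bar>norm (Zv k \<theta> \<omega>)\<bar> ^ 2 \<partial>P \<theta>) \<le> C2"
    by (rule bounded_moments_bound[OF Zv_moments(3), of 2]) blast
  show ?thesis
  proof (rule uniform_weak_convergence_of_char[where C = "max C1 C2"])
    fix \<theta> assume \<theta>: "\<theta> \<in> \<Theta>"
    show "prob_space (P \<theta>)" by (rule prob[OF \<theta>])
    show "prob_space (law \<theta>)" "sets (law \<theta>) = sets borel" by (rule law_facts[OF \<theta>])+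
    show "Zv T \<theta> \<in> borel_measurable (P \<theta>)" for T by (rule Zv_measurable[OF \<theta>])
    show "integrable (P \<theta>) (\<lambda>\<omega>. (norm (Zv T \<theta> \<omega>))\<^sup>2)" for T
      by (rule bounded_moments_integrable_power[OF Zv_moments(3) \<theta>])
    show "(\<integral>\<omega>. (norm (Zv T \<theta> \<omega>))\<^sup>2 \<partial>P \<theta>) \<le> max C1 C2" for T using C2[OF \<theta>, of T] by simp
    show "integrable (law \<theta>) (\<lambda>x. (norm x)\<^sup>2)" by (rule law_second_moment[OF \<theta>])
    show "(\<integral>x. (norm x)\<^sup>2 \<partial>law \<theta>) \<le> max C1 C2" using C1[OF \<theta>] law_second_moment(2)[OF \<theta>] by simp
  next
    fix u :: "real^2"
    obtain C where C: "\<And>\<theta> T. \<theta> \<in> \<Theta> \<Longrightarrow> T \<ge> 1 \<Longrightarrow>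
      cmod ((\<integral>\<omega>. iexp (u $ 1 * Zv T \<theta> \<omega> $ 1 + u $ 2 * Zv T \<theta> \<omega> $ 2) \<partial>P \<theta>) - exp (- Q \<theta> (u $ 1) (u $ 2) / 2)) \<le> C / sqrt (real T)"
      by (rule Zv_char_rate[OF bounded_moments_numeral[of "u $ 1"] bounded_moments_numeral[of "u $ 2"]]) blast
    show "uniform_limit \<Theta> (\<lambda>T \<theta>. \<integral>\<omega>. iexp (u \<bullet> Zv T \<theta> \<omega>) \<partial>P \<theta>) (\<lambda>\<theta>. \<integral>x. iexp (u \<bullet> x) \<partial>law \<theta>) sequentially"
    proof (rule uniform_limit_of_rate[where C = C])
      fix \<theta> T assume \<theta>: "\<theta> \<in> \<Theta>" and T: "1 \<le> (T :: nat)"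
      have in2: "u \<bullet> x = u $ 1 * x $ 1 + u $ 2 * x $ 2" for x by (simp add: inner_vec_def sum_2)
      show "cmod ((\<integral>\<omega>. iexp (u \<bullet> Zv T \<theta> \<omega>) \<partial>P \<theta>) - (\<integral>x. iexp (u \<bullet> x) \<partial>law \<theta>)) \<le> C / sqrt (real T)"
        using C[OF \<theta> T] unfolding law_facts(3)[OF \<theta>] Kmat_quadratic in2[of "Zv T \<theta> _"] .
    qed
  qed
qed

end

lemma cmod_iexp_diff_le: "cmod (iexp x - iexp y) \<le> \<bar>x - y\<bar>"
proof -
  have "iexp x - iexp y = iexp y * (iexp (x - y) - 1)"
    by (simp add: right_diff_distrib exp_diff exp_minus divide_inverse)
  then show ?thesis using cmod_iexp_minus_one_le[of "x - y"] by (simp add: norm_mult)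
qed

text \<open>Clipping \<open>X\<close> at the level of \<open>Z\<close> yields an array that is
  dominated everywhere and agrees with \<open>X\<close> almost everywhere.\<close>

lemma (in prob_family) bounded_moments_dominated_AE:
  assumes Z: "bounded_moments Z"
    and X: "\<And>i k. i \<in> I \<Longrightarrow> X i k \<in> borel_measurable (P i)"
    and le: "\<And>i k. i \<in> I \<Longrightarrow> AE \<omega> in P i. \<bar>X i k \<omega>\<bar> \<le> Z i k \<omega>"
  shows "bounded_moments X"
proof (rule bounded_moments_cong_AE[OF _ X])
  show "bounded_moments (\<lambda>i k \<omega>. max (- \<bar>Z i k \<omega>\<bar>) (min \<bar>Z i k \<omega>\<bar> (X i k \<omega>)))"
  proof (rule bounded_moments_dominated[OF bounded_moments_abs[OF Z]])
    fix i k assume i: "i \<in> I"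
    note [measurable] = X[OF i, of k] bounded_moments_measurable[OF Z i, of k]
    show "(\<lambda>\<omega>. max (- \<bar>Z i k \<omega>\<bar>) (min \<bar>Z i k \<omega>\<bar> (X i k \<omega>))) \<in> borel_measurable (P i)" by measurable
  qed (auto simp: max_def min_def)
  fix i k assume "i \<in> I"
  from le[OF this, of k] show "AE \<omega> in P i. X i k \<omega> = max (- \<bar>Z i k \<omega>\<bar>) (min \<bar>Z i k \<omega>\<bar> (X i k \<omega>))"
    by eventually_elim (auto simp: max_def min_def)
qed

section \<open>Limit covariances of the statistics and the linear image of their limit law\<close>

context observed_family
begin

lemma Zv_component_measurable: "\<theta> \<in> \<Theta> \<Longrightarrow> (\<lambda>\<omega>. Zv T \<theta> \<omega> $ i) \<in> borel_measurable (P \<theta>)"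
  using Zv_measurable[of \<theta> T] by (simp add: borel_measurable_vec_iff)

lemma Zv_component_moments: "bounded_moments (\<lambda>\<theta> T \<omega>. Zv T \<theta> \<omega> $ i)"
  using exhaust_2[of i] Zv_moments(1,2) by auto

lemma Zv_test_function_limit:
  fixes f :: "real^2 \<Rightarrow> real"
  assumes f: "continuous_on UNIV f" and bm: "bounded_moments (\<lambda>\<theta> T \<omega>. f (Zv T \<theta> \<omega>))" and \<theta>: "\<theta> \<in> \<Theta>"
  shows "(\<lambda>T. \<integral>\<omega>. f (Zv T \<theta> \<omega>) \<partial>P \<theta>) \<longlonglongrightarrow> (\<integral>x. f x \<partial>law \<theta>)"
proof -
  obtain C where C: "\<And>\<theta> T. \<theta> \<in> \<Theta> \<Longrightarrow> (\<integral>\<omega>. \<bar>f (Zv T \<theta> \<omega>)\<bar> ^ 2 \<partial>P \<theta>) \<le> C"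
    by (rule bounded_moments_bound[OF bm, of 2]) blast
  have "uniform_limit \<Theta> (\<lambda>T \<theta>. \<integral>\<omega>. f (Zv T \<theta> \<omega>) \<partial>P \<theta>) (\<lambda>\<theta>. \<integral>x. f x \<partial>law \<theta>) sequentially"
    by (rule uniform_weak_convergence_unbounded(1)[where C = C, OF prob law_facts(1,2) Zv_measurable Zv_weak f])
      (use bounded_moments_integrable_power[OF bm, of _ _ 2] C in auto)
  then show ?thesis by (rule tendsto_uniform_limitI[OF _ \<theta>])
qed

lemma scaled_covariance:
  assumes \<theta>: "\<theta> \<in> \<Theta>" and T: "T \<ge> 1"
  shows "(real T *\<^sub>R covariance_matrix (P \<theta>) (R_vec X T)) $ i $ j =
    (\<integral>\<omega>. Zv T \<theta> \<omega> $ i * Zv T \<theta> \<omega> $ j \<partial>P \<theta>) - (\<integral>\<omega>. Zv T \<theta> \<omega> $ i \<partial>P \<theta>) * (\<integral>\<omega>. Zv T \<theta> \<omega> $ j \<partial>P \<theta>)"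
proof -
  interpret S: prob_space "P \<theta>" by (rule prob[OF \<theta>])
  define c where "c = sqrt (real T)"
  have c: "c > 0" "c * c = real T" using T by (auto simp: c_def)
  note Zi = bounded_moments_integrable[OF Zv_component_moments \<theta>]
  have ZZ: "integrable (P \<theta>) (\<lambda>\<omega>. Zv T \<theta> \<omega> $ i * Zv T \<theta> \<omega> $ j)"
    by (rule bounded_moments_integrable[OF bounded_moments_mult[OF Zv_component_moments Zv_component_moments] \<theta>])
  define e where "e i = (\<integral>\<omega>. Zv T \<theta> \<omega> $ i \<partial>P \<theta>)" for i
  have R: "R_vec X T \<omega> $ i = \<Phi> \<sigma> b \<theta> $ i + Zv T \<theta> \<omega> $ i / c" for \<omega> i
    using c by (simp add: Zv_def c_def)
  have E: "(\<integral>\<omega>. R_vec X T \<omega> $ i \<partial>P \<theta>) = \<Phi> \<sigma> b \<theta> $ i + e i / c" for i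
    unfolding R e_def using Zi by (simp add: S.prob_space)
  have "real T * (\<integral>\<omega>. (R_vec X T \<omega> $ i - (\<Phi> \<sigma> b \<theta> $ i + e i / c)) * (R_vec X T \<omega> $ j - (\<Phi> \<sigma> b \<theta> $ j + e j / c)) \<partial>P \<theta>) =
      (\<integral>\<omega>. real T * ((R_vec X T \<omega> $ i - (\<Phi> \<sigma> b \<theta> $ i + e i / c)) * (R_vec X T \<omega> $ j - (\<Phi> \<sigma> b \<theta> $ j + e j / c))) \<partial>P \<theta>)"
    by simp
  also have "\<dots> = (\<integral>\<omega>. Zv T \<theta> \<omega> $ i * Zv T \<theta> \<omega> $ j - e j * Zv T \<theta> \<omega> $ i - e i * Zv T \<theta> \<omega> $ j + e i * e j \<partial>P \<theta>)"
  proof (rule Bochner_Integration.integral_cong[OF refl])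
    fix \<omega>
    have d: "R_vec X T \<omega> $ i - (\<Phi> \<sigma> b \<theta> $ i + e i / c) = Zv T \<theta> \<omega> $ i / c - e i / c" for i
      unfolding R by simp
    have *: "real T * ((z / c - x / c) * (z' / c - y / c)) = (z - x) * (z' - y)" for x y z z'
      unfolding c(2)[symmetric] diff_divide_distrib[symmetric] using c(1) by simp
    show "real T * ((R_vec X T \<omega> $ i - (\<Phi> \<sigma> b \<theta> $ i + e i / c)) * (R_vec X T \<omega> $ j - (\<Phi> \<sigma> b \<theta> $ j + e j / c))) =
        Zv T \<theta> \<omega> $ i * Zv T \<theta> \<omega> $ j - e j * Zv T \<theta> \<omega> $ i - e i * Zv T \<theta> \<omega> $ j + e i * e j"
      unfolding d * by (simp add: algebra_simps)
  qed
  also have "\<dots> = (\<integral>\<omega>. Zv T \<theta> \<omega> $ i * Zv T \<theta> \<omega> $ j \<partial>P \<theta>) - e i * e j"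
    using Zi ZZ by (simp add: S.prob_space e_def[symmetric])
  finally show ?thesis unfolding covariance_matrix_def E by (simp add: e_def)
qed

lemma Kmat_entry: "axis i 1 \<bullet> (Kmat \<theta> *v axis j 1) = Kmat \<theta> $ i $ j"
  by (simp add: cart_eq_inner_axis[symmetric] inner_commute[of "axis i 1"] matrix_vector_mul_component[symmetric] matrix_vector_mult_basis column_def)

text \<open>Since all moments of the normalized statistics are bounded, coordinates and their
  products are admissible test functions: the scaled covariances converge to the covariance of the
  limit law.\<close>

theorem moments_limit:
  assumes \<theta>: "\<theta> \<in> \<Theta>"
  shows "moments_limit_law (P \<theta>) \<sigma> b X \<theta> (Kmat \<theta>) (law \<theta>)"
  unfolding moments_limit_law_def
proof (intro conjI)
  have lin: "(\<lambda>T. \<integral>\<omega>. Zv T \<theta> \<omega> $ i \<partial>P \<theta>) \<longlonglongrightarrow> 0" for i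
    using Zv_test_function_limit[of "\<lambda>x. x $ i", OF _ Zv_component_moments \<theta>] law_facts(5)[OF \<theta>, of "axis i 1"]
    by (simp add: inner_axis' continuous_intros)
  have quad: "(\<lambda>T. \<integral>\<omega>. Zv T \<theta> \<omega> $ i * Zv T \<theta> \<omega> $ j \<partial>P \<theta>) \<longlonglongrightarrow> Kmat \<theta> $ i $ j" for i j
    using Zv_test_function_limit[of "\<lambda>x. x $ i * x $ j", OF _ bounded_moments_mult[OF Zv_component_moments Zv_component_moments] \<theta>]
      law_facts(9)[OF \<theta>, of "axis i 1" "axis j 1"]
    by (simp add: inner_axis' continuous_intros Kmat_entry[unfolded inner_axis', simplified])
  show "(\<lambda>T. real T *\<^sub>R covariance_matrix (P \<theta>) (R_vec X T)) \<longlonglongrightarrow> Kmat \<theta>"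
  proof (intro vec_tendstoI)
    fix i j
    have "(\<lambda>T. (\<integral>\<omega>. Zv T \<theta> \<omega> $ i * Zv T \<theta> \<omega> $ j \<partial>P \<theta>) - (\<integral>\<omega>. Zv T \<theta> \<omega> $ i \<partial>P \<theta>) * (\<integral>\<omega>. Zv T \<theta> \<omega> $ j \<partial>P \<theta>))
        \<longlonglongrightarrow> Kmat \<theta> $ i $ j - 0 * 0"
      by (intro tendsto_intros lin quad)
    then have "(\<lambda>T. (\<integral>\<omega>. Zv T \<theta> \<omega> $ i * Zv T \<theta> \<omega> $ j \<partial>P \<theta>) - (\<integral>\<omega>. Zv T \<theta> \<omega> $ i \<partial>P \<theta>) * (\<integral>\<omega>. Zv T \<theta> \<omega> $ j \<partial>P \<theta>))
        \<longlonglongrightarrow> Kmat \<theta> $ i $ j" by simp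
    then show "(\<lambda>T. (real T *\<^sub>R covariance_matrix (P \<theta>) (R_vec X T)) $ i $ j) \<longlonglongrightarrow> Kmat \<theta> $ i $ j"
      by (rule Lim_transform_eventually)
        (use eventually_ge_at_top[of "1::nat"] in \<open>eventually_elim, simp only: scaled_covariance[OF \<theta>]\<close>)
  qed
  show "Kmat \<theta> $ 1 $ 1 = K11 \<sigma> b \<theta>" using Q_first[OF \<theta>] by (simp add: Kmat_def Let_def)
  show "centred_gaussian (law \<theta>) (Kmat \<theta>)" by (rule law_gaussian[OF \<theta>])
  show "uniform_weak_convergence {\<theta>} (\<lambda>_. P \<theta>) (\<lambda>T \<theta> \<omega>. sqrt (real T) *\<^sub>R (R_vec X T \<omega> - \<Phi> \<sigma> b \<theta>)) (\<lambda>_. law \<theta>)"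
    unfolding uniform_weak_convergence_def
  proof (intro allI impI)
    fix g :: "real^2 \<Rightarrow> real" assume "continuous_on UNIV g \<and> bounded (range g)"
    then have "uniform_limit \<Theta> (\<lambda>T \<theta>. \<integral>\<omega>. g (Zv T \<theta> \<omega>) \<partial>P \<theta>) (\<lambda>\<theta>. \<integral>x. g x \<partial>law \<theta>) sequentially"
      using Zv_weak unfolding uniform_weak_convergence_def by blast
    then have "uniform_limit {\<theta>} (\<lambda>T \<theta>. \<integral>\<omega>. g (Zv T \<theta> \<omega>) \<partial>P \<theta>) (\<lambda>\<theta>. \<integral>x. g x \<partial>law \<theta>) sequentially"
      by (rule uniform_limit_on_subset) (use \<theta> in auto)
    then show "uniform_limit {\<theta>} (\<lambda>T \<theta>'. \<integral>\<omega>. g (sqrt (real T) *\<^sub>R (R_vec X T \<omega> - \<Phi> \<sigma> b \<theta>')) \<partial>P \<theta>) (\<lambda>\<theta>'. \<integral>x. g x \<partial>law \<theta>) sequentially"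
      by (simp add: Zv_def cong: uniform_limit_cong')
  qed
qed

text \<open>The derivative of the inverse moment map at \<open>\<Phi> \<sigma> b \<theta>\<close>,
  as a matrix.\<close>

definition J where "J \<theta> = (\<chi> i j. xi_star \<sigma> b \<theta> (axis j 1) $ i)"

lemma xi_star_J: "xi_star \<sigma> b \<theta> = (\<lambda>\<xi>. J \<theta> *v \<xi>)"
  unfolding J_def using xi_star_linear by blast

definition law_star where "law_star \<theta> = distr (law \<theta>) borel (xi_star \<sigma> b \<theta>)"
definition Q_star where "Q_star \<theta> = covariance_matrix (law \<theta>) (xi_star \<sigma> b \<theta>)"

lemma law_star_gaussian: "\<theta> \<in> \<Theta> \<Longrightarrow> centred_gaussian (law_star \<theta>) (Q_star \<theta>)"
  unfolding law_star_def Q_star_def xi_star_J by (rule centred_gaussian_linear_image(1)[OF law_gaussian])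

lemma Q_star_quadratic: "\<theta> \<in> \<Theta> \<Longrightarrow> u \<bullet> (Q_star \<theta> *v u) = Q \<theta> ((u v* J \<theta>) $ 1) ((u v* J \<theta>) $ 2)"
  unfolding Q_star_def xi_star_J centred_gaussian_linear_image(2)[OF law_gaussian] Kmat_quadratic ..

lemmas law_star_facts = centred_gaussian_facts[OF law_star_gaussian]

lemma xi_star_norm:
  obtains C where "C > 0" "\<And>\<theta> \<xi>. \<theta> \<in> \<Theta> \<Longrightarrow> norm (xi_star \<sigma> b \<theta> \<xi>) \<le> C * norm \<xi>"
proof -
  obtain C where C: "C > 0" "\<And>\<theta> \<xi>. \<theta> \<in> \<Theta> \<Longrightarrow> \<bar>xi3 \<sigma> b \<theta> \<xi>\<bar> \<le> C * norm \<xi>" "\<And>\<theta> \<xi>. \<theta> \<in> \<Theta> \<Longrightarrow> \<bar>xi4 \<sigma> b \<theta> \<xi>\<bar> \<le> C * norm \<xi>"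
    by (rule xi_bounded) blast
  show ?thesis
  proof (rule that[of "2 * C"])
    fix \<theta> \<xi> :: "real^2" assume \<theta>: "\<theta> \<in> \<Theta>"
    show "norm (xi_star \<sigma> b \<theta> \<xi>) \<le> 2 * C * norm \<xi>"
      using norm_vector2_le[of "xi_star \<sigma> b \<theta> \<xi>"] C(2,3)[OF \<theta>, of \<xi>] by (simp add: xi_star_def)
  qed (use C in simp)
qed

text \<open>Makes the coordinates of \<open>u v* J \<theta>\<close> admissible weights in
  \<open>Zv_char_rate\<close>.\<close>

lemma dual_direction_bounded: "bounded_moments (\<lambda>\<theta> k \<omega>. (u v* J \<theta>) $ j)"
proof -
  obtain C where C: "C > 0" "\<And>\<theta> \<xi>. \<theta> \<in> \<Theta> \<Longrightarrow> norm (xi_star \<sigma> b \<theta> \<xi>) \<le> C * norm \<xi>" by (rule xi_star_norm) blast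
  show ?thesis
  proof (rule bounded_moments_const[of _ "norm u * C"])
    fix \<theta> assume \<theta>: "\<theta> \<in> \<Theta>"
    have "(u v* J \<theta>) $ j = u \<bullet> xi_star \<sigma> b \<theta> (axis j 1)"
      by (simp add: vector_matrix_mult_def J_def inner_vec_def mult.commute)
    then have "\<bar>(u v* J \<theta>) $ j\<bar> \<le> norm u * norm (xi_star \<sigma> b \<theta> (axis j 1))"
      using Cauchy_Schwarz_ineq2 by metis
    also have "\<dots> \<le> norm u * (C * norm (axis j (1::real) :: real^2))"
      by (intro mult_left_mono C(2)[OF \<theta>]) auto
    finally show "\<bar>(u v* J \<theta>) $ j\<bar> \<le> norm u * C" by (simp add: norm_axis_1)
  qed
qed

end

section \<open>The estimator\<close>

locale estimated_family = observed_family +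
  fixes F :: "'a measure" and est :: "nat \<Rightarrow> 'a \<Rightarrow> real^2" and K :: "(real^2) set"
  assumes sample_space: "\<theta> \<in> \<Theta> \<Longrightarrow> sets (P \<theta>) = sets F"
    and estimator: "T \<ge> 1 \<Longrightarrow> moments_estimator F \<sigma> b \<Theta> X T (est T)"
    and K: "compact K" "K \<subseteq> \<Theta>"
begin

definition Zs :: "nat \<Rightarrow> real^2 \<Rightarrow> 'a \<Rightarrow> real^2" where
  "Zs T \<theta> \<omega> = sqrt (real T) *\<^sub>R (est T \<omega> - \<theta>)"

lemma K_\<Theta>: "\<theta> \<in> K \<Longrightarrow> \<theta> \<in> \<Theta>"
  using K by auto

sublocale KP: prob_family K P
  by (rule prob_family.intro) (use prob K_\<Theta> in auto)

lemma est_measurable: "\<theta> \<in> \<Theta> \<Longrightarrow> T \<ge> 1 \<Longrightarrow> est T \<in> borel_measurable (P \<theta>)"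
  using estimator[of T] measurable_cong_sets[OF sample_space[of \<theta>] refl, of borel] by (auto simp: moments_estimator_def)

lemma Zs_measurable: "\<theta> \<in> \<Theta> \<Longrightarrow> Zs T \<theta> \<in> borel_measurable (P \<theta>)"
proof (cases "T = 0")
  case False
  assume "\<theta> \<in> \<Theta>"
  then have "est T \<in> borel_measurable (P \<theta>)" using False by (intro est_measurable) auto
  then show ?thesis unfolding Zs_def[abs_def] by measurable
qed (simp add: Zs_def[abs_def])

lemma restrict_moments: "bounded_moments Z \<Longrightarrow> KP.bounded_moments Z"
  by (rule bounded_moments_subset[OF prob_family_axioms _ K(2)])

text \<open>\<open>delta_method\<close> at every sample point, multiplied by \<open>sqrt T\<close>:
  the quadratic error in the unscaled statistics becomes a quadratic error in the scaled ones,
  divided by \<open>sqrt T\<close>.\<close>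

lemma linearization:
  obtains C where "C > 0" "\<And>\<theta> T \<omega>. \<theta> \<in> K \<Longrightarrow> \<omega> \<in> space (P \<theta>) \<Longrightarrow>
    norm (Zs T \<theta> \<omega> - xi_star \<sigma> b \<theta> (Zv T \<theta> \<omega>)) \<le> C * (norm (Zv T \<theta> \<omega>))\<^sup>2 / sqrt (real T)"
proof -
  obtain C where C: "C > 0" "\<And>\<theta> \<phi> R. \<theta> \<in> K \<Longrightarrow> \<phi> \<in> \<Theta> \<Longrightarrow> (\<exists>\<theta>'\<in>\<Theta>. \<Phi> \<sigma> b \<theta>' = R) \<longrightarrow> \<Phi> \<sigma> b \<phi> = R \<Longrightarrow>
    norm (\<phi> - \<theta> - xi_star \<sigma> b \<theta> (R - \<Phi> \<sigma> b \<theta>)) \<le> C * (norm (R - \<Phi> \<sigma> b \<theta>))\<^sup>2"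
    by (rule delta_method[OF K]) blast
  show ?thesis
  proof (rule that[OF C(1)])
    fix \<theta> T \<omega> assume \<theta>: "\<theta> \<in> K" and \<omega>: "\<omega> \<in> space (P \<theta>)"
    have lin: "xi_star \<sigma> b \<theta> (c *\<^sub>R x) = c *\<^sub>R xi_star \<sigma> b \<theta> x" for c x
      unfolding xi_star_J by (rule matrix_vector_mult_scaleR)
    show "norm (Zs T \<theta> \<omega> - xi_star \<sigma> b \<theta> (Zv T \<theta> \<omega>)) \<le> C * (norm (Zv T \<theta> \<omega>))\<^sup>2 / sqrt (real T)"
    proof (cases "T = 0")
      case True
      then show ?thesis using lin[of 0 0] by (simp add: Zs_def Zv_def)
    next
      case False
      have "\<omega> \<in> space F" using \<omega> sets_eq_imp_space_eq[OF sample_space[OF K_\<Theta>[OF \<theta>]]] by simp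
      then have est: "est T \<omega> \<in> \<Theta>" "(\<exists>\<theta>'\<in>\<Theta>. \<Phi> \<sigma> b \<theta>' = R_vec X T \<omega>) \<longrightarrow> \<Phi> \<sigma> b (est T \<omega>) = R_vec X T \<omega>"
        using estimator[of T] False by (auto simp: moments_estimator_def)
      define D where "D = R_vec X T \<omega> - \<Phi> \<sigma> b \<theta>"
      define c where "c = sqrt (real T)"
      have c: "c > 0" using False by (simp add: c_def)
      have Z: "Zv T \<theta> \<omega> = c *\<^sub>R D" by (simp add: Zv_def c_def D_def)
      have "Zs T \<theta> \<omega> - xi_star \<sigma> b \<theta> (Zv T \<theta> \<omega>) = c *\<^sub>R (est T \<omega> - \<theta> - xi_star \<sigma> b \<theta> D)"
        unfolding Z lin Zs_def c_def[symmetric] by (simp only: scaleR_diff_right)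
      then have "norm (Zs T \<theta> \<omega> - xi_star \<sigma> b \<theta> (Zv T \<theta> \<omega>)) = c * norm (est T \<omega> - \<theta> - xi_star \<sigma> b \<theta> D)"
        using c by simp
      also have "\<dots> \<le> c * (C * (norm D)\<^sup>2)"
        using C(2)[OF \<theta> est] c by (intro mult_left_mono) (auto simp: D_def)
      also have "\<dots> = C * (norm (Zv T \<theta> \<omega>))\<^sup>2 / c"
      proof -
        have "norm (Zv T \<theta> \<omega>) = c * norm D" using c by (simp add: Z)
        then show ?thesis using c by (simp add: power_mult_distrib power2_eq_square)
      qed
      finally show ?thesis by (simp add: c_def)
    qed
  qed
qed

text \<open>By the linearization the scaled error of the estimator is at most a quadratic polynomial
  in the norm of the scaled statistics, whose moments of all orders are bounded.\<close>

lemma Zs_moments: "KP.bounded_moments (\<lambda>\<theta> T \<omega>. norm (Zs T \<theta> \<omega>))"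
proof -
  obtain C where C: "C > 0" "\<And>\<theta> T \<omega>. \<theta> \<in> K \<Longrightarrow> \<omega> \<in> space (P \<theta>) \<Longrightarrow>
    norm (Zs T \<theta> \<omega> - xi_star \<sigma> b \<theta> (Zv T \<theta> \<omega>)) \<le> C * (norm (Zv T \<theta> \<omega>))\<^sup>2 / sqrt (real T)" by (rule linearization) blast
  obtain D where D: "D > 0" "\<And>\<theta> \<xi>. \<theta> \<in> \<Theta> \<Longrightarrow> norm (xi_star \<sigma> b \<theta> \<xi>) \<le> D * norm \<xi>" by (rule xi_star_norm) blast
  have "KP.bounded_moments (\<lambda>\<theta> T \<omega>. C * (norm (Zv T \<theta> \<omega>))\<^sup>2 + D * norm (Zv T \<theta> \<omega>))"
    by (intro restrict_moments bounded_moments_intros Zv_moments)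
  then show ?thesis
  proof (rule KP.bounded_moments_dominated_AE)
    fix \<theta> T assume \<theta>: "\<theta> \<in> K"
    show "(\<lambda>\<omega>. norm (Zs T \<theta> \<omega>)) \<in> borel_measurable (P \<theta>)"
      using Zs_measurable[OF K_\<Theta>[OF \<theta>]] by measurable
    show "AE \<omega> in P \<theta>. \<bar>norm (Zs T \<theta> \<omega>)\<bar> \<le> C * (norm (Zv T \<theta> \<omega>))\<^sup>2 + D * norm (Zv T \<theta> \<omega>)"
    proof (rule AE_I2)
      fix \<omega> assume \<omega>: "\<omega> \<in> space (P \<theta>)"
      have "C * (norm (Zv T \<theta> \<omega>))\<^sup>2 / sqrt (real T) \<le> C * (norm (Zv T \<theta> \<omega>))\<^sup>2"
        using C(1) by (cases "T = 0") (auto intro!: divide_left_mono[of 1 _ _, simplified])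
      moreover have "norm (Zs T \<theta> \<omega>) \<le> norm (Zs T \<theta> \<omega> - xi_star \<sigma> b \<theta> (Zv T \<theta> \<omega>)) + norm (xi_star \<sigma> b \<theta> (Zv T \<theta> \<omega>))"
        by (metis diff_add_cancel norm_triangle_ineq)
      ultimately show "\<bar>norm (Zs T \<theta> \<omega>)\<bar> \<le> C * (norm (Zv T \<theta> \<omega>))\<^sup>2 + D * norm (Zv T \<theta> \<omega>)"
        using C(2)[OF \<theta> \<omega>, of T] D(2)[OF K_\<Theta>[OF \<theta>], of "Zv T \<theta> \<omega>"] by simp
    qed
  qed
qed

lemma Zs_bound:
  obtains C where "C > 0" "\<And>\<theta> T. \<theta> \<in> K \<Longrightarrow> (\<integral>\<omega>. norm (Zs T \<theta> \<omega>) ^ n \<partial>P \<theta>) \<le> C"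
proof -
  obtain C where C: "C \<ge> 0" "\<And>\<theta> T. \<theta> \<in> K \<Longrightarrow> (\<integral>\<omega>. \<bar>norm (Zs T \<theta> \<omega>)\<bar> ^ n \<partial>P \<theta>) \<le> C"
    by (rule KP.bounded_moments_bound[OF Zs_moments, of n]) blast
  show ?thesis
  proof (rule that[of "C + 1"])
    fix \<theta> T assume "\<theta> \<in> K"
    then show "(\<integral>\<omega>. norm (Zs T \<theta> \<omega>) ^ n \<partial>P \<theta>) \<le> C + 1" using C(2)[of \<theta> T] by simp
  qed (use C(1) in simp)
qed

lemma Zs_integrable: "\<theta> \<in> K \<Longrightarrow> integrable (P \<theta>) (\<lambda>\<omega>. norm (Zs T \<theta> \<omega>) ^ n)"
  by (rule KP.bounded_moments_integrable_power[OF Zs_moments])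

text \<open>For fixed \<open>u\<close>, the functional of the linearized estimator is the functional
  of the statistics in the direction \<open>u v* J \<theta>\<close>, for which the rate is
  available. The linearization changes the characteristic function by at most the norm of
  \<open>u\<close> times its mean error, again of order \<open>1 / sqrt T\<close>.\<close>

theorem Zs_weak: "uniform_weak_convergence K P Zs law_star"
proof -
  obtain D where D: "D > 0" "\<And>\<theta> \<xi>. \<theta> \<in> \<Theta> \<Longrightarrow> norm (xi_star \<sigma> b \<theta> \<xi>) \<le> D * norm \<xi>" by (rule xi_star_norm) blast
  obtain C1 where C1: "C1 > 0" "\<And>\<theta> T. \<theta> \<in> K \<Longrightarrow> (\<integral>\<omega>. norm (Zs T \<theta> \<omega>) ^ 2 \<partial>P \<theta>) \<le> C1" by (rule Zs_bound[of 2]) blast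
  obtain C2 where C2: "\<And>\<theta>. \<theta> \<in> \<Theta> \<Longrightarrow> Q \<theta> 1 0 + Q \<theta> 0 1 \<le> C2" by (rule Q_bounded) blast
  obtain C3 where C3: "C3 > 0" "\<And>\<theta> T \<omega>. \<theta> \<in> K \<Longrightarrow> \<omega> \<in> space (P \<theta>) \<Longrightarrow>
    norm (Zs T \<theta> \<omega> - xi_star \<sigma> b \<theta> (Zv T \<theta> \<omega>)) \<le> C3 * (norm (Zv T \<theta> \<omega>))\<^sup>2 / sqrt (real T)" by (rule linearization) blast
  obtain C4 where C4: "\<And>\<theta> T. \<theta> \<in> \<Theta> \<Longrightarrow> (\<integral>\<omega>. \<bar>norm (Zv T \<theta> \<omega>)\<bar> ^ 2 \<partial>P \<theta>) \<le> C4"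
    by (rule bounded_moments_bound[OF Zv_moments(3), of 2]) blast
  show ?thesis
  proof (rule uniform_weak_convergence_of_char[where C = "max C1 (D\<^sup>2 * C2)"])
    fix \<theta> assume \<theta>: "\<theta> \<in> K"
    note \<theta>' = K_\<Theta>[OF \<theta>]
    show "prob_space (P \<theta>)" by (rule prob[OF \<theta>'])
    show "prob_space (law_star \<theta>)" "sets (law_star \<theta>) = sets borel" by (rule law_star_facts[OF \<theta>'])+
    show "Zs T \<theta> \<in> borel_measurable (P \<theta>)" for T by (rule Zs_measurable[OF \<theta>'])
    show "integrable (P \<theta>) (\<lambda>\<omega>. (norm (Zs T \<theta> \<omega>))\<^sup>2)" for T by (rule Zs_integrable[OF \<theta>])
    show "(\<integral>\<omega>. (norm (Zs T \<theta> \<omega>))\<^sup>2 \<partial>P \<theta>) \<le> max C1 (D\<^sup>2 * C2)" for T using C1(2)[OF \<theta>, of T] by simp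
    have m: "xi_star \<sigma> b \<theta> \<in> borel_measurable (law \<theta>)"
    proof -
      have "xi_star \<sigma> b \<theta> \<in> borel_measurable borel" unfolding xi_star_J
        by (intro borel_measurable_continuous_onI matrix_vector_mult_linear_continuous_on)
      then show ?thesis using measurable_cong_sets[OF law_facts(2)[OF \<theta>'] refl, of borel] by blast
    qed
    have le: "(norm (xi_star \<sigma> b \<theta> x))\<^sup>2 \<le> D\<^sup>2 * (norm x)\<^sup>2" for x
      using power_mono[OF D(2)[OF \<theta>', of x], of 2] by (simp add: power_mult_distrib)
    have "integrable (law \<theta>) (\<lambda>x. D\<^sup>2 * (norm x)\<^sup>2)" using law_second_moment(1)[OF \<theta>'] by simp
    then have i: "integrable (law \<theta>) (\<lambda>x. (norm (xi_star \<sigma> b \<theta> x))\<^sup>2)"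
      "(\<integral>x. (norm (xi_star \<sigma> b \<theta> x))\<^sup>2 \<partial>law \<theta>) \<le> (\<integral>x. D\<^sup>2 * (norm x)\<^sup>2 \<partial>law \<theta>)"
      using integrable_integral_le[of "law \<theta>" "\<lambda>x. D\<^sup>2 * (norm x)\<^sup>2" "\<lambda>x. (norm (xi_star \<sigma> b \<theta> x))\<^sup>2"] le m by auto
    show "integrable (law_star \<theta>) (\<lambda>x. (norm x)\<^sup>2)"
      unfolding law_star_def using i(1) m by (subst integrable_distr_eq) auto
    have "(\<integral>x. (norm x)\<^sup>2 \<partial>law_star \<theta>) = (\<integral>x. (norm (xi_star \<sigma> b \<theta> x))\<^sup>2 \<partial>law \<theta>)"
      unfolding law_star_def using m by (subst integral_distr) auto
    also have "\<dots> \<le> D\<^sup>2 * C2"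
      using i(2) C2[OF \<theta>'] law_second_moment(2)[OF \<theta>'] mult_left_mono[of "Q \<theta> 1 0 + Q \<theta> 0 1" C2 "D\<^sup>2"] by simp
    finally show "(\<integral>x. (norm x)\<^sup>2 \<partial>law_star \<theta>) \<le> max C1 (D\<^sup>2 * C2)" by simp
  next
    fix u :: "real^2"
    obtain C where C: "\<And>\<theta> T. \<theta> \<in> \<Theta> \<Longrightarrow> T \<ge> 1 \<Longrightarrow>
      cmod ((\<integral>\<omega>. iexp ((u v* J \<theta>) $ 1 * Zv T \<theta> \<omega> $ 1 + (u v* J \<theta>) $ 2 * Zv T \<theta> \<omega> $ 2) \<partial>P \<theta>)
        - exp (- Q \<theta> ((u v* J \<theta>) $ 1) ((u v* J \<theta>) $ 2) / 2)) \<le> C / sqrt (real T)"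
      by (rule Zv_char_rate[OF dual_direction_bounded[of u 1] dual_direction_bounded[of u 2]]) blast
    show "uniform_limit K (\<lambda>T \<theta>. \<integral>\<omega>. iexp (u \<bullet> Zs T \<theta> \<omega>) \<partial>P \<theta>) (\<lambda>\<theta>. \<integral>x. iexp (u \<bullet> x) \<partial>law_star \<theta>) sequentially"
    proof (rule uniform_limit_of_rate[where C = "norm u * (C3 * C4) + C"])
      fix \<theta> T assume \<theta>: "\<theta> \<in> K" and T: "1 \<le> (T :: nat)"
      note \<theta>' = K_\<Theta>[OF \<theta>]
      interpret S: prob_space "P \<theta>" by (rule prob[OF \<theta>'])
      define a where "a \<omega> = u \<bullet> Zs T \<theta> \<omega>" for \<omega>
      define a' where "a' \<omega> = (u v* J \<theta>) $ 1 * Zv T \<theta> \<omega> $ 1 + (u v* J \<theta>) $ 2 * Zv T \<theta> \<omega> $ 2" for \<omega>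
      have a': "a' \<omega> = u \<bullet> xi_star \<sigma> b \<theta> (Zv T \<theta> \<omega>)" for \<omega>
      proof -
        have "a' \<omega> = (u v* J \<theta>) \<bullet> Zv T \<theta> \<omega>" by (simp add: a'_def inner_vec_def[of "u v* J \<theta>"] sum_2)
        then show ?thesis unfolding xi_star_J by (simp only: dot_lmul_matrix)
      qed
      have am: "a \<in> borel_measurable (P \<theta>)" unfolding a_def[abs_def] using Zs_measurable[OF \<theta>'] by measurable
      have a'm: "a' \<in> borel_measurable (P \<theta>)" unfolding a'_def[abs_def]
        using Zv_component_measurable[OF \<theta>'] by measurable
      have ei: "integrable (P \<theta>) (\<lambda>\<omega>. iexp (a \<omega>))" "integrable (P \<theta>) (\<lambda>\<omega>. iexp (a' \<omega>))"
        using am a'm by (intro S.integrable_iexp; simp)+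
      have zi: "integrable (P \<theta>) (\<lambda>\<omega>. (norm (Zv T \<theta> \<omega>))\<^sup>2)"
        by (rule bounded_moments_integrable_power[OF Zv_moments(3) \<theta>'])
      have "cmod ((\<integral>\<omega>. iexp (a \<omega>) \<partial>P \<theta>) - (\<integral>\<omega>. iexp (a' \<omega>) \<partial>P \<theta>)) = cmod (\<integral>\<omega>. iexp (a \<omega>) - iexp (a' \<omega>) \<partial>P \<theta>)"
        by (simp only: Bochner_Integration.integral_diff[OF ei])
      also have "\<dots> \<le> (\<integral>\<omega>. cmod (iexp (a \<omega>) - iexp (a' \<omega>)) \<partial>P \<theta>)" by (rule integral_norm_bound)
      also have "\<dots> \<le> (\<integral>\<omega>. norm u * (C3 * (norm (Zv T \<theta> \<omega>))\<^sup>2 / sqrt (real T)) \<partial>P \<theta>)"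
      proof (rule integral_mono)
        show "integrable (P \<theta>) (\<lambda>\<omega>. cmod (iexp (a \<omega>) - iexp (a' \<omega>)))"
          by (intro integrable_norm Bochner_Integration.integrable_diff ei)
        show "integrable (P \<theta>) (\<lambda>\<omega>. norm u * (C3 * (norm (Zv T \<theta> \<omega>))\<^sup>2 / sqrt (real T)))" using zi by simp
        fix \<omega> assume \<omega>: "\<omega> \<in> space (P \<theta>)"
        have "cmod (iexp (a \<omega>) - iexp (a' \<omega>)) \<le> \<bar>u \<bullet> (Zs T \<theta> \<omega> - xi_star \<sigma> b \<theta> (Zv T \<theta> \<omega>))\<bar>"
          using cmod_iexp_diff_le[of "a \<omega>" "a' \<omega>"] by (simp add: a_def a' inner_diff_right)
        also have "\<dots> \<le> norm u * norm (Zs T \<theta> \<omega> - xi_star \<sigma> b \<theta> (Zv T \<theta> \<omega>))" by (rule Cauchy_Schwarz_ineq2)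
        also have "\<dots> \<le> norm u * (C3 * (norm (Zv T \<theta> \<omega>))\<^sup>2 / sqrt (real T))"
          by (intro mult_left_mono C3(2)[OF \<theta> \<omega>]) auto
        finally show "cmod (iexp (a \<omega>) - iexp (a' \<omega>)) \<le> norm u * (C3 * (norm (Zv T \<theta> \<omega>))\<^sup>2 / sqrt (real T))" .
      qed
      also have "\<dots> = norm u * (C3 * (\<integral>\<omega>. (norm (Zv T \<theta> \<omega>))\<^sup>2 \<partial>P \<theta>) / sqrt (real T))" by simp
      also have "\<dots> \<le> norm u * (C3 * C4 / sqrt (real T))"
        using C4[OF \<theta>', of T] C3(1) by (intro mult_left_mono divide_right_mono) auto
      finally have 1: "cmod ((\<integral>\<omega>. iexp (a \<omega>) \<partial>P \<theta>) - (\<integral>\<omega>. iexp (a' \<omega>) \<partial>P \<theta>)) \<le> norm u * (C3 * C4) / sqrt (real T)" by simp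
      have 2: "cmod ((\<integral>\<omega>. iexp (a' \<omega>) \<partial>P \<theta>) - (\<integral>x. iexp (u \<bullet> x) \<partial>law_star \<theta>)) \<le> C / sqrt (real T)"
        using C[OF \<theta>' T] unfolding law_star_facts(3)[OF \<theta>'] Q_star_quadratic[OF \<theta>'] a'_def .
      show "cmod ((\<integral>\<omega>. iexp (u \<bullet> Zs T \<theta> \<omega>) \<partial>P \<theta>) - (\<integral>x. iexp (u \<bullet> x) \<partial>law_star \<theta>)) \<le> (norm u * (C3 * C4) + C) / sqrt (real T)"
        using norm_triangle_ineq[of "(\<integral>\<omega>. iexp (a \<omega>) \<partial>P \<theta>) - (\<integral>\<omega>. iexp (a' \<omega>) \<partial>P \<theta>)"
            "(\<integral>\<omega>. iexp (a' \<omega>) \<partial>P \<theta>) - (\<integral>x. iexp (u \<bullet> x) \<partial>law_star \<theta>)"] 1 2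
        unfolding a_def add_divide_distrib by simp
    qed
  qed
qed

lemma estimator_weak_convergence:
  "uniform_weak_convergence K P (\<lambda>T \<theta> \<omega>. sqrt (real T) *\<^sub>R (est T \<omega> - \<theta>)) law_star"
  using Zs_weak by (simp add: Zs_def[abs_def])

text \<open>Polynomial growth bounds the second moment of \<open>f (Zs T \<theta> \<omega>)\<close>
  uniformly, which is what the extension of weak convergence to unbounded functions asks
  for.\<close>

lemma Zs_test_function_limit:
  fixes f :: "real^2 \<Rightarrow> real"
  assumes f: "continuous_on UNIV f" and le: "\<And>x. \<bar>f x\<bar> \<le> 1 + norm x ^ n"
  shows "uniform_limit K (\<lambda>T \<theta>. \<integral>\<omega>. f (Zs T \<theta> \<omega>) \<partial>P \<theta>) (\<lambda>\<theta>. \<integral>x. f x \<partial>law_star \<theta>) sequentially"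
proof -
  have fm: "(\<lambda>\<omega>. f (Zs T \<theta> \<omega>)) \<in> borel_measurable (P \<theta>)" if "\<theta> \<in> K" for T \<theta>
    by (rule measurable_compose[OF Zs_measurable[OF K_\<Theta>[OF that]] borel_measurable_continuous_onI[OF f]])
  have bm: "KP.bounded_moments (\<lambda>\<theta> T \<omega>. f (Zs T \<theta> \<omega>))"
    by (rule KP.bounded_moments_dominated[OF KP.bounded_moments_add[OF KP.bounded_moments_numeral[of 1]
        KP.bounded_moments_power[OF Zs_moments, of n]] fm le])
  obtain C where C: "\<And>\<theta> T. \<theta> \<in> K \<Longrightarrow> (\<integral>\<omega>. \<bar>f (Zs T \<theta> \<omega>)\<bar> ^ 2 \<partial>P \<theta>) \<le> C"
    by (rule KP.bounded_moments_bound[OF bm, of 2]) blast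
  show ?thesis
    by (rule uniform_weak_convergence_unbounded(1)[where C = C, OF KP.prob law_star_facts(1,2) Zs_measurable Zs_weak f])
      (use KP.bounded_moments_integrable_power[OF bm, of _ _ 2] C K_\<Theta> in auto)
qed

text \<open>Chebyshev's inequality with the bounded second moment of \<open>Zs\<close>; the bound of
  order \<open>1 / T\<close> is weakened to \<open>1 / sqrt T\<close> to fit
  \<open>uniform_limit_of_rate\<close>.\<close>

theorem consistency:
  assumes \<epsilon>: "\<epsilon> > 0"
  shows "uniform_limit K (\<lambda>T \<theta>. measure (P \<theta>) {\<omega> \<in> space (P \<theta>). norm (est T \<omega> - \<theta>) > \<epsilon>}) (\<lambda>_. 0) sequentially"
proof -
  obtain C where C: "C > 0" "\<And>\<theta> T. \<theta> \<in> K \<Longrightarrow> (\<integral>\<omega>. norm (Zs T \<theta> \<omega>) ^ 2 \<partial>P \<theta>) \<le> C" by (rule Zs_bound[of 2]) blast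
  show ?thesis
  proof (rule uniform_limit_of_rate[where C = "C / \<epsilon>\<^sup>2"])
    fix \<theta> T assume \<theta>: "\<theta> \<in> K" and T: "1 \<le> (T :: nat)"
    interpret S: prob_space "P \<theta>" by (rule prob[OF K_\<Theta>[OF \<theta>]])
    define A where "A = {\<omega> \<in> space (P \<theta>). norm (est T \<omega> - \<theta>) > \<epsilon>}"
    note [measurable] = est_measurable[OF K_\<Theta>[OF \<theta>] T]
    have A: "A \<in> sets (P \<theta>)" unfolding A_def by measurable
    have sq: "1 \<le> sqrt (real T)" "sqrt (real T) \<le> real T" using T real_sqrt_le_mono[of "real T" "real T * real T"] by auto
    have "measure (P \<theta>) A = (\<integral>\<omega>. indicator A \<omega> \<partial>P \<theta>)" using A by simp
    also have "\<dots> \<le> (\<integral>\<omega>. norm (Zs T \<theta> \<omega>) ^ 2 / (real T * \<epsilon>\<^sup>2) \<partial>P \<theta>)"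
    proof (rule integral_mono)
      show "integrable (P \<theta>) (\<lambda>\<omega>. norm (Zs T \<theta> \<omega>) ^ 2 / (real T * \<epsilon>\<^sup>2))" using Zs_integrable[OF \<theta>] by simp
      show "integrable (P \<theta>) (indicator A :: _ \<Rightarrow> real)" using A by (simp add: integrable_indicator_iff S.emeasure_eq_measure)
      fix \<omega>
      have eq: "norm (Zs T \<theta> \<omega>) ^ 2 = real T * (norm (est T \<omega> - \<theta>))\<^sup>2" by (simp add: Zs_def power_mult_distrib)
      show "indicator A \<omega> \<le> norm (Zs T \<theta> \<omega>) ^ 2 / (real T * \<epsilon>\<^sup>2)"
      proof (cases "\<omega> \<in> A")
        case True
        then have "\<epsilon>\<^sup>2 \<le> (norm (est T \<omega> - \<theta>))\<^sup>2" using \<epsilon> by (intro power_mono) (auto simp: A_def)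
        then show ?thesis unfolding eq using True T \<epsilon> by simp
      qed simp
    qed
    also have "\<dots> = (\<integral>\<omega>. norm (Zs T \<theta> \<omega>) ^ 2 \<partial>P \<theta>) / (real T * \<epsilon>\<^sup>2)" by simp
    also have "\<dots> \<le> C / (sqrt (real T) * \<epsilon>\<^sup>2)"
      using C(2)[OF \<theta>, of T] C(1) sq \<epsilon> T by (intro frac_le mult_right_mono mult_pos_pos) auto
    finally show "norm (measure (P \<theta>) {\<omega> \<in> space (P \<theta>). norm (est T \<omega> - \<theta>) > \<epsilon>} - 0) \<le> C / \<epsilon>\<^sup>2 / sqrt (real T)"
      by (simp add: A_def mult.commute)
  qed
qed

theorem mixed_moments:
  "uniform_limit K
     (\<lambda>T \<theta>. \<integral>\<omega>. (sqrt (real T) * (est T \<omega> - \<theta>) $ 1) ^ i * (sqrt (real T) * (est T \<omega> - \<theta>) $ 2) ^ j \<partial>P \<theta>)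
     (\<lambda>\<theta>. \<integral>x. x $ 1 ^ i * x $ 2 ^ j \<partial>law_star \<theta>) sequentially"
proof -
  have "uniform_limit K (\<lambda>T \<theta>. \<integral>\<omega>. Zs T \<theta> \<omega> $ 1 ^ i * Zs T \<theta> \<omega> $ 2 ^ j \<partial>P \<theta>)
     (\<lambda>\<theta>. \<integral>x. x $ 1 ^ i * x $ 2 ^ j \<partial>law_star \<theta>) sequentially"
  proof (rule Zs_test_function_limit[where n = "i + j"])
    fix x :: "real^2"
    have "\<bar>x $ 1 ^ i * x $ 2 ^ j\<bar> \<le> norm x ^ i * norm x ^ j"
      unfolding abs_mult power_abs using component_le_norm_cart[of x]
      by (intro mult_mono power_mono) (auto simp: real_norm_def)
    then show "\<bar>x $ 1 ^ i * x $ 2 ^ j\<bar> \<le> 1 + norm x ^ (i + j)" by (simp add: power_add)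
  qed (intro continuous_intros)
  then show ?thesis by (simp add: Zs_def)
qed

theorem absolute_moments:
  assumes p: "p > 0"
  shows "uniform_limit K (\<lambda>T \<theta>. \<integral>\<omega>. norm (sqrt (real T) *\<^sub>R (est T \<omega> - \<theta>)) powr p \<partial>P \<theta>)
    (\<lambda>\<theta>. \<integral>x. norm x powr p \<partial>law_star \<theta>) sequentially"
proof -
  have "uniform_limit K (\<lambda>T \<theta>. \<integral>\<omega>. norm (Zs T \<theta> \<omega>) powr p \<partial>P \<theta>) (\<lambda>\<theta>. \<integral>x. norm x powr p \<partial>law_star \<theta>) sequentially"
  proof (rule Zs_test_function_limit[where n = "nat \<lceil>p\<rceil>"])
    show "continuous_on UNIV (\<lambda>x::real^2. norm x powr p)"
      using p by (intro continuous_on_powr' continuous_intros) auto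
    show "\<bar>norm x powr p\<bar> \<le> 1 + norm x ^ nat \<lceil>p\<rceil>" for x :: "real^2" using abs_powr_le[of "norm x" p] p by simp
  qed
  then show ?thesis by (simp add: Zs_def)
qed

theorem moment_estimate:
  assumes p: "p \<ge> 2"
  shows "\<exists>C>0. \<forall>T\<ge>1. \<forall>\<theta>\<in>K. real T powr (p / 2) * (\<integral>\<omega>. norm (est T \<omega> - \<theta>) powr p \<partial>P \<theta>) \<le> C"
proof -
  define n where "n = nat \<lceil>p\<rceil>"
  obtain C where C: "C > 0" "\<And>\<theta> T. \<theta> \<in> K \<Longrightarrow> (\<integral>\<omega>. norm (Zs T \<theta> \<omega>) ^ n \<partial>P \<theta>) \<le> C" by (rule Zs_bound[of n]) blast
  have "real T powr (p / 2) * (\<integral>\<omega>. norm (est T \<omega> - \<theta>) powr p \<partial>P \<theta>) \<le> 1 + C"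
    if T: "T \<ge> 1" and \<theta>: "\<theta> \<in> K" for T \<theta>
  proof -
    interpret S: prob_space "P \<theta>" by (rule prob[OF K_\<Theta>[OF \<theta>]])
    have "norm (Zs T \<theta> \<omega>) powr p = real T powr (p / 2) * norm (est T \<omega> - \<theta>) powr p" for \<omega>
      by (simp add: Zs_def powr_mult powr_half_sqrt[symmetric] powr_powr)
    then have "real T powr (p / 2) * (\<integral>\<omega>. norm (est T \<omega> - \<theta>) powr p \<partial>P \<theta>) = (\<integral>\<omega>. norm (Zs T \<theta> \<omega>) powr p \<partial>P \<theta>)" by simp
    also have "\<dots> \<le> (\<integral>\<omega>. 1 + norm (Zs T \<theta> \<omega>) ^ n \<partial>P \<theta>)"
    proof (rule integrable_integral_le(2))
      show "integrable (P \<theta>) (\<lambda>\<omega>. 1 + norm (Zs T \<theta> \<omega>) ^ n)" using Zs_integrable[OF \<theta>] by simp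
      show "(\<lambda>\<omega>. norm (Zs T \<theta> \<omega>) powr p) \<in> borel_measurable (P \<theta>)"
        using Zs_measurable[OF K_\<Theta>[OF \<theta>], of T] by measurable
      show "\<bar>norm (Zs T \<theta> \<omega>) powr p\<bar> \<le> 1 + norm (Zs T \<theta> \<omega>) ^ n" for \<omega>
        using abs_powr_le[of "norm (Zs T \<theta> \<omega>)" p] p by (simp add: n_def)
    qed
    also have "\<dots> \<le> 1 + C" using C(2)[OF \<theta>, of T] Zs_integrable[OF \<theta>] by (simp add: S.prob_space)
    finally show ?thesis .
  qed
  then show ?thesis using C(1) by (intro exI[of _ "1 + C"]) auto
qed

end

theorem proposition3:
  fixes \<alpha>\<^sub>a \<beta>\<^sub>a \<alpha>\<^sub>f \<beta>\<^sub>f \<sigma> b d\<^sub>x d\<^sub>y :: real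
    and \<Theta> :: "(real^2) set"
    and F :: "'w measure"
    and P :: "real^2 \<Rightarrow> 'w measure"
    and X :: "real \<Rightarrow> 'w \<Rightarrow> real"
    and Y W V :: "real^2 \<Rightarrow> real \<Rightarrow> 'w \<Rightarrow> real"
    and est :: "nat \<Rightarrow> 'w \<Rightarrow> real^2"
  assumes "\<alpha>\<^sub>a > 0" and "\<alpha>\<^sub>f > 0" and "\<sigma> \<noteq> 0" and "b \<noteq> 0"
    and Theta: "\<Theta> = {\<theta>. \<theta> $ 1 \<in> {\<alpha>\<^sub>a<..<\<beta>\<^sub>a} \<and> \<theta> $ 2 \<in> {\<alpha>\<^sub>f<..<\<beta>\<^sub>f}}"
    and sample_space: "\<And>\<theta>. \<theta> \<in> \<Theta> \<Longrightarrow> sets (P \<theta>) = sets F"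
    and model: "\<And>\<theta>. \<theta> \<in> \<Theta> \<Longrightarrow>
      partially_observed_system (P \<theta>) (W \<theta>) (V \<theta>) X (Y \<theta>) \<sigma> b d\<^sub>x d\<^sub>y \<theta>"
    and estimator: "\<And>T. T \<ge> 1 \<Longrightarrow> moments_estimator F \<sigma> b \<Theta> X T (est T)"
  shows "\<exists>K \<mu> Q \<mu>_star.
    (\<forall>\<theta>\<in>\<Theta>. moments_limit_law (P \<theta>) \<sigma> b X \<theta> (K \<theta>) (\<mu> \<theta>)
        \<and> \<mu>_star \<theta> = distr (\<mu> \<theta>) borel (xi_star \<sigma> b \<theta>)
        \<and> Q \<theta> = covariance_matrix (\<mu> \<theta>) (xi_star \<sigma> b \<theta>)
        \<and> centred_gaussian (\<mu>_star \<theta>) (Q \<theta>))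
    \<and> (\<forall>\<KK>. compact \<KK> \<and> \<KK> \<subseteq> \<Theta> \<longrightarrow>
        (\<forall>\<epsilon>>0. uniform_limit \<KK>
          (\<lambda>T \<theta>. measure (P \<theta>) {\<omega> \<in> space (P \<theta>). norm (est T \<omega> - \<theta>) > \<epsilon>}) (\<lambda>_. 0) sequentially)
      \<and> uniform_weak_convergence \<KK> P (\<lambda>T \<theta> \<omega>. sqrt (real T) *\<^sub>R (est T \<omega> - \<theta>)) \<mu>_star
      \<and> (\<forall>i j::nat. uniform_limit \<KK>
          (\<lambda>T \<theta>. \<integral>\<omega>. (sqrt (real T) * (est T \<omega> - \<theta>) $ 1) ^ i * (sqrt (real T) * (est T \<omega> - \<theta>) $ 2) ^ j \<partial>P \<theta>)
          (\<lambda>\<theta>. \<integral>x. x $ 1 ^ i * x $ 2 ^ j \<partial>\<mu>_star \<theta>) sequentially)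
      \<and> (\<forall>p>0. uniform_limit \<KK>
          (\<lambda>T \<theta>. \<integral>\<omega>. norm (sqrt (real T) *\<^sub>R (est T \<omega> - \<theta>)) powr p \<partial>P \<theta>)
          (\<lambda>\<theta>. \<integral>x. norm x powr p \<partial>\<mu>_star \<theta>) sequentially)
      \<and> (\<forall>p\<ge>2. \<exists>C>0. \<forall>T\<ge>1. \<forall>\<theta>\<in>\<KK>.
          real T powr (p / 2) * (\<integral>\<omega>. norm (est T \<omega> - \<theta>) powr p \<partial>P \<theta>) \<le> C))"
proof (cases "\<Theta> = {}")
  \<comment> \<open>An empty box has only the empty compact subset, and all claims are vacuous.
    Otherwise the bounds are strictly ordered, as \<open>estimation_box\<close> requires.\<close>
  case True
  have "measure M {\<omega> \<in> space M. False} = 0" for M :: "'w measure" by simp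
  then show ?thesis
    using True
    by (auto simp: uniform_weak_convergence_def uniform_limit_iff intro!: exI[of _ "1 :: real"])
next
  case False
  then have "\<alpha>\<^sub>a < \<beta>\<^sub>a" "\<alpha>\<^sub>f < \<beta>\<^sub>f" by (auto simp: Theta)
  then interpret B: estimation_box \<alpha>\<^sub>a \<beta>\<^sub>a \<alpha>\<^sub>f \<beta>\<^sub>f \<sigma> b
    using assms(1-4) by unfold_locales auto
  have \<Theta>: "B.\<Theta> = \<Theta>" by (simp add: B.\<Theta>_def Theta)
  interpret O: observed_family \<alpha>\<^sub>a \<beta>\<^sub>a \<alpha>\<^sub>f \<beta>\<^sub>f \<sigma> b P X Y W V d\<^sub>x d\<^sub>y
    using assms(3) model by (intro observed_family.intro B.estimation_box_axioms observed_family_axioms.intro) (auto simp: \<Theta>)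
  \<comment> \<open>Instantiated separately for each compact set; the limit laws come from
    \<open>observed_family\<close> and so are common to all of them.\<close>
  have E: "estimated_family \<alpha>\<^sub>a \<beta>\<^sub>a \<alpha>\<^sub>f \<beta>\<^sub>f \<sigma> b P X Y W V d\<^sub>x d\<^sub>y F est \<KK>" if "compact \<KK>" "\<KK> \<subseteq> \<Theta>" for \<KK>
    using that sample_space estimator
    by (intro estimated_family.intro O.observed_family_axioms estimated_family_axioms.intro) (auto simp: \<Theta>)
  show ?thesis
  proof (rule exI[of _ O.Kmat], rule exI[of _ O.law], rule exI[of _ O.Q_star], rule exI[of _ O.law_star],
      intro conjI ballI allI impI, goal_cases)
    case (1 \<theta>)
    then show ?case using O.moments_limit[of \<theta>] by (simp add: \<Theta>)
  next
    case (2 \<theta>)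
    show ?case by (rule O.law_star_def)
  next
    case (3 \<theta>)
    show ?case by (rule O.Q_star_def)
  next
    case (4 \<theta>)
    then show ?case using O.law_star_gaussian[of \<theta>] by (simp add: \<Theta>)
  next
    case (5 \<KK> \<epsilon>)
    then show ?case using estimated_family.consistency[OF E] by blast
  next
    case (6 \<KK>)
    then show ?case using estimated_family.estimator_weak_convergence[OF E] by blast
  next
    case (7 \<KK> i j)
    then show ?case using estimated_family.mixed_moments[OF E] by blast
  next
    case (8 \<KK> p)
    then show ?case using estimated_family.absolute_moments[OF E] by blast
  next
    case (9 \<KK> p)
    then show ?case using estimated_family.moment_estimate[OF E] by blast
  qed
qed

end
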